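(* Let $H$ be a fixed connected graph with $3k+j$ vertices, where $k \ge 0$ is an integer and $j \in \{0,1,2\}$. If $G=(V,E)$ is a graph with $n$ vertices and $c : E \rightarrow C$ is an edge-coloring (with an arbitrary color set $C$), then, provided $H$ is not $K_3$, a monochromatic $H$-subgraph of $G$ (if one exists) can be found in $O(n^{\omega k +j})$ time. A monochromatic triangle (if one exists) can be found in $O(n^{(3+\omega)/2})$ time.
   Context: $\omega$ denotes the exponent of square matrix multiplication ($n\times n$ matrices can be multiplied in $O(n^\omega)$ arithmetic operations). An $H$-subgraph of an edge-colored graph is monochromatic if all of its edges have the same color. *)

theory Defs
  imports
    Complex_Main
    "HOL-Library.Landau_Symbols"
    "Graph_Theory.Graph_Theory"
    "Jordan_Normal_Form.Matrix"
begin

section \<open>Model of computation: a unit-cost word RAM\<close>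

text \<open>
  Programs are finite texts, fixed before the input is given.  Memory consists of named arrays of
  integer words (finitely many of them occur in a program; a scalar is the cell 0 of an array), so
  the arrays amount to one interleaved RAM memory.  Addresses are computed, hence indirect
  addressing is available.

  Every number that occurs in a run must fit into a machine word, that is, have absolute value at
  most \<open>W\<close>; a program that leaves this range is stuck, i.e. has no execution.  Without such a bound
  unit-cost arithmetic is unreasonably powerful: two matrices could be packed into huge integers
  and multiplied in quadratic time.
\<close>

type_synonym state = "string \<Rightarrow> int \<Rightarrow> int"

datatype binop = Plus | Minus | Times | Quotient | Remainder | Less

primrec apply_op :: "binop \<Rightarrow> int \<Rightarrow> int \<Rightarrow> int" where
  "apply_op Plus a b = a + b"
| "apply_op Minus a b = a - b"
| "apply_op Times a b = a * b"
| "apply_op Quotient a b = a div b"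
| "apply_op Remainder a b = a mod b"
| "apply_op Less a b = (if a < b then 1 else 0)"

datatype expr = Const int | Read string expr | Op binop expr expr

primrec val :: "state \<Rightarrow> expr \<Rightarrow> int" where
  "val s (Const a) = a"
| "val s (Read x e) = s x (val s e)"
| "val s (Op f e1 e2) = apply_op f (val s e1) (val s e2)"

primrec fits :: "int \<Rightarrow> state \<Rightarrow> expr \<Rightarrow> bool" where
  "fits W s (Const a) \<longleftrightarrow> \<bar>a\<bar> \<le> W"
| "fits W s (Read x e) \<longleftrightarrow> fits W s e \<and> \<bar>s x (val s e)\<bar> \<le> W"
| "fits W s (Op f e1 e2) \<longleftrightarrow>
     fits W s e1 \<and> fits W s e2 \<and> \<bar>apply_op f (val s e1) (val s e2)\<bar> \<le> W"

primrec cost :: "expr \<Rightarrow> nat" where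
  "cost (Const a) = 1"
| "cost (Read x e) = 1 + cost e"
| "cost (Op f e1 e2) = 1 + cost e1 + cost e2"

datatype com =
    Skip
  | Write string expr expr   \<comment> \<open>\<open>x[e1] := e2\<close>\<close>
  | Seq com com
  | Cond expr com com   \<comment> \<open>nonzero means true\<close>
  | While expr com

text \<open>\<open>exec W P s t s'\<close>: with word bound \<open>W\<close>, program \<open>P\<close> started in \<open>s\<close> halts after \<open>t\<close> steps in \<open>s'\<close>.\<close>

inductive exec :: "int \<Rightarrow> com \<Rightarrow> state \<Rightarrow> nat \<Rightarrow> state \<Rightarrow> bool" for W :: int where
  Skip: "exec W Skip s 1 s"
| Write: "\<lbrakk>fits W s e1; fits W s e2\<rbrakk> \<Longrightarrow>
    exec W (Write x e1 e2) s (1 + cost e1 + cost e2) (s(x := (s x)(val s e1 := val s e2)))"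
| Seq: "\<lbrakk>exec W P s t s'; exec W Q s' t' s''\<rbrakk> \<Longrightarrow> exec W (Seq P Q) s (t + t') s''"
| Cond_true: "\<lbrakk>fits W s e; val s e \<noteq> 0; exec W P s t s'\<rbrakk> \<Longrightarrow>
    exec W (Cond e P Q) s (1 + cost e + t) s'"
| Cond_false: "\<lbrakk>fits W s e; val s e = 0; exec W Q s t s'\<rbrakk> \<Longrightarrow>
    exec W (Cond e P Q) s (1 + cost e + t) s'"
| While_false: "\<lbrakk>fits W s e; val s e = 0\<rbrakk> \<Longrightarrow> exec W (While e P) s (1 + cost e) s"
| While_true: "\<lbrakk>fits W s e; val s e \<noteq> 0; exec W P s t s'; exec W (While e P) s' t' s''\<rbrakk> \<Longrightarrow>
    exec W (While e P) s (1 + cost e + t + t') s''"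

text \<open>
  A computational problem is given by \<open>input n M x s\<close> (the state \<open>s\<close> holds the instance \<open>x\<close>, of size
  parameter \<open>n\<close> and with numerical data of magnitude at most \<open>M\<close>) and \<open>answer x s'\<close> (the state \<open>s'\<close>
  holds a correct answer for \<open>x\<close>).  It is solvable in $O(n^\tau)$ time if one program solves all
  instances in worst-case time $O(n^\tau)$, uniformly in \<open>M\<close>, on words of $O(\log (n + M))$ bits, i.e.
  for every word bound at least polynomial in \<open>n + M\<close>.  The input does not constrain the memory
  outside the input cells: no initialisation is assumed.
\<close>

definition solvable_in_time ::
  "(nat \<Rightarrow> nat \<Rightarrow> 'x \<Rightarrow> state \<Rightarrow> bool) \<Rightarrow> ('x \<Rightarrow> state \<Rightarrow> bool) \<Rightarrow> real \<Rightarrow> bool" where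
  "solvable_in_time input answer \<tau> \<longleftrightarrow>
     (\<exists>(P :: com) (d :: nat) (T :: nat \<Rightarrow> real).
        T \<in> O(\<lambda>n. real n powr \<tau>) \<and>
        (\<forall>n M x s W.
           input n M x s \<and> W \<ge> (int n + int M + 2) ^ d \<and> (\<forall>y i. \<bar>s y i\<bar> \<le> W) \<longrightarrow>
           (\<exists>t s'. exec W P s t s' \<and> real t \<le> T n \<and> answer x s')))"


section \<open>Square matrix multiplication\<close>

definition matrices_input :: "nat \<Rightarrow> nat \<Rightarrow> int mat \<times> int mat \<Rightarrow> state \<Rightarrow> bool" where
  "matrices_input n M = (\<lambda>(A, B) s.
     A \<in> carrier_mat n n \<and> B \<in> carrier_mat n n \<and>
     s ''n'' 0 = int n \<and>
     (\<forall>i<n. \<forall>j<n.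
        \<bar>A $$ (i, j)\<bar> \<le> int M \<and> s ''A'' (int (i * n + j)) = A $$ (i, j) \<and>
        \<bar>B $$ (i, j)\<bar> \<le> int M \<and> s ''B'' (int (i * n + j)) = B $$ (i, j)))"

definition product_answer :: "int mat \<times> int mat \<Rightarrow> state \<Rightarrow> bool" where
  "product_answer = (\<lambda>(A, B) s.
     \<forall>i<dim_row A. \<forall>j<dim_col B. s ''C'' (int (i * dim_col B + j)) = (A * B) $$ (i, j))"

text \<open>
  \<open>\<omega>\<close> is an achieved exponent, not necessarily the infimum of the achieved ones: that infimum need
  not be attained, and then no exact $O(n^\omega)$ bound is available for it.
\<close>

definition matrix_multiplication_exponent :: "real \<Rightarrow> bool" where
  "matrix_multiplication_exponent \<omega> \<longleftrightarrow> solvable_in_time matrices_input product_answer \<omega>"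


section \<open>Monochromatic subgraphs\<close>

text \<open>
  Finite simple undirected graphs are rendered as \<open>pair_graph\<close>s: an edge is the pair of arcs
  \<open>(u, v)\<close>, \<open>(v, u)\<close>, and it is coloured as the set \<open>{u, v}\<close>.
\<close>

definition monochromatic :: "('v set \<Rightarrow> 'c) \<Rightarrow> 'v pair_pre_digraph \<Rightarrow> bool" where
  "monochromatic c S \<longleftrightarrow>
     (\<forall>(u, v) \<in> parcs S. \<forall>(u', v') \<in> parcs S. c {u, v} = c {u', v'})"

definition monochromatic_H_subgraph ::
  "'h pair_pre_digraph \<Rightarrow> 'v pair_pre_digraph \<Rightarrow> ('v set \<Rightarrow> 'c) \<Rightarrow> 'v pair_pre_digraph \<Rightarrow> bool" where
  "monochromatic_H_subgraph H G c S \<longleftrightarrow>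
     subgraph (with_proj S) (with_proj G) \<and>
     digraph_iso (with_proj H) (with_proj S) \<and>
     monochromatic c S"

text \<open>
  The input graph is given by its coloured adjacency matrix.  The colours come from an arbitrary
  set; the machine sees them through an arbitrary injective numbering.
\<close>

definition coloured_graph_input ::
  "nat \<Rightarrow> nat \<Rightarrow> int pair_pre_digraph \<times> (int set \<Rightarrow> 'c) \<Rightarrow> state \<Rightarrow> bool" where
  "coloured_graph_input n M = (\<lambda>(G, c) s.
     pair_graph G \<and> pverts G = {0..<int n} \<and>
     s ''n'' 0 = int n \<and>
     (\<exists>number :: 'c \<Rightarrow> nat.
        inj_on number {c {u, v} | u v. (u, v) \<in> parcs G} \<and>
        (\<forall>(u, v) \<in> parcs G. number (c {u, v}) \<le> M) \<and>
        (\<forall>u\<in>pverts G. \<forall>v\<in>pverts G. s ''G'' (u * int n + v) =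
           (if (u, v) \<in> parcs G then int (number (c {u, v})) + 1 else 0))))"

text \<open>The subgraph is output as a list of its vertices and a list of its arcs.\<close>

definition output_graph :: "'h pair_pre_digraph \<Rightarrow> state \<Rightarrow> int pair_pre_digraph" where
  "output_graph H s =
     \<lparr> pverts = s ''vertex'' ` {0..<int (card (pverts H))},
       parcs = (\<lambda>i. (s ''tail'' i, s ''head'' i)) ` {0..<int (card (parcs H))} \<rparr>"

definition H_subgraph_answer ::
  "'h pair_pre_digraph \<Rightarrow> int pair_pre_digraph \<times> (int set \<Rightarrow> 'c) \<Rightarrow> state \<Rightarrow> bool" where
  "H_subgraph_answer H = (\<lambda>(G, c) s.
     if \<exists>S. monochromatic_H_subgraph H G c S
     then s ''found'' 0 = 1 \<and> monochromatic_H_subgraph H G c (output_graph H s)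
     else s ''found'' 0 = 0)"

end

theory Submission
  imports Defs
begin

text \<open>
  Split the vertices of \<open>H\<close> into a part of size \<open>j\<close> and three parts of size \<open>k\<close>.  For every
  placement of the first part and every colour, list the placements of the second and of the third
  part that are compatible with it in this colour; a placement of the last part that completes a
  compatible pair is a nonzero entry of a product of two 0-1 matrices.  If the first part spans an edge
  together with the second part, and another one together with the third part, then a placement
  determines its colour.  So the lists of different colours have total length $O(n^k)$, and since
  $x \mapsto x^\omega$ is superadditive, all the products together take time $O(n^{\omega k})$.
  A connected graph has such a split unless it is a triangle or a star with $3k$ vertices,
  and a star is found by counting neighbours in quadratic time.

  For triangles, call a vertex light in a colour if it has at most \<open>D\<close> neighbours in this colour.
  Triangles with a light vertex are found in time $O(n^2 D)$ by inspecting pairs of neighbours.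
  The heavy vertices of one colour are treated by a matrix product; as their numbers add up to at
  most $n^2 / D$ over all colours, this takes time $O(n^{\omega + 1} / D)$.  The balance is
  $D = n^{(\omega - 1)/2}$, which is approached by doubling \<open>D\<close>.
\<close>

section \<open>Reasoning about programs\<close>

text \<open>There can be about \<open>n^2\<close> colours, so combining every colour with every
  placement is too slow; this is why placements have to determine their colour. No edge with this
  effect is demanded for the last part, whose \<open>N = n^k\<close> placements are shared by all
  colours. The products are therefore rectangular; for a colour with lists of total length
  \<open>m\<close> they are cut into about \<open>N / m\<close> square blocks of side
  \<open>m\<close>, at a cost of about \<open>N * m^(\<omega>-1)\<close>. The sum over the colours
  thus rests on superadditivity with the exponent \<open>\<omega> - 1\<close>, which requires
  \<open>\<omega> \<ge> 2\<close>; this inequality is derived from the size of the output of a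
  matrix product. The machine shapes the rest. The text of the multiplication program is arbitrary
  and may overwrite any array that it names, even those of the input, so the graph is copied to
  arrays with new names. Memory is not initialised and no operator skips an operand, so each test
  has to stay within a word even when it reads meaningless cells.\<close>

definition run :: "int \<Rightarrow> com \<Rightarrow> state \<Rightarrow> real \<Rightarrow> (state \<Rightarrow> bool) \<Rightarrow> bool" where
  "run W c s t Q \<longleftrightarrow> (\<exists>t' s'. exec W c s t' s' \<and> real t' \<le> t \<and> Q s')"

definition ok :: "int \<Rightarrow> state \<Rightarrow> bool" where
  "ok W s \<longleftrightarrow> (\<forall>y i. \<bar>s y i\<bar> \<le> W)"

definition ev :: "int \<Rightarrow> state \<Rightarrow> expr \<Rightarrow> int \<Rightarrow> bool" where
  "ev W s e z \<longleftrightarrow> fits W s e \<and> val s e = z"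

definition upd :: "state \<Rightarrow> string \<Rightarrow> int \<Rightarrow> int \<Rightarrow> state" where
  "upd s x a b = s(x := (s x)(a := b))"

abbreviation Var :: "string \<Rightarrow> expr" where
  "Var x \<equiv> Read x (Const 0)"

abbreviation Set :: "string \<Rightarrow> expr \<Rightarrow> com" where
  "Set x e \<equiv> Write x (Const 0) e"

abbreviation keeps :: "string set \<Rightarrow> state \<Rightarrow> state \<Rightarrow> bool" where
  "keeps X s s' \<equiv> \<forall>y. y \<notin> X \<longrightarrow> s' y = s y"

primrec writes :: "com \<Rightarrow> string set" where
  "writes Skip = {}"
| "writes (Write x e1 e2) = {x}"
| "writes (Seq c d) = writes c \<union> writes d"
| "writes (Cond e c d) = writes c \<union> writes d"
| "writes (While e c) = writes c"

lemma upd_apply [simp]: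
  "upd s x a b y = (if y = x then (s x)(a := b) else s y)"
  by (simp add: upd_def)

lemma okD: "ok W s \<Longrightarrow> \<bar>s y i\<bar> \<le> W"
  by (simp add: ok_def)

lemma ok_nonneg: "ok W s \<Longrightarrow> 0 \<le> W"
  using okD[of W s "[]" 0] by linarith

lemma ok_upd [simp]: "ok W s \<Longrightarrow> \<bar>b\<bar> \<le> W \<Longrightarrow> ok W (upd s x a b)"
  by (simp add: ok_def)

lemma fits_val: "fits W s e \<Longrightarrow> \<bar>val s e\<bar> \<le> W"
  by (cases e) auto

lemma exec_ok: "exec W c s t s' \<Longrightarrow> ok W s \<Longrightarrow> ok W s'"
proof (induction rule: exec.induct)
  case (Write s e1 e2 x)
  then show ?case
    using fits_val[of W s e2] by (auto simp: ok_def)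
qed auto

lemma exec_keeps: "exec W c s t s' \<Longrightarrow> y \<notin> writes c \<Longrightarrow> s' y = s y"
  by (induction rule: exec.induct) auto

lemma ev_Const: "\<bar>a\<bar> \<le> W \<Longrightarrow> ev W s (Const a) a"
  by (simp add: ev_def)

lemma ev_Read: "ok W s \<Longrightarrow> ev W s e a \<Longrightarrow> ev W s (Read x e) (s x a)"
  by (auto simp: ev_def ok_def)

lemma ev_Var: "ok W s \<Longrightarrow> s x 0 = a \<Longrightarrow> ev W s (Var x) a"
  by (auto simp: ev_def okD dest: ok_nonneg)

lemma ev_Op:
  "ev W s e1 a \<Longrightarrow> ev W s e2 b \<Longrightarrow> \<bar>apply_op f a b\<bar> \<le> W \<Longrightarrow> apply_op f a b = z
   \<Longrightarrow> ev W s (Op f e1 e2) z"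
  by (simp add: ev_def)

lemma run_frame:
  "run W c s t Q \<Longrightarrow> ok W s \<Longrightarrow> run W c s t (\<lambda>s'. Q s' \<and> ok W s' \<and> keeps (writes c) s s')"
  unfolding run_def using exec_ok exec_keeps by metis

text \<open>The rule of consequence with the frame built in: the word bound and every array that the
  program text does not write are preserved, so specifications need not mention them.\<close>

lemma run_mono:
  assumes "run W c s t Q" "ok W s" "t \<le> t'"
    and "\<And>s'. Q s' \<Longrightarrow> ok W s' \<Longrightarrow> keeps (writes c) s s' \<Longrightarrow> Q' s'"
  shows "run W c s t' Q'"
proof -
  have "run W c s t (\<lambda>s'. Q s' \<and> ok W s' \<and> keeps (writes c) s s')"
    by (rule run_frame) fact+
  then show ?thesis
    unfolding run_def using assms(3,4) by (meson order_trans)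
qed

lemma run_Skip: "Q s \<Longrightarrow> run W Skip s 1 Q"
  unfolding run_def using exec.Skip by fastforce

lemma run_Write:
  assumes "ev W s e1 a" "ev W s e2 b" "Q (upd s x a b)"
  shows "run W (Write x e1 e2) s (real (1 + cost e1 + cost e2)) Q"
proof -
  have "exec W (Write x e1 e2) s (1 + cost e1 + cost e2) (upd s x a b)"
    using exec.Write[of W s e1 e2 x] assms(1,2) by (simp add: ev_def upd_def)
  then show ?thesis
    unfolding run_def using assms(3) by (meson order_refl)
qed

lemma run_Seq:
  assumes "run W c s t1 R" "ok W s"
    and "\<And>s'. R s' \<Longrightarrow> ok W s' \<Longrightarrow> keeps (writes c) s s' \<Longrightarrow> run W d s' t2 Q"
  shows "run W (Seq c d) s (t1 + t2) Q"
proof -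
  obtain n1 s1 where 1: "exec W c s n1 s1" "real n1 \<le> t1" "R s1" "ok W s1" "keeps (writes c) s s1"
    using run_frame[OF assms(1,2)] unfolding run_def by blast
  obtain n2 s2 where 2: "exec W d s1 n2 s2" "real n2 \<le> t2" "Q s2"
    using assms(3)[OF 1(3-5)] unfolding run_def by blast
  have "exec W (Seq c d) s (n1 + n2) s2"
    by (rule exec.Seq) fact+
  then show ?thesis
    unfolding run_def using 1(2) 2(2,3) by (metis add_mono of_nat_add)
qed

lemma run_Cond:
  assumes "ev W s e z"
    and "z \<noteq> 0 \<Longrightarrow> run W c s t Q" "z = 0 \<Longrightarrow> run W d s t Q"
  shows "run W (Cond e c d) s (1 + real (cost e) + t) Q"
proof (cases "z = 0")
  case True
  then obtain n s1 where 1: "exec W d s n s1" "real n \<le> t" "Q s1"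
    using assms(3) unfolding run_def by blast
  have "exec W (Cond e c d) s (1 + cost e + n) s1"
    using assms(1) True 1 by (intro exec.Cond_false) (auto simp: ev_def)
  then show ?thesis
    unfolding run_def using 1 by (intro exI conjI) auto
next
  case False
  then obtain n s1 where 1: "exec W c s n s1" "real n \<le> t" "Q s1"
    using assms(2) unfolding run_def by blast
  have "exec W (Cond e c d) s (1 + cost e + n) s1"
    using assms(1) False 1 by (intro exec.Cond_true) (auto simp: ev_def)
  then show ?thesis
    unfolding run_def using 1 by (intro exI conjI) auto
qed

lemma run_While_false:
  "ev W s e 0 \<Longrightarrow> Q s \<Longrightarrow> run W (While e c) s (1 + real (cost e)) Q"
  unfolding run_def ev_def using exec.While_false by (metis of_nat_Suc order_refl plus_1_eq_Suc of_nat_1 of_nat_add)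

lemma run_While_true:
  assumes "ev W s e z" "z \<noteq> 0" "run W (Seq c (While e c)) s t Q"
  shows "run W (While e c) s (1 + real (cost e) + t) Q"
proof -
  obtain n s1 where 1: "exec W (Seq c (While e c)) s n s1" "real n \<le> t" "Q s1"
    using assms(3) unfolding run_def by blast
  obtain n1 n2 s0 where 2: "exec W c s n1 s0" "exec W (While e c) s0 n2 s1" "n = n1 + n2"
    using 1(1) by (cases) auto
  have "exec W (While e c) s (1 + cost e + n1 + n2) s1"
    using assms(1,2) 2 by (intro exec.While_true) (auto simp: ev_def)
  then show ?thesis
    unfolding run_def using 1 2 by (intro exI conjI) auto
qed

section \<open>Counting loops\<close>

definition For :: "string \<Rightarrow> expr \<Rightarrow> com \<Rightarrow> com" where
  "For x e c = Seq (Set x (Const 0))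
     (While (Op Less (Var x) e) (Seq c (Set x (Op Plus (Var x) (Const 1)))))"

lemma writes_For [simp]: "writes (For x e c) = insert x (writes c)"
  by (auto simp: For_def)

text \<open>The bound \<open>e\<close> is evaluated anew in each round, so it must have the value
  \<open>m\<close> in every state that differs from the first one only in arrays written by the
  loop. Rounds have individual costs \<open>b i\<close>; this is what later allows products of
  unequal sizes to be added up. A round adds \<open>6\<close> for the increment and
  \<open>4 + cost e\<close> for the test. The initial assignment and the last, failing test fit into
  the charge for one more round, hence the factor \<open>m + 1\<close>.\<close>

lemma run_For:
  assumes "ok W s" "1 \<le> W" "x \<notin> writes c" "int m \<le> W"
    and e: "\<And>s'. ok W s' \<Longrightarrow> keeps (insert x (writes c)) s s' \<Longrightarrow> ev W s' e (int m)"
    and I0: "I 0 (upd s x 0 0)"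
    and body: "\<And>i s'. i < m \<Longrightarrow> ok W s' \<Longrightarrow> keeps (insert x (writes c)) s s' \<Longrightarrow>
      s' x 0 = int i \<Longrightarrow> I i s' \<Longrightarrow> run W c s' (b i) (\<lambda>s''. I (Suc i) (upd s'' x 0 (int (Suc i))))"
  shows "run W (For x e c) s ((\<Sum>i<m. b i) + real (m + 1) * (10 + real (cost e))) (I m)"
proof -
  let ?w = "While (Op Less (Var x) e) (Seq c (Set x (Op Plus (Var x) (Const 1))))"
  let ?K = "10 + real (cost e)"
  \<comment> \<open>Induction on the number \<open>k\<close> of rounds that are left, so that the
    counter stands at \<open>m - k\<close>.\<close>
  have w: "run W ?w s' ((\<Sum>i\<in>{m - k..<m}. b i) + real k * ?K + (4 + real (cost e))) (I m)"
    if "k \<le> m" "ok W s'" "keeps (insert x (writes c)) s s'" "s' x 0 = int (m - k)" "I (m - k) s'" for k s'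
    using that
  proof (induction k arbitrary: s')
    case 0
    have ee: "ev W s' (Op Less (Var x) e) 0"
      using e[of s'] 0 assms(2) ev_Var[of W s' x]
      by (intro ev_Op[where a = "int m" and b = "int m"]) auto
    show ?case
      by (rule run_mono[OF run_While_false[OF ee, where Q = "I m"]]) (use 0 in auto)
  next
    case (Suc k)
    let ?i = "m - Suc k"
    have i: "?i < m" "Suc ?i = m - k" using Suc.prems by auto
    have ee: "ev W s' (Op Less (Var x) e) 1"
      using e[of s'] Suc.prems assms(2) ev_Var[of W s' x] i
      by (intro ev_Op[where a = "int ?i" and b = "int m"]) auto
    have inc: "run W (Seq c (Set x (Op Plus (Var x) (Const 1)))) s' (b ?i + 6)
        (\<lambda>s''. I (m - k) s'' \<and> s'' x 0 = int (m - k))"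
    proof (rule run_Seq)
      show "run W c s' (b ?i) (\<lambda>s''. I (m - k) (upd s'' x 0 (int (m - k))))"
        using body[of ?i s'] Suc.prems i by auto
      fix s2 assume s2: "I (m - k) (upd s2 x 0 (int (m - k)))" "ok W s2" "keeps (writes c) s' s2"
      have "s2 x 0 = int ?i" using s2(3) assms(3) Suc.prems(4) by auto
      then have "ev W s2 (Op Plus (Var x) (Const 1)) (int (m - k))"
        using s2(2) assms(2,4) i ev_Var[of W s2 x]
        by (intro ev_Op[where a = "int ?i" and b = 1]) (auto simp: ev_Const)
      from run_Write[OF _ this, of "Const 0" 0 "\<lambda>s''. I (m - k) s'' \<and> s'' x 0 = int (m - k)" x] s2(1)
      show "run W (Set x (Op Plus (Var x) (Const 1))) s2 6
          (\<lambda>s''. I (m - k) s'' \<and> s'' x 0 = int (m - k))"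
        using assms(2) by (simp add: ev_Const)
    qed (use Suc.prems in auto)
    have sum: "(\<Sum>i\<in>{?i..<m}. b i) = b ?i + (\<Sum>i\<in>{m - k..<m}. b i)"
      using i by (metis sum.atLeast_Suc_lessThan)
    show ?case
    proof (rule run_mono[OF run_While_true[OF ee]])
      show "run W (Seq (Seq c (Set x (Op Plus (Var x) (Const 1)))) ?w) s'
         ((b ?i + 6) + ((\<Sum>i\<in>{m - k..<m}. b i) + real k * ?K + (4 + real (cost e)))) (I m)"
      proof (rule run_Seq[OF inc])
        fix s2 assume s2: "I (m - k) s2 \<and> s2 x 0 = int (m - k)" "ok W s2"
          "keeps (writes (Seq c (Set x (Op Plus (Var x) (Const 1))))) s' s2"
        have "keeps (insert x (writes c)) s s2" using s2(3) Suc.prems(3) by auto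
        then show "run W ?w s2 ((\<Sum>i\<in>{m - k..<m}. b i) + real k * ?K + (4 + real (cost e))) (I m)"
          using Suc.IH[of s2] s2(1,2) Suc.prems(1) by simp
      qed (use Suc.prems in auto)
    qed (use Suc.prems sum in \<open>auto simp: algebra_simps\<close>)
  qed
  have "run W (For x e c) s (3 + ((\<Sum>i\<in>{m - m..<m}. b i) + real m * ?K + (4 + real (cost e)))) (I m)"
    unfolding For_def
  proof (rule run_Seq[where R = "\<lambda>s'. I 0 s' \<and> s' x 0 = 0"])
    show "run W (Set x (Const 0)) s 3 (\<lambda>s'. I 0 s' \<and> s' x 0 = 0)"
      using run_Write[of W s "Const 0" 0 "Const 0" 0 _ x] I0 assms(2) by (auto simp: ev_Const)
    fix s' assume "I 0 s' \<and> s' x 0 = 0" "ok W s'" "keeps (writes (Set x (Const 0))) s s'"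
    then show "run W ?w s' ((\<Sum>i\<in>{m - m..<m}. b i) + real m * ?K + (4 + real (cost e))) (I m)"
      using w[of m s'] by auto
  qed (use assms in auto)
  then show ?thesis
    by (rule run_mono) (use assms(1) in \<open>auto simp: algebra_simps atLeast0LessThan\<close>)
qed

corollary run_For_const:
  assumes "ok W s" "1 \<le> W" "x \<notin> writes c" "int m \<le> W"
    and "\<And>s'. ok W s' \<Longrightarrow> keeps (insert x (writes c)) s s' \<Longrightarrow> ev W s' e (int m)"
    and "I 0 (upd s x 0 0)"
    and "\<And>i s'. i < m \<Longrightarrow> ok W s' \<Longrightarrow> keeps (insert x (writes c)) s s' \<Longrightarrow>
      s' x 0 = int i \<Longrightarrow> I i s' \<Longrightarrow> run W c s' b (\<lambda>s''. I (Suc i) (upd s'' x 0 (int (Suc i))))"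
    and "0 \<le> b"
  shows "run W (For x e c) s (real (m + 1) * (b + 10 + real (cost e))) (I m)"
  by (rule run_mono[OF run_For[where b = "\<lambda>_. b", OF assms(1-7)]])
    (use assms in \<open>auto simp: algebra_simps\<close>)

section \<open>Loop-free programs\<close>

primrec wp :: "int \<Rightarrow> com \<Rightarrow> (state \<Rightarrow> bool) \<Rightarrow> state \<Rightarrow> bool" where
  "wp W Skip Q = Q"
| "wp W (Write x e1 e2) Q = (\<lambda>s. fits W s e1 \<and> fits W s e2 \<and> Q (upd s x (val s e1) (val s e2)))"
| "wp W (Seq c d) Q = wp W c (wp W d Q)"
| "wp W (Cond e c d) Q = (\<lambda>s. fits W s e \<and> (val s e \<noteq> 0 \<longrightarrow> wp W c Q s) \<and> (val s e = 0 \<longrightarrow> wp W d Q s))"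
| "wp W (While e c) Q = (\<lambda>s. False)"

primrec tmax :: "com \<Rightarrow> nat" where
  "tmax Skip = 1"
| "tmax (Write x e1 e2) = 1 + cost e1 + cost e2"
| "tmax (Seq c d) = tmax c + tmax d"
| "tmax (Cond e c d) = 1 + cost e + max (tmax c) (tmax d)"
| "tmax (While e c) = 0"

text \<open>Loop-free programs can be evaluated symbolically: a goal about such a program becomes
  one about values of expressions, and its time is bounded by taking the longer branch of every
  conditional. A loop has the precondition \<open>False\<close>, so loops remain with
  \<open>run_For\<close>.\<close>

lemma run_wp: "wp W c Q s \<Longrightarrow> run W c s (real (tmax c)) Q"
proof (induction c arbitrary: s Q)
  case (Seq c d)
  then obtain t1 s1 where 1: "exec W c s t1 s1" "real t1 \<le> real (tmax c)" "wp W d Q s1"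
    unfolding run_def wp.simps by blast
  with Seq.IH(2) obtain t2 s2 where 2: "exec W d s1 t2 s2" "real t2 \<le> real (tmax d)" "Q s2"
    unfolding run_def by blast
  have "exec W (Seq c d) s (t1 + t2) s2" by (rule exec.Seq) fact+
  then show ?case
    unfolding run_def using 1 2 by (intro exI[of _ "t1 + t2"] exI[of _ s2]) auto
next
  case (Cond e c d)
  have "run W (Cond e c d) s (1 + real (cost e) + real (max (tmax c) (tmax d))) Q"
  proof (rule run_Cond)
    show "ev W s e (val s e)" using Cond.prems by (simp add: ev_def)
    assume "val s e \<noteq> 0"
    then show "run W c s (real (max (tmax c) (tmax d))) Q"
      using Cond.IH(1)[of Q s] Cond.prems unfolding run_def wp.simps by fastforce
  next
    assume "val s e = 0"
    then show "run W d s (real (max (tmax c) (tmax d))) Q"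
      using Cond.IH(2)[of Q s] Cond.prems unfolding run_def wp.simps by fastforce
  qed
  then show ?case by (simp add: add.assoc)
next
  case (Write x e1 e2)
  then show ?case using run_Write[of W s e1 _ e2 _ Q x] by (simp add: ev_def)
qed (auto simp: run_Skip)

primrec evars :: "expr \<Rightarrow> string set" where
  "evars (Const a) = {}"
| "evars (Read x e) = insert x (evars e)"
| "evars (Op f e1 e2) = evars e1 \<union> evars e2"

text \<open>For frame conditions \<open>writes\<close> is enough. A clock that is added to a program
  must not be read by it either, so new names have to avoid this larger set.\<close>

primrec vars :: "com \<Rightarrow> string set" where
  "vars Skip = {}"
| "vars (Write x e1 e2) = insert x (evars e1 \<union> evars e2)"
| "vars (Seq c d) = vars c \<union> vars d"
| "vars (Cond e c d) = evars e \<union> vars c \<union> vars d"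
| "vars (While e c) = evars e \<union> vars c"

lemma finite_vars: "finite (vars c)"
proof -
  have "finite (evars e)" for e by (induction e) auto
  then show ?thesis by (induction c) auto
qed

lemma writes_subset_vars: "writes c \<subseteq> vars c"
  by (induction c) auto

text \<open>The integer product counts the middle indices that fit both sides. The summands are
  nonnegative, so nothing cancels and the Boolean product can be read off.\<close>

lemma mat_mult_index_nonzero:
  assumes "i < m" "j < m"
  shows "(mat m m (\<lambda>(i, l). of_bool (a i l)) * mat m m (\<lambda>(l, j). of_bool (b l j))) $$ (i, j) \<noteq> (0::int)
    \<longleftrightarrow> (\<exists>l<m. a i l \<and> b l j)"
proof -
  have "(mat m m (\<lambda>(i, l). of_bool (a i l)) * mat m m (\<lambda>(l, j). of_bool (b l j))) $$ (i, j)
      = (\<Sum>l\<in>{0..<m}. of_bool (a i l \<and> b l j) :: int)"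
    using assms by (simp add: times_mat_def scalar_prod_def of_bool_conj)
  also have "\<dots> \<noteq> 0 \<longleftrightarrow> (\<exists>l<m. a i l \<and> b l j)"
    by (subst sum_nonneg_eq_0_iff) auto
  finally show ?thesis .
qed

section \<open>Row-major addresses and searches by one matrix product\<close>

lemma row_major_eq:
  assumes "j < m" "j' < m"
  shows "i * m + j = i' * m + j' \<longleftrightarrow> i = i' \<and> j = (j' :: nat)"
proof -
  have "i = i' \<and> j = j'" if "i * m + j = i' * m + j'"
    using arg_cong[OF that, of "\<lambda>x. x div m"] arg_cong[OF that, of "\<lambda>x. x mod m"] assms by simp
  then show ?thesis by blast
qed

lemma row_major_less:
  assumes "i < m" "j < n"
  shows "i * n + j < m * (n::nat)"
proof -
  have "i * n + j < Suc i * n" using assms by simp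
  also have "\<dots> \<le> m * n" using assms by (intro mult_right_mono) auto
  finally show ?thesis .
qed

abbreviation cell :: "string \<Rightarrow> string \<Rightarrow> string \<Rightarrow> expr" where
  "cell i m j \<equiv> Op Plus (Op Times (Var i) (Var m)) (Var j)"

lemma ev_cell:
  assumes "ok W s" "s x 0 = int i" "s y 0 = int m" "s z 0 = int j"
    and "i < k" "j < m" "int (k * m) \<le> W"
  shows "ev W s (cell x y z) (int (i * m + j))"
proof -
  have "int (i * m + j) \<le> W"
    using row_major_less[of i k j m] assms by linarith
  moreover have "0 \<le> int (i * m)" "0 \<le> int j" by simp_all
  ultimately have "\<bar>int i * int m\<bar> \<le> W" "\<bar>int i * int m + int j\<bar> \<le> W"
    unfolding of_nat_add of_nat_mult by linarith+
  then show ?thesis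
    using assms by (intro ev_Op[where a = "int (i * m)" and b = "int j"]
        ev_Op[where a = "int i" and b = "int m"] ev_Var) auto
qed

text \<open>Since \<open>P\<close> is an arbitrary text, the arrays \<open>v i\<close> of everything
  built around it get names outside its variables and outside the names fixed by the input and
  output formats. All other arrays, \<open>''G''\<close> included, may be overwritten by
  \<open>P\<close>. The bound with \<open>m + 1\<close> holds for every \<open>m\<close> and not
  only for large ones.\<close>

locale mm_program =
  fixes P :: com and d\<^sub>0 :: nat and C\<^sub>0 \<omega> :: real and v :: "nat \<Rightarrow> string"
  assumes v_inj [simp]: "v i = v j \<longleftrightarrow> i = j"
    and v_vars: "v i \<notin> vars P"
    and v_names: "v i \<notin> {''n'', ''A'', ''B'', ''C'', ''G'', ''found'', ''vertex'', ''tail'', ''head''}"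
    and P: "\<And>m M X s W. matrices_input m M X s \<Longrightarrow> (int m + int M + 2) ^ d\<^sub>0 \<le> W \<Longrightarrow> ok W s \<Longrightarrow>
      run W P s (C\<^sub>0 * (real m + 1) powr \<omega>) (product_answer X)"
    and C\<^sub>0: "0 \<le> C\<^sub>0" and \<omega>: "2 \<le> \<omega>"
begin

lemma v_simps [simp]:
  "v i \<notin> vars P" "v i \<notin> writes P"
  "v i \<noteq> ''n''" "v i \<noteq> ''A''" "v i \<noteq> ''B''" "v i \<noteq> ''C''" "v i \<noteq> ''G''"
  "v i \<noteq> ''found''" "v i \<noteq> ''vertex''" "v i \<noteq> ''tail''" "v i \<noteq> ''head''"
  "''n'' \<noteq> v i" "''A'' \<noteq> v i" "''B'' \<noteq> v i" "''C'' \<noteq> v i" "''G'' \<noteq> v i"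
  "''found'' \<noteq> v i" "''vertex'' \<noteq> v i" "''tail'' \<noteq> v i" "''head'' \<noteq> v i"
  using v_vars[of i] v_names[of i] writes_subset_vars[of P] by auto

definition fill :: "string \<Rightarrow> nat \<Rightarrow> nat \<Rightarrow> expr \<Rightarrow> com" where
  "fill X x y e = For (v x) (Var (v 7)) (For (v y) (Var (v 7)) (Write X (cell (v x) (v 7) (v y)) e))"

lemma run_fill:
  assumes "ok W s" "1 \<le> W" "int (m * m) \<le> W" "s (v 7) 0 = int m"
    and "X \<noteq> v x" "X \<noteq> v y" "X \<noteq> v 7" "x \<noteq> y" "x \<noteq> 7" "y \<noteq> 7"
    and e: "\<And>s' i l. ok W s' \<Longrightarrow> keeps {X, v x, v y} s s' \<Longrightarrow> i < m \<Longrightarrow> l < m \<Longrightarrow> s' (v x) 0 = int i \<Longrightarrow>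
      s' (v y) 0 = int l \<Longrightarrow> ev W s' e (of_bool (a i l))"
  shows "run W (fill X x y e) s ((real m + 1)\<^sup>2 * (50 + real (cost e)))
    (\<lambda>s'. \<forall>i<m. \<forall>l<m. s' X (int (i * m + l)) = of_bool (a i l))"
proof -
  let ?W = "Write X (cell (v x) (v 7) (v y)) e"
  have mW: "int m \<le> W"
  proof -
    have "m \<le> m * m" by simp
    then show ?thesis using assms(3) by linarith
  qed
  have e7: "ev W s' (Var (v 7)) (int m)" if "ok W s'" "keeps {X, v x, v y} s s'" for s'
    using that assms by (intro ev_Var) auto
  let ?I = "\<lambda>i k s'. (\<forall>i'<i. \<forall>l<m. s' X (int (i' * m + l)) = of_bool (a i' l)) \<and>
     (\<forall>l<k. s' X (int (i * m + l)) = of_bool (a i l))"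
  have "run W (fill X x y e) s (real (m + 1) * (real (m + 1) * (18 + real (cost e) + 10 + real (cost (Var (v 7))))
     + 10 + real (cost (Var (v 7)))))
     (\<lambda>s'. \<forall>i<m. \<forall>l<m. s' X (int (i * m + l)) = of_bool (a i l))"
    unfolding fill_def
  proof (rule run_For_const[where I = "\<lambda>i s'. \<forall>i'<i. \<forall>l<m. s' X (int (i' * m + l)) = of_bool (a i' l)"])
    fix i s1 assume 1: "i < m" "ok W s1" "keeps (insert (v x) (writes (For (v y) (Var (v 7)) ?W))) s s1"
      "s1 (v x) 0 = int i" "\<forall>i'<i. \<forall>l<m. s1 X (int (i' * m + l)) = of_bool (a i' l)"
    have k1: "keeps {X, v x, v y} s s1" using 1(3) by auto
    have "run W (For (v y) (Var (v 7)) ?W) s1 (real (m + 1) * (18 + real (cost e) + 10 + real (cost (Var (v 7)))))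
       (?I i m)"
    proof (rule run_For_const[where I = "?I i"])
      fix l s2 assume 2: "l < m" "ok W s2" "keeps (insert (v y) (writes ?W)) s1 s2"
        "s2 (v y) 0 = int l" "?I i l s2"
      have x2: "s2 (v x) 0 = int i" "s2 (v 7) 0 = int m" using 2(3) k1 1(4) assms by auto
      have k2: "keeps {X, v x, v y} s s2" using 2(3) k1 by auto
      have c: "ev W s2 (cell (v x) (v 7) (v y)) (int (i * m + l))"
        using 2 x2 assms 1 by (intro ev_cell) auto
      have e2: "ev W s2 e (of_bool (a i l))"
        using e[OF 2(2) k2 1(1) 2(1) x2(1) 2(4)] .
      have "?I i (Suc l) (upd (upd s2 X (int (i * m + l)) (of_bool (a i l))) (v y) 0 (int (Suc l)))"
        using 2(1,5) assms(6) by (auto simp: row_major_eq less_Suc_eq simp del: of_nat_add of_nat_mult)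
      from run_Write[where Q = "\<lambda>s. ?I i (Suc l) (upd s (v y) 0 (int (Suc l)))", OF c e2 this]
      show "run W ?W s2 (18 + real (cost e)) (\<lambda>s''. ?I i (Suc l) (upd s'' (v y) 0 (int (Suc l))))"
        by (rule run_mono) (use 2 in auto)
    qed (use assms 1 mW e7 k1 in \<open>auto simp: ev_Var\<close>)
    then show "run W (For (v y) (Var (v 7)) ?W) s1 (real (m + 1) * (18 + real (cost e) + 10 + real (cost (Var (v 7)))))
       (\<lambda>s''. \<forall>i'<Suc i. \<forall>l<m. upd s'' (v x) 0 (int (Suc i)) X (int (i' * m + l)) = of_bool (a i' l))"
      by (rule run_mono) (use 1 assms in \<open>auto simp: less_Suc_eq\<close>)
  qed (use assms mW e7 in auto)
  then show ?thesis
    by (rule run_mono) (use assms(1) in \<open>auto simp: algebra_simps power2_eq_square\<close>)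
qed

text \<open>The product only tells for which pairs \<open>(i, j)\<close> some middle index exists.
  One such pair that also satisfies \<open>eC\<close> is remembered, and its middle index is then
  found in linear time by evaluating \<open>eA\<close> and \<open>eB\<close> again. The expressions
  refer to the row, the column and the middle index through \<open>v 4\<close>, \<open>v 5\<close>
  and \<open>v 6\<close>; \<open>ex\<close>, \<open>ey\<close>, \<open>ez\<close> translate the
  indices into the reported values.\<close>

definition detect :: "expr \<Rightarrow> expr \<Rightarrow> expr \<Rightarrow> expr \<Rightarrow> expr \<Rightarrow> expr \<Rightarrow> expr \<Rightarrow> com" where
  "detect em eA eB eC ex ey ez =
    Seq (Set (v 7) em) (Seq (Set ''n'' (Var (v 7))) (Seq (fill ''A'' 4 6 eA) (Seq (fill ''B'' 6 5 eB) (Seq P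
    (Seq (Set (v 8) (Const 0))
    (Seq (For (v 4) (Var (v 7)) (For (v 5) (Var (v 7))
       (Cond (Read ''C'' (cell (v 4) (v 7) (v 5)))
         (Cond eC (Seq (Set (v 8) (Const 1)) (Seq (Set (v 9) (Var (v 4))) (Set (v 10) (Var (v 5))))) Skip) Skip)))
    (Cond (Var (v 8))
      (Seq (Set (v 4) (Var (v 9))) (Seq (Set (v 5) (Var (v 10)))
      (For (v 6) (Var (v 7))
        (Cond eA (Cond eB
          (Seq (Set (v 0) (Const 1)) (Seq (Set (v 11) ex) (Seq (Set (v 12) ey) (Set (v 13) ez)))) Skip) Skip))))
      Skip)))))))"

definition scratch :: "string set" where
  "scratch = writes P \<union> {''n'', ''A'', ''B'', ''C''} \<union> v ` {0, 4, 5, 6, 7, 8, 9, 10, 11, 12, 13}"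

lemma writes_fill [simp]: "writes (fill X x y e) = {X, v x, v y}"
  by (auto simp: fill_def)

lemma writes_detect: "writes (detect em eA eB eC ex ey ez) \<subseteq> scratch"
  by (auto simp: detect_def scratch_def)

lemma v_scratch [simp]: "v i \<in> scratch \<longleftrightarrow> i \<in> {0, 4, 5, 6, 7, 8, 9, 10, 11, 12, 13}"
  by (auto simp: scratch_def)

lemma scratchI [simp]: "''n'' \<in> scratch" "''A'' \<in> scratch" "''B'' \<in> scratch" "''C'' \<in> scratch"
  "y \<in> writes P \<Longrightarrow> y \<in> scratch"
  by (auto simp: scratch_def)

end

context mm_program
begin

lemma not_scratch:
  "y \<notin> scratch \<Longrightarrow> i \<in> {0, 4, 5, 6, 7, 8, 9, 10, 11, 12, 13} \<Longrightarrow> y \<noteq> v i"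
  "y \<notin> scratch \<Longrightarrow> y \<noteq> ''n''" "y \<notin> scratch \<Longrightarrow> y \<noteq> ''A''" "y \<notin> scratch \<Longrightarrow> y \<noteq> ''B''" "y \<notin> scratch \<Longrightarrow> y \<noteq> ''C''"
  by (auto simp: scratch_def)

text \<open>The constant \<open>K\<close> stands outside the quantifiers over inputs and word
  bounds, for it may depend on the texts of the expressions only. The expressions are evaluated deep
  inside the loops; hence they must have their values on the whole index square, in every state that
  agrees with \<open>s\<close> outside \<open>scratch\<close>.\<close>

definition detect_bound :: "expr \<Rightarrow> expr \<Rightarrow> expr \<Rightarrow> expr \<Rightarrow> expr \<Rightarrow> expr \<Rightarrow> expr \<Rightarrow> real \<Rightarrow> bool" where
  "detect_bound em eA eB eC ex ey ez K \<longleftrightarrow> 0 \<le> K \<and> (\<forall>W s m a b c X Y Z.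
    ok W s \<longrightarrow> (int m + 3) ^ d\<^sub>0 \<le> W \<longrightarrow> int (m * m) \<le> W \<longrightarrow> 1 \<le> W \<longrightarrow>
    ev W s em (int m) \<longrightarrow>
    (\<forall>s' i l. ok W s' \<longrightarrow> keeps scratch s s' \<longrightarrow> i < m \<longrightarrow> l < m \<longrightarrow>
      s' (v 4) 0 = int i \<longrightarrow> s' (v 6) 0 = int l \<longrightarrow> ev W s' eA (of_bool (a i l))) \<longrightarrow>
    (\<forall>s' l j. ok W s' \<longrightarrow> keeps scratch s s' \<longrightarrow> l < m \<longrightarrow> j < m \<longrightarrow>
      s' (v 6) 0 = int l \<longrightarrow> s' (v 5) 0 = int j \<longrightarrow> ev W s' eB (of_bool (b l j))) \<longrightarrow>
    (\<forall>s' i j. ok W s' \<longrightarrow> keeps scratch s s' \<longrightarrow> i < m \<longrightarrow> j < m \<longrightarrow>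
      s' (v 4) 0 = int i \<longrightarrow> s' (v 5) 0 = int j \<longrightarrow> ev W s' eC (of_bool (c i j))) \<longrightarrow>
    (\<forall>s' i. ok W s' \<longrightarrow> keeps scratch s s' \<longrightarrow> i < m \<longrightarrow> s' (v 4) 0 = int i \<longrightarrow> ev W s' ex (X i)) \<longrightarrow>
    (\<forall>s' j. ok W s' \<longrightarrow> keeps scratch s s' \<longrightarrow> j < m \<longrightarrow> s' (v 5) 0 = int j \<longrightarrow> ev W s' ey (Y j)) \<longrightarrow>
    (\<forall>s' l. ok W s' \<longrightarrow> keeps scratch s s' \<longrightarrow> l < m \<longrightarrow> s' (v 6) 0 = int l \<longrightarrow> ev W s' ez (Z l)) \<longrightarrow>
    run W (detect em eA eB eC ex ey ez) s (K * (real m + 1) powr \<omega>)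
      (\<lambda>s'. if \<exists>i<m. \<exists>j<m. \<exists>l<m. a i l \<and> b l j \<and> c i j
        then s' (v 0) 0 = 1 \<and> (\<exists>i<m. \<exists>j<m. \<exists>l<m. a i l \<and> b l j \<and> c i j \<and>
          s' (v 11) 0 = X i \<and> s' (v 12) 0 = Y j \<and> s' (v 13) 0 = Z l)
        else \<forall>k\<in>{0, 11, 12, 13}. s' (v k) = s (v k)))"

lemma detect_bound_exists: "\<exists>K. detect_bound em eA eB eC ex ey ez K"
proof -
  define inner where "inner = Cond eA (Cond eB
          (Seq (Set (v 0) (Const 1)) (Seq (Set (v 11) ex) (Seq (Set (v 12) ey) (Set (v 13) ez)))) Skip) Skip"
  define mark where "mark = Cond (Read ''C'' (cell (v 4) (v 7) (v 5)))
         (Cond eC (Seq (Set (v 8) (Const 1)) (Seq (Set (v 9) (Var (v 4))) (Set (v 10) (Var (v 5))))) Skip) Skip"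
  define tail where "tail = Cond (Var (v 8))
      (Seq (Set (v 4) (Var (v 9))) (Seq (Set (v 5) (Var (v 10))) (For (v 6) (Var (v 7)) inner))) Skip"
  define K where "K = real (cost em) + 1000 + real (cost eA) + real (cost eB) + C\<^sub>0 +
    2 * real (tmax mark) + 2 * real (tmax inner)"
  have K0: "0 \<le> K" by (simp add: K_def C\<^sub>0)
  have "run W (detect em eA eB eC ex ey ez) s (K * (real m + 1) powr \<omega>)
      (\<lambda>s'. if \<exists>i<m. \<exists>j<m. \<exists>l<m. a i l \<and> b l j \<and> c i j
        then s' (v 0) 0 = 1 \<and> (\<exists>i<m. \<exists>j<m. \<exists>l<m. a i l \<and> b l j \<and> c i j \<and>
          s' (v 11) 0 = X i \<and> s' (v 12) 0 = Y j \<and> s' (v 13) 0 = Z l)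
        else \<forall>k\<in>{0, 11, 12, 13}. s' (v k) = s (v k))" (is "run W _ s _ ?Q")
    if H: "ok W s" "(int m + 3) ^ d\<^sub>0 \<le> W" "int (m * m) \<le> W" "1 \<le> W" "ev W s em (int m)"
      and A: "\<And>s' i l. ok W s' \<Longrightarrow> keeps scratch s s' \<Longrightarrow> i < m \<Longrightarrow> l < m \<Longrightarrow>
        s' (v 4) 0 = int i \<Longrightarrow> s' (v 6) 0 = int l \<Longrightarrow> ev W s' eA (of_bool (a i l))"
      and B: "\<And>s' l j. ok W s' \<Longrightarrow> keeps scratch s s' \<Longrightarrow> l < m \<Longrightarrow> j < m \<Longrightarrow>
        s' (v 6) 0 = int l \<Longrightarrow> s' (v 5) 0 = int j \<Longrightarrow> ev W s' eB (of_bool (b l j))"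
      and C: "\<And>s' i j. ok W s' \<Longrightarrow> keeps scratch s s' \<Longrightarrow> i < m \<Longrightarrow> j < m \<Longrightarrow>
        s' (v 4) 0 = int i \<Longrightarrow> s' (v 5) 0 = int j \<Longrightarrow> ev W s' eC (of_bool (c i j))"
      and X: "\<And>s' i. ok W s' \<Longrightarrow> keeps scratch s s' \<Longrightarrow> i < m \<Longrightarrow> s' (v 4) 0 = int i \<Longrightarrow> ev W s' ex (X i)"
      and Y: "\<And>s' j. ok W s' \<Longrightarrow> keeps scratch s s' \<Longrightarrow> j < m \<Longrightarrow> s' (v 5) 0 = int j \<Longrightarrow> ev W s' ey (Y j)"
      and Z: "\<And>s' l. ok W s' \<Longrightarrow> keeps scratch s s' \<Longrightarrow> l < m \<Longrightarrow> s' (v 6) 0 = int l \<Longrightarrow> ev W s' ez (Z l)"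
    for W s m a b c X Y Z
  proof -
    have mW: "int m \<le> W"
    proof -
      have "m \<le> m * m" by simp
      then show ?thesis using H(3) by linarith
    qed
    let ?prod = "\<lambda>i j. \<exists>l<m. a i l \<and> b l j"
    have ifits: "\<bar>int i\<bar> \<le> W" if "i < m" for i using that mW by simp
    have inner: "run W inner s' (real (tmax inner))
       (\<lambda>s''. if a i l \<and> b l j then s'' (v 0) 0 = 1 \<and> s'' (v 11) 0 = X i \<and> s'' (v 12) 0 = Y j \<and> s'' (v 13) 0 = Z l
          else s'' = s')"
      if "ok W s'" "keeps scratch s s'" "i < m" "j < m" "l < m"
        "s' (v 4) 0 = int i" "s' (v 5) 0 = int j" "s' (v 6) 0 = int l" for s' i j l
    proof -
      have 1: "ev W s' eA (of_bool (a i l))" "ev W s' eB (of_bool (b l j))"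
        using A B that by auto
      let ?s1 = "upd s' (v 0) 0 1" let ?s2 = "upd ?s1 (v 11) 0 (X i)" let ?s3 = "upd ?s2 (v 12) 0 (Y j)"
      have x: "ev W ?s1 ex (X i)"
        by (rule X) (use that H in auto)
      have fx: "ok W ?s1 \<and> \<bar>X i\<bar> \<le> W"
        using x fits_val[of W ?s1 ex] that(1) H(4) by (auto simp: ev_def)
      have y: "ev W ?s2 ey (Y j)"
        by (rule Y) (use that H fx in auto)
      have fy: "ok W ?s2 \<and> \<bar>Y j\<bar> \<le> W"
        using y fits_val[of W ?s2 ey] fx by (auto simp: ev_def)
      have z: "ev W ?s3 ez (Z l)"
        by (rule Z) (use that H fy in auto)
      have "wp W inner (\<lambda>s''. if a i l \<and> b l j then s'' (v 0) 0 = 1 \<and> s'' (v 11) 0 = X i \<and> s'' (v 12) 0 = Y j \<and> s'' (v 13) 0 = Z l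
          else s'' = s') s'"
        using 1 x y z H(4) unfolding inner_def by (simp add: ev_def)
      then show ?thesis by (rule run_wp)
    qed
    have mark: "run W mark s' (real (tmax mark))
       (\<lambda>s''. if ?prod i j \<and> c i j then s'' (v 8) 0 = 1 \<and> s'' (v 9) 0 = int i \<and> s'' (v 10) 0 = int j
          else s'' = s')"
      if "ok W s'" "keeps scratch s s'" "i < m" "j < m" "s' (v 7) 0 = int m"
        "s' (v 4) 0 = int i" "s' (v 5) 0 = int j" "s' ''C'' (int (i * m + j)) \<noteq> 0 \<longleftrightarrow> ?prod i j" for s' i j
    proof -
      have "ev W s' (cell (v 4) (v 7) (v 5)) (int (i * m + j))"
        using that H by (intro ev_cell) auto
      from ev_Read[OF that(1) this, of "''C''"]
      have 1: "fits W s' (Read ''C'' (cell (v 4) (v 7) (v 5)))"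
        "val s' (Read ''C'' (cell (v 4) (v 7) (v 5))) = 0 \<longleftrightarrow> \<not> ?prod i j"
        using that(8) by (auto simp: ev_def simp del: fits.simps val.simps)
      have 2: "ev W s' eC (of_bool (c i j))" using C that by auto
      have "wp W mark (\<lambda>s''. if ?prod i j \<and> c i j then s'' (v 8) 0 = 1 \<and> s'' (v 9) 0 = int i \<and> s'' (v 10) 0 = int j
          else s'' = s') s'"
        unfolding mark_def wp.simps(4) 1(2) using 1(1) 2 H(4) that ifits[of i] ifits[of j] by (auto simp: ev_def)
      then show ?thesis by (rule run_wp)
    qed
    \<comment> \<open>Progress in lexicographic order: either no pair before \<open>(i, j)\<close>
      qualifies, or the flag \<open>v 8\<close> is set and \<open>v 9\<close>, \<open>v 10\<close>
      hold a qualifying pair. The end of a row turns \<open>(i, m)\<close> into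
      \<open>(i + 1, 0)\<close>.\<close>
    let ?hit = "\<lambda>i j s'. if s' (v 8) 0 = 0 then \<forall>i'<m. \<forall>j'<m. (i' < i \<or> i' = i \<and> j' < j) \<longrightarrow> \<not> (?prod i' j' \<and> c i' j')
       else \<exists>i'<m. \<exists>j'<m. ?prod i' j' \<and> c i' j' \<and> s' (v 9) 0 = int i' \<and> s' (v 10) 0 = int j'"
    let ?outs = "\<lambda>s'. \<forall>k\<in>{0, 11, 12, 13}. s' (v k) = s (v k)"
    have loop: "run W (For (v 4) (Var (v 7)) (For (v 5) (Var (v 7)) mark)) s'
        (real (m + 1) * (real (m + 1) * (real (tmax mark) + 10 + real (cost (Var (v 7)))) + 10 + real (cost (Var (v 7)))))
        (?hit m 0)"
      if s': "ok W s'" "keeps scratch s s'" "s' (v 7) 0 = int m" "s' (v 8) 0 = 0"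
        "\<forall>i<m. \<forall>j<m. s' ''C'' (int (i * m + j)) \<noteq> 0 \<longleftrightarrow> ?prod i j" for s'
    proof (rule run_For_const[where I = "\<lambda>i s'. ?hit i 0 s'"])
      fix i s1 assume 1: "i < m" "ok W s1" "keeps (insert (v 4) (writes (For (v 5) (Var (v 7)) mark))) s' s1"
        "s1 (v 4) 0 = int i" "?hit i 0 s1"
      have w1: "keeps {v 4, v 5, v 8, v 9, v 10} s' s1" using 1(3) by (auto simp: mark_def)
      have "run W (For (v 5) (Var (v 7)) mark) s1 (real (m + 1) * (real (tmax mark) + 10 + real (cost (Var (v 7)))))
         (?hit i m)"
      proof (rule run_For_const[where I = "\<lambda>j s'. ?hit i j s'"])
        fix j s2 assume 2: "j < m" "ok W s2" "keeps (insert (v 5) (writes mark)) s1 s2"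
          "s2 (v 5) 0 = int j" "?hit i j s2"
        have w2: "keeps {v 5, v 8, v 9, v 10} s1 s2" using 2(3) by (auto simp: mark_def)
        then have w3: "keeps {v 4, v 5, v 8, v 9, v 10} s' s2" using w1 by auto
        have "run W mark s2 (real (tmax mark))
         (\<lambda>s''. if ?prod i j \<and> c i j then s'' (v 8) 0 = 1 \<and> s'' (v 9) 0 = int i \<and> s'' (v 10) 0 = int j
            else s'' = s2)"
          by (rule mark) (use 1 2 w2 w3 s' in \<open>auto simp: not_scratch\<close>)
        then show "run W mark s2 (real (tmax mark)) (\<lambda>s''. ?hit i (Suc j) (upd s'' (v 5) 0 (int (Suc j))))"
        proof (rule run_mono)
          fix s3 assume 3: "if ?prod i j \<and> c i j then s3 (v 8) 0 = 1 \<and> s3 (v 9) 0 = int i \<and> s3 (v 10) 0 = int j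
            else s3 = s2"
          show "?hit i (Suc j) (upd s3 (v 5) 0 (int (Suc j)))"
          proof (cases "?prod i j \<and> c i j")
            case True
            then show ?thesis using 3 1(1) 2(1) by auto
          next
            case False
            then show ?thesis using 3 2(5) by (auto simp: less_Suc_eq split: if_splits)
          qed
        qed (use 2 in auto)
      qed (use 1 H mW s' w1 in \<open>auto simp: ev_Var mark_def\<close>)
      then show "run W (For (v 5) (Var (v 7)) mark) s1 (real (m + 1) * (real (tmax mark) + 10 + real (cost (Var (v 7)))))
         (\<lambda>s''. ?hit (Suc i) 0 (upd s'' (v 4) 0 (int (Suc i))))"
        by (rule run_mono) (use 1 in \<open>auto simp: less_Suc_eq split: if_splits\<close>)
    qed (use H mW s' in \<open>auto simp: ev_Var mark_def\<close>)
    let ?QQ = "\<lambda>s'. if \<exists>i<m. \<exists>j<m. ?prod i j \<and> c i j then s' (v 0) 0 = 1 \<and> (\<exists>i<m. \<exists>j<m. \<exists>l<m. a i l \<and> b l j \<and> c i j \<and>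
          s' (v 11) 0 = X i \<and> s' (v 12) 0 = Y j \<and> s' (v 13) 0 = Z l) else ?outs s'"
    have tail: "run W tail s' (3 + (13 + (real (m + 1) * (real (tmax inner) + 10 + real (cost (Var (v 7))))))) ?QQ"
      if s': "ok W s'" "keeps scratch s s'" "s' (v 7) 0 = int m" "?outs s'" "?hit m 0 s'" for s'
    proof -
      have "run W tail s' (1 + real (cost (Var (v 8))) + (13 + (real (m + 1) * (real (tmax inner) + 10 + real (cost (Var (v 7))))))) ?QQ"
        unfolding tail_def
      proof (rule run_Cond)
        show "ev W s' (Var (v 8)) (s' (v 8) 0)" using s' by (auto simp: ev_Var)
        assume hit: "s' (v 8) 0 \<noteq> 0"
        obtain i j where ij: "i < m" "j < m" "?prod i j" "c i j" "s' (v 9) 0 = int i" "s' (v 10) 0 = int j"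
          using s'(5) hit by auto
        have "run W (Seq (Set (v 4) (Var (v 9))) (Seq (Set (v 5) (Var (v 10))) (For (v 6) (Var (v 7)) inner))) s'
          (4 + (4 + (real (m + 1) * (real (tmax inner) + 10 + real (cost (Var (v 7))))))) ?QQ"
        proof (rule run_Seq)
          show "run W (Set (v 4) (Var (v 9))) s' 4 (\<lambda>s''. s'' (v 4) 0 = int i)"
            using run_Write[of W s' "Const 0" 0 "Var (v 9)" "int i" "\<lambda>s''. s'' (v 4) 0 = int i" "v 4"] s' ij H
            by (auto simp: ev_Var ev_Const)
          fix s1 assume s1: "s1 (v 4) 0 = int i" "ok W s1" "keeps (writes (Set (v 4) (Var (v 9)))) s' s1"
          show "run W (Seq (Set (v 5) (Var (v 10))) (For (v 6) (Var (v 7)) inner)) s1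
            (4 + (real (m + 1) * (real (tmax inner) + 10 + real (cost (Var (v 7)))))) ?QQ"
          proof (rule run_Seq)
            show "run W (Set (v 5) (Var (v 10))) s1 4 (\<lambda>s''. s'' (v 5) 0 = int j)"
              using run_Write[of W s1 "Const 0" 0 "Var (v 10)" "int j" "\<lambda>s''. s'' (v 5) 0 = int j" "v 5"] s1 ij H
              by (auto simp: ev_Var ev_Const)
            fix s2 assume s2: "s2 (v 5) 0 = int j" "ok W s2" "keeps (writes (Set (v 5) (Var (v 10)))) s1 s2"
            have k2: "keeps {v 4, v 5} s' s2" using s1 s2 by auto
            let ?J = "\<lambda>k s'. if \<exists>l<k. a i l \<and> b l j then s' (v 0) 0 = 1 \<and> (\<exists>l<m. a i l \<and> b l j \<and>
               s' (v 11) 0 = X i \<and> s' (v 12) 0 = Y j \<and> s' (v 13) 0 = Z l) else ?outs s'"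
            have "run W (For (v 6) (Var (v 7)) inner) s2
                (real (m + 1) * (real (tmax inner) + 10 + real (cost (Var (v 7))))) (?J m)"
            proof (rule run_For_const[where I = ?J])
              fix l s3 assume 3: "l < m" "ok W s3" "keeps (insert (v 6) (writes inner)) s2 s3"
                "s3 (v 6) 0 = int l" "?J l s3"
              have w3: "keeps {v 6, v 0, v 11, v 12, v 13} s2 s3" using 3(3) by (auto simp: inner_def)
              have "run W inner s3 (real (tmax inner))
                 (\<lambda>s''. if a i l \<and> b l j then s'' (v 0) 0 = 1 \<and> s'' (v 11) 0 = X i \<and> s'' (v 12) 0 = Y j \<and> s'' (v 13) 0 = Z l
                    else s'' = s3)"
                by (rule inner) (use 3 w3 k2 s2 s1 s' ij in \<open>auto simp: not_scratch\<close>)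
              then show "run W inner s3 (real (tmax inner)) (\<lambda>s''. ?J (Suc l) (upd s'' (v 6) 0 (int (Suc l))))"
              proof (rule run_mono)
                fix s4 assume 4: "if a i l \<and> b l j then s4 (v 0) 0 = 1 \<and> s4 (v 11) 0 = X i \<and> s4 (v 12) 0 = Y j \<and> s4 (v 13) 0 = Z l
                    else s4 = s3"
                show "?J (Suc l) (upd s4 (v 6) 0 (int (Suc l)))"
                proof (cases "a i l \<and> b l j")
                  case True
                  then show ?thesis using 4 3(1) by auto
                next
                  case False
                  then have "(\<exists>l'<Suc l. a i l' \<and> b l' j) \<longleftrightarrow> (\<exists>l'<l. a i l' \<and> b l' j)"
                    using less_Suc_eq by auto
                  then show ?thesis using False 4 3(5) by auto
                qed
              qed (use 3 in auto)
            qed (use s2 H mW k2 s' in \<open>auto simp: ev_Var inner_def\<close>)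
            then show "run W (For (v 6) (Var (v 7)) inner) s2
                (real (m + 1) * (real (tmax inner) + 10 + real (cost (Var (v 7))))) ?QQ"
            proof (rule run_mono)
              fix s5 assume "?J m s5"
              then show "?QQ s5" using ij by auto
            qed (use s2 in auto)
          qed (use s1 in auto)
        qed (use s' in auto)
        then show "run W (Seq (Set (v 4) (Var (v 9))) (Seq (Set (v 5) (Var (v 10))) (For (v 6) (Var (v 7)) inner))) s'
          (13 + (real (m + 1) * (real (tmax inner) + 10 + real (cost (Var (v 7)))))) ?QQ"
          by (rule run_mono) (use s' in auto)
      next
        assume "s' (v 8) 0 = 0"
        then have "\<not> (\<exists>i<m. \<exists>j<m. ?prod i j \<and> c i j)" using s'(5) by (simp only: if_True simp_thms) blast
        then have "?QQ s'" using s'(4) by (simp only: if_False)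
        from run_Skip[of ?QQ, OF this]
        show "run W Skip s' (13 + (real (m + 1) * (real (tmax inner) + 10 + real (cost (Var (v 7)))))) ?QQ"
          by (rule run_mono) (use s' in auto)
      qed
      then show ?thesis by simp
    qed
    let ?t1 = "real (2 + cost em)"
    let ?tA = "(real m + 1)\<^sup>2 * (50 + real (cost eA))" let ?tB = "(real m + 1)\<^sup>2 * (50 + real (cost eB))"
    let ?tl = "real (m + 1) * (real (m + 1) * (real (tmax mark) + 10 + real (cost (Var (v 7)))) + 10 + real (cost (Var (v 7))))"
    let ?tt = "3 + (13 + (real (m + 1) * (real (tmax inner) + 10 + real (cost (Var (v 7))))))"
    have main: "run W (detect em eA eB eC ex ey ez) s
      (?t1 + (4 + (?tA + (?tB + (C\<^sub>0 * (real m + 1) powr \<omega> + (3 + (?tl + ?tt))))))) ?QQ"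
      unfolding detect_def mark_def[symmetric] inner_def[symmetric] tail_def[symmetric]
    proof (rule run_Seq)
      show "run W (Set (v 7) em) s ?t1 (\<lambda>s'. s' (v 7) 0 = int m \<and> keeps {v 7} s s')"
        by (rule run_mono[OF run_Write[where a = 0 and b = "int m" and Q = "\<lambda>s'. s' (v 7) 0 = int m \<and> keeps {v 7} s s'"]])
          (use H in \<open>auto simp: ev_Const\<close>)
    next
      fix s1 assume "s1 (v 7) 0 = int m \<and> keeps {v 7} s s1" and ok1: "ok W s1"
      then have 1: "s1 (v 7) 0 = int m" "keeps {v 7} s s1" by auto
      show "run W (Seq (Set ''n'' (Var (v 7))) (Seq (fill ''A'' 4 6 eA) (Seq (fill ''B'' 6 5 eB)
        (Seq P (Seq (Set (v 8) (Const 0)) (Seq (For (v 4) (Var (v 7)) (For (v 5) (Var (v 7)) mark)) tail)))))) s1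
        (4 + (?tA + (?tB + (C\<^sub>0 * (real m + 1) powr \<omega> + (3 + (?tl + ?tt)))))) ?QQ"
      proof (rule run_Seq)
        show "run W (Set ''n'' (Var (v 7))) s1 4 (\<lambda>s'. s' ''n'' 0 = int m)"
          by (rule run_mono[OF run_Write[where a = 0 and b = "int m" and Q = "\<lambda>s'. s' ''n'' 0 = int m"]])
            (use H 1 ok1 in \<open>auto simp: ev_Const ev_Var\<close>)
      next
        fix s2 assume 2: "s2 ''n'' 0 = int m" and ok2: "ok W s2" and "keeps (writes (Set ''n'' (Var (v 7)))) s1 s2"
        then have k2: "keeps {v 7, ''n''} s s2" "s2 (v 7) 0 = int m" using 1 by auto
        show "run W (Seq (fill ''A'' 4 6 eA) (Seq (fill ''B'' 6 5 eB)
          (Seq P (Seq (Set (v 8) (Const 0)) (Seq (For (v 4) (Var (v 7)) (For (v 5) (Var (v 7)) mark)) tail))))) s2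
          (?tA + (?tB + (C\<^sub>0 * (real m + 1) powr \<omega> + (3 + (?tl + ?tt))))) ?QQ"
        proof (rule run_Seq)
          show "run W (fill ''A'' 4 6 eA) s2 ?tA (\<lambda>s'. \<forall>i<m. \<forall>l<m. s' ''A'' (int (i * m + l)) = of_bool (a i l))"
          proof (rule run_fill)
            show "ev W s' eA (of_bool (a i l))"
              if "ok W s'" "keeps {''A'', v 4, v 6} s2 s'" "i < m" "l < m" "s' (v 4) 0 = int i" "s' (v 6) 0 = int l"
              for s' i l
              by (rule A) (use that k2 in \<open>auto simp: not_scratch\<close>)
          qed (use ok2 k2 H in auto)
        next
          fix s3 assume 3: "\<forall>i<m. \<forall>l<m. s3 ''A'' (int (i * m + l)) = of_bool (a i l)"
            and ok3: "ok W s3" and "keeps (writes (fill ''A'' 4 6 eA)) s2 s3"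
          then have k3: "keeps {v 7, ''n'', ''A'', v 4, v 6} s s3" "s3 (v 7) 0 = int m" "s3 ''n'' 0 = int m"
            using k2 2 by auto
          show "run W (Seq (fill ''B'' 6 5 eB)
            (Seq P (Seq (Set (v 8) (Const 0)) (Seq (For (v 4) (Var (v 7)) (For (v 5) (Var (v 7)) mark)) tail)))) s3
            (?tB + (C\<^sub>0 * (real m + 1) powr \<omega> + (3 + (?tl + ?tt)))) ?QQ"
          proof (rule run_Seq)
            show "run W (fill ''B'' 6 5 eB) s3 ?tB (\<lambda>s'. \<forall>l<m. \<forall>j<m. s' ''B'' (int (l * m + j)) = of_bool (b l j))"
            proof (rule run_fill)
              show "ev W s' eB (of_bool (b l j))"
                if "ok W s'" "keeps {''B'', v 6, v 5} s3 s'" "l < m" "j < m" "s' (v 6) 0 = int l" "s' (v 5) 0 = int j"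
                for s' l j
                by (rule B) (use that k3 in \<open>auto simp: not_scratch\<close>)
            qed (use ok3 k3 H in auto)
          next
            fix s4 assume 4: "\<forall>i<m. \<forall>l<m. s4 ''B'' (int (i * m + l)) = of_bool (b i l)"
              and ok4: "ok W s4" and "keeps (writes (fill ''B'' 6 5 eB)) s3 s4"
            then have k4: "keeps {v 7, ''n'', ''A'', ''B'', v 4, v 5, v 6} s s4" "s4 (v 7) 0 = int m" "s4 ''n'' 0 = int m"
              "\<forall>i<m. \<forall>l<m. s4 ''A'' (int (i * m + l)) = of_bool (a i l)"
              using k3 3 by auto
            let ?MA = "mat m m (\<lambda>(i, l). of_bool (a i l)) :: int mat"
            let ?MB = "mat m m (\<lambda>(i, l). of_bool (b i l)) :: int mat"
            show "run W (Seq P (Seq (Set (v 8) (Const 0)) (Seq (For (v 4) (Var (v 7)) (For (v 5) (Var (v 7)) mark)) tail))) s4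
              (C\<^sub>0 * (real m + 1) powr \<omega> + (3 + (?tl + ?tt))) ?QQ"
            proof (rule run_Seq)
              \<comment> \<open>All entries are \<open>0\<close> or \<open>1\<close>, so the
                magnitude is \<open>1\<close> and the word bound that \<open>P\<close> demands is
                the assumed power of \<open>m + 3\<close>.\<close>
              show "run W P s4 (C\<^sub>0 * (real m + 1) powr \<omega>) (product_answer (?MA, ?MB))"
                by (rule P[where M = 1]) (use H ok4 k4 4 in \<open>auto simp: matrices_input_def add.commute\<close>)
            next
              fix s5 assume 5: "product_answer (?MA, ?MB) s5" and ok5: "ok W s5" and "keeps (writes P) s4 s5"
              then have k5: "keeps scratch s s5" "s5 (v 7) 0 = int m" "\<forall>k\<in>{0,11,12,13}. s5 (v k) = s (v k)"
                using k4 by (auto simp: scratch_def)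
              have "\<forall>i<m. \<forall>j<m. s5 ''C'' (int (i * m + j)) = (?MA * ?MB) $$ (i, j)"
                using 5 by (simp add: product_answer_def)
              then have C5: "\<forall>i<m. \<forall>j<m. s5 ''C'' (int (i * m + j)) \<noteq> 0 \<longleftrightarrow> ?prod i j"
                using mat_mult_index_nonzero[of _ m _ a b] by (simp del: of_nat_add of_nat_mult)
              show "run W (Seq (Set (v 8) (Const 0)) (Seq (For (v 4) (Var (v 7)) (For (v 5) (Var (v 7)) mark)) tail)) s5
                 (3 + (?tl + ?tt)) ?QQ"
              proof (rule run_Seq)
                show "run W (Set (v 8) (Const 0)) s5 3 (\<lambda>s'. s' (v 8) 0 = 0)"
                  by (rule run_mono[OF run_Write[where a = 0 and b = 0 and Q = "\<lambda>s'. s' (v 8) 0 = 0"]])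
                    (use H ok5 in \<open>auto simp: ev_Const\<close>)
              next
                fix s6 assume 6: "s6 (v 8) 0 = 0" and ok6: "ok W s6" and w6: "keeps (writes (Set (v 8) (Const 0))) s5 s6"
                show "run W (Seq (For (v 4) (Var (v 7)) (For (v 5) (Var (v 7)) mark)) tail) s6 (?tl + ?tt) ?QQ"
                proof (rule run_Seq[OF loop])
                  fix s7 assume 7: "?hit m 0 s7" and ok7: "ok W s7"
                    and w7: "keeps (writes (For (v 4) (Var (v 7)) (For (v 5) (Var (v 7)) mark))) s6 s7"
                  then have w7': "keeps {v 4, v 5, v 8, v 9, v 10} s6 s7" by (auto simp: mark_def)
                  show "run W tail s7 ?tt ?QQ"
                    by (rule tail) (use 7 ok7 w7' k5 w6 in \<open>auto simp: not_scratch\<close>)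
                qed (use 6 ok6 w6 k5 C5 in \<open>auto simp: not_scratch\<close>)
              qed (use ok5 in auto)
            qed (use ok4 in auto)
          qed (use ok3 in auto)
        qed (use ok2 in auto)
      qed (use ok1 in auto)
    qed (use H in auto)
    show ?thesis
    proof (rule run_mono[OF main])
      let ?x = "real m + 1"
      \<comment> \<open>Filling the matrices and scanning the product is quadratic;
        \<open>\<omega> \<ge> 2\<close> lets the multiplication absorb it.\<close>
      have p: "?x\<^sup>2 \<le> ?x powr \<omega>"
        using powr_mono[of 2 \<omega> ?x] \<omega> by (simp add: powr_numeral)
      have q: "?x \<le> ?x\<^sup>2" "1 \<le> ?x\<^sup>2" by (simp_all add: power2_eq_square algebra_simps)
      have q': "?x * (24 + real (tmax inner)) \<le> ?x\<^sup>2 * (24 + real (tmax inner))"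
        "1 * (real (cost em) + 25) \<le> ?x\<^sup>2 * (real (cost em) + 25)"
        by (intro mult_right_mono q; simp)+
      have "?t1 + (4 + (?tA + (?tB + (C\<^sub>0 * ?x powr \<omega> + (3 + (?tl + ?tt)))))) =
        (real (cost em) + 25) + ?x * (24 + real (tmax inner)) +
        ?x\<^sup>2 * (112 + real (cost eA) + real (cost eB) + real (tmax mark)) + C\<^sub>0 * ?x powr \<omega>"
        by (simp add: algebra_simps power2_eq_square)
      also have "\<dots> \<le> ?x\<^sup>2 * (real (cost em) + 25) + ?x\<^sup>2 * (24 + real (tmax inner)) +
        ?x\<^sup>2 * (112 + real (cost eA) + real (cost eB) + real (tmax mark)) + C\<^sub>0 * ?x powr \<omega>"
        using add_mono[OF q'(2) q'(1)] by (intro add_right_mono) (simp only: mult_1)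
      also have "\<dots> = ?x\<^sup>2 * (real (cost em) + 161 + real (tmax inner) + real (cost eA) + real (cost eB) + real (tmax mark))
         + C\<^sub>0 * ?x powr \<omega>"
        by (simp add: algebra_simps)
      also have "\<dots> \<le> ?x powr \<omega> * (real (cost em) + 161 + real (tmax inner) + real (cost eA) + real (cost eB) + real (tmax mark))
         + C\<^sub>0 * ?x powr \<omega>"
        using p by (intro add_right_mono mult_right_mono) auto
      also have "\<dots> \<le> K * ?x powr \<omega>"
        unfolding K_def by (simp add: algebra_simps)
      finally show "?t1 + (4 + (?tA + (?tB + (C\<^sub>0 * ?x powr \<omega> + (3 + (?tl + ?tt)))))) \<le> K * ?x powr \<omega>" .
    next
      fix s' assume "?QQ s'"
      moreover have "(\<exists>i<m. \<exists>j<m. ?prod i j \<and> c i j) \<longleftrightarrow> (\<exists>i<m. \<exists>j<m. \<exists>l<m. a i l \<and> b l j \<and> c i j)"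
        by blast
      ultimately show "?Q s'" by (simp del: of_nat_add of_nat_mult)
    qed (use H in auto)
  qed
  then show ?thesis unfolding detect_bound_def using K0 by (intro exI[of _ K]) blast
qed

text \<open>One fixed constant for each choice of expressions, so that later running times are
  closed terms.\<close>

definition detect_cost :: "expr \<Rightarrow> expr \<Rightarrow> expr \<Rightarrow> expr \<Rightarrow> expr \<Rightarrow> expr \<Rightarrow> expr \<Rightarrow> real" where
  "detect_cost em eA eB eC ex ey ez = (SOME K. detect_bound em eA eB eC ex ey ez K)"

lemma detect_cost_bound: "detect_bound em eA eB eC ex ey ez (detect_cost em eA eB eC ex ey ez)"
  unfolding detect_cost_def by (rule someI_ex[OF detect_bound_exists])

lemma detect_cost_nonneg: "0 \<le> detect_cost em eA eB eC ex ey ez"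
  using detect_cost_bound by (simp add: detect_bound_def)

lemma run_detect:
  assumes "ok W s" "(int m + 3) ^ d\<^sub>0 \<le> W" "int (m * m) \<le> W" "1 \<le> W" "ev W s em (int m)"
    and "\<And>s' i l. ok W s' \<Longrightarrow> keeps scratch s s' \<Longrightarrow> i < m \<Longrightarrow> l < m \<Longrightarrow>
      s' (v 4) 0 = int i \<Longrightarrow> s' (v 6) 0 = int l \<Longrightarrow> ev W s' eA (of_bool (a i l))"
    and "\<And>s' l j. ok W s' \<Longrightarrow> keeps scratch s s' \<Longrightarrow> l < m \<Longrightarrow> j < m \<Longrightarrow>
      s' (v 6) 0 = int l \<Longrightarrow> s' (v 5) 0 = int j \<Longrightarrow> ev W s' eB (of_bool (b l j))"
    and "\<And>s' i j. ok W s' \<Longrightarrow> keeps scratch s s' \<Longrightarrow> i < m \<Longrightarrow> j < m \<Longrightarrow>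
      s' (v 4) 0 = int i \<Longrightarrow> s' (v 5) 0 = int j \<Longrightarrow> ev W s' eC (of_bool (c i j))"
    and "\<And>s' i. ok W s' \<Longrightarrow> keeps scratch s s' \<Longrightarrow> i < m \<Longrightarrow> s' (v 4) 0 = int i \<Longrightarrow> ev W s' ex (X i)"
    and "\<And>s' j. ok W s' \<Longrightarrow> keeps scratch s s' \<Longrightarrow> j < m \<Longrightarrow> s' (v 5) 0 = int j \<Longrightarrow> ev W s' ey (Y j)"
    and "\<And>s' l. ok W s' \<Longrightarrow> keeps scratch s s' \<Longrightarrow> l < m \<Longrightarrow> s' (v 6) 0 = int l \<Longrightarrow> ev W s' ez (Z l)"
  shows "run W (detect em eA eB eC ex ey ez) s (detect_cost em eA eB eC ex ey ez * (real m + 1) powr \<omega>)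
      (\<lambda>s'. if \<exists>i<m. \<exists>j<m. \<exists>l<m. a i l \<and> b l j \<and> c i j
        then s' (v 0) 0 = 1 \<and> (\<exists>i<m. \<exists>j<m. \<exists>l<m. a i l \<and> b l j \<and> c i j \<and>
          s' (v 11) 0 = X i \<and> s' (v 12) 0 = Y j \<and> s' (v 13) 0 = Z l)
        else \<forall>k\<in>{0, 11, 12, 13}. s' (v k) = s (v k))"
  by (rule conjunct2[OF detect_cost_bound[unfolded detect_bound_def], rule_format]) (fact assms | rule assms; simp)+

end

section \<open>Copies of a graph as embeddings\<close>

text \<open>Colours are the nonzero matrix entries and \<open>0\<close> codes a missing edge, so
  \<open>c \<noteq> 0\<close> makes the map preserve adjacency as well as colour. Without edges any
  nonzero \<open>c\<close> will do.\<close>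

definition embedding :: "nat \<Rightarrow> (int \<Rightarrow> int \<Rightarrow> int) \<Rightarrow> nat \<Rightarrow> (nat \<times> nat) list \<Rightarrow> (nat \<Rightarrow> int) \<Rightarrow> int \<Rightarrow> bool" where
  "embedding n g h es f c \<longleftrightarrow> c \<noteq> 0 \<and> f ` {..<h} \<subseteq> {0..<int n} \<and> inj_on f {..<h} \<and>
     (\<forall>(a, b)\<in>set es. g (f a) (f b) = c)"

text \<open>The matrix is abstracted to a function on all integers, which frees symmetry and bounds
  from range conditions. The upper bound is \<open>M + 1\<close> because the input format adds
  \<open>1\<close> to each colour number.\<close>

definition colour_matrix :: "nat \<Rightarrow> nat \<Rightarrow> (int \<Rightarrow> int \<Rightarrow> int) \<Rightarrow> state \<Rightarrow> bool" where
  "colour_matrix n M g s \<longleftrightarrow> (\<forall>x y. 0 \<le> g x y \<and> g x y \<le> int M + 1 \<and> g x y = g y x) \<and> (\<forall>x. g x x = 0) \<and>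
     s ''n'' 0 = int n \<and> (\<forall>x<n. \<forall>y<n. s ''G'' (int (x * n + y)) = g (int x) (int y))"

text \<open>The order of \<open>hs\<close> is left open: choosing it puts selected vertices of
  \<open>H\<close> into selected parts. Each edge contributes both of its arcs to
  \<open>es\<close>.\<close>

definition index_list :: "'h pair_pre_digraph \<Rightarrow> 'h list \<Rightarrow> (nat \<times> nat) list \<Rightarrow> bool" where
  "index_list H hs es \<longleftrightarrow> distinct hs \<and> set hs = pverts H \<and> distinct es \<and>
     set es = {(a, b). a < length hs \<and> b < length hs \<and> (hs ! a, hs ! b) \<in> parcs H}"

lemma index_list_exists:
  assumes "pair_graph H" "distinct hs" "set hs = pverts H"
  shows "\<exists>es. index_list H hs es"
proof -
  have "finite {(a, b). a < length hs \<and> b < length hs \<and> (hs ! a, hs ! b) \<in> parcs H}"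
    by (rule finite_subset[of _ "{..<length hs} \<times> {..<length hs}"]) auto
  from finite_distinct_list[OF this] show ?thesis
    using assms(2,3) unfolding index_list_def by blast
qed

lemma index_list_arcs:
  assumes "pair_graph H" "index_list H hs es"
  shows "parcs H = (\<lambda>(a, b). (hs ! a, hs ! b)) ` set es" "card (parcs H) = length es"
    "card (pverts H) = length hs"
proof -
  interpret pair_graph H by fact
  have 1: "distinct hs" "set hs = pverts H" "distinct es"
    and 2: "set es = {(a, b). a < length hs \<and> b < length hs \<and> (hs ! a, hs ! b) \<in> parcs H}"
    using assms(2) by (auto simp: index_list_def)
  show 3: "parcs H = (\<lambda>(a, b). (hs ! a, hs ! b)) ` set es"
  proof
    show "parcs H \<subseteq> (\<lambda>(a, b). (hs ! a, hs ! b)) ` set es"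
    proof
      fix e assume e: "e \<in> parcs H"
      obtain x y where xy: "e = (x, y)" by (cases e)
      then have "x \<in> set hs" "y \<in> set hs" using e 1(2) in_arcsD1 in_arcsD2 by auto
      then obtain a b where "a < length hs" "b < length hs" "hs ! a = x" "hs ! b = y"
        by (auto simp: in_set_conv_nth)
      then show "e \<in> (\<lambda>(a, b). (hs ! a, hs ! b)) ` set es"
        using e xy by (intro image_eqI[of _ _ "(a, b)"]) (auto simp: 2)
    qed
  qed (auto simp: 2)
  have "inj_on (\<lambda>(a, b). (hs ! a, hs ! b)) (set es)"
    using 1(1) by (auto simp: inj_on_def 2 nth_eq_iff_index_eq)
  then show "card (parcs H) = length es"
    unfolding 3 using 1(3) by (simp add: card_image distinct_card)
  show "card (pverts H) = length hs"
    using 1 distinct_card by metis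
qed

context
  fixes H :: "'h pair_pre_digraph" and hs es G c n
    and number :: "'c \<Rightarrow> nat" and g :: "int \<Rightarrow> int \<Rightarrow> int"
  assumes H: "pair_graph H" and hs: "index_list H hs es"
    and G: "pair_graph G" and V: "pverts G = {0..<int n}"
    and number: "inj_on number {c {u, v} | u v. (u, v) \<in> parcs G}"
    and g: "g = (\<lambda>u v. if (u, v) \<in> parcs G then int (number (c {u, v})) + 1 else 0)"
begin

text \<open>An isomorphism from \<open>H\<close> onto the subgraph, read along \<open>hs\<close>, is
  the embedding, and any one arc supplies the common entry of \<open>g\<close>. If there is no arc,
  the entry \<open>1\<close> serves.\<close>

lemma embedding_of_subgraph:
  assumes "monochromatic_H_subgraph H G c S"
  shows "\<exists>f k. embedding n g (length hs) es f k"
proof -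
  note arcs = index_list_arcs[OF H hs]
  obtain hom where hom: "pre_digraph.digraph_isomorphism (with_proj H) hom"
    and S: "with_proj S = app_iso hom (with_proj H)"
    using assms by (auto simp: monochromatic_H_subgraph_def digraph_iso_def)
  have sub: "pverts S \<subseteq> pverts G" "parcs S \<subseteq> parcs G" and mono: "monochromatic c S"
    using assms by (auto simp: monochromatic_H_subgraph_def subgraph_def)
  have verts: "pverts S = iso_verts hom ` pverts H"
    using arg_cong[OF S, of verts] by simp
  have parcs: "parcs S = iso_arcs hom ` parcs H"
    using arg_cong[OF S, of arcs] by simp
  have tail: "iso_tail hom = fst" "iso_head hom = snd"
    using arg_cong[OF S, of tail] arg_cong[OF S, of head] by simp_all
  have inj: "inj_on (iso_verts hom) (pverts H)"
    and ends: "\<And>a. a \<in> parcs H \<Longrightarrow> iso_verts hom (fst a) = fst (iso_arcs hom a) \<and> iso_verts hom (snd a) = snd (iso_arcs hom a)"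
    using hom by (simp_all add: pre_digraph.digraph_isomorphism_def tail)
  define f where "f i = iso_verts hom (hs ! i)" for i
  have dist: "distinct hs" "set hs = pverts H" using hs by (auto simp: index_list_def)
  have nth: "hs ! i \<in> pverts H" if "i < length hs" for i using nth_mem[OF that] dist(2) by simp
  then have "f ` {..<length hs} \<subseteq> {0..<int n}"
    using sub(1) unfolding verts V f_def by blast
  moreover have "inj_on f {..<length hs}"
  proof (rule inj_onI)
    fix i j assume "i \<in> {..<length hs}" "j \<in> {..<length hs}" "f i = f j"
    then have "hs ! i = hs ! j" using inj_onD[OF inj _ nth nth] by (simp add: f_def)
    then show "i = j" using dist \<open>i \<in> _\<close> \<open>j \<in> _\<close> by (auto simp: nth_eq_iff_index_eq)
  qed
  moreover have arc: "(f a, f b) \<in> parcs S" if "(a, b) \<in> set es" for a b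
  proof -
    have e: "(hs ! a, hs ! b) \<in> parcs H" using arcs(1) that by auto
    from ends[OF e] have "iso_arcs hom (hs ! a, hs ! b) = (f a, f b)"
      by (simp add: f_def prod_eq_iff)
    then show ?thesis using parcs e by (metis imageI)
  qed
  have "\<exists>k. k \<noteq> 0 \<and> (\<forall>(a, b)\<in>set es. g (f a) (f b) = k)"
  proof (cases "es = []")
    case True
    then show ?thesis by (intro exI[of _ 1]) auto
  next
    case False
    then obtain a0 b0 where "(a0, b0) \<in> set es" by (metis last_in_set surj_pair)
    then have e0: "(f a0, f b0) \<in> parcs S" by (rule arc)
    have "g (f a) (f b) = int (number (c {f a0, f b0})) + 1" if "(a, b) \<in> set es" for a b
    proof -
      have "c {f a, f b} = c {f a0, f b0}"
        using mono bspec[OF bspec[OF mono[unfolded monochromatic_def] arc[OF that], unfolded prod.case] e0] by simp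
      then show ?thesis using arc[OF that] sub(2) by (auto simp: g)
    qed
    then show ?thesis by (intro exI[of _ "int (number (c {f a0, f b0})) + 1"]) auto
  qed
  ultimately show ?thesis unfolding embedding_def by blast
qed

text \<open>Equal entries of \<open>g\<close> mean equal colours because \<open>number\<close> is
  injective on the colours in use. The isomorphism is the embedding composed with
  \<open>idx\<close>, the inverse of the list \<open>hs\<close>.\<close>

lemma subgraph_of_embedding:
  assumes "embedding n g (length hs) es f k"
  shows "monochromatic_H_subgraph H G c
    \<lparr>pverts = f ` {..<length hs}, parcs = (\<lambda>(a, b). (f a, f b)) ` set es\<rparr>" (is "monochromatic_H_subgraph H G c ?S")
proof -
  interpret H: pair_graph H by (rule H)
  interpret G: pair_graph G by (rule G)
  note arcs = index_list_arcs[OF H hs]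
  have dist: "distinct hs" "set hs = pverts H" using hs by (auto simp: index_list_def)
  have lt: "a < length hs" "b < length hs" if "(a, b) \<in> set es" for a b
    using hs that by (auto simp: index_list_def)
  have f: "k \<noteq> 0" "f ` {..<length hs} \<subseteq> {0..<int n}" "inj_on f {..<length hs}"
    "\<And>a b. (a, b) \<in> set es \<Longrightarrow> g (f a) (f b) = k"
    using assms by (auto simp: embedding_def)
  have inG: "(f a, f b) \<in> parcs G \<and> int (number (c {f a, f b})) + 1 = k" if "(a, b) \<in> set es" for a b
    using f(4)[OF that] f(1) by (auto simp: g split: if_splits)
  have "wf_digraph (with_proj ?S)"
    using lt by unfold_locales auto
  moreover have "wf_digraph (with_proj G)" by (rule G.wf_digraph)
  ultimately have sub: "subgraph (with_proj ?S) (with_proj G)"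
    using f(2) V inG by (auto simp: subgraph_def compatible_def)
  have mono: "monochromatic c ?S"
  proof -
    have "c {f a, f b} = c {f a', f b'}" if "(a, b) \<in> set es" "(a', b') \<in> set es" for a b a' b'
    proof (rule inj_onD[OF number])
      show "number (c {f a, f b}) = number (c {f a', f b'})"
        using inG[OF that(1)] inG[OF that(2)] by linarith
    qed (use inG that in blast)+
    then show ?thesis unfolding monochromatic_def by auto
  qed
  define idx where "idx x = (THE i. i < length hs \<and> hs ! i = x)" for x
  have idx: "idx (hs ! i) = i" if "i < length hs" for i
    unfolding idx_def using that dist(1) by (intro the_equality) (auto simp: nth_eq_iff_index_eq)
  define hom where "hom = \<lparr>iso_verts = (\<lambda>x. f (idx x)), iso_arcs = (\<lambda>(x, y). (f (idx x), f (idx y))),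
    iso_head = snd, iso_tail = fst\<rparr>"
  have injv: "inj_on (\<lambda>x. f (idx x)) (pverts H)"
  proof (rule inj_onI)
    fix x y assume "x \<in> pverts H" "y \<in> pverts H" "f (idx x) = f (idx y)"
    then obtain i j where ij: "i < length hs" "j < length hs" "x = hs ! i" "y = hs ! j"
      unfolding dist(2)[symmetric] in_set_conv_nth by blast
    then have "f i = f j" using idx \<open>f (idx x) = f (idx y)\<close> by simp
    then show "x = y" using f(3) ij by (auto dest: inj_onD)
  qed
  have "pre_digraph.digraph_isomorphism (with_proj H) hom"
    unfolding pre_digraph.digraph_isomorphism_def
  proof (intro conjI)
    show "wf_digraph (with_proj H)" by (rule H.wf_digraph)
    show "inj_on (iso_verts hom) (verts (with_proj H))" using injv by (simp add: hom_def)
    show "inj_on (iso_arcs hom) (arcs (with_proj H))"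
    proof (rule inj_onI)
      fix e e' assume e: "e \<in> arcs (with_proj H)" "e' \<in> arcs (with_proj H)" "iso_arcs hom e = iso_arcs hom e'"
      then have "fst e = fst e'" "snd e = snd e'"
        by (auto simp: hom_def case_prod_beta intro!: inj_onD[OF injv] H.arc_fst_in_verts H.arc_snd_in_verts)
      then show "e = e'" by (rule prod_eqI)
    qed
  qed (auto simp: hom_def)
  moreover have "with_proj ?S = app_iso hom (with_proj H)"
  proof -
    have "f ` {..<length hs} = (\<lambda>x. f (idx x)) ` pverts H"
    proof -
      have "pverts H = (!) hs ` {..<length hs}" using dist(2) by (auto simp: set_conv_nth)
      then show ?thesis using idx by (auto simp: image_image)
    qed
    moreover have "(\<lambda>(a, b). (f a, f b)) ` set es = (\<lambda>(x, y). (f (idx x), f (idx y))) ` parcs H"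
      unfolding arcs(1) image_image using lt idx by (intro image_cong) auto
    ultimately show ?thesis by (simp add: with_proj_def app_iso_def hom_def)
  qed
  ultimately have "digraph_iso (with_proj H) (with_proj ?S)"
    unfolding digraph_iso_def by blast
  with sub mono show ?thesis by (simp add: monochromatic_H_subgraph_def)
qed

end

section \<open>From embeddings to the required output\<close>

primrec copy :: "string \<Rightarrow> string \<Rightarrow> nat \<Rightarrow> nat list \<Rightarrow> com" where
  "copy X Y k [] = Skip"
| "copy X Y k (a # as) = Seq (Write X (Const (int k)) (Read Y (Const (int a)))) (copy X Y (Suc k) as)"

lemma wp_copy:
  assumes "ok W s" "X \<noteq> Y" "int (k + length as) \<le> W" "\<forall>a\<in>set as. int a \<le> W"
    and "\<And>s'. ok W s' \<Longrightarrow> keeps {X} s s' \<Longrightarrow> (\<forall>i<k. s' X (int i) = s X (int i)) \<Longrightarrow>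
      (\<forall>i<length as. s' X (int (k + i)) = s Y (int (as ! i))) \<Longrightarrow> Q s'"
  shows "wp W (copy X Y k as) Q s"
  using assms
proof (induction as arbitrary: k s)
  case Nil
  then show ?case by auto
next
  case (Cons a as)
  let ?s = "upd s X (int k) (s Y (int a))"
  have "wp W (copy X Y (Suc k) as) Q ?s"
  proof (rule Cons.IH)
    show "ok W ?s" using Cons.prems(1) by (simp add: okD)
    fix s' assume s': "ok W s'" "keeps {X} ?s s'" "\<forall>i<Suc k. s' X (int i) = ?s X (int i)"
      "\<forall>i<length as. s' X (int (Suc k + i)) = ?s Y (int (as ! i))"
    show "Q s'"
    proof (rule Cons.prems(5))
      show "\<forall>i<length (a # as). s' X (int (k + i)) = s Y (int ((a # as) ! i))"
      proof (intro allI impI)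
        fix i assume "i < length (a # as)"
        then show "s' X (int (k + i)) = s Y (int ((a # as) ! i))"
          using s'(3,4) Cons.prems(2) by (cases i) auto
      qed
    qed (use s' in auto)
  qed (use Cons.prems in auto)
  then show ?case using Cons.prems okD[of W s Y "int a"] by auto
qed

context mm_program
begin

text \<open>The common interface of all searches: a flag in \<open>v 0\<close> and, if it is set,
  the images of the vertices of \<open>H\<close> in \<open>v 1\<close>. Program, word exponent and
  time constant are chosen before the instance.\<close>

definition detects :: "nat \<Rightarrow> (nat \<times> nat) list \<Rightarrow> real \<Rightarrow> bool" where
  "detects h es \<tau> \<longleftrightarrow> (\<exists>c d K. \<forall>n M g W s.
     colour_matrix n M g s \<longrightarrow> ok W s \<longrightarrow> (int n + int M + 2) ^ d \<le> W \<longrightarrow>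
     run W c s (K * (real n + 1) powr \<tau>)
      (\<lambda>s'. if \<exists>f k. embedding n g h es f k
        then s' (v 0) 0 = 1 \<and> (\<exists>k. embedding n g h es (\<lambda>i. s' (v 1) (int i)) k)
        else s' (v 0) 0 = 0))"

definition emit :: "nat \<Rightarrow> (nat \<times> nat) list \<Rightarrow> com" where
  "emit h es = Cond (Var (v 0))
     (Seq (Set ''found'' (Const 1)) (Seq (copy ''vertex'' (v 1) 0 [0..<h])
       (Seq (copy ''tail'' (v 1) 0 (map fst es)) (copy ''head'' (v 1) 0 (map snd es)))))
     (Set ''found'' (Const 0))"

lemma run_emit:
  assumes "ok W s" "int h \<le> W" "int (length es) \<le> W" "1 \<le> W" "\<forall>(a, b)\<in>set es. a < h \<and> b < h"
  shows "run W (emit h es) s (real (tmax (emit h es)))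
    (\<lambda>s'. if s (v 0) 0 = 0 then s' ''found'' 0 = 0 else s' ''found'' 0 = 1 \<and>
      (\<forall>i<h. s' ''vertex'' (int i) = s (v 1) (int i)) \<and>
      (\<forall>i<length es. s' ''tail'' (int i) = s (v 1) (int (fst (es ! i))) \<and>
         s' ''head'' (int i) = s (v 1) (int (snd (es ! i)))))" (is "run _ _ _ _ ?Q")
proof (rule run_wp)
  have lt: "fst e < h" "snd e < h" if "e \<in> set es" for e using assms(5) that by auto
  have le: "int a \<le> W" if "a < h" for a using assms(2) that by simp
  have el: "int (fst e) \<le> W" "int (snd e) \<le> W" if "e \<in> set es" for e using lt[OF that] le by auto
  have "wp W (Seq (copy ''vertex'' (v 1) 0 [0..<h])
       (Seq (copy ''tail'' (v 1) 0 (map fst es)) (copy ''head'' (v 1) 0 (map snd es)))) ?Q (upd s ''found'' 0 1)"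
    if "s (v 0) 0 \<noteq> 0"
    unfolding wp.simps(3)
  proof (rule wp_copy)
    fix s1 assume 1: "ok W s1" "keeps {''vertex''} (upd s ''found'' 0 1) s1"
      "\<forall>i<length [0..<h]. s1 ''vertex'' (int (0 + i)) = upd s ''found'' 0 1 (v 1) (int ([0..<h] ! i))"
    show "wp W (copy ''tail'' (v 1) 0 (map fst es)) (wp W (copy ''head'' (v 1) 0 (map snd es)) ?Q) s1"
    proof (rule wp_copy)
      fix s2 assume 2: "ok W s2" "keeps {''tail''} s1 s2"
        "\<forall>i<length (map fst es). s2 ''tail'' (int (0 + i)) = s1 (v 1) (int (map fst es ! i))"
      show "wp W (copy ''head'' (v 1) 0 (map snd es)) ?Q s2"
      proof (rule wp_copy)
        fix s3 assume 3: "ok W s3" "keeps {''head''} s2 s3"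
          "\<forall>i<length (map snd es). s3 ''head'' (int (0 + i)) = s2 (v 1) (int (map snd es ! i))"
        show "?Q s3" using that 1 2 3 by auto
      qed (use 2 assms el in auto)
    qed (use 1 assms el in auto)
  qed (use assms le in auto)
  then show "wp W (emit h es) ?Q s"
    unfolding emit_def wp.simps(4)
    using assms okD[OF assms(1), of "v 0" 0] by auto
qed

lemma powr_bigo: "0 \<le> \<tau> \<Longrightarrow> (\<lambda>n. K * (real n + 1) powr \<tau>) \<in> O(\<lambda>n. real n powr \<tau>)"
proof (rule bigoI[of _ "\<bar>K\<bar> * 2 powr \<tau>"])
  assume \<tau>: "0 \<le> \<tau>"
  show "\<forall>\<^sub>F n in at_top. norm (K * (real n + 1) powr \<tau>) \<le> \<bar>K\<bar> * 2 powr \<tau> * norm (real n powr \<tau>)"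
  proof (rule eventually_at_top_linorderI[of 1])
    fix n :: nat assume "1 \<le> n"
    then have "(real n + 1) powr \<tau> \<le> (2 * real n) powr \<tau>"
      using \<tau> by (intro powr_mono2) auto
    then have "\<bar>K\<bar> * (real n + 1) powr \<tau> \<le> \<bar>K\<bar> * (2 powr \<tau> * real n powr \<tau>)"
      by (intro mult_left_mono) (auto simp: powr_mult)
    then show "norm (K * (real n + 1) powr \<tau>) \<le> \<bar>K\<bar> * 2 powr \<tau> * norm (real n powr \<tau>)"
      by (simp add: abs_mult mult.assoc)
  qed
qed

lemma solvable_of_detects:
  fixes H :: "'h pair_pre_digraph"
  assumes "detects (length hs) es \<tau>" "pair_graph H" "index_list H hs es" "0 \<le> \<tau>"
  shows "solvable_in_time coloured_graph_input
    (H_subgraph_answer H :: int pair_pre_digraph \<times> (int set \<Rightarrow> 'c) \<Rightarrow> state \<Rightarrow> bool) \<tau>"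
proof -
  let ?h = "length hs"
  obtain p d K where p: "\<And>n M g W s. colour_matrix n M g s \<Longrightarrow> ok W s \<Longrightarrow> (int n + int M + 2) ^ d \<le> W \<Longrightarrow>
     run W p s (K * (real n + 1) powr \<tau>)
      (\<lambda>s'. if \<exists>f k. embedding n g ?h es f k
        then s' (v 0) 0 = 1 \<and> (\<exists>k. embedding n g ?h es (\<lambda>i. s' (v 1) (int i)) k)
        else s' (v 0) 0 = 0)"
    using assms(1) unfolding detects_def by blast
  define q where "q = Seq p (emit ?h es)"
  \<comment> \<open>The words must also hold the vertex and arc indices of the fixed graph. As the
    base of the word bound is at least \<open>2\<close> and \<open>e \<le> 2 ^ e\<close>, it is
    enough to add these numbers to the exponent.\<close>
  define D where "D = d + ?h + length es"
  define K' where "K' = K + real (tmax (emit ?h es))"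
  note arcs = index_list_arcs[OF assms(2,3)]
  have es: "\<forall>(a, b)\<in>set es. a < ?h \<and> b < ?h" using assms(3) by (auto simp: index_list_def)
  have main: "\<exists>t s'. exec W q s t s' \<and> real t \<le> K' * (real n + 1) powr \<tau> \<and> H_subgraph_answer H (G, c) s'"
    if inp: "coloured_graph_input n M (G, c) s" and W: "(int n + int M + 2) ^ D \<le> W" and ok: "ok W s"
    for n M s W G and c :: "int set \<Rightarrow> 'c"
  proof -
    from inp obtain number :: "'c \<Rightarrow> nat" where G: "pair_graph G" "pverts G = {0..<int n}" "s ''n'' 0 = int n"
      and inj: "inj_on number {c {u, v} | u v. (u, v) \<in> parcs G}"
      and M: "\<forall>(u, v) \<in> parcs G. number (c {u, v}) \<le> M"
      and sG: "\<forall>u\<in>pverts G. \<forall>v\<in>pverts G. s ''G'' (u * int n + v) =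
           (if (u, v) \<in> parcs G then int (number (c {u, v})) + 1 else 0)"
      by (auto simp: coloured_graph_input_def)
    interpret G: pair_graph G by (rule G(1))
    define g where "g = (\<lambda>u v. if (u, v) \<in> parcs G then int (number (c {u, v})) + 1 else 0)"
    have sym: "(x, y) \<in> parcs G \<longleftrightarrow> (y, x) \<in> parcs G" for x y
      using G.arcs_symmetric[of x y] G.arcs_symmetric[of y x] by auto
    have cm: "colour_matrix n M g s"
      unfolding colour_matrix_def
    proof (intro conjI allI impI)
      fix x y
      show "g x y \<le> int M + 1" using M by (auto simp: g_def)
      show "g x y = g y x" using sym[of x y] by (simp add: g_def insert_commute)
      show "g x x = 0" using G.pair_no_loops by (force simp: g_def)
    next
      fix x y assume "x < n" "y < n"
      then show "s ''G'' (int (x * n + y)) = g (int x) (int y)" using sG G(2) by (simp add: g_def)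
    qed (use G in \<open>auto simp: g_def\<close>)
    let ?B = "int n + int M + 2"
    have "2 ^ e \<le> ?B ^ e" for e by (intro power_mono) auto
    moreover have "int e \<le> 2 ^ e" for e
      using of_nat_mono[OF less_imp_le[OF less_exp[of e]], where ?'a = int] by simp
    ultimately have Bn: "int e \<le> ?B ^ e" for e using order_trans by blast
    have pow: "?B ^ e \<le> W" if "e \<le> D" for e
      by (rule order_trans[OF power_increasing[OF that] W]) simp
    have W1: "1 \<le> W" using pow[of 0] by simp
    have "?B ^ d \<le> W" "int ?h \<le> W" "int (length es) \<le> W"
      using pow[of d] pow[of ?h] pow[of "length es"] Bn[of ?h] Bn[of "length es"] by (auto simp: D_def)
    note Ws = this
    let ?R = "\<lambda>s'. if \<exists>f k. embedding n g ?h es f k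
        then s' (v 0) 0 = 1 \<and> (\<exists>k. embedding n g ?h es (\<lambda>i. s' (v 1) (int i)) k)
        else s' (v 0) 0 = 0"
    have "run W q s (K * (real n + 1) powr \<tau> + real (tmax (emit ?h es))) (H_subgraph_answer H (G, c))"
      unfolding q_def
    proof (rule run_Seq[OF p[OF cm ok Ws(1)] ok])
      fix s1 assume 1: "?R s1" "ok W s1"
      show "run W (emit ?h es) s1 (real (tmax (emit ?h es))) (H_subgraph_answer H (G, c))"
      proof (rule run_mono[OF run_emit])
        fix s2 assume 2: "if s1 (v 0) 0 = 0 then s2 ''found'' 0 = 0 else s2 ''found'' 0 = 1 \<and>
          (\<forall>i<?h. s2 ''vertex'' (int i) = s1 (v 1) (int i)) \<and>
          (\<forall>i<length es. s2 ''tail'' (int i) = s1 (v 1) (int (fst (es ! i))) \<and>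
             s2 ''head'' (int i) = s1 (v 1) (int (snd (es ! i))))"
        show "H_subgraph_answer H (G, c) s2"
        proof (cases "\<exists>f k. embedding n g ?h es f k")
          case True
          then obtain k where k: "embedding n g ?h es (\<lambda>i. s1 (v 1) (int i)) k" and f: "s1 (v 0) 0 = 1"
            using 1(1) by auto
          have lst: "(\<lambda>i. f (int i)) ` {..<N} = f ` {0..<int N}" for f :: "int \<Rightarrow> 'z" and N
            using image_int_atLeastLessThan[of 0 N] by (auto simp: image_image[symmetric] lessThan_atLeast0)
          have "pverts (output_graph H s2) = (\<lambda>i. s1 (v 1) (int i)) ` {..<?h}"
            using 2 f arcs(3) lst[of "s2 ''vertex''" ?h] by (auto simp: output_graph_def)
          moreover have "parcs (output_graph H s2) = (\<lambda>(a, b). (s1 (v 1) (int a), s1 (v 1) (int b))) ` set es"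
          proof -
            have "parcs (output_graph H s2) = (\<lambda>i. (s2 ''tail'' (int i), s2 ''head'' (int i))) ` {..<length es}"
              using lst[of "\<lambda>i. (s2 ''tail'' i, s2 ''head'' i)" "length es"] arcs(2) by (simp add: output_graph_def)
            also have "\<dots> = (\<lambda>i. (\<lambda>(a, b). (s1 (v 1) (int a), s1 (v 1) (int b))) (es ! i)) ` {..<length es}"
              using 2 f by (intro image_cong) (auto simp: case_prod_beta)
            also have "\<dots> = (\<lambda>(a, b). (s1 (v 1) (int a), s1 (v 1) (int b))) ` set es"
              using nth_image[of "length es" es] by (simp only: image_image[symmetric] lessThan_atLeast0 order_refl take_all)
            finally show ?thesis .
          qed
          ultimately have "output_graph H s2 = \<lparr>pverts = (\<lambda>i. s1 (v 1) (int i)) ` {..<?h},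
              parcs = (\<lambda>(a, b). (s1 (v 1) (int a), s1 (v 1) (int b))) ` set es\<rparr>"
            by simp
          with subgraph_of_embedding[OF assms(2,3) G(1,2) inj g_def k]
          have "monochromatic_H_subgraph H G c (output_graph H s2)" by simp
          then show ?thesis using 2 f unfolding H_subgraph_answer_def by auto
        next
          case False
          then have "\<not> (\<exists>S. monochromatic_H_subgraph H G c S)"
            using embedding_of_subgraph[OF assms(2,3) G(1,2) inj g_def] by blast
          then show ?thesis using 1(1) 2 False by (simp add: H_subgraph_answer_def)
        qed
      qed (use 1 Ws W1 es in auto)
    qed
    then have "run W q s (K' * (real n + 1) powr \<tau>) (H_subgraph_answer H (G, c))"
    proof (rule run_mono)
      have "1 \<le> (real n + 1) powr \<tau>" using assms(4) by (intro ge_one_powr_ge_zero) auto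
      then have "real (tmax (emit ?h es)) * 1 \<le> real (tmax (emit ?h es)) * (real n + 1) powr \<tau>"
        by (intro mult_left_mono) auto
      then show "K * (real n + 1) powr \<tau> + real (tmax (emit ?h es)) \<le> K' * (real n + 1) powr \<tau>"
        by (simp add: K'_def algebra_simps)
    qed (use ok in auto)
    then show ?thesis by (auto simp: run_def)
  qed
  show ?thesis
    unfolding solvable_in_time_def
    by (rule exI[of _ q], rule exI[of _ D], rule exI[of _ "\<lambda>n. K' * (real n + 1) powr \<tau>"])
      (use main powr_bigo[OF assms(4)] in \<open>auto simp: ok_def\<close>)
qed

end

section \<open>The exponent of matrix multiplication is at least 2\<close>

lemma exec_changes:
  "exec W c s t s' \<Longrightarrow> finite {p. s' (fst p) (snd p) \<noteq> s (fst p) (snd p)} \<and>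
    card {p. s' (fst p) (snd p) \<noteq> s (fst p) (snd p)} \<le> t"
proof (induction rule: exec.induct)
  case (Write s e1 e2 x)
  let ?s = "s(x := (s x)(val s e1 := val s e2))"
  have sub: "{p. ?s (fst p) (snd p) \<noteq> s (fst p) (snd p)} \<subseteq> {(x, val s e1)}"
    by (auto split: if_splits)
  from finite_subset[OF this] card_mono[OF _ this] show ?case by auto
next
  case (Seq P s t s' Q t' s'')
  let ?D = "\<lambda>s s' :: state. {p. s' (fst p) (snd p) \<noteq> s (fst p) (snd p)}"
  have sub: "?D s s'' \<subseteq> ?D s s' \<union> ?D s' s''" by auto
  moreover have fin: "finite (?D s s' \<union> ?D s' s'')" using Seq.IH by simp
  ultimately have "card (?D s s'') \<le> card (?D s s' \<union> ?D s' s'')" by (rule card_mono[rotated])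
  also have "\<dots> \<le> t + t'" using Seq.IH card_Un_le[of "?D s s'" "?D s' s''"] by linarith
  finally show ?case using sub fin finite_subset by blast
next
  case (While_true s e P t s' t' s'')
  let ?D = "\<lambda>s s' :: state. {p. s' (fst p) (snd p) \<noteq> s (fst p) (snd p)}"
  have sub: "?D s s'' \<subseteq> ?D s s' \<union> ?D s' s''" by auto
  moreover have fin: "finite (?D s s' \<union> ?D s' s'')" using While_true.IH by simp
  ultimately have "card (?D s s'') \<le> card (?D s s' \<union> ?D s' s'')" by (rule card_mono[rotated])
  also have "\<dots> \<le> 1 + cost e + t + t'" using While_true.IH card_Un_le[of "?D s s'" "?D s' s''"] by linarith
  finally show ?case using sub fin finite_subset by blast
qed auto

text \<open>The product of two zero matrices has to overwrite every cell of an output array that is filled with ones.\<close>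

lemma matrix_product_time_ge:
  assumes "\<And>n M X s W. matrices_input n M X s \<Longrightarrow> (int n + int M + 2) ^ d \<le> W \<Longrightarrow> ok W s \<Longrightarrow>
      run W P s (T n) (product_answer X)"
  shows "(real n)\<^sup>2 \<le> T n"
proof -
  define Z where "Z = (0\<^sub>m n n :: int mat)"
  define s :: state where "s = (\<lambda>y i. if y = ''C'' then 1 else if y = ''n'' then int n else 0)"
  define W where "W = (int n + 2) ^ (d + 1)"
  have "(int n + 2) ^ 1 \<le> W" "(int n + 2) ^ d \<le> W"
    unfolding W_def by (rule power_increasing; simp)+
  then have "matrices_input n 0 (Z, Z) s" "(int n + int 0 + 2) ^ d \<le> W" "ok W s"
    by (auto simp: matrices_input_def s_def Z_def ok_def)
  from assms[OF this] obtain t s' where e: "exec W P s t s'" and t: "real t \<le> T n"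
    and ans: "product_answer (Z, Z) s'" by (auto simp: run_def)
  have zero: "s' ''C'' (int (i * n + j)) = 0" if "i < n" "j < n" for i j
    using ans that by (simp add: product_answer_def Z_def)
  have "(\<lambda>k. (''C'', int k)) ` {..<n * n} \<subseteq> {p. s' (fst p) (snd p) \<noteq> s (fst p) (snd p)}"
  proof
    fix p assume "p \<in> (\<lambda>k. (''C'', int k)) ` {..<n * n}"
    then obtain k where k: "k < n * n" "p = (''C'', int k)" by auto
    then have "0 < n" by (cases n) auto
    then have "k div n < n" "k mod n < n" using k(1) by (auto simp: less_mult_imp_div_less)
    from zero[OF this] show "p \<in> {p. s' (fst p) (snd p) \<noteq> s (fst p) (snd p)}"
      using k by (simp add: s_def)
  qed
  from order_trans[OF card_mono[OF conjunct1[OF exec_changes[OF e]] this] conjunct2[OF exec_changes[OF e]]]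
  have "card ((\<lambda>k. (''C'', int k)) ` {..<n * n}) \<le> t" .
  moreover have "card ((\<lambda>k. (''C'', int k)) ` {..<n * n}) = n * n"
    by (subst card_image) (auto simp: inj_on_def)
  ultimately have "real (n * n) \<le> real t" by (simp only: of_nat_le_iff)
  then show ?thesis using t by (simp add: power2_eq_square)
qed

lemma matrix_multiplication_exponent_ge_2:
  fixes T :: "nat \<Rightarrow> real"
  assumes "T \<in> O(\<lambda>n. real n powr \<omega>)" "\<And>n. (real n)\<^sup>2 \<le> T n"
  shows "2 \<le> \<omega>"
proof (rule ccontr)
  assume "\<not> 2 \<le> \<omega>"
  then have \<omega>: "0 < 2 - \<omega>" by simp
  from assms(1) obtain c where c: "c > 0" "\<forall>\<^sub>F n in at_top. norm (T n) \<le> c * norm (real n powr \<omega>)"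
    by (auto elim: landau_o.bigE)
  then obtain N where N: "\<And>n. N \<le> n \<Longrightarrow> norm (T n) \<le> c * norm (real n powr \<omega>)"
    unfolding eventually_at_top_linorder by blast
  \<comment> \<open>So large that \<open>real n powr (2 - \<omega>)\<close> exceeds
    \<open>c + 1\<close>; the quadratic lower bound then outgrows the assumed upper bound.\<close>
  obtain n where n: "real n > (c + 1) powr (1 / (2 - \<omega>)) + real N + 1"
    using reals_Archimedean2 by blast
  have pos: "0 \<le> (c + 1) powr (1 / (2 - \<omega>))" by simp
  have n': "N \<le> n" "0 < real n" using n pos by linarith+
  have "real n powr 2 = (real n)\<^sup>2" using n' by (simp add: powr_numeral)
  also have "\<dots> \<le> c * real n powr \<omega>"
    using N[OF n'(1)] assms(2)[of n] by simp
  also have "\<dots> < (c + 1) * real n powr \<omega>" using n' by (intro mult_strict_right_mono) auto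
  also have "c + 1 = ((c + 1) powr (1 / (2 - \<omega>))) powr (2 - \<omega>)"
    using \<omega> c(1) by (simp add: powr_powr)
  also have "\<dots> * real n powr \<omega> \<le> real n powr (2 - \<omega>) * real n powr \<omega>"
    using \<omega> n pos by (intro mult_right_mono powr_mono2) auto
  also have "\<dots> = real n powr 2" using n' by (simp add: powr_add[symmetric])
  finally show False by simp
qed

text \<open>The finitely many values below the threshold \<open>N\<close> are absorbed by adding
  their sum \<open>S\<close> to the constant; the base \<open>n + 1\<close> makes the power at least
  \<open>1\<close>, also at \<open>n = 0\<close>.\<close>

lemma bigo_powr_bound:
  fixes T :: "nat \<Rightarrow> real"
  assumes "T \<in> O(\<lambda>n. real n powr \<omega>)" "0 \<le> \<omega>"
  shows "\<exists>C\<ge>0. \<forall>n. T n \<le> C * (real n + 1) powr \<omega>"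
proof -
  from assms(1) obtain c where c: "c > 0" "\<forall>\<^sub>F n in at_top. norm (T n) \<le> c * norm (real n powr \<omega>)"
    by (auto elim: landau_o.bigE)
  then obtain N where N: "\<And>n. N \<le> n \<Longrightarrow> norm (T n) \<le> c * norm (real n powr \<omega>)"
    unfolding eventually_at_top_linorder by blast
  define S where "S = (\<Sum>n<N. \<bar>T n\<bar>)"
  have S: "0 \<le> S" by (simp add: S_def sum_nonneg)
  have "T n \<le> (c + S) * (real n + 1) powr \<omega>" for n
  proof (cases "N \<le> n")
    case True
    have "T n \<le> c * real n powr \<omega>" using N[OF True] by simp
    also have "\<dots> \<le> c * (real n + 1) powr \<omega>"
      using c(1) assms(2) by (intro mult_left_mono powr_mono2) auto
    also have "\<dots> \<le> (c + S) * (real n + 1) powr \<omega>"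
      using S by (intro mult_right_mono) auto
    finally show ?thesis .
  next
    case False
    have "1 \<le> (real n + 1) powr \<omega>" using assms(2) by (intro ge_one_powr_ge_zero) auto
    then have "(c + S) * 1 \<le> (c + S) * (real n + 1) powr \<omega>"
      using c(1) S by (intro mult_left_mono) auto
    moreover have "\<bar>T n\<bar> \<le> S" unfolding S_def using False by (intro member_le_sum) auto
    then have "T n \<le> (c + S) * 1" using c(1) by simp
    ultimately show ?thesis by (rule order_trans[rotated])
  qed
  then show ?thesis using c(1) S by (intro exI[of _ "c + S"]) auto
qed

lemma mm_program_exists:
  assumes "matrix_multiplication_exponent \<omega>"
  shows "\<exists>P d C v. mm_program P d C \<omega> v"
proof -
  from assms obtain P d T where T: "T \<in> O(\<lambda>n. real n powr \<omega>)"
    and P0: "\<forall>n M X s W. matrices_input n M X s \<and> (int n + int M + 2) ^ d \<le> W \<and> (\<forall>y i. \<bar>s y i\<bar> \<le> W) \<longrightarrow>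
      (\<exists>t s'. exec W P s t s' \<and> real t \<le> T n \<and> product_answer X s')"
    unfolding matrix_multiplication_exponent_def solvable_in_time_def by (elim exE conjE)
  have P: "run W P s (T n) (product_answer X)"
    if "matrices_input n M X s" "(int n + int M + 2) ^ d \<le> W" "ok W s" for n M X s W
    using P0 that unfolding run_def ok_def by blast
  have ge: "(real n)\<^sup>2 \<le> T n" for n by (rule matrix_product_time_ge[OF P])
  have \<omega>: "2 \<le> \<omega>" by (rule matrix_multiplication_exponent_ge_2[OF T ge])
  obtain C where C: "0 \<le> C" "\<And>n. T n \<le> C * (real n + 1) powr \<omega>"
    using bigo_powr_bound[OF T] \<omega> by auto
  define A where "A = length ` (vars P \<union> {''n'', ''A'', ''B'', ''C'', ''G'', ''found'', ''vertex'', ''tail'', ''head''})"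
  \<comment> \<open>A name that is longer than all names in use is new, and names of different
    lengths are distinct.\<close>
  define v where "v i = replicate (Suc (Max A) + i) CHR ''x''" for i
  have fin: "finite A" by (simp add: A_def finite_vars)
  have new: "v i \<notin> vars P \<union> {''n'', ''A'', ''B'', ''C'', ''G'', ''found'', ''vertex'', ''tail'', ''head''}" for i
  proof
    assume "v i \<in> vars P \<union> {''n'', ''A'', ''B'', ''C'', ''G'', ''found'', ''vertex'', ''tail'', ''head''}"
    then have "length (v i) \<in> A" unfolding A_def by (rule imageI)
    then have "length (v i) \<le> Max A" by (rule Max_ge[OF fin])
    then show False by (simp add: v_def)
  qed
  have "mm_program P d C \<omega> v"
  proof
    show "v i = v j \<longleftrightarrow> i = j" for i j
      by (metis add_left_cancel length_replicate v_def)
    show "run W P s (C * (real m + 1) powr \<omega>) (product_answer X)"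
      if "matrices_input m M X s" "(int m + int M + 2) ^ d \<le> W" "ok W s" for m M X s W
      by (rule run_mono[OF P[OF that] that(3) C(2)])
  qed (use new C(1) \<omega> in auto)
  then show ?thesis by blast
qed

section \<open>Neighbourhoods by colour\<close>

lemma row_major_eq_int:
  assumes "0 \<le> j" "j < m" "0 \<le> j'" "j' < m"
  shows "i * m + j = i' * m + j' \<longleftrightarrow> i = i' \<and> j = (j' :: int)"
proof -
  have "i = i' \<and> j = j'" if "i * m + j = i' * m + j'"
    using arg_cong[OF that, of "\<lambda>x. x div m"] arg_cong[OF that, of "\<lambda>x. x mod m"] assms by simp
  then show ?thesis by blast
qed

definition nbrs :: "(int \<Rightarrow> int \<Rightarrow> int) \<Rightarrow> nat \<Rightarrow> int \<Rightarrow> nat \<Rightarrow> nat list" where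
  "nbrs g x c k = filter (\<lambda>y. g (int x) (int y) = c) [0..<k]"

lemma nbrs_0 [simp]: "nbrs g x c 0 = []"
  by (simp add: nbrs_def)

lemma nbrs_Suc: "nbrs g x c (Suc k) = nbrs g x c k @ (if g (int x) (int k) = c then [k] else [])"
  by (simp add: nbrs_def)

lemma length_nbrs: "length (nbrs g x c k) \<le> k"
  using length_filter_le[of _ "[0..<k]"] by (simp add: nbrs_def)

lemma set_nbrs: "set (nbrs g x c k) = {y. y < k \<and> g (int x) (int y) = c}"
  by (auto simp: nbrs_def)

lemma distinct_nbrs: "distinct (nbrs g x c k)"
  by (simp add: nbrs_def)

context mm_program
begin

definition stored :: "nat \<Rightarrow> (int \<Rightarrow> int \<Rightarrow> int) \<Rightarrow> state \<Rightarrow> bool" where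
  "stored n g s \<longleftrightarrow> s (v 2) 0 = int n \<and> (\<forall>x<n. \<forall>y<n. s (v 3) (int (x * n + y)) = g (int x) (int y))"

abbreviation G_at :: "nat \<Rightarrow> nat \<Rightarrow> expr" where
  "G_at x y \<equiv> Read (v 3) (cell (v x) (v 2) (v y))"

lemma stored_keeps: "stored n g s \<Longrightarrow> keeps X s s' \<Longrightarrow> v 2 \<notin> X \<Longrightarrow> v 3 \<notin> X \<Longrightarrow> stored n g s'"
  by (auto simp: stored_def)

lemma ev_G_at:
  assumes "ok W s" "stored n g s" "s (v x) 0 = int i" "s (v y) 0 = int j" "i < n" "j < n" "int (n * n) \<le> W"
  shows "ev W s (G_at x y) (g (int i) (int j))"
proof -
  have "ev W s (cell (v x) (v 2) (v y)) (int (i * n + j))"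
    using assms by (intro ev_cell) (auto simp: stored_def)
  from ev_Read[OF assms(1) this, of "v 3"] show ?thesis
    using assms by (simp add: stored_def)
qed

text \<open>The input has to leave its original arrays: \<open>''n''\<close> is overwritten with the
  size of each matrix to be multiplied, and \<open>''G''\<close> may be written by
  \<open>P\<close>.\<close>

definition init :: com where
  "init = Seq (Set (v 2) (Var ''n'')) (Seq (Set (v 0) (Const 0))
     (For (v 32) (Op Times (Var (v 2)) (Var (v 2))) (Write (v 3) (Var (v 32)) (Read ''G'' (Var (v 32))))))"

lemma run_init:
  assumes "colour_matrix n M g s" "ok W s" "int (n * n) \<le> W" "1 \<le> W"
  shows "run W init s (100 * (real n + 1)\<^sup>2) (\<lambda>s'. stored n g s' \<and> s' (v 0) 0 = 0)"
proof -
  let ?L = "For (v 32) (Op Times (Var (v 2)) (Var (v 2))) (Write (v 3) (Var (v 32)) (Read ''G'' (Var (v 32))))"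
  have "n \<le> n * n" by simp
  then have nW: "int n \<le> W" using assms(3) by linarith
  have "run W init s (4 + (3 + real (n * n + 1) * (6 + 10 + 5))) (\<lambda>s'. stored n g s' \<and> s' (v 0) 0 = 0)"
    unfolding init_def
  proof (rule run_Seq)
    show "run W (Set (v 2) (Var ''n'')) s 4 (\<lambda>s'. s' (v 2) 0 = int n)"
      by (rule run_mono[OF run_Write[where a = 0 and b = "int n" and Q = "\<lambda>s'. s' (v 2) 0 = int n"]])
        (use assms in \<open>auto simp: ev_Const ev_Var colour_matrix_def\<close>)
    fix s1 assume 1: "s1 (v 2) 0 = int n" "ok W s1" "keeps (writes (Set (v 2) (Var ''n''))) s s1"
    show "run W (Seq (Set (v 0) (Const 0)) ?L) s1 (3 + real (n * n + 1) * (6 + 10 + 5))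
       (\<lambda>s'. stored n g s' \<and> s' (v 0) 0 = 0)"
    proof (rule run_Seq)
      show "run W (Set (v 0) (Const 0)) s1 3 (\<lambda>s'. s' (v 0) 0 = 0)"
        by (rule run_mono[OF run_Write[where a = 0 and b = 0 and Q = "\<lambda>s'. s' (v 0) 0 = 0"]])
          (use assms 1 in \<open>auto simp: ev_Const\<close>)
      fix s2 assume 2: "s2 (v 0) 0 = 0" "ok W s2" "keeps (writes (Set (v 0) (Const 0))) s1 s2"
      have e: "ev W s' (Op Times (Var (v 2)) (Var (v 2))) (int (n * n))"
        if "ok W s'" "s' (v 2) 0 = int n" for s'
        using that assms(3) by (intro ev_Op[where a = "int n" and b = "int n"] ev_Var) auto
      have "run W ?L s2 (real (n * n + 1) * (6 + 10 + real (cost (Op Times (Var (v 2)) (Var (v 2))))))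
        (\<lambda>s'. \<forall>k<n * n. s' (v 3) (int k) = s ''G'' (int k))"
      proof (rule run_For_const[where I = "\<lambda>i s'. \<forall>k<i. s' (v 3) (int k) = s ''G'' (int k)"])
        fix i s3 assume 3: "i < n * n" "ok W s3" "s3 (v 32) 0 = int i" "\<forall>k<i. s3 (v 3) (int k) = s ''G'' (int k)"
          "keeps (insert (v 32) (writes (Write (v 3) (Var (v 32)) (Read ''G'' (Var (v 32)))))) s2 s3"
        have "ev W s3 (Var (v 32)) (int i)" using 3 by (simp add: ev_Var)
        moreover from ev_Read[OF 3(2) this, of "''G''"]
        have "ev W s3 (Read ''G'' (Var (v 32))) (s ''G'' (int i))"
          using 1 2 3(5) by auto
        ultimately have "run W (Write (v 3) (Var (v 32)) (Read ''G'' (Var (v 32)))) s3 (real (1 + 2 + 3))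
          (\<lambda>s'. \<forall>k<Suc i. upd s' (v 32) 0 (int (Suc i)) (v 3) (int k) = s ''G'' (int k))"
          using run_Write[of W s3 "Var (v 32)" "int i" "Read ''G'' (Var (v 32))" "s ''G'' (int i)"
              "\<lambda>s'. \<forall>k<Suc i. upd s' (v 32) 0 (int (Suc i)) (v 3) (int k) = s ''G'' (int k)" "v 3"] 3(4)
          by (auto simp: less_Suc_eq)
        then show "run W (Write (v 3) (Var (v 32)) (Read ''G'' (Var (v 32)))) s3 6
          (\<lambda>s'. \<forall>k<Suc i. upd s' (v 32) 0 (int (Suc i)) (v 3) (int k) = s ''G'' (int k))"
          by simp
      qed (use 1 2 assms e in auto)
      then show "run W ?L s2 (real (n * n + 1) * (6 + 10 + 5)) (\<lambda>s'. stored n g s' \<and> s' (v 0) 0 = 0)"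
      proof (rule run_mono)
        fix s4 assume "\<forall>k<n * n. s4 (v 3) (int k) = s ''G'' (int k)" "keeps (writes ?L) s2 s4"
        then show "stored n g s4 \<and> s4 (v 0) 0 = 0"
          using 1 2 assms(1) row_major_less[of _ n _ n]
          by (auto simp: stored_def colour_matrix_def simp del: of_nat_add of_nat_mult)
      qed (use 2 in auto)
    qed (use 1 in auto)
  qed (use assms in auto)
  then show ?thesis
  proof (rule run_mono)
    show "4 + (3 + real (n * n + 1) * (6 + 10 + 5)) \<le> 100 * (real n + 1)\<^sup>2"
      by (simp add: power2_eq_square algebra_simps)
  qed (use assms in auto)
qed

text \<open>For a single vertex the claimed exponent is \<open>1\<close>, which does not even allow
  reading the matrix. Vertex \<open>0\<close> is a copy as soon as \<open>n\<close> is
  positive.\<close>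

lemma detects_vertex:
  assumes "0 \<le> \<tau>"
  shows "detects 1 [] \<tau>"
proof -
  define c where "c = Cond (Var ''n'') (Seq (Write (v 1) (Const 0) (Const 0)) (Set (v 0) (Const 1))) (Set (v 0) (Const 0))"
  have "run W c s (real (tmax c) * (real n + 1) powr \<tau>)
      (\<lambda>s'. if \<exists>f k. embedding n g 1 [] f k
        then s' (v 0) 0 = 1 \<and> (\<exists>k. embedding n g 1 [] (\<lambda>i. s' (v 1) (int i)) k)
        else s' (v 0) 0 = 0)" (is "run _ _ _ _ ?Q")
    if "colour_matrix n M g s" "ok W s" "(int n + int M + 2) ^ 1 \<le> W" for n M g W s
  proof -
    have n: "s ''n'' 0 = int n" using that by (simp add: colour_matrix_def)
    have pos: "embedding n g 1 [] f 1" if "f 0 = 0" "0 < n" for f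
      using that by (auto simp: embedding_def lessThan_Suc)
    have zero: "\<not> embedding n g 1 [] f k" if "n = 0" for f k
      using that by (auto simp: embedding_def)
    have "wp W c ?Q s"
    proof (cases "n = 0")
      case True
      then show ?thesis
        unfolding c_def using that n zero by (auto simp: okD)
    next
      case False
      then show ?thesis
        unfolding c_def using that n pos[of "\<lambda>i. upd s (v 1) 0 0 (v 1) (int i)"] pos[of "\<lambda>_. 0"]
        by (auto simp: okD)
    qed
    then show ?thesis
    proof (rule run_mono[OF run_wp])
      have "1 \<le> (real n + 1) powr \<tau>" using assms by (intro ge_one_powr_ge_zero) auto
      then have "real (tmax c) * 1 \<le> real (tmax c) * (real n + 1) powr \<tau>" by (intro mult_left_mono) auto
      then show "real (tmax c) \<le> real (tmax c) * (real n + 1) powr \<tau>" by simp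
    qed (use that in auto)
  qed
  then show ?thesis unfolding detects_def by blast
qed

abbreviation count_at :: expr where
  "count_at \<equiv> Read (v 27) (Var (v 29))"

text \<open>Sorts each row by colour in linear time. Colours serve as addresses: the list of colour
  \<open>c\<close> occupies the cells from \<open>c * n\<close> on. Only counters of colours that
  occur in the row are reset, which avoids a loop over all colours and makes no assumption on the
  memory. The action runs before column \<open>k\<close> is appended, so it sees exactly the earlier
  vertices of the same colour.\<close>

definition scan :: "com \<Rightarrow> com" where
  "scan act = For (v 25) (Var (v 2)) (Seq
     (For (v 26) (Var (v 2)) (Write (v 27) (G_at 25 26) (Const 0)))
     (For (v 26) (Var (v 2)) (Seq (Set (v 29) (G_at 25 26)) (Seq act
       (Seq (Write (v 28) (Op Plus (Op Times (Var (v 29)) (Var (v 2))) count_at) (Var (v 26)))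
         (Write (v 27) (Var (v 29)) (Op Plus count_at (Const 1))))))))"

definition listed :: "nat \<Rightarrow> (int \<Rightarrow> int \<Rightarrow> int) \<Rightarrow> nat \<Rightarrow> nat \<Rightarrow> state \<Rightarrow> bool" where
  "listed n g x k s \<longleftrightarrow> (\<forall>c\<in>g (int x) ` int ` {..<n}. s (v 27) c = int (length (nbrs g x c k)) \<and>
     (\<forall>i<length (nbrs g x c k). s (v 28) (c * int n + int i) = int (nbrs g x c k ! i)))"

lemma listed_keeps: "listed n g x k s \<Longrightarrow> keeps X s s' \<Longrightarrow> v 27 \<notin> X \<Longrightarrow> v 28 \<notin> X \<Longrightarrow> listed n g x k s'"
  by (simp add: listed_def)

lemma listed_push:
  assumes L: "listed n g x k s" and k: "k < n" and c: "g (int x) (int k) = c" and l: "l = int (length (nbrs g x c k))"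
  shows "listed n g x (Suc k) (upd (upd s (v 28) (c * int n + l) (int k)) (v 27) c (l + 1))"
  unfolding listed_def
proof (intro ballI conjI allI impI)
  fix c' assume c': "c' \<in> g (int x) ` int ` {..<n}"
  note L' = bspec[OF L[unfolded listed_def] c']
  show "upd (upd s (v 28) (c * int n + l) (int k)) (v 27) c (l + 1) (v 27) c' = int (length (nbrs g x c' (Suc k)))"
    using L' c l by (auto simp: nbrs_Suc)
  fix i assume i: "i < length (nbrs g x c' (Suc k))"
  have "length (nbrs g x c' (Suc k)) \<le> Suc k" by (rule length_nbrs)
  then have "i < n" using i k by linarith
  moreover have "length (nbrs g x c k) < n" using length_nbrs[of g x c k] k by linarith
  ultimately have "c' * int n + int i = c * int n + l \<longleftrightarrow> c' = c \<and> i = length (nbrs g x c k)"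
    using l by (subst row_major_eq_int) auto
  then show "upd (upd s (v 28) (c * int n + l) (int k)) (v 27) c (l + 1) (v 28) (c' * int n + int i) =
      int (nbrs g x c' (Suc k) ! i)"
    using L' i c by (auto simp: nbrs_Suc nth_append split: if_splits)
qed

text \<open>The predicate \<open>Inv\<close> is the invariant of the action alone. It has to
  tolerate changes of the arrays that belong to the scan, and in turn the action must not write
  these or the stored matrix. Passing from \<open>Inv x n\<close> to \<open>Inv (Suc x) 0\<close> is
  the change of row.\<close>

lemma run_scan:
  assumes ok: "ok W s" and st: "stored n g s" and W: "int (n * n) \<le> W" "(int M + 2) * int n \<le> W" "int M + 2 \<le> W"
    and g: "\<And>x y. 0 \<le> g x y \<and> g x y \<le> int M + 1"
    and act: "writes act \<inter> v ` {2, 3, 25, 26, 27, 28, 29} = {}"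
    and I0: "Inv 0 0 s"
    and I_step: "\<And>x s'. Inv x n s' \<Longrightarrow> Inv (Suc x) 0 s'"
    and I_keeps: "\<And>x k s1 s2. Inv x k s1 \<Longrightarrow> keeps (v ` {25, 26, 27, 28, 29}) s1 s2 \<Longrightarrow> Inv x k s2"
    and run: "\<And>x k s'. ok W s' \<Longrightarrow> keeps (writes (scan act)) s s' \<Longrightarrow> x < n \<Longrightarrow> k < n \<Longrightarrow>
      s' (v 25) 0 = int x \<Longrightarrow> s' (v 26) 0 = int k \<Longrightarrow> s' (v 29) 0 = g (int x) (int k) \<Longrightarrow>
      stored n g s' \<Longrightarrow> listed n g x k s' \<Longrightarrow> Inv x k s' \<Longrightarrow> run W act s' b (Inv x (Suc k))"
    and b: "0 \<le> b"
  shows "run W (scan act) s ((real n + 1)\<^sup>2 * (b + 200)) (Inv n 0)"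
proof -
  have "n \<le> n * n" by simp
  then have nW: "int n \<le> W" using W by linarith
  have W1: "1 \<le> W" using W by linarith
  let ?reset = "Write (v 27) (G_at 25 26) (Const 0)"
  let ?push = "Seq (Write (v 28) (Op Plus (Op Times (Var (v 29)) (Var (v 2))) count_at) (Var (v 26)))
         (Write (v 27) (Var (v 29)) (Op Plus count_at (Const 1)))"
  let ?body = "Seq (Set (v 29) (G_at 25 26)) (Seq act ?push)"
  let ?F = "\<lambda>c. For (v 26) (Var (v 2)) c"
  let ?t1 = "real (n + 1) * (11 + 10 + real (cost (Var (v 2))))"
  let ?t2 = "real (n + 1) * ((11 + (b + 26)) + 10 + real (cost (Var (v 2))))"
  have w: "writes (scan act) = writes act \<union> v ` {25, 26, 27, 28, 29}"
    by (auto simp: scan_def)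
  have act': "v j \<notin> writes act" if "j \<in> {2, 3, 25, 26, 27, 28, 29}" for j
    using act that by blast
  have "run W (scan act) s (real (n + 1) * ((?t1 + ?t2) + 10 + real (cost (Var (v 2))))) (Inv n 0)"
    unfolding scan_def
  proof (rule run_For_const[where I = "\<lambda>x s'. Inv x 0 s'"])
    show "Inv 0 0 (upd s (v 25) 0 0)" by (rule I_keeps[OF I0]) auto
    fix x s1 assume 1: "x < n" "ok W s1" "keeps (insert (v 25) (writes (Seq (?F ?reset) (?F ?body)))) s s1"
      "s1 (v 25) 0 = int x" "Inv x 0 s1"
    have st1: "stored n g s1" using stored_keeps[OF st 1(3)] act' by auto
    show "run W (Seq (?F ?reset) (?F ?body)) s1 (?t1 + ?t2) (\<lambda>s''. Inv (Suc x) 0 (upd s'' (v 25) 0 (int (Suc x))))"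
    proof (rule run_Seq)
      show "run W (?F ?reset) s1 ?t1 (\<lambda>s'. \<forall>y<n. s' (v 27) (g (int x) (int y)) = 0)"
      proof (rule run_For_const[where I = "\<lambda>k s'. \<forall>y<k. s' (v 27) (g (int x) (int y)) = 0"])
        fix k s2 assume 2: "k < n" "ok W s2" "keeps (insert (v 26) (writes ?reset)) s1 s2" "s2 (v 26) 0 = int k"
          "\<forall>y<k. s2 (v 27) (g (int x) (int y)) = 0"
        have "stored n g s2" using stored_keeps[OF st1 2(3)] by auto
        then have "ev W s2 (G_at 25 26) (g (int x) (int k))"
          using 1 2 W by (intro ev_G_at) auto
        from run_Write[OF this, of "Const 0" 0 "\<lambda>s'. \<forall>y<Suc k. upd s' (v 26) 0 (int (Suc k)) (v 27) (g (int x) (int y)) = 0" "v 27"]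
        show "run W ?reset s2 11 (\<lambda>s'. \<forall>y<Suc k. upd s' (v 26) 0 (int (Suc k)) (v 27) (g (int x) (int y)) = 0)"
          using 2(5) W1 by (auto simp: less_Suc_eq ev_Const)
      qed (use 1 st1 W1 nW in \<open>auto simp: ev_Var stored_def\<close>)
    next
      fix s2 assume 2: "\<forall>y<n. s2 (v 27) (g (int x) (int y)) = 0" "ok W s2" "keeps (writes (?F ?reset)) s1 s2"
      have st2: "stored n g s2" using stored_keeps[OF st1 2(3)] by auto
      have k2: "keeps (writes (scan act)) s s2" using 1(3) 2(3) unfolding w by auto
      have x2: "s2 (v 25) 0 = int x" using 1(4) 2(3) by auto
      have I2: "Inv x 0 s2" by (rule I_keeps[OF 1(5)]) (use 2(3) in auto)
      have L2: "listed n g x 0 s2" using 2(1) by (auto simp: listed_def)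
      have "run W (?F ?body) s2 ?t2 (\<lambda>s'. Inv x n s' \<and> listed n g x n s')"
      proof (rule run_For_const[where I = "\<lambda>k s'. Inv x k s' \<and> listed n g x k s'"])
        show "Inv x 0 (upd s2 (v 26) 0 0) \<and> listed n g x 0 (upd s2 (v 26) 0 0)"
          by (intro conjI I_keeps[OF I2] listed_keeps[OF L2, of "{v 26}"]) auto
        fix k s3 assume 3: "k < n" "ok W s3" "keeps (insert (v 26) (writes ?body)) s2 s3" "s3 (v 26) 0 = int k"
          "Inv x k s3 \<and> listed n g x k s3"
        have st3: "stored n g s3" using stored_keeps[OF st2 3(3)] act' by auto
        have x3: "s3 (v 25) 0 = int x" using x2 3(3) act' by auto
        let ?c = "g (int x) (int k)" let ?l = "int (length (nbrs g x ?c k))"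
        have cc: "0 \<le> ?c" "?c \<le> int M + 1" "?c \<in> g (int x) ` int ` {..<n}" using g 3(1) by auto
        have lk: "?l \<le> int k" using length_nbrs[of g x ?c k] by simp
        have cn: "?c * int n \<le> (int M + 1) * int n" "0 \<le> ?c * int n" using cc by (auto intro: mult_right_mono)
        have bd: "?c * int n \<le> W" "?c * int n + ?l \<le> W" "?l + 1 \<le> W" "?c \<le> W"
          using cn lk 3(1) W nW cc(2) by (auto simp: algebra_simps)
        have abd: "\<bar>?c * int n\<bar> \<le> W" "\<bar>?c * int n + ?l\<bar> \<le> W" "\<bar>?l + 1\<bar> \<le> W" "\<bar>?c\<bar> \<le> W" "\<bar>?l\<bar> \<le> W"
          using bd cn(2) cc(1) by linarith+
        show "run W ?body s3 (11 + (b + 26))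
          (\<lambda>s''. Inv x (Suc k) (upd s'' (v 26) 0 (int (Suc k))) \<and> listed n g x (Suc k) (upd s'' (v 26) 0 (int (Suc k))))"
        proof (rule run_Seq)
          have "ev W s3 (G_at 25 26) ?c" using 3 x3 st3 1 W by (intro ev_G_at) auto
          from run_Write[OF _ this, of "Const 0" 0 "\<lambda>s'. s' (v 29) 0 = ?c" "v 29"]
          show "run W (Set (v 29) (G_at 25 26)) s3 11 (\<lambda>s'. s' (v 29) 0 = ?c)"
            using W1 by (simp add: ev_Const)
          fix s4 assume 4: "s4 (v 29) 0 = ?c" "ok W s4" "keeps (writes (Set (v 29) (G_at 25 26))) s3 s4"
          have k4: "keeps {v 29} s3 s4" using 4(3) by auto
          have st4: "stored n g s4" by (rule stored_keeps[OF st3 k4]) auto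
          have L4: "listed n g x k s4" by (rule listed_keeps[OF conjunct2[OF 3(5)] k4]) auto
          have I4: "Inv x k s4" by (rule I_keeps[OF conjunct1[OF 3(5)]]) (use k4 in auto)
          have x4: "s4 (v 25) 0 = int x" "s4 (v 26) 0 = int k" using k4 x3 3(4) by auto
          show "run W (Seq act ?push) s4 (b + 26)
            (\<lambda>s''. Inv x (Suc k) (upd s'' (v 26) 0 (int (Suc k))) \<and> listed n g x (Suc k) (upd s'' (v 26) 0 (int (Suc k))))"
          proof (rule run_Seq)
            show "run W act s4 b (Inv x (Suc k))"
            proof (rule run)
              show "keeps (writes (scan act)) s s4" using k2 3(3) k4 unfolding w by auto
            qed (use 1 3 4 st4 L4 I4 x4 in auto)
            fix s5 assume 5: "Inv x (Suc k) s5" "ok W s5" "keeps (writes act) s4 s5"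
            have st5: "stored n g s5" by (rule stored_keeps[OF st4 5(3)]) (use act' in auto)
            have L5: "listed n g x k s5" by (rule listed_keeps[OF L4 5(3)]) (use act' in auto)
            have x5: "s5 (v 29) 0 = ?c" "s5 (v 26) 0 = int k" "s5 (v 2) 0 = int n"
              using 5(3) act' 4(1) x4 st5 by (auto simp: stored_def)
            have l5: "s5 (v 27) ?c = ?l" using L5 cc(3) by (auto simp: listed_def)
            let ?s6 = "upd s5 (v 28) (?c * int n + ?l) (int k)"
            let ?s7 = "upd ?s6 (v 27) ?c (?l + 1)"
            have L7: "listed n g x (Suc k) ?s7" by (rule listed_push[OF L5 3(1)]) auto
            have "Inv x (Suc k) (upd ?s7 (v 26) 0 (int (Suc k))) \<and> listed n g x (Suc k) (upd ?s7 (v 26) 0 (int (Suc k)))"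
              by (intro conjI I_keeps[OF 5(1)] listed_keeps[OF L7, of "{v 26}"]) auto
            then have "wp W ?push (\<lambda>s''. Inv x (Suc k) (upd s'' (v 26) 0 (int (Suc k))) \<and> listed n g x (Suc k) (upd s'' (v 26) 0 (int (Suc k)))) s5"
              using x5 l5 abd nW W1 3(1) lk by auto
            from run_wp[OF this]
            show "run W ?push s5 26 (\<lambda>s''. Inv x (Suc k) (upd s'' (v 26) 0 (int (Suc k))) \<and> listed n g x (Suc k) (upd s'' (v 26) 0 (int (Suc k))))"
              by (rule run_mono) (use 5 in auto)
          qed (use 4 in auto)
        qed (use 3 in auto)
      qed (use 2 st2 W1 nW act' b in \<open>auto simp: ev_Var stored_def\<close>)
      then show "run W (?F ?body) s2 ?t2 (\<lambda>s''. Inv (Suc x) 0 (upd s'' (v 25) 0 (int (Suc x))))"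
      proof (rule run_mono)
        fix s3 assume "Inv x n s3 \<and> listed n g x n s3"
        then show "Inv (Suc x) 0 (upd s3 (v 25) 0 (int (Suc x)))"
          using I_keeps[OF I_step, of x s3 "upd s3 (v 25) 0 (int (Suc x))"] by auto
      qed (use 2 in auto)
    qed (use 1 in auto)
  qed (use ok st W1 nW act' b in \<open>auto simp: ev_Var stored_def\<close>)
  then show ?thesis
  proof (rule run_mono)
    have "b * (real n + 1) \<le> b * (real n + 1)\<^sup>2" using b by (intro mult_left_mono) (auto simp: power2_eq_square)
    then show "real (n + 1) * ((?t1 + ?t2) + 10 + real (cost (Var (v 2)))) \<le> (real n + 1)\<^sup>2 * (b + 200)"
      by (simp add: power2_eq_square algebra_simps)
  qed (use ok in auto)
qed

end

lemma ev_And: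
  "ev W s a (of_bool p) \<Longrightarrow> ev W s b (of_bool q) \<Longrightarrow> 1 \<le> W \<Longrightarrow> ev W s (Op Times a b) (of_bool (p \<and> q))"
  by (rule ev_Op) auto

lemma ev_Less:
  "ev W s a x \<Longrightarrow> ev W s b y \<Longrightarrow> 1 \<le> W \<Longrightarrow> ev W s (Op Less a b) (of_bool (x < y))"
  by (rule ev_Op) auto

text \<open>Let \<open>B = n + M + 2\<close>. Every quantity is at most \<open>B^2 + D\<close>, and
  from \<open>D \<le> B ^ D\<close> and \<open>2 \<le> B^2\<close> this is at most
  \<open>2 * B ^ (D + 2) \<le> B ^ (D + 4)\<close>.\<close>

lemma word_bounds:
  assumes "(int n + int M + 2) ^ (D + 4) \<le> W"
  shows "int (n * n) \<le> W" "(int M + 2) * int n \<le> W" "int M + 2 \<le> W" "(int M + 2) * int n + int D \<le> W"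
    "int D \<le> W" "1 \<le> W" "int n \<le> W"
proof -
  let ?B = "int n + int M + 2"
  have le: "a * b \<le> ?B\<^sup>2" if "0 \<le> a" "0 \<le> b" "a \<le> ?B" "b \<le> ?B" for a b :: int
    unfolding power2_eq_square using that by (intro mult_mono) auto
  have "int D \<le> 2 ^ D" using of_nat_mono[OF less_imp_le[OF less_exp[of D]], where ?'a = int] by simp
  also have "\<dots> \<le> ?B ^ D" by (intro power_mono) auto
  finally have D: "int D \<le> ?B ^ D" .
  have 1: "1 \<le> ?B ^ D" "1 \<le> ?B\<^sup>2" by (simp_all add: one_le_power)
  have "?B\<^sup>2 + int D \<le> ?B\<^sup>2 * ?B ^ D + ?B\<^sup>2 * ?B ^ D"
  proof (rule add_mono)
    show "?B\<^sup>2 \<le> ?B\<^sup>2 * ?B ^ D"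
      using mult_left_mono[OF 1(1) zero_le_power2[of ?B]] by (simp only: mult_1_right)
    show "int D \<le> ?B\<^sup>2 * ?B ^ D"
      using D mult_right_mono[OF 1(2) order_trans[OF zero_le_one 1(1)]] unfolding mult_1 by (rule order_trans)
  qed
  also have "\<dots> = 2 * ?B ^ (D + 2)" by (simp only: power_add mult_2 mult.commute)
  also have "\<dots> \<le> ?B\<^sup>2 * ?B ^ (D + 2)"
    by (intro mult_right_mono order_trans[OF _ le[of 1 2]]) auto
  also have "\<dots> = ?B ^ (2 + (D + 2))" by (rule power_add[symmetric])
  also have "2 + (D + 2) = D + 4" by simp
  finally have W: "?B\<^sup>2 + int D \<le> W" using assms by linarith
  have "int n * int n \<le> ?B\<^sup>2" "(int M + 2) * int n \<le> ?B\<^sup>2" "(int M + 2) * 1 \<le> ?B\<^sup>2" "int n * 1 \<le> ?B\<^sup>2"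
    by (rule le; simp)+
  then show "int (n * n) \<le> W" "(int M + 2) * int n \<le> W" "int M + 2 \<le> W" "(int M + 2) * int n + int D \<le> W"
    "int D \<le> W" "1 \<le> W" "int n \<le> W"
    using W 1(2) by simp_all
qed

context mm_program
begin

lemma detects_mono:
  assumes "detects h es \<tau>" "\<tau> \<le> \<tau>'"
  shows "detects h es \<tau>'"
proof -
  obtain c d K where c: "\<And>n M g W s. colour_matrix n M g s \<Longrightarrow> ok W s \<Longrightarrow> (int n + int M + 2) ^ d \<le> W \<Longrightarrow>
     run W c s (K * (real n + 1) powr \<tau>)
      (\<lambda>s'. if \<exists>f k. embedding n g h es f k
        then s' (v 0) 0 = 1 \<and> (\<exists>k. embedding n g h es (\<lambda>i. s' (v 1) (int i)) k)
        else s' (v 0) 0 = 0)"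
    using assms(1) unfolding detects_def by blast
  have K: "K * (real n + 1) powr \<tau> \<le> \<bar>K\<bar> * (real n + 1) powr \<tau>'" for n
    using assms(2) by (intro mult_mono powr_mono) auto
  show ?thesis unfolding detects_def
    by (rule exI[of _ c], rule exI[of _ d], rule exI[of _ "\<bar>K\<bar>"]) (blast intro: run_mono[OF c _ K])
qed

lemma run_after_init:
  assumes "colour_matrix n M g s" "ok W s" "int (n * n) \<le> W" "1 \<le> W"
    and "\<And>s1. ok W s1 \<Longrightarrow> stored n g s1 \<Longrightarrow> s1 (v 0) 0 = 0 \<Longrightarrow> run W c s1 t Q"
  shows "run W (Seq init c) s (100 * (real n + 1)\<^sup>2 + t) Q"
  by (rule run_Seq[OF run_init[OF assms(1-4)] assms(2)]) (use assms(5) in blast)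

section \<open>Monochromatic stars\<close>

primrec grab :: "nat \<Rightarrow> com" where
  "grab 0 = Skip"
| "grab (Suc i) = Seq (grab i) (Write (v 1) (Const (int (Suc i)))
     (Read (v 28) (Op Plus (Op Times (Var (v 29)) (Var (v 2))) (Const (int i)))))"

lemma writes_grab: "writes (grab i) \<subseteq> {v 1}"
  by (induction i) auto

lemma wp_grab:
  assumes "ok W s" "int N \<le> W" "s (v 29) 0 = c" "s (v 2) 0 = int n" "0 \<le> c" "c * int n + int N \<le> W"
    and "\<And>s'. ok W s' \<Longrightarrow> keeps {v 1} s s' \<Longrightarrow> s' (v 1) 0 = s (v 1) 0 \<Longrightarrow>
      (\<forall>i<N. s' (v 1) (int (Suc i)) = s (v 28) (c * int n + int i)) \<Longrightarrow> Q s'"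
  shows "wp W (grab N) Q s"
  using assms
proof (induction N arbitrary: Q)
  case 0
  then show ?case by auto
next
  case (Suc N)
  have "wp W (grab N) (wp W (Write (v 1) (Const (int (Suc N)))
     (Read (v 28) (Op Plus (Op Times (Var (v 29)) (Var (v 2))) (Const (int N)))) ) Q) s"
  proof (rule Suc.IH)
    fix s1 assume 1: "ok W s1" "keeps {v 1} s s1" "s1 (v 1) 0 = s (v 1) 0"
      "\<forall>i<N. s1 (v 1) (int (Suc i)) = s (v 28) (c * int n + int i)"
    let ?s2 = "upd s1 (v 1) (int (Suc N)) (s (v 28) (c * int n + int N))"
    have x: "s1 (v 29) 0 = c" "s1 (v 2) 0 = int n" "s1 (v 28) = s (v 28)" using 1(2) Suc.prems by auto
    have "ok W ?s2" by (rule ok_upd[OF 1(1) okD[OF Suc.prems(1)]])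
    then have "Q ?s2"
      by (rule Suc.prems(7)) (use 1 in \<open>auto simp: less_Suc_eq\<close>)
    moreover have "0 \<le> c * int n" using Suc.prems by simp
    then have "\<bar>c * int n\<bar> \<le> W" "\<bar>c * int n + int N\<bar> \<le> W" "\<bar>int (Suc N)\<bar> \<le> W" "\<bar>int N\<bar> \<le> W"
      using Suc.prems(2,6) by linarith+
    moreover have "int n \<le> W" using okD[OF 1(1), of "v 2" 0] x(2) by simp
    moreover note okD[OF 1(1)] ok_nonneg[OF 1(1)]
    ultimately show "wp W (Write (v 1) (Const (int (Suc N)))
       (Read (v 28) (Op Plus (Op Times (Var (v 29)) (Var (v 2))) (Const (int N))))) Q s1"
      using x okD[OF Suc.prems(1)] by auto
  qed (use Suc.prems in auto)
  then show ?case by simp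
qed

text \<open>The action strikes when column \<open>k\<close> becomes the \<open>D\<close>-th
  neighbour in its colour, that is, when \<open>D - 1\<close> earlier ones are listed; the two
  comparisons pin the counter to this value. As \<open>D\<close> is fixed, copying the leaves takes
  constant time per matrix entry, which keeps the search quadratic.\<close>

definition star_act :: "nat \<Rightarrow> com" where
  "star_act D = Cond (Op Times (Op Less (Const 0) (Var (v 29)))
       (Op Times (Op Less count_at (Const (int D))) (Op Less (Const (int D - 2)) count_at)))
     (Seq (Write (v 1) (Const 0) (Var (v 25))) (Seq (grab (D - 1))
       (Seq (Write (v 1) (Const (int D)) (Var (v 26))) (Set (v 0) (Const 1))))) Skip"

lemma star_embedding:
  assumes D: "1 \<le> D" and es: "set es = {(0, i) | i. 1 \<le> i \<and> i \<le> D} \<union> {(i, 0) | i. 1 \<le> i \<and> i \<le> D}"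
    and g: "\<And>x y. g x y = g y x" "\<And>x. g x x = 0"
    and x: "x < n" "k < n" and c: "c \<noteq> 0" "g (int x) (int k) = c"
    and len: "Suc (length (nbrs g x c k)) = D"
    and f: "f 0 = int x" "\<And>i. i < D - 1 \<Longrightarrow> f (Suc i) = int (nbrs g x c k ! i)" "f D = int k"
  shows "embedding n g (Suc D) es f c"
proof -
  let ?L = "nbrs g x c k @ [k]"
  have L: "length ?L = D" "distinct ?L" "set ?L \<subseteq> {y. y < n \<and> g (int x) (int y) = c}"
    using len x(2) c(2) by (auto simp: distinct_nbrs set_nbrs)
  have fL: "f (Suc i) = int (?L ! i)" if "i < D" for i
    using that f(2)[of i] f(3) len by (cases "i = D - 1") (auto simp: nth_append)
  have leaf: "?L ! i < n \<and> g (int x) (int (?L ! i)) = c" if "i < D" for i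
    using L nth_mem[of i ?L] that by auto
  have leaf': "f i \<in> {0..<int n} \<and> g (int x) (f i) = c" if "1 \<le> i" "i \<le> D" for i
    using that fL[of "i - 1"] leaf[of "i - 1"] by (cases i) auto
  have "inj_on f {..<Suc D}"
  proof (rule inj_onI)
    fix i j assume ij: "i \<in> {..<Suc D}" "j \<in> {..<Suc D}" "f i = f j"
    have ne: "f i \<noteq> f 0" if "1 \<le> i" "i \<le> D" for i
      using leaf'[OF that] g(2)[of "int x"] c(1) f(1) by metis
    show "i = j"
    proof (cases "i = 0 \<or> j = 0")
      case True
      then show ?thesis using ne[of i] ne[of j] ij by (cases i; cases j) auto
    next
      case False
      then obtain i' j' where "i = Suc i'" "j = Suc j'" by (metis not0_implies_Suc)
      then show ?thesis using ij fL[of i'] fL[of j'] L(1,2) by (auto simp: nth_eq_iff_index_eq)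
    qed
  qed
  moreover have "f ` {..<Suc D} \<subseteq> {0..<int n}"
  proof
    fix y assume "y \<in> f ` {..<Suc D}"
    then obtain i where "y = f i" "i \<le> D" by auto
    then show "y \<in> {0..<int n}" using leaf'[of i] f(1) x(1) by (cases i) auto
  qed
  moreover have "\<forall>(a, b)\<in>set es. g (f a) (f b) = c"
    unfolding es using leaf' f(1) g(1) by auto
  ultimately show ?thesis using c(1) by (simp add: embedding_def)
qed

lemma star_degree:
  assumes D: "1 \<le> D" and es: "set es = {(0, i) | i. 1 \<le> i \<and> i \<le> D} \<union> {(i, 0) | i. 1 \<le> i \<and> i \<le> D}"
    and e: "embedding n g (Suc D) es f c"
  shows "nat (f 0) < n \<and> c \<noteq> 0 \<and> D \<le> length (nbrs g (nat (f 0)) c n)"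
proof -
  have f: "c \<noteq> 0" "\<And>i. i \<le> D \<Longrightarrow> 0 \<le> f i \<and> f i < int n" "inj_on f {..<Suc D}"
    "\<And>i. 1 \<le> i \<Longrightarrow> i \<le> D \<Longrightarrow> g (f 0) (f i) = c"
    using e es by (auto simp: embedding_def image_subset_iff)
  have "(\<lambda>i. nat (f i)) ` {1..D} \<subseteq> set (nbrs g (nat (f 0)) c n)"
  proof
    fix y assume "y \<in> (\<lambda>i. nat (f i)) ` {1..D}"
    then obtain i where "y = nat (f i)" "1 \<le> i" "i \<le> D" by auto
    then show "y \<in> set (nbrs g (nat (f 0)) c n)"
      using f(2)[of i] f(2)[of 0] f(4)[of i] by (auto simp: set_nbrs)
  qed
  then have "card ((\<lambda>i. nat (f i)) ` {1..D}) \<le> card (set (nbrs g (nat (f 0)) c n))"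
    by (intro card_mono) auto
  moreover have "inj_on (\<lambda>i. nat (f i)) {1..D}"
  proof (rule inj_onI)
    fix i j assume "i \<in> {1..D}" "j \<in> {1..D}" "nat (f i) = nat (f j)"
    then show "i = j" using f(2)[of i] f(2)[of j] inj_onD[OF f(3), of i j] by (auto simp: eq_nat_nat_iff)
  qed
  ultimately have "D \<le> length (nbrs g (nat (f 0)) c n)"
    by (simp add: card_image distinct_card[OF distinct_nbrs])
  then show ?thesis using f(1) f(2)[of 0] by auto
qed

lemma detects_star:
  assumes D: "1 \<le> D" and es: "set es = {(0, i) | i. 1 \<le> i \<and> i \<le> D} \<union> {(i, 0) | i. 1 \<le> i \<and> i \<le> D}"
  shows "detects (Suc D) es 2"
proof -
  let ?c = "Seq init (scan (star_act D))"
  let ?K = "real (tmax (star_act D)) + 300"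
  let ?d = "D + 4"
  have "run W ?c s (?K * (real n + 1) powr 2)
      (\<lambda>s'. if \<exists>f k. embedding n g (Suc D) es f k
        then s' (v 0) 0 = 1 \<and> (\<exists>k. embedding n g (Suc D) es (\<lambda>i. s' (v 1) (int i)) k)
        else s' (v 0) 0 = 0)" (is "run _ _ _ _ ?Q")
    if cm: "colour_matrix n M g s" and ok: "ok W s" and W: "(int n + int M + 2) ^ ?d \<le> W" for n M g W s
  proof -
    have gs: "\<And>x y. 0 \<le> g x y \<and> g x y \<le> int M + 1" "\<And>x y. g x y = g y x" "\<And>x. g x x = 0"
      using cm by (auto simp: colour_matrix_def)
    note Wn = word_bounds[OF W]
    \<comment> \<open>The second conjunct is completeness: if some colour occurs \<open>D\<close>
      times in a finished row, or in the first \<open>k\<close> columns of the current row, then the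
      flag is set.\<close>
    let ?Inv = "\<lambda>x k s'. (s' (v 0) 0 = 0 \<or> s' (v 0) 0 = 1 \<and> (\<exists>c. embedding n g (Suc D) es (\<lambda>i. s' (v 1) (int i)) c)) \<and>
       ((\<exists>x'<x. \<exists>c. c \<noteq> 0 \<and> D \<le> length (nbrs g x' c n)) \<or> (\<exists>c. c \<noteq> 0 \<and> D \<le> length (nbrs g x c k)) \<longrightarrow> s' (v 0) 0 = 1)"
    have "run W ?c s (100 * (real n + 1)\<^sup>2 + (real n + 1)\<^sup>2 * (real (tmax (star_act D)) + 200)) (?Inv n 0)"
    proof (rule run_after_init[OF cm ok Wn(1,6)])
      fix s1 assume 1: "ok W s1" "stored n g s1" "s1 (v 0) 0 = 0"
      show "run W (scan (star_act D)) s1 ((real n + 1)\<^sup>2 * (real (tmax (star_act D)) + 200)) (?Inv n 0)"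
      proof (rule run_scan[where M = M and g = g and Inv = ?Inv])
        show "writes (star_act D) \<inter> v ` {2, 3, 25, 26, 27, 28, 29} = {}"
          using writes_grab[of "D - 1"] by (auto simp: star_act_def)
        show "?Inv 0 0 s1" using 1 D by auto
        show "?Inv (Suc x) 0 s'" if "?Inv x n s'" for x s'
          using that D by (auto simp: less_Suc_eq)
        show "?Inv x k s2" if "?Inv x k s1" "keeps (v ` {25, 26, 27, 28, 29}) s1 s2" for x k s1 s2
        proof -
          have "s2 (v 0) = s1 (v 0)" "s2 (v 1) = s1 (v 1)" using that(2) by auto
          then show ?thesis using that(1) by simp
        qed
      next
        fix x k s' assume x: "x < n" "k < n" "s' (v 25) 0 = int x" "s' (v 26) 0 = int k"
          "s' (v 29) 0 = g (int x) (int k)" "stored n g s'" "listed n g x k s'" and ok': "ok W s'"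
          and I: "?Inv x k s'"
        let ?c = "g (int x) (int k)" let ?l = "length (nbrs g x ?c k)"
        have l: "s' (v 27) ?c = int ?l" "\<And>i. i < ?l \<Longrightarrow> s' (v 28) (?c * int n + int i) = int (nbrs g x ?c k ! i)"
          using x by (auto simp: listed_def)
        have cW: "?c \<le> W" "0 \<le> ?c" "?c * int n + int (D - 1) \<le> W"
        proof -
          have "?c * int n \<le> (int M + 2) * int n" using gs(1)[of "int x" "int k"] by (intro mult_right_mono) auto
          then show "?c * int n + int (D - 1) \<le> W" using Wn(4) by linarith
        qed (use gs(1)[of "int x" "int k"] Wn in linarith)+
        \<comment> \<open>Column \<open>k\<close> lengthens the list of one colour by one vertex, so
          a list can newly reach the length \<open>D\<close> only if it had length
          \<open>D - 1\<close>.\<close>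
        have other: "(\<exists>c. c \<noteq> 0 \<and> D \<le> length (nbrs g x c (Suc k))) \<longleftrightarrow>
            (\<exists>c. c \<noteq> 0 \<and> D \<le> length (nbrs g x c k)) \<or> (?c \<noteq> 0 \<and> D = Suc ?l)"
          by (auto simp: nbrs_Suc le_Suc_eq)
        let ?E = "Op Times (Op Less (Const 0) (Var (v 29)))
          (Op Times (Op Less count_at (Const (int D))) (Op Less (Const (int D - 2)) count_at))"
        let ?p = "0 < ?c \<and> int ?l < int D \<and> int D - 2 < int ?l"
        have cnt: "ev W s' count_at (int ?l)"
          using ev_Read[OF ok' ev_Var[OF ok' x(5)], of "v 27"] l(1) by simp
        have E: "ev W s' ?E (of_bool ?p)"
          using ok' cnt x(5) Wn D by (intro ev_And ev_Less ev_Const ev_Var) auto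
        have p: "?p \<longleftrightarrow> ?c \<noteq> 0 \<and> D = Suc ?l" using cW(2) by auto
        have "wp W (star_act D) (?Inv x (Suc k)) s'"
          unfolding star_act_def wp.simps(4)
        proof (intro conjI impI)
          show "fits W s' ?E" using E by (simp add: ev_def)
          assume "val s' ?E \<noteq> 0"
          then have pp: "?c \<noteq> 0" "D = Suc ?l" using E p by (auto simp: ev_def simp del: val.simps)
          let ?s0 = "upd s' (v 1) 0 (int x)"
          have ok0: "ok W ?s0" using ok' x(1) Wn(7) by auto
          have "wp W (grab (D - 1)) (wp W (Seq (Write (v 1) (Const (int D)) (Var (v 26))) (Set (v 0) (Const 1))) (?Inv x (Suc k))) ?s0"
          proof (rule wp_grab[where c = ?c and n = n])
            fix s2 assume 2: "ok W s2" "keeps {v 1} ?s0 s2" "s2 (v 1) 0 = ?s0 (v 1) 0"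
              "\<forall>i<D - 1. s2 (v 1) (int (Suc i)) = ?s0 (v 28) (?c * int n + int i)"
            let ?s3 = "upd (upd s2 (v 1) (int D) (int k)) (v 0) 0 1"
            have "embedding n g (Suc D) es (\<lambda>i. ?s3 (v 1) (int i)) ?c"
              by (rule star_embedding[where x = x and k = k and g = g])
                (use D es gs x pp 2 l(2) in auto)
            then have "?Inv x (Suc k) ?s3" by auto
            moreover have "s2 (v 26) 0 = int k" using 2(2) x(4) by simp
            ultimately show "wp W (Seq (Write (v 1) (Const (int D)) (Var (v 26))) (Set (v 0) (Const 1))) (?Inv x (Suc k)) s2"
              using x(2) Wn by (simp del: upd_apply)
          qed (use ok0 x Wn cW D in \<open>auto simp: stored_def\<close>)
          then show "wp W (Seq (Write (v 1) (Const 0) (Var (v 25))) (Seq (grab (D - 1))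
              (Seq (Write (v 1) (Const (int D)) (Var (v 26))) (Set (v 0) (Const 1))))) (?Inv x (Suc k)) s'"
            using x(1,3) Wn by (simp del: upd_apply)
        next
          assume "val s' ?E = 0"
          then have "\<not> (?c \<noteq> 0 \<and> D = Suc ?l)" using E p by (auto simp: ev_def simp del: val.simps)
          then show "wp W Skip (?Inv x (Suc k)) s'"
            using I unfolding wp.simps(1) other by blast
        qed
        then show "run W (star_act D) s' (real (tmax (star_act D))) (?Inv x (Suc k))"
          by (rule run_wp)
      qed (use 1 Wn gs in auto)
    qed
    then show ?thesis
    proof (rule run_mono)
      fix s' assume I: "?Inv n 0 s'"
      show "?Q s'"
      proof (cases "\<exists>f k. embedding n g (Suc D) es f k")
        case True
        then obtain f c where "embedding n g (Suc D) es f c" by blast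
        from star_degree[OF D es this] have "s' (v 0) 0 = 1" using conjunct2[OF I] by blast
        moreover from this conjunct1[OF I] have "\<exists>c. embedding n g (Suc D) es (\<lambda>i. s' (v 1) (int i)) c" by simp
        ultimately show ?thesis unfolding if_P[OF True] by (rule conjI)
      next
        case False
        then have "s' (v 0) 0 = 0" using conjunct1[OF I] by blast
        then show ?thesis unfolding if_not_P[OF False] .
      qed
    qed (use ok in \<open>auto simp: algebra_simps powr_numeral\<close>)
  qed
  then show ?thesis unfolding detects_def by blast
qed

end

section \<open>Searching a partitioned vertex set\<close>

text \<open>\<open>Less\<close> is the only comparison of the machine. Conditions are 0-1 integers
  and conjunction is multiplication, which evaluates both factors whatever the first one
  gives.\<close>

definition eq_expr :: "expr \<Rightarrow> expr \<Rightarrow> expr" where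
  "eq_expr a b = Op Times (Op Minus (Const 1) (Op Less a b)) (Op Minus (Const 1) (Op Less b a))"

definition conj_expr :: "expr list \<Rightarrow> expr" where
  "conj_expr es = foldr (Op Times) es (Const 1)"

lemma ev_not: "ev W s a (of_bool p) \<Longrightarrow> 1 \<le> W \<Longrightarrow> ev W s (Op Minus (Const 1) a) (of_bool (\<not> p))"
  by (rule ev_Op[where a = 1 and b = "of_bool p"]) (auto simp: ev_Const)

lemma ev_eq:
  assumes "ev W s a x" "ev W s b y" "1 \<le> W"
  shows "ev W s (eq_expr a b) (of_bool (x = y))"
proof -
  have "ev W s (eq_expr a b) (of_bool (\<not> x < y \<and> \<not> y < x))"
    unfolding eq_expr_def using assms by (intro ev_And ev_not ev_Less)
  moreover have "(\<not> x < y \<and> \<not> y < x) = (x = y)" by auto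
  ultimately show ?thesis by simp
qed

lemma ev_conj_map:
  assumes "\<And>a. a \<in> set as \<Longrightarrow> ev W s (f a) (of_bool (p a))" "1 \<le> W"
  shows "ev W s (conj_expr (map f as)) (of_bool (\<forall>a\<in>set as. p a))"
  using assms(1)
proof (induction as)
  case Nil
  then show ?case using assms(2) by (simp add: conj_expr_def ev_Const)
next
  case (Cons a as)
  then have "ev W s (Op Times (f a) (conj_expr (map f as))) (of_bool (p a \<and> (\<forall>a\<in>set as. p a)))"
    using assms(2) by (intro ev_And) auto
  then show ?case by (simp add: conj_expr_def)
qed

text \<open>A tuple over \<open>{0..<n}\<close> is coded as the integer of which it lists the base-\<open>n\<close> digits.\<close>

lemma digits_exist:
  assumes "\<And>i. i < k \<Longrightarrow> f i < n"
  shows "\<exists>x<n ^ k. \<forall>i<k. x div n ^ i mod n = (f i :: nat)"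
  using assms
proof (induction k)
  case (Suc k)
  then obtain x where x: "x < n ^ k" "\<forall>i<k. x div n ^ i mod n = f i" by fastforce
  have n: "0 < n" using Suc.prems[of 0] by auto
  let ?y = "x + f k * n ^ k"
  have fk: "f k < n" using Suc.prems by simp
  have "?y < n ^ k + f k * n ^ k" using x(1) by simp
  also have "\<dots> = Suc (f k) * n ^ k" by simp
  also have "\<dots> \<le> n * n ^ k" using fk by (intro mult_right_mono) auto
  finally have "?y < n ^ Suc k" by simp
  moreover have "?y div n ^ i mod n = f i" if "i < Suc k" for i
  proof (cases "i = k")
    case True
    then show ?thesis using x(1) fk n by simp
  next
    case False
    then have i: "i < k" using that by simp
    then have "n ^ k = n ^ i * n ^ (k - i)" by (simp flip: power_add)
    then have "?y = x + (f k * n ^ (k - i)) * n ^ i" by (simp only: ac_simps)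
    moreover have "(x + (f k * n ^ (k - i)) * n ^ i) div n ^ i = f k * n ^ (k - i) + x div n ^ i"
      using n by (intro div_mult_self1) simp
    ultimately have "?y div n ^ i = x div n ^ i + f k * n ^ (k - i)" by (simp only: add.commute)
    also have "n ^ (k - i) = n * n ^ (k - i - 1)" using power_Suc[of n "k - i - 1"] i by (simp only: Suc_diff_Suc[of "i" k, symmetric] diff_Suc_1)
    finally have "?y div n ^ i = x div n ^ i + (f k * n ^ (k - i - 1)) * n" by simp
    then show ?thesis using x(2) i by simp
  qed
  ultimately show ?case by blast
qed auto

text \<open>Because of the reduction modulo \<open>n\<close>, every integer codes a tuple of
  vertices, even a negative or an overly large one. Tests applied to meaningless cells therefore
  still read inside the matrix.\<close>

definition digit :: "nat \<Rightarrow> int \<times> nat \<Rightarrow> int" where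
  "digit n = (\<lambda>(x, i). x div int n ^ i mod int n)"

lemma digit_range: "0 < n \<Longrightarrow> 0 \<le> digit n p \<and> digit n p < int n"
  by (simp add: digit_def case_prod_beta)

primrec npow :: "(nat \<Rightarrow> string) \<Rightarrow> nat \<Rightarrow> expr" where
  "npow v 0 = Const 1"
| "npow v (Suc i) = Op Times (npow v i) (Var (v 2))"

definition digit_expr :: "(nat \<Rightarrow> string) \<Rightarrow> expr \<times> nat \<Rightarrow> expr" where
  "digit_expr v = (\<lambda>(e, i). Op Remainder (Op Quotient e (npow v i)) (Var (v 2)))"

lemma ev_npow:
  assumes "ok W s" "s (v 2) 0 = int n" "\<And>i. i \<le> k \<Longrightarrow> int n ^ i \<le> W"
  shows "ev W s (npow v k) (int n ^ k)"
  using assms(3)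
proof (induction k)
  case 0
  then show ?case using 0[of 0] by (simp add: ev_Const)
next
  case (Suc k)
  then show ?case
    using Suc.prems[of "Suc k"] assms(1,2)
    by (auto intro!: ev_Op[where a = "int n ^ k" and b = "int n"] ev_Var simp: mult.commute)
qed

text \<open>Dividing by a positive integer does not increase the absolute value, not even when a
  negative quotient is rounded down. So arbitrary cell contents of word size stay within a
  word.\<close>

lemma ev_digit:
  assumes "ok W s" "s (v 2) 0 = int n" "\<And>i'. i' \<le> i \<Longrightarrow> int n ^ i' \<le> W" "0 < n" "ev W s e x" "int n \<le> W"
  shows "ev W s (digit_expr v (e, i)) (digit n (x, i))"
proof -
  have x: "\<bar>x\<bar> \<le> W" using assms(1,5) fits_val[of W s e] by (auto simp: ev_def)
  have p: "0 < int n ^ i" using assms(4) by simp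
  have "\<bar>x div int n ^ i\<bar> \<le> \<bar>x\<bar>"
  proof (cases "0 \<le> x")
    case True
    then show ?thesis using zdiv_mono2[of x 1 "int n ^ i"] p by (simp add: pos_imp_zdiv_nonneg_iff)
  next
    case False
    then show ?thesis
      using zdiv_mono2_neg[of x 1 "int n ^ i"] div_nonpos_pos_le0[of x "int n ^ i"] p by simp
  qed
  then show ?thesis
    unfolding digit_expr_def digit_def prod.case using assms x
    by (intro ev_Op[where a = "x div int n ^ i" and b = "int n"] ev_Op[where a = x and b = "int n ^ i"] ev_npow ev_Var)
      (auto simp: abs_mod_less dest: digit_range[of n "(x, i)"] simp: digit_def)
qed

text \<open>Sends an index of a vertex of \<open>H\<close> to the code of its part and the place
  within that part. It is polymorphic so as to serve both for the codes and for the expressions that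
  compute them.\<close>

definition pos :: "nat \<Rightarrow> nat \<Rightarrow> 'a \<Rightarrow> 'a \<Rightarrow> 'a \<Rightarrow> 'a \<Rightarrow> nat \<Rightarrow> 'a \<times> nat" where
  "pos j k w x y z a = (if a < j then (w, a) else if a < j + k then (x, a - j)
     else if a < j + 2 * k then (y, a - j - k) else (z, a - j - 2 * k))"

text \<open>
  The vertices of \<open>H\<close> are split into a part of size \<open>j\<close>, which is searched exhaustively, and three
  parts of size \<open>k\<close>.  The vertices of the first part and either of the first two parts of size \<open>k\<close>
  span an edge, so their images determine the colour.
\<close>

locale partitioned = mm_program +
  fixes j k :: nat and es :: "(nat \<times> nat) list" and a1 b1 a2 b2 :: nat
  assumes es_less: "\<And>a b. (a, b) \<in> set es \<Longrightarrow> a < j + 3 * k \<and> b < j + 3 * k"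
    and edge1: "(a1, b1) \<in> set es" "a1 < j + k" "b1 < j + k"
    and edge2: "(a2, b2) \<in> set es" "a2 < j \<or> j + k \<le> a2 \<and> a2 < j + 2 * k" "b2 < j \<or> j + k \<le> b2 \<and> b2 < j + 2 * k"
    and exponent: "2 \<le> \<omega> * real k + real j"
begin

text \<open>All five sets contain the part of size \<open>j\<close>. Any two indices lie together in
  \<open>S12\<close>, \<open>S13\<close> or \<open>S23\<close>; hence three tests, each blind to one
  long part, check every edge and the distinctness of every pair of images. This is what makes the
  search one for triangles.\<close>

definition S1 :: "nat set" where "S1 = {..<j + k}"
definition S2 :: "nat set" where "S2 = {..<j} \<union> {j + k..<j + 2 * k}"
definition S12 :: "nat set" where "S12 = {..<j + 2 * k}"
definition S13 :: "nat set" where "S13 = {..<j + k} \<union> {j + 2 * k..<j + 3 * k}"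
definition S23 :: "nat set" where "S23 = {..<j} \<union> {j + k..<j + 3 * k}"

lemmas S_defs = S1_def S2_def S12_def S13_def S23_def

abbreviation image_of :: "nat \<Rightarrow> int \<Rightarrow> int \<Rightarrow> int \<Rightarrow> int \<Rightarrow> nat \<Rightarrow> int" where
  "image_of n w x y z a \<equiv> digit n (pos j k w x y z a)"

definition tst :: "nat \<Rightarrow> (int \<Rightarrow> int \<Rightarrow> int) \<Rightarrow> nat set \<Rightarrow> int \<Rightarrow> int \<Rightarrow> int \<Rightarrow> int \<Rightarrow> int \<Rightarrow> bool" where
  "tst n g I c w x y z \<longleftrightarrow>
     (\<forall>(a, b)\<in>set es. a \<in> I \<and> b \<in> I \<longrightarrow> g (image_of n w x y z a) (image_of n w x y z b) = c) \<and>
     (\<forall>a\<in>I. \<forall>b\<in>I. a < b \<longrightarrow> image_of n w x y z a \<noteq> image_of n w x y z b)"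

definition vertex_expr :: "expr \<Rightarrow> expr \<Rightarrow> expr \<Rightarrow> expr \<Rightarrow> nat \<Rightarrow> expr" where
  "vertex_expr w x y z a = digit_expr v (pos j k w x y z a)"

definition colour_expr :: "expr \<Rightarrow> expr \<Rightarrow> expr \<Rightarrow> expr \<Rightarrow> nat \<times> nat \<Rightarrow> expr" where
  "colour_expr w x y z = (\<lambda>(a, b). Read (v 3)
     (Op Plus (Op Times (vertex_expr w x y z a) (Var (v 2))) (vertex_expr w x y z b)))"

definition test :: "nat set \<Rightarrow> expr \<Rightarrow> expr \<Rightarrow> expr \<Rightarrow> expr \<Rightarrow> expr \<Rightarrow> expr" where
  "test I c w x y z = Op Times
     (conj_expr (map (\<lambda>p. eq_expr (colour_expr w x y z p) c) (filter (\<lambda>(a, b). a \<in> I \<and> b \<in> I) es)))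
     (conj_expr (map (\<lambda>(a, b). Op Minus (Const 1) (eq_expr (vertex_expr w x y z a) (vertex_expr w x y z b)))
       (filter (\<lambda>(a, b). a \<in> I \<and> b \<in> I \<and> a < b) (List.product [0..<j + 3 * k] [0..<j + 3 * k]))))"

definition room :: "int \<Rightarrow> nat \<Rightarrow> state \<Rightarrow> (int \<Rightarrow> int \<Rightarrow> int) \<Rightarrow> bool" where
  "room W n s g \<longleftrightarrow> ok W s \<and> stored n g s \<and> 0 < n \<and> 1 \<le> W \<and> int (n * n) \<le> W \<and> (\<forall>i\<le>j + k. int n ^ i \<le> W)"

lemma ev_vertex:
  assumes "room W n s g" "ev W s ew w" "ev W s ex x" "ev W s ey y" "ev W s ez z" "a < j + 3 * k"
  shows "ev W s (vertex_expr ew ex ey ez a) (image_of n w x y z a)"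
proof -
  have r: "ok W s" "s (v 2) 0 = int n" "0 < n" "\<And>i. i \<le> j + k \<Longrightarrow> int n ^ i \<le> W" "int n \<le> W"
  proof -
    have "n \<le> n * n" by simp
    then show "int n \<le> W" using assms(1) unfolding room_def by linarith
  qed (use assms(1) in \<open>auto simp: room_def stored_def\<close>)
  have dig: "ev W s (digit_expr v (e, i)) (digit n (u, i))" if "ev W s e u" "i \<le> j + k" for e u i
    by (rule ev_digit) (use that r in auto)
  show ?thesis
    unfolding vertex_expr_def pos_def using assms(2-6) by (auto intro!: dig)
qed

lemma ev_colour:
  assumes "room W n s g" "ev W s ew w" "ev W s ex x" "ev W s ey y" "ev W s ez z" "a < j + 3 * k" "b < j + 3 * k"
  shows "ev W s (colour_expr ew ex ey ez (a, b)) (g (image_of n w x y z a) (image_of n w x y z b))"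
proof -
  let ?a = "image_of n w x y z a" let ?b = "image_of n w x y z b"
  have r: "ok W s" "s (v 2) 0 = int n" "0 < n" "int (n * n) \<le> W" "stored n g s"
    using assms(1) by (auto simp: room_def stored_def)
  define a' b' where "a' = nat ?a" and "b' = nat ?b"
  have ab: "?a = int a'" "?b = int b'" "a' < n" "b' < n"
    using digit_range[OF r(3), of "pos j k w x y z a"] digit_range[OF r(3), of "pos j k w x y z b"]
    by (simp_all add: a'_def b'_def nat_less_iff)
  have a: "ev W s (vertex_expr ew ex ey ez a) (int a')" and b: "ev W s (vertex_expr ew ex ey ez b) (int b')"
    using ev_vertex[OF assms(1-5) assms(6)] ev_vertex[OF assms(1-5) assms(7)] ab(1,2) by simp_all
  have "int (a' * n + b') \<le> W" using row_major_less[OF ab(3,4)] r(4) by linarith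
  then have "\<bar>int a' * int n\<bar> \<le> W" "\<bar>int (a' * n) + int b'\<bar> \<le> W" by (simp_all add: abs_of_nonneg)
  then have "ev W s (Op Plus (Op Times (vertex_expr ew ex ey ez a) (Var (v 2))) (vertex_expr ew ex ey ez b)) (int (a' * n + b'))"
    by (intro ev_Op[where a = "int (a' * n)" and b = "int b'"] ev_Op[where a = "int a'" and b = "int n"] a b ev_Var r) auto
  from ev_Read[OF r(1) this, of "v 3"] show ?thesis
    using r(5) ab by (simp add: colour_expr_def stored_def)
qed

lemma ev_test:
  assumes "room W n s g" "ev W s ew w" "ev W s ex x" "ev W s ey y" "ev W s ez z" "ev W s ec c"
    and I: "I \<subseteq> {..<j + 3 * k}"
  shows "ev W s (test I ec ew ex ey ez) (of_bool (tst n g I c w x y z))"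
proof -
  have W: "1 \<le> W" using assms(1) by (simp add: room_def)
  let ?D = "image_of n w x y z"
  let ?es = "filter (\<lambda>(a, b). a \<in> I \<and> b \<in> I) es"
  let ?ps = "filter (\<lambda>(a, b). a \<in> I \<and> b \<in> I \<and> a < b) (List.product [0..<j + 3 * k] [0..<j + 3 * k])"
  have "ev W s (test I ec ew ex ey ez)
     (of_bool ((\<forall>p\<in>set ?es. g (?D (fst p)) (?D (snd p)) = c) \<and> (\<forall>p\<in>set ?ps. ?D (fst p) \<noteq> ?D (snd p))))"
    unfolding test_def
  proof (intro ev_And ev_conj_map W)
    fix p assume "p \<in> set ?es"
    then have "fst p < j + 3 * k" "snd p < j + 3 * k" using I by auto
    from ev_eq[OF ev_colour[OF assms(1-5) this] assms(6) W]
    show "ev W s (eq_expr (colour_expr ew ex ey ez p) ec) (of_bool (g (?D (fst p)) (?D (snd p)) = c))"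
      by simp
  next
    fix p assume "p \<in> set ?ps"
    then have "fst p < j + 3 * k" "snd p < j + 3 * k" by auto
    from ev_not[OF ev_eq[OF ev_vertex[OF assms(1-5) this(1)] ev_vertex[OF assms(1-5) this(2)] W] W]
    show "ev W s (case p of (a, b) \<Rightarrow> Op Minus (Const 1) (eq_expr (vertex_expr ew ex ey ez a) (vertex_expr ew ex ey ez b)))
       (of_bool (?D (fst p) \<noteq> ?D (snd p)))"
      by (simp add: case_prod_beta)
  qed
  moreover have "(\<forall>p\<in>set ?es. g (?D (fst p)) (?D (snd p)) = c) \<longleftrightarrow>
      (\<forall>(a, b)\<in>set es. a \<in> I \<and> b \<in> I \<longrightarrow> g (?D a) (?D b) = c)"
    by auto
  moreover have "(\<forall>p\<in>set ?ps. ?D (fst p) \<noteq> ?D (snd p)) \<longleftrightarrow> (\<forall>a\<in>I. \<forall>b\<in>I. a < b \<longrightarrow> ?D a \<noteq> ?D b)"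
    using I by (auto simp: subset_iff)
  ultimately show ?thesis by (simp only: tst_def)
qed

lemma tst_cong:
  assumes "\<And>a. a \<in> I \<Longrightarrow> image_of n w x y z a = image_of n w' x' y' z' a"
  shows "tst n g I c w x y z = tst n g I c w' x' y' z'"
  unfolding tst_def by (intro conj_cong ball_cong refl) (simp_all add: assms case_prod_beta)

lemma tst_edge:
  "tst n g I c w x y z \<Longrightarrow> (a, b) \<in> set es \<Longrightarrow> a \<in> I \<Longrightarrow> b \<in> I \<Longrightarrow>
    g (image_of n w x y z a) (image_of n w x y z b) = c"
  unfolding tst_def by (drule conjunct1, drule (1) bspec) simp

lemma tst_distinct:
  "tst n g I c w x y z \<Longrightarrow> a \<in> I \<Longrightarrow> b \<in> I \<Longrightarrow> a < b \<Longrightarrow> image_of n w x y z a \<noteq> image_of n w x y z b"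
  unfolding tst_def by blast

lemma tst_mono:
  assumes "tst n g I c w x y z" "J \<subseteq> I"
  shows "tst n g J c w x y z"
  unfolding tst_def
proof (intro conjI ballI impI)
  fix p assume "p \<in> set es"
  then show "case p of (a, b) \<Rightarrow> a \<in> J \<and> b \<in> J \<longrightarrow> g (image_of n w x y z a) (image_of n w x y z b) = c"
    using tst_edge[OF assms(1), of "fst p" "snd p"] assms(2) by (auto simp: case_prod_beta subset_iff)
qed (use tst_distinct[OF assms(1)] assms(2) in blast)

lemma pos_irrelevant:
  "a \<in> S1 \<Longrightarrow> pos j k w x y z a = pos j k w x y' z' a"
  "a \<in> S2 \<Longrightarrow> pos j k w x y z a = pos j k w x' y z' a"
  "a \<in> S12 \<Longrightarrow> pos j k w x y z a = pos j k w x y z' a"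
  "a \<in> S13 \<Longrightarrow> pos j k w x y z a = pos j k w x y' z a"
  "a \<in> S23 \<Longrightarrow> pos j k w x y z a = pos j k w x' y z a"
  unfolding pos_def S_defs by auto

text \<open>Each set omits one or two of the long parts, so the codes of these parts can be
  replaced. The programs fill the gaps with \<open>0\<close> or with a repeated code.\<close>

lemma tst_irrelevant:
  "tst n g S1 c w x y z = tst n g S1 c w x y' z'"
  "tst n g S2 c w x y z = tst n g S2 c w x' y z'"
  "tst n g S12 c w x y z = tst n g S12 c w x y z'"
  "tst n g S13 c w x y z = tst n g S13 c w x y' z"
  "tst n g S23 c w x y z = tst n g S23 c w x' y z"
  by (rule tst_cong, rule arg_cong[where f = "digit n"], erule pos_irrelevant)+

definition sol :: "nat \<Rightarrow> (int \<Rightarrow> int \<Rightarrow> int) \<Rightarrow> int \<Rightarrow> int \<Rightarrow> int \<Rightarrow> int \<Rightarrow> int \<Rightarrow> bool" where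
  "sol n g w c x y z \<longleftrightarrow> 0 < c \<and> tst n g S12 c w x y z \<and> tst n g S13 c w x y z \<and> tst n g S23 c w x y z"

text \<open>Both ends of the edge lie in \<open>S1\<close>, so only \<open>w\<close> and
  \<open>x\<close> matter; the repeated \<open>x\<close> fills the other places.\<close>

definition col1 :: "nat \<Rightarrow> (int \<Rightarrow> int \<Rightarrow> int) \<Rightarrow> int \<Rightarrow> int \<Rightarrow> int" where
  "col1 n g w x = g (image_of n w x x x a1) (image_of n w x x x b1)"

definition col2 :: "nat \<Rightarrow> (int \<Rightarrow> int \<Rightarrow> int) \<Rightarrow> int \<Rightarrow> int \<Rightarrow> int" where
  "col2 n g w y = g (image_of n w y y y a2) (image_of n w y y y b2)"

text \<open>The fact behind the time bound: for fixed \<open>w\<close> a code passes the test in at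
  most one colour, so the lists of different colours are disjoint.\<close>

lemma tst_col1: "tst n g S1 c w x x x \<Longrightarrow> col1 n g w x = c"
  unfolding col1_def by (erule tst_edge[OF _ edge1(1)]) (use edge1 in \<open>auto simp: S_defs\<close>)

lemma tst_col2: "tst n g S2 c w x x x \<Longrightarrow> col2 n g w x = c"
  unfolding col2_def by (erule tst_edge[OF _ edge2(1)]) (use edge2 in \<open>auto simp: S_defs\<close>)

lemma sol_parts:
  assumes "sol n g w c x y z"
  shows "tst n g S1 c w x x x" "tst n g S2 c w y y y"
proof -
  have 12: "tst n g S12 c w x y z" using assms by (simp add: sol_def)
  have sub: "S1 \<subseteq> S12" "S2 \<subseteq> S12" by (auto simp: S_defs)
  show "tst n g S1 c w x x x"
    using tst_mono[OF 12 sub(1)] tst_irrelevant(1)[of n g c w x y z x x] by simp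
  show "tst n g S2 c w y y y"
    using tst_mono[OF 12 sub(2)] tst_irrelevant(2)[of n g c w x y z y y] by simp
qed

lemma sol_embedding:
  assumes "0 < n" "sol n g w c x y z"
  shows "embedding n g (j + 3 * k) es (image_of n w x y z) c"
proof -
  let ?D = "image_of n w x y z"
  have t: "tst n g S12 c w x y z" "tst n g S13 c w x y z" "tst n g S23 c w x y z" "c \<noteq> 0"
    using assms(2) by (auto simp: sol_def)
  have cover: "\<exists>I. a \<in> I \<and> b \<in> I \<and> tst n g I c w x y z" if "a < j + 3 * k" "b < j + 3 * k" for a b
  proof -
    have "a \<in> S12 \<and> b \<in> S12 \<or> a \<in> S13 \<and> b \<in> S13 \<or> a \<in> S23 \<and> b \<in> S23"
      using that by (auto simp: S_defs)
    then show ?thesis using t(1-3) by blast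
  qed
  have ne: "?D a \<noteq> ?D b" if "a < b" "b < j + 3 * k" for a b
    using cover[of a b] that tst_distinct by fastforce
  have "inj_on ?D {..<j + 3 * k}"
  proof (rule inj_onI)
    fix a b assume "a \<in> {..<j + 3 * k}" "b \<in> {..<j + 3 * k}" "?D a = ?D b"
    then show "a = b" using ne[of a b] ne[of b a] by (cases a b rule: linorder_cases) auto
  qed
  moreover have "g (?D a) (?D b) = c" if "(a, b) \<in> set es" for a b
    using cover[of a b] es_less[OF that] tst_edge[OF _ that] by blast
  moreover have "?D a \<in> {0..<int n}" for a
    using digit_range[OF assms(1), of "pos j k w x y z a"] by simp
  ultimately show ?thesis
    using t(4) by (auto simp: embedding_def)
qed

lemma embedding_sol:
  assumes "\<And>x y. 0 \<le> g x y" "embedding n g (j + 3 * k) es f c"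
  shows "\<exists>w<n ^ j. \<exists>x<n ^ k. \<exists>y<n ^ k. \<exists>z<n ^ k. sol n g (int w) c (int x) (int y) (int z)"
proof -
  have f: "c \<noteq> 0" "\<And>a. a < j + 3 * k \<Longrightarrow> 0 \<le> f a \<and> f a < int n" "inj_on f {..<j + 3 * k}"
    "\<And>a b. (a, b) \<in> set es \<Longrightarrow> g (f a) (f b) = c"
    using assms(2) by (auto simp: embedding_def image_subset_iff)
  have ex: "\<exists>x<n ^ l. \<forall>i<l. x div n ^ i mod n = nat (f (b + i))" if "b + l \<le> j + 3 * k" for b l
    by (rule digits_exist) (use f(2) that in \<open>auto simp: nat_less_iff\<close>)
  obtain w where w: "w < n ^ j" "\<And>i. i < j \<Longrightarrow> w div n ^ i mod n = nat (f (0 + i))" using ex[of 0 j] by auto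
  obtain x where x: "x < n ^ k" "\<And>i. i < k \<Longrightarrow> x div n ^ i mod n = nat (f (j + i))" using ex[of j k] by auto
  obtain y where y: "y < n ^ k" "\<And>i. i < k \<Longrightarrow> y div n ^ i mod n = nat (f (j + k + i))" using ex[of "j + k" k] by auto
  obtain z where z: "z < n ^ k" "\<And>i. i < k \<Longrightarrow> z div n ^ i mod n = nat (f (j + 2 * k + i))" using ex[of "j + 2 * k" k] by auto
  have dig: "digit n (int u, i) = int (u div n ^ i mod n)" for u i
    by (simp add: digit_def of_nat_mod of_nat_div)
  have D: "image_of n (int w) (int x) (int y) (int z) a = f a" if "a < j + 3 * k" for a
  proof -
    consider "a < j" | "j \<le> a" "a < j + k" | "j + k \<le> a" "a < j + 2 * k" | "j + 2 * k \<le> a" by linarith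
    then show ?thesis
    proof cases
      case 1
      then show ?thesis using w(2)[of a] f(2)[OF that] by (simp add: pos_def dig)
    next
      case 2
      then show ?thesis using x(2)[of "a - j"] f(2)[OF that] by (simp add: pos_def dig)
    next
      case 3
      then show ?thesis using y(2)[of "a - j - k"] f(2)[OF that] by (simp add: pos_def dig)
    next
      case 4
      then have "a - j - 2 * k < k" "j + 2 * k + (a - j - 2 * k) = a" using that by auto
      then show ?thesis using 4 z(2)[of "a - j - 2 * k"] f(2)[OF that] by (simp add: pos_def dig)
    qed
  qed
  have tst: "tst n g I c (int w) (int x) (int y) (int z)" if "I \<subseteq> {..<j + 3 * k}" for I
  proof -
    have "f a \<noteq> f b" if "a \<in> I" "b \<in> I" "a < b" for a b
      using that \<open>I \<subseteq> _\<close> inj_onD[OF f(3), of a b] by auto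
    then show ?thesis unfolding tst_def using D f(4) that by (auto simp: subset_iff)
  qed
  have "0 \<le> c" using assms(1) f(4)[OF edge1(1)] by metis
  then have "sol n g (int w) c (int x) (int y) (int z)"
    using f(1) by (auto simp: sol_def S_defs intro!: tst)
  then show ?thesis using w(1) x(1) y(1) z(1) by blast
qed

end

section \<open>Collecting colour classes and multiplying their matrices\<close>

context mm_program
begin

definition collect :: "nat \<Rightarrow> nat \<Rightarrow> expr \<Rightarrow> com" where
  "collect L p t = Seq (Set (v p) (Const 0)) (For (v 23) (Var (v 21)) (Cond t
     (Seq (Write (v L) (Var (v p)) (Var (v 23))) (Set (v p) (Op Plus (Var (v p)) (Const 1)))) Skip))"

lemma writes_collect [simp]: "writes (collect L p t) = {v p, v 23, v L}"
  by (auto simp: collect_def)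

lemma run_collect:
  assumes "ok W s" "1 \<le> W" "int N \<le> W" "s (v 21) 0 = int N" "L \<noteq> p" "p \<notin> {21, 23}" "L \<notin> {21, 23}"
    and t: "\<And>s' i. ok W s' \<Longrightarrow> keeps {v 23, v p, v L} s s' \<Longrightarrow> i < N \<Longrightarrow> s' (v 23) 0 = int i \<Longrightarrow>
      ev W s' t (of_bool (Q i))"
  shows "run W (collect L p t) s ((real N + 1) * (40 + real (cost t)))
    (\<lambda>s'. s' (v p) 0 = int (length (filter Q [0..<N])) \<and>
      (\<forall>i<length (filter Q [0..<N]). s' (v L) (int i) = int (filter Q [0..<N] ! i)))"
proof -
  let ?B = "Cond t (Seq (Write (v L) (Var (v p)) (Var (v 23))) (Set (v p) (Op Plus (Var (v p)) (Const 1)))) Skip"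
  let ?I = "\<lambda>k s'. s' (v p) 0 = int (length (filter Q [0..<k])) \<and>
      (\<forall>i<length (filter Q [0..<k]). s' (v L) (int i) = int (filter Q [0..<k] ! i))"
  have "run W (collect L p t) s (3 + real (N + 1) * (real (tmax ?B) + 10 + real (cost (Var (v 21))))) (?I N)"
    unfolding collect_def
  proof (rule run_Seq)
    show "run W (Set (v p) (Const 0)) s 3 (\<lambda>s'. s' (v p) 0 = 0)"
      by (rule run_mono[OF run_Write[where a = 0 and b = 0 and Q = "\<lambda>s'. s' (v p) 0 = 0"]])
        (use assms in \<open>auto simp: ev_Const\<close>)
    fix s1 assume 1: "s1 (v p) 0 = 0" "ok W s1" "keeps (writes (Set (v p) (Const 0))) s s1"
    have N1: "s1 (v 21) 0 = int N" using 1(3) assms(4,6) by auto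
    show "run W (For (v 23) (Var (v 21)) ?B) s1 (real (N + 1) * (real (tmax ?B) + 10 + real (cost (Var (v 21))))) (?I N)"
    proof (rule run_For_const[where I = ?I])
      fix k s2 assume 2: "k < N" "ok W s2" "keeps (insert (v 23) (writes ?B)) s1 s2" "s2 (v 23) 0 = int k" "?I k s2"
      have "keeps {v 23, v p, v L} s s2" using 1(3) 2(3) by auto
      from t[OF 2(2) this 2(1,4)] have t2: "fits W s2 t" "val s2 t = of_bool (Q k)" by (auto simp: ev_def)
      let ?l = "length (filter Q [0..<k])"
      have "?l \<le> k" using length_filter_le[of Q "[0..<k]"] by simp
      then have l: "\<bar>int ?l\<bar> \<le> W" "\<bar>int ?l + 1\<bar> \<le> W" "\<bar>int k\<bar> \<le> W" using 2(1) assms(3) by linarith+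
      have "wp W ?B (\<lambda>s''. ?I (Suc k) (upd s'' (v 23) 0 (int (Suc k)))) s2"
        using t2 2(4,5) l assms(2,5-7) by (auto simp: nth_append less_Suc_eq)
      then show "run W ?B s2 (real (tmax ?B)) (\<lambda>s''. ?I (Suc k) (upd s'' (v 23) 0 (int (Suc k))))"
        by (rule run_wp)
    qed (use 1 assms N1 in \<open>auto simp: ev_Var\<close>)
  qed (use assms in auto)
  then show ?thesis
    by (rule run_mono) (use assms(1) in \<open>auto simp: algebra_simps\<close>)
qed

end

lemma (in partitioned) vertices_pos: "0 < j + k"
  using edge1(2) by linarith

context partitioned
begin

definition first_colour :: com where
  "first_colour = Set (v 20) (colour_expr (Var (v 14)) (Var (v 15)) (Var (v 15)) (Var (v 15)) (a1, b1))"

abbreviation me :: expr where "me \<equiv> Op Plus (Var (v 16)) (Var (v 17))"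
abbreviation Xe :: expr where "Xe \<equiv> Read (v 18) (Var (v 4))"
abbreviation Ye :: expr where "Ye \<equiv> Read (v 19) (Var (v 5))"
abbreviation Ze :: expr where "Ze \<equiv> Op Plus (Op Times (Var (v 22)) me) (Var (v 6))"

text \<open>The side of the square is the sum of the two list lengths, so the row index must first
  be compared with the length of its own list. The middle index \<open>v 6\<close> is an offset in
  block number \<open>v 22\<close> of the codes \<open>z\<close>, and the part that the test ignores
  is filled with \<open>0\<close>.\<close>

definition eA :: expr where "eA = Op Times (Op Less (Var (v 4)) (Var (v 16))) (Op Times (Op Less Ze (Var (v 21)))
  (test S13 (Var (v 20)) (Var (v 14)) Xe (Const 0) Ze))"
definition eB :: expr where "eB = Op Times (Op Less (Var (v 5)) (Var (v 17))) (Op Times (Op Less Ze (Var (v 21)))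
  (test S23 (Var (v 20)) (Var (v 14)) (Const 0) Ye Ze))"
definition eC :: expr where "eC = Op Times (Op Less (Var (v 4)) (Var (v 16))) (Op Times (Op Less (Var (v 5)) (Var (v 17)))
  (test S12 (Var (v 20)) (Var (v 14)) Xe Ye (Const 0)))"
text \<open>The code \<open>w\<close> is reported together with \<open>x\<close> because
  \<open>v 14\<close> moves on after a hit while \<open>detect\<close> reports three numbers only.
  For indices beyond the list the array may hold anything; the remainder keeps the value within a
  word.\<close>

definition eX :: expr where "eX = Op Plus (Op Times (Var (v 14)) (Var (v 21))) (Op Remainder Xe (Var (v 21)))"

definition block :: com where "block = detect me eA eB eC eX Ye Ze"

text \<open>The codes \<open>z\<close> are not tied to a colour, so all of them have to be tried
  with every class. Blocks as long as the side of the matrices keep the products square;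
  \<open>N div m + 1\<close> of them cover the range below \<open>N\<close>.\<close>

definition blocks :: com where
  "blocks = For (v 22) (Op Plus (Op Quotient (Var (v 21)) me) (Const 1)) block"

text \<open>All members of a class lead to the same colour and the same lists. The class is treated
  only at its least member, which is the head of the list just collected.\<close>

definition first_expr :: expr where
  "first_expr = Op Times (Op Less (Const 0) (Var (v 20))) (Op Times (Op Less (Const 0) (Var (v 16)))
     (eq_expr (Read (v 18) (Const 0)) (Var (v 15))))"

definition side :: "nat set \<Rightarrow> expr" where
  "side S = test S (Var (v 20)) (Var (v 14)) (Var (v 23)) (Var (v 23)) (Var (v 23))"

definition class_step :: com where
  "class_step = Seq first_colour (Seq (collect 18 16 (side S1)) (Seq (collect 19 17 (side S2))
     (Cond first_expr blocks Skip)))"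

definition fits_word :: "int \<Rightarrow> nat \<Rightarrow> nat \<Rightarrow> bool" where
  "fits_word W n M \<longleftrightarrow> 1 \<le> W \<and> int (n * n) \<le> W \<and> (\<forall>i\<le>j + k. int n ^ i \<le> W) \<and> int M + 2 \<le> W \<and>
     (int (2 * n ^ k) + 3) ^ d\<^sub>0 \<le> W \<and> int (2 * n ^ k * (2 * n ^ k)) \<le> W \<and> int (3 * n ^ k) \<le> W \<and>
     int (n ^ j * n ^ k) \<le> W \<and> int (j + 3 * k) \<le> W"

definition found_at :: "nat \<Rightarrow> (int \<Rightarrow> int \<Rightarrow> int) \<Rightarrow> state \<Rightarrow> bool" where
  "found_at n g s \<longleftrightarrow> (\<exists>w<n ^ j. \<exists>x<n ^ k. \<exists>y<n ^ k. \<exists>z<n ^ k. \<exists>c. sol n g (int w) c (int x) (int y) (int z) \<and>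
     s (v 11) 0 = int (w * n ^ k + x) \<and> s (v 12) 0 = int y \<and> s (v 13) 0 = int z)"

text \<open>The proposition \<open>C\<close> says that the part of the search space examined so far
  contains a solution. It grows along the loops, whereas the soundness of a reported solution is
  required throughout.\<close>

definition Inv :: "nat \<Rightarrow> (int \<Rightarrow> int \<Rightarrow> int) \<Rightarrow> bool \<Rightarrow> state \<Rightarrow> bool" where
  "Inv n g C s \<longleftrightarrow> (s (v 0) 0 = 0 \<or> s (v 0) 0 = 1 \<and> found_at n g s) \<and> (C \<longrightarrow> s (v 0) 0 = 1)"

lemma Inv_keeps: "Inv n g C s \<Longrightarrow> keeps X s s' \<Longrightarrow> X \<inter> v ` {0, 11, 12, 13} = {} \<Longrightarrow> Inv n g C s'"
proof -
  assume a: "Inv n g C s" "keeps X s s'" "X \<inter> v ` {0, 11, 12, 13} = {}"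
  then have "s' (v 0) = s (v 0)" "s' (v 11) = s (v 11)" "s' (v 12) = s (v 12)" "s' (v 13) = s (v 13)" by auto
  then show "Inv n g C s'" using a(1) by (simp add: Inv_def found_at_def)
qed

lemma Inv_mono: "Inv n g C s \<Longrightarrow> (C' \<Longrightarrow> C) \<Longrightarrow> Inv n g C' s"
  by (auto simp: Inv_def)

definition side_list :: "nat \<Rightarrow> (int \<Rightarrow> int \<Rightarrow> int) \<Rightarrow> nat set \<Rightarrow> nat \<Rightarrow> int \<Rightarrow> nat list" where
  "side_list n g S w c = filter (\<lambda>x. tst n g S c (int w) (int x) (int x) (int x)) [0..<n ^ k]"

definition msize :: "nat \<Rightarrow> (int \<Rightarrow> int \<Rightarrow> int) \<Rightarrow> nat \<Rightarrow> int \<Rightarrow> nat" where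
  "msize n g w c = length (side_list n g S1 w c) + length (side_list n g S2 w c)"

lemma length_side_list: "length (side_list n g S w c) \<le> n ^ k"
  using length_filter_le[of _ "[0..<n ^ k]"] by (simp add: side_list_def)

lemma set_side_list: "set (side_list n g S w c) = {x. x < n ^ k \<and> tst n g S c (int w) (int x) (int x) (int x)}"
  by (auto simp: side_list_def)

lemma msize_le: "msize n g w c \<le> 2 * n ^ k"
  unfolding msize_def using length_side_list[of n g S1 w c] length_side_list[of n g S2 w c] by linarith

definition class_state :: "int \<Rightarrow> nat \<Rightarrow> (int \<Rightarrow> int \<Rightarrow> int) \<Rightarrow> nat \<Rightarrow> int \<Rightarrow> state \<Rightarrow> bool" where
  "class_state W n g w c s \<longleftrightarrow> room W n s g \<and> s (v 21) 0 = int (n ^ k) \<and> s (v 14) 0 = int w \<and> s (v 20) 0 = c \<and>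
     s (v 16) 0 = int (length (side_list n g S1 w c)) \<and> s (v 17) 0 = int (length (side_list n g S2 w c)) \<and>
     (\<forall>i<length (side_list n g S1 w c). s (v 18) (int i) = int (side_list n g S1 w c ! i)) \<and>
     (\<forall>i<length (side_list n g S2 w c). s (v 19) (int i) = int (side_list n g S2 w c ! i))"

lemma room_keeps: "room W n s g \<Longrightarrow> ok W s' \<Longrightarrow> keeps X s s' \<Longrightarrow> v 2 \<notin> X \<Longrightarrow> v 3 \<notin> X \<Longrightarrow> room W n s' g"
  unfolding room_def using stored_keeps by blast

lemma class_state_keeps:
  assumes "class_state W n g w c s" "ok W s'" "keeps X s s'" "X \<inter> v ` {2, 3, 14, 16, 17, 18, 19, 20, 21} = {}"
  shows "class_state W n g w c s'"
proof -
  have "s' (v i) = s (v i)" if "i \<in> {2, 3, 14, 16, 17, 18, 19, 20, 21}" for i using assms(3,4) that by auto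
  moreover have "room W n s' g" using assms by (intro room_keeps[of W n s g s' X]) (auto simp: class_state_def)
  ultimately show ?thesis using assms(1) by (simp add: class_state_def)
qed

lemma run_block:
  assumes fw: "fits_word W n M" and cs: "class_state W n g w c s" and c: "0 < c" and w: "w < n ^ j"
    and b: "s (v 22) 0 = int b" "b \<le> n ^ k div msize n g w c" and m: "0 < msize n g w c" and I: "Inv n g C s"
  shows "run W block s (detect_cost me eA eB eC eX Ye Ze * (real (msize n g w c) + 1) powr \<omega>)
    (Inv n g (C \<or> (\<exists>x<n ^ k. \<exists>y<n ^ k. \<exists>z<n ^ k. sol n g (int w) c (int x) (int y) (int z) \<and>
      b * msize n g w c \<le> z \<and> z < Suc b * msize n g w c)))"
proof -
  let ?N = "n ^ k" let ?m = "msize n g w c"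
  let ?xs = "side_list n g S1 w c" let ?ys = "side_list n g S2 w c"
  let ?z = "\<lambda>l. b * ?m + l"
  let ?a = "\<lambda>i l. i < length ?xs \<and> ?z l < ?N \<and> tst n g S13 c (int w) (s (v 18) (int i)) 0 (int (?z l))"
  let ?b = "\<lambda>l y. y < length ?ys \<and> ?z l < ?N \<and> tst n g S23 c (int w) 0 (s (v 19) (int y)) (int (?z l))"
  let ?c = "\<lambda>i y. i < length ?xs \<and> y < length ?ys \<and> tst n g S12 c (int w) (s (v 18) (int i)) (s (v 19) (int y)) 0"
  have room: "room W n s g" and ok: "ok W s" and n0: "0 < n" and W1: "1 \<le> W"
    using cs by (auto simp: class_state_def room_def)
  have N0: "0 < ?N" using n0 by simp
  have m2: "?m \<le> 2 * ?N" by (rule msize_le)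
  have m2': "int ?m \<le> 2 * int n ^ k" "int (length ?xs) + int (length ?ys) \<le> 2 * int n ^ k"
    using of_nat_mono[OF m2, where 'a = int] by (simp_all add: msize_def)
  have fw': "(int (2 * ?N) + 3) ^ d\<^sub>0 \<le> W" "int (2 * ?N * (2 * ?N)) \<le> W" "int (3 * ?N) \<le> W" "int (n ^ j * ?N) \<le> W"
    using fw by (auto simp: fits_word_def)
  have "b * ?m \<le> ?N" using b(2) by (metis div_times_less_eq_dividend mult_le_mono1 order_trans)
  then have bm: "int b * int ?m \<le> int ?N" by (metis of_nat_le_iff of_nat_mult)
  have Sub: "S12 \<subseteq> {..<j + 3 * k}" "S13 \<subseteq> {..<j + 3 * k}" "S23 \<subseteq> {..<j + 3 * k}" by (auto simp: S_defs)
  have cs': "class_state W n g w c s'" if "ok W s'" "keeps scratch s s'" for s'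
    by (rule class_state_keeps[OF cs that]) auto
  have evm: "ev W s' me (int ?m)" if "class_state W n g w c s'" for s'
    using that m2' fw'(3) by (intro ev_Op[where a = "int (length ?xs)" and b = "int (length ?ys)"] ev_Var)
      (auto simp: class_state_def room_def msize_def)
  have evz: "ev W s' Ze (int (?z l))" if "class_state W n g w c s'" "s' (v 22) 0 = int b" "s' (v 6) 0 = int l" "l < ?m" for s' l
  proof -
    have ok': "ok W s'" using that(1) by (simp add: class_state_def room_def)
    have "\<bar>int b * int ?m\<bar> \<le> W" "\<bar>int (b * ?m) + int l\<bar> \<le> W"
      using bm m2' that(4) fw'(3) by (simp_all add: abs_of_nonneg)
    then show ?thesis
      using that ok' by (intro ev_Op[where a = "int (b * ?m)" and b = "int l"] ev_Op[where a = "int b" and b = "int ?m"]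
          evm ev_Var) auto
  qed
  have evs: "ev W s' (Var (v 20)) c" "ev W s' (Var (v 14)) (int w)" "ev W s' (Var (v 16)) (int (length ?xs))"
    "ev W s' (Var (v 17)) (int (length ?ys))" "ev W s' (Var (v 21)) (int ?N)" "ev W s' (Const 0) 0" "room W n s' g" "ok W s'"
    if "class_state W n g w c s'" for s'
    using that W1 by (auto simp: class_state_def room_def intro!: ev_Var ev_Const)
  have evx: "ev W s' Xe (s (v 18) (int i))" if "class_state W n g w c s'" "keeps scratch s s'" "s' (v 4) 0 = int i" for s' i
    using ev_Read[OF evs(8)[OF that(1)] ev_Var[OF evs(8)[OF that(1)] that(3)], of "v 18"] that(2) by simp
  have evy: "ev W s' Ye (s (v 19) (int i))" if "class_state W n g w c s'" "keeps scratch s s'" "s' (v 5) 0 = int i" for s' i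
    using ev_Read[OF evs(8)[OF that(1)] ev_Var[OF evs(8)[OF that(1)] that(3)], of "v 19"] that(2) by simp
  have sb: "s' (v 22) 0 = int b" if "keeps scratch s s'" for s' using that b(1) by simp
  have less: "ev W s' (Op Less e f) (of_bool (x < y))" if "ev W s' e (int x)" "ev W s' f (int y)" for s' e f x y
    using ev_Less[OF that W1] by simp
  have "run W block s (detect_cost me eA eB eC eX Ye Ze * (real ?m + 1) powr \<omega>)
      (\<lambda>s'. if \<exists>i<?m. \<exists>y<?m. \<exists>l<?m. ?a i l \<and> ?b l y \<and> ?c i y
        then s' (v 0) 0 = 1 \<and> (\<exists>i<?m. \<exists>y<?m. \<exists>l<?m. ?a i l \<and> ?b l y \<and> ?c i y \<and>
          s' (v 11) 0 = int w * int ?N + s (v 18) (int i) mod int ?N \<and> s' (v 12) 0 = s (v 19) (int y) \<and> s' (v 13) 0 = int (?z l))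
        else \<forall>k\<in>{0, 11, 12, 13}. s' (v k) = s (v k))"
    unfolding block_def
  proof (rule run_detect)
    show "(int ?m + 3) ^ d\<^sub>0 \<le> W"
      by (rule order_trans[OF power_mono fw'(1)]) (use m2' in auto)
    have "?m * ?m \<le> 2 * ?N * (2 * ?N)" using m2 by (intro mult_mono) auto
    then show "int (?m * ?m) \<le> W" using fw'(2) by linarith
    fix s' i l assume s': "ok W s'" "keeps scratch s s'" "i < ?m" "l < ?m" "s' (v 4) 0 = int i" "s' (v 6) 0 = int l"
    note cs2 = cs'[OF s'(1,2)]
    note e = evs[OF cs2] evx[OF cs2 s'(2,5)] evz[OF cs2 sb[OF s'(2)] s'(6,4)]
    show "ev W s' eA (of_bool (?a i l))" unfolding eA_def
      by (intro ev_And less W1 e ev_test[OF e(7,2,9,6,10,1) Sub(2)] ev_Var[OF s'(1)] s'(5))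
  next
    fix s' l y assume s': "ok W s'" "keeps scratch s s'" "l < ?m" "y < ?m" "s' (v 6) 0 = int l" "s' (v 5) 0 = int y"
    note cs2 = cs'[OF s'(1,2)]
    note e = evs[OF cs2] evy[OF cs2 s'(2,6)] evz[OF cs2 sb[OF s'(2)] s'(5,3)]
    show "ev W s' eB (of_bool (?b l y))" unfolding eB_def
      by (intro ev_And less W1 e ev_test[OF e(7,2,6,9,10,1) Sub(3)] ev_Var[OF s'(1)] s'(6))
  next
    fix s' i y assume s': "ok W s'" "keeps scratch s s'" "i < ?m" "y < ?m" "s' (v 4) 0 = int i" "s' (v 5) 0 = int y"
    note cs2 = cs'[OF s'(1,2)]
    note e = evs[OF cs2] evx[OF cs2 s'(2,5)] evy[OF cs2 s'(2,6)]
    show "ev W s' eC (of_bool (?c i y))" unfolding eC_def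
      by (intro ev_And less W1 e ev_test[OF e(7,2,9,10,6,1) Sub(1)] ev_Var[OF s'(1)] s'(5,6))
  next
    fix s' i assume s': "ok W s'" "keeps scratch s s'" "i < ?m" "s' (v 4) 0 = int i"
    note cs2 = cs'[OF s'(1,2)]
    note e = evs[OF cs2] evx[OF cs2 s'(2,4)]
    let ?r = "s (v 18) (int i) mod int ?N"
    have r: "0 \<le> ?r" "?r < int ?N" using N0 by simp_all
    \<comment> \<open>As the remainder is below \<open>N\<close>, the combined code of
      \<open>w\<close> and \<open>x\<close> is below \<open>n ^ j * N\<close> and thus fits into a
      word.\<close>
    have "(w + 1) * ?N \<le> n ^ j * ?N" using w by (intro mult_right_mono) auto
    then have "int w * int ?N + int ?N \<le> W"
      using fw'(4) by (metis (mono_tags, opaque_lifting) of_nat_le_iff of_nat_mult of_nat_add order_trans distrib_right mult_1)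
    then have bd: "\<bar>int w * int ?N\<bar> \<le> W" "\<bar>int w * int ?N + ?r\<bar> \<le> W" "\<bar>?r\<bar> \<le> W"
      using r zero_le_mult_iff[of "int w" "int ?N"] unfolding abs_le_iff by linarith+
    show "ev W s' eX (int w * int ?N + ?r)" unfolding eX_def
      by (rule ev_Op[OF ev_Op[OF e(2) e(5)] ev_Op[OF e(9) e(5)]]) (use bd in simp_all)
  next
    fix s' y assume s': "ok W s'" "keeps scratch s s'" "y < ?m" "s' (v 5) 0 = int y"
    show "ev W s' Ye (s (v 19) (int y))" by (rule evy[OF cs'[OF s'(1,2)] s'(2,4)])
  next
    fix s' l assume s': "ok W s'" "keeps scratch s s'" "l < ?m" "s' (v 6) 0 = int l"
    show "ev W s' Ze (int (?z l))" by (rule evz[OF cs'[OF s'(1,2)] sb[OF s'(2)] s'(4,3)])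
  qed (use ok W1 evm[OF cs] in auto)
  then show ?thesis
  proof (rule run_mono)
    have xs: "?xs ! i < ?N \<and> s (v 18) (int i) = int (?xs ! i)" if "i < length ?xs" for i
      using nth_mem[OF that] that cs by (simp add: set_side_list class_state_def)
    have ys: "?ys ! i < ?N \<and> s (v 19) (int i) = int (?ys ! i)" if "i < length ?ys" for i
      using nth_mem[OF that] that cs by (simp add: set_side_list class_state_def)
    \<comment> \<open>Each matrix entry was computed with \<open>0\<close> in the place of the part
      that its test ignores; restoring the actual codes changes none of the three tests.\<close>
    have sol: "sol n g (int w) c (s (v 18) (int i)) (s (v 19) (int y)) (int (?z l)) \<longleftrightarrow> 
       tst n g S12 c (int w) (s (v 18) (int i)) (s (v 19) (int y)) 0 \<and>
       tst n g S13 c (int w) (s (v 18) (int i)) 0 (int (?z l)) \<and> tst n g S23 c (int w) 0 (s (v 19) (int y)) (int (?z l))" for i y l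
      unfolding sol_def using c tst_irrelevant(3)[of n g c "int w" "s (v 18) (int i)" "s (v 19) (int y)" "int (?z l)" 0]
        tst_irrelevant(4)[of n g c "int w" "s (v 18) (int i)" "s (v 19) (int y)" "int (?z l)" 0]
        tst_irrelevant(5)[of n g c "int w" "s (v 18) (int i)" "s (v 19) (int y)" "int (?z l)" 0] by simp
    fix s' assume s': "if \<exists>i<?m. \<exists>y<?m. \<exists>l<?m. ?a i l \<and> ?b l y \<and> ?c i y
        then s' (v 0) 0 = 1 \<and> (\<exists>i<?m. \<exists>y<?m. \<exists>l<?m. ?a i l \<and> ?b l y \<and> ?c i y \<and>
          s' (v 11) 0 = int w * int ?N + s (v 18) (int i) mod int ?N \<and> s' (v 12) 0 = s (v 19) (int y) \<and> s' (v 13) 0 = int (?z l))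
        else \<forall>k\<in>{0, 11, 12, 13}. s' (v k) = s (v k)"
    let ?goal = "\<exists>x<n ^ k. \<exists>y<n ^ k. \<exists>z<n ^ k. sol n g (int w) c (int x) (int y) (int z) \<and>
      b * msize n g w c \<le> z \<and> z < Suc b * msize n g w c"
    show "Inv n g (C \<or> ?goal) s'"
    proof (cases "\<exists>i<?m. \<exists>y<?m. \<exists>l<?m. ?a i l \<and> ?b l y \<and> ?c i y")
      case True
      with s' obtain i y l where f: "s' (v 0) 0 = 1" "?a i l" "?b l y" "?c i y"
          "s' (v 11) 0 = int w * int ?N + s (v 18) (int i) mod int ?N" "s' (v 12) 0 = s (v 19) (int y)" "s' (v 13) 0 = int (?z l)"
        unfolding if_P[OF True] by blast
      have i: "i < length ?xs" "y < length ?ys" using f(2,3) by auto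
      have "sol n g (int w) c (int (?xs ! i)) (int (?ys ! y)) (int (?z l))"
        using sol[of i y l] f(2-4) xs[OF i(1)] ys[OF i(2)] by simp
      moreover have "s' (v 11) 0 = int (w * ?N + ?xs ! i)" "s' (v 12) 0 = int (?ys ! y)"
        using f(5,6) xs[OF i(1)] ys[OF i(2)] by simp_all
      ultimately have "found_at n g s'"
        unfolding found_at_def using w xs[OF i(1)] ys[OF i(2)] f(2,7) by blast
      then show ?thesis using f(1) by (simp add: Inv_def)
    next
      case False
      with s' have same: "\<forall>k\<in>{0, 11, 12, 13}. s' (v k) = s (v k)" by (simp only: if_False)
      have "\<not> ?goal"
      proof
        assume ?goal
        then obtain x y z where xyz: "x < ?N" "y < ?N" "z < ?N" "sol n g (int w) c (int x) (int y) (int z)"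
          "b * ?m \<le> z" "z < Suc b * ?m" by blast
        \<comment> \<open>A solution passes the partial tests on \<open>S1\<close> and
          \<open>S2\<close>, so its codes occur in the two lists and correspond to indices below
          \<open>m\<close>.\<close>
        from sol_parts[OF xyz(4)] xyz(1,2) have "x \<in> set ?xs" "y \<in> set ?ys" by (simp_all add: set_side_list)
        then obtain i i' where i: "i < length ?xs" "?xs ! i = x" "i' < length ?ys" "?ys ! i' = y"
          by (auto simp: in_set_conv_nth)
        define l where "l = z - b * ?m"
        have l: "l < ?m" "?z l = z" using xyz(5,6) by (auto simp: l_def)
        have "sol n g (int w) c (s (v 18) (int i)) (s (v 19) (int i')) (int (?z l))"
          using xyz(4) xs[OF i(1)] ys[OF i(3)] i(2,4) l(2) by simp
        then have "?a i l \<and> ?b l i' \<and> ?c i i'" using sol[of i i' l] i l xyz(3) by simp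
        moreover have "i < ?m" "i' < ?m" using i by (auto simp: msize_def)
        ultimately show False using False l(1) by blast
      qed
      moreover have "Inv n g C s'"
        using I same by (simp add: Inv_def found_at_def)
      ultimately have "(C \<or> ?goal) = C" "Inv n g C s'" by blast+
      then show ?thesis by (simp only:)
    qed
  qed (use ok in auto)
qed

end

context partitioned
begin

text \<open>The loop makes \<open>N div m + 1\<close> rounds and the rule for loops charges one
  more; \<open>30\<close> exceeds the overhead of a round.\<close>

definition blocks_time :: "nat \<Rightarrow> nat \<Rightarrow> real" where
  "blocks_time N m = real (N div m + 2) * (detect_cost me eA eB eC eX Ye Ze * (real m + 1) powr \<omega> + 30)"

lemma writes_block: "writes block \<subseteq> scratch"
  unfolding block_def by (rule writes_detect)

lemma run_blocks:
  assumes fw: "fits_word W n M" and cs: "class_state W n g w c s" and c: "0 < c" and w: "w < n ^ j"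
    and m: "0 < msize n g w c" and I: "Inv n g C s"
  shows "run W blocks s (blocks_time (n ^ k) (msize n g w c))
    (Inv n g (C \<or> (\<exists>x<n ^ k. \<exists>y<n ^ k. \<exists>z<n ^ k. sol n g (int w) c (int x) (int y) (int z))))"
proof -
  let ?N = "n ^ k" let ?m = "msize n g w c" let ?b = "?N div ?m + 1"
  let ?e = "Op Plus (Op Quotient (Var (v 21)) me) (Const 1)"
  let ?S = "\<lambda>P. \<exists>x<?N. \<exists>y<?N. \<exists>z<?N. sol n g (int w) c (int x) (int y) (int z) \<and> P z"
  have ok: "ok W s" and W1: "1 \<le> W" and n0: "0 < n" using cs by (auto simp: class_state_def room_def)
  have fw': "int (3 * ?N) \<le> W" using fw by (auto simp: fits_word_def)
  have N0: "0 < ?N" using n0 by simp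
  have m2: "?m \<le> 2 * ?N" by (rule msize_le)
  have "?N div ?m \<le> ?N" by simp
  then have bW: "int ?b \<le> W" "int (?N div ?m) \<le> W" "int ?N \<le> W" "int ?m \<le> W" using fw' N0 m2 by linarith+
  have cs': "class_state W n g w c s'" if "ok W s'" "keeps (insert (v 22) (writes block)) s s'" for s'
    by (rule class_state_keeps[OF cs that(1), of "insert (v 22) scratch"]) (use that(2) writes_block in auto)
  have 22: "v 22 \<notin> writes block" using writes_block by auto
  have "run W blocks s (real (?b + 1) * (detect_cost me eA eB eC eX Ye Ze * (real ?m + 1) powr \<omega> + 10 + real (cost ?e)))
    (\<lambda>s'. Inv n g (C \<or> ?S (\<lambda>z. z < ?b * ?m)) s')"
    unfolding blocks_def
  proof (rule run_For_const[where I = "\<lambda>b. Inv n g (C \<or> ?S (\<lambda>z. z < b * ?m))"])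
    show "Inv n g (C \<or> ?S (\<lambda>z. z < 0 * ?m)) (upd s (v 22) 0 0)"
      by (rule Inv_keeps[where X = "{v 22}", OF Inv_mono[OF I]]) auto
    have q: "\<bar>int n ^ k div int ?m\<bar> \<le> W"
      using bW(2) of_nat_0_le_iff[of "?N div ?m", where 'a = int] by (simp add: zdiv_int)
    show "ev W s' ?e (int ?b)" if "ok W s'" "keeps (insert (v 22) (writes block)) s s'" for s'
    proof -
      have c': "s' (v 21) 0 = int ?N" "s' (v 16) 0 = int (length (side_list n g S1 w c))"
        "s' (v 17) 0 = int (length (side_list n g S2 w c))"
        using cs'[OF that] by (auto simp: class_state_def)
      have "ev W s' me (int ?m)"
        using bW by (intro ev_Op[OF ev_Var[OF that(1) c'(2)] ev_Var[OF that(1) c'(3)]]) (simp_all add: msize_def)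
      then have "ev W s' (Op Quotient (Var (v 21)) me) (int (?N div ?m))"
        using q by (intro ev_Op[OF ev_Var[OF that(1) c'(1)]]) (simp_all add: zdiv_int)
      from ev_Op[OF this ev_Const[of 1 W s'], of Plus] show ?thesis
        using bW W1 by (simp add: add.commute)
    qed
    fix b s' assume b: "b < ?b" "ok W s'" "keeps (insert (v 22) (writes block)) s s'" "s' (v 22) 0 = int b"
      "Inv n g (C \<or> ?S (\<lambda>z. z < b * ?m)) s'"
    have "run W block s' (detect_cost me eA eB eC eX Ye Ze * (real ?m + 1) powr \<omega>)
      (Inv n g ((C \<or> ?S (\<lambda>z. z < b * ?m)) \<or> ?S (\<lambda>z. b * ?m \<le> z \<and> z < Suc b * ?m)))"
      by (rule run_block[OF fw cs'[OF b(2,3)] c w b(4) _ m b(5)]) (use b(1) in simp)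
    then show "run W block s' (detect_cost me eA eB eC eX Ye Ze * (real ?m + 1) powr \<omega>)
      (\<lambda>s''. Inv n g (C \<or> ?S (\<lambda>z. z < Suc b * ?m)) (upd s'' (v 22) 0 (int (Suc b))))"
    proof (rule run_mono)
      fix s'' assume i: "Inv n g ((C \<or> ?S (\<lambda>z. z < b * ?m)) \<or> ?S (\<lambda>z. b * ?m \<le> z \<and> z < Suc b * ?m)) s''"
      have "Inv n g (C \<or> ?S (\<lambda>z. z < Suc b * ?m)) s''"
        by (rule Inv_mono[OF i]) (metis not_le)
      then show "Inv n g (C \<or> ?S (\<lambda>z. z < Suc b * ?m)) (upd s'' (v 22) 0 (int (Suc b)))"
        by (rule Inv_keeps[where X = "{v 22}"]) auto
    qed (use b in auto)
  qed (use ok W1 22 bW detect_cost_nonneg in auto)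
  then show ?thesis
  proof (rule run_mono)
    show "real (?b + 1) * (detect_cost me eA eB eC eX Ye Ze * (real ?m + 1) powr \<omega> + 10 + real (cost ?e)) \<le> blocks_time ?N ?m"
      unfolding blocks_time_def by (intro mult_mono) (auto simp: detect_cost_nonneg)
    fix s' assume i: "Inv n g (C \<or> ?S (\<lambda>z. z < ?b * ?m)) s'"
    have "z < ?b * ?m" if "z < ?N" for z
    proof -
      have "?N < ?b * ?m" using m by (metis Suc_eq_plus1 dividend_less_div_times add.commute mult_Suc)
      then show ?thesis using that by simp
    qed
    then show "Inv n g (C \<or> (\<exists>x<?N. \<exists>y<?N. \<exists>z<?N. sol n g (int w) c (int x) (int y) (int z))) s'"
      by (intro Inv_mono[OF i]) blast
  qed (use ok in auto)
qed

definition first :: "nat \<Rightarrow> (int \<Rightarrow> int \<Rightarrow> int) \<Rightarrow> nat \<Rightarrow> nat \<Rightarrow> bool" where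
  "first n g w x \<longleftrightarrow> (let c = col1 n g (int w) (int x) in
     0 < c \<and> side_list n g S1 w c \<noteq> [] \<and> side_list n g S1 w c ! 0 = x)"

definition step_time :: "nat \<Rightarrow> (int \<Rightarrow> int \<Rightarrow> int) \<Rightarrow> nat \<Rightarrow> nat \<Rightarrow> real" where
  "step_time n g w x = (if first n g w x then blocks_time (n ^ k) (msize n g w (col1 n g (int w) (int x))) else 1)"

definition step_cost :: real where
  "step_cost = real (tmax first_colour) + real (cost (side S1)) + real (cost (side S2)) + real (cost first_expr) + 100"

definition class_solved :: "nat \<Rightarrow> (int \<Rightarrow> int \<Rightarrow> int) \<Rightarrow> nat \<Rightarrow> nat \<Rightarrow> bool" where
  "class_solved n g w x \<longleftrightarrow> first n g w x \<and>
     (\<exists>x'<n ^ k. \<exists>y<n ^ k. \<exists>z<n ^ k. sol n g (int w) (col1 n g (int w) (int x)) (int x') (int y) (int z))"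

definition step_writes :: "string set" where
  "step_writes = scratch \<union> v ` {16, 17, 18, 19, 20, 22, 23}"

lemma writes_class_step: "writes class_step \<subseteq> step_writes"
  using writes_block by (auto simp: class_step_def first_colour_def blocks_def step_writes_def)

lemma blocks_time_nonneg: "0 \<le> blocks_time N m"
  by (simp add: blocks_time_def detect_cost_nonneg)

text \<open>The lists are collected anew for every \<open>x\<close>, also if its class was treated
  before. For each \<open>w\<close> this costs about \<open>N^2\<close> in all, which
  \<open>\<omega> \<ge> 2\<close> permits; only the products have to be restricted to the first
  member of a class.\<close>

lemma run_class_step:
  assumes fw: "fits_word W n M" and room: "room W n s g" and g: "\<And>x y. 0 \<le> g x y \<and> g x y \<le> int M + 1"
    and s: "s (v 21) 0 = int (n ^ k)" "s (v 14) 0 = int w" "s (v 15) 0 = int x"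
    and wx: "w < n ^ j" "x < n ^ k" and I: "Inv n g C s"
  shows "run W class_step s (step_cost * (real (n ^ k) + 1) + step_time n g w x) (Inv n g (C \<or> class_solved n g w x))"
proof -
  let ?N = "n ^ k" let ?c = "col1 n g (int w) (int x)"
  let ?xs = "side_list n g S1 w ?c" let ?ys = "side_list n g S2 w ?c"
  have ok: "ok W s" and W1: "1 \<le> W" using room by (auto simp: room_def)
  have fw': "int (3 * ?N) \<le> W" "int (n ^ j * ?N) \<le> W" "int M + 2 \<le> W" using fw by (auto simp: fits_word_def)
  have NW: "int ?N \<le> W" using fw'(1) by linarith
  have Sub: "S1 \<subseteq> {..<j + 3 * k}" "S2 \<subseteq> {..<j + 3 * k}" by (auto simp: S_defs)
  have cW: "\<bar>?c\<bar> \<le> W" using g fw'(3) unfolding col1_def by (smt (verit))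
  have lts: "a1 < j + 3 * k" "b1 < j + 3 * k" using es_less[OF edge1(1)] by auto
  have side: "ev W s' (side S) (of_bool (tst n g S ?c (int w) (int i) (int i) (int i)))"
    if "room W n s' g" "s' (v 20) 0 = ?c" "s' (v 14) 0 = int w" "s' (v 23) 0 = int i" "S \<subseteq> {..<j + 3 * k}" for s' S i
  proof -
    have "ok W s'" using that(1) by (simp add: room_def)
    then show ?thesis unfolding side_def using that by (intro ev_test ev_Var) auto
  qed
  let ?t1 = "real (tmax first_colour)"
  let ?t2 = "(real ?N + 1) * (40 + real (cost (side S1)))" let ?t3 = "(real ?N + 1) * (40 + real (cost (side S2)))"
  let ?t4 = "1 + real (cost first_expr) + step_time n g w x"
  have "run W class_step s (?t1 + (?t2 + (?t3 + ?t4))) (Inv n g (C \<or> class_solved n g w x))"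
    unfolding class_step_def
  proof (rule run_Seq)
    have "ev W s (colour_expr (Var (v 14)) (Var (v 15)) (Var (v 15)) (Var (v 15)) (a1, b1)) ?c"
      unfolding col1_def by (rule ev_colour[OF room _ _ _ _ lts]) (use s ok in \<open>auto intro: ev_Var\<close>)
    then have "wp W first_colour (\<lambda>s'. s' (v 20) 0 = ?c) s"
      using W1 by (simp add: first_colour_def ev_def)
    then show "run W first_colour s ?t1 (\<lambda>s'. s' (v 20) 0 = ?c)" by (rule run_wp)
    fix s1 assume 1: "s1 (v 20) 0 = ?c" "ok W s1" "keeps (writes first_colour) s s1"
    have k1: "keeps {v 20} s s1" using 1(3) by (simp add: first_colour_def)
    have r1: "room W n s1 g" by (rule room_keeps[OF room 1(2) k1]) auto
    have s1: "s1 (v 21) 0 = int ?N" "s1 (v 14) 0 = int w" "s1 (v 15) 0 = int x" using k1 s by auto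
    show "run W (Seq (collect 18 16 (side S1)) (Seq (collect 19 17 (side S2)) (Cond first_expr blocks Skip))) s1
       (?t2 + (?t3 + ?t4)) (Inv n g (C \<or> class_solved n g w x))"
    proof (rule run_Seq)
      show "run W (collect 18 16 (side S1)) s1 ?t2 (\<lambda>s'. s' (v 16) 0 = int (length ?xs) \<and>
          (\<forall>i<length ?xs. s' (v 18) (int i) = int (?xs ! i)))"
        unfolding side_list_def
      proof (rule run_collect)
        fix s' i assume s': "ok W s'" "keeps {v 23, v 16, v 18} s1 s'" "s' (v 23) 0 = int i"
        have "room W n s' g" by (rule room_keeps[OF r1 s'(1,2)]) auto
        then show "ev W s' (side S1) (of_bool (tst n g S1 ?c (int w) (int i) (int i) (int i)))"
          by (rule side) (use s' 1 s1 Sub in auto)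
      qed (use 1 W1 NW s1 in auto)
      fix s2 assume 2: "s2 (v 16) 0 = int (length ?xs) \<and> (\<forall>i<length ?xs. s2 (v 18) (int i) = int (?xs ! i))"
        "ok W s2" "keeps (writes (collect 18 16 (side S1))) s1 s2"
      have k2: "keeps {v 23, v 16, v 18} s1 s2" using 2(3) by auto
      have r2: "room W n s2 g" by (rule room_keeps[OF r1 2(2) k2]) auto
      have s2: "s2 (v 21) 0 = int ?N" "s2 (v 14) 0 = int w" "s2 (v 15) 0 = int x" "s2 (v 20) 0 = ?c" using k2 s1 1(1) by auto
      show "run W (Seq (collect 19 17 (side S2)) (Cond first_expr blocks Skip)) s2
         (?t3 + ?t4) (Inv n g (C \<or> class_solved n g w x))"
      proof (rule run_Seq)
        show "run W (collect 19 17 (side S2)) s2 ?t3 (\<lambda>s'. s' (v 17) 0 = int (length ?ys) \<and>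
            (\<forall>i<length ?ys. s' (v 19) (int i) = int (?ys ! i)))"
          unfolding side_list_def
        proof (rule run_collect)
          fix s' i assume s': "ok W s'" "keeps {v 23, v 17, v 19} s2 s'" "s' (v 23) 0 = int i"
          have "room W n s' g" by (rule room_keeps[OF r2 s'(1,2)]) auto
          then show "ev W s' (side S2) (of_bool (tst n g S2 ?c (int w) (int i) (int i) (int i)))"
            by (rule side) (use s' s2 Sub in auto)
        qed (use 2 W1 NW s2 in auto)
        fix s3 assume 3: "s3 (v 17) 0 = int (length ?ys) \<and> (\<forall>i<length ?ys. s3 (v 19) (int i) = int (?ys ! i))"
          "ok W s3" "keeps (writes (collect 19 17 (side S2))) s2 s3"
        have k3: "keeps {v 23, v 17, v 19} s2 s3" using 3(3) by auto
        have r3: "room W n s3 g" by (rule room_keeps[OF r2 3(2) k3]) auto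
        have cs: "class_state W n g w ?c s3"
          using r3 3(1) 2(1) k3 s2 by (auto simp: class_state_def)
        have k: "keeps {v 20, v 23, v 16, v 18, v 17, v 19} s s3" using k1 k2 k3 by auto
        have I3: "Inv n g C s3" by (rule Inv_keeps[OF I k]) auto
        have s3: "s3 (v 15) 0 = int x" "s3 (v 20) 0 = ?c" "s3 (v 16) 0 = int (length ?xs)" using k3 s2 2(1) by auto
        have lens: "int (length ?xs) \<le> W" using length_side_list[of n g S1 w ?c] NW by linarith
        have "ev W s3 first_expr (of_bool (0 < ?c \<and> 0 < int (length ?xs) \<and> s3 (v 18) 0 = int x))"
          unfolding first_expr_def using 3(2) W1 s3
          by (intro ev_And ev_Less ev_eq ev_Var ev_Read ev_Const) auto
        moreover have "(0 < ?c \<and> 0 < int (length ?xs) \<and> s3 (v 18) 0 = int x) = first n g w x"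
          using 2(1) k3 unfolding first_def Let_def by force
        ultimately have fe: "ev W s3 first_expr (of_bool (first n g w x))" by simp
        show "run W (Cond first_expr blocks Skip) s3 ?t4 (Inv n g (C \<or> class_solved n g w x))"
        proof (rule run_Cond[OF fe])
          assume "of_bool (first n g w x) \<noteq> (0 :: int)"
          then have f: "first n g w x" by simp
          then have f': "0 < ?c" "?xs \<noteq> []" by (auto simp: first_def Let_def)
          have "run W blocks s3 (blocks_time ?N (msize n g w ?c))
             (Inv n g (C \<or> (\<exists>x'<?N. \<exists>y<?N. \<exists>z<?N. sol n g (int w) ?c (int x') (int y) (int z))))"
            by (rule run_blocks[OF fw cs f'(1) wx(1) _ I3]) (use f'(2) in \<open>simp add: msize_def\<close>)
          then show "run W blocks s3 (step_time n g w x) (Inv n g (C \<or> class_solved n g w x))"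
            using f by (simp add: step_time_def class_solved_def)
        next
          assume "of_bool (first n g w x) = (0 :: int)"
          then have f: "\<not> first n g w x" by simp
          then have "Inv n g (C \<or> class_solved n g w x) s3" using I3 by (simp add: class_solved_def)
          then show "run W Skip s3 (step_time n g w x) (Inv n g (C \<or> class_solved n g w x))"
            using f run_Skip by (simp add: step_time_def)
        qed
      qed (use 2 in auto)
    qed (use 1 in auto)
  qed (use ok in auto)
  then show ?thesis
  proof (rule run_mono)
    have "a * 1 \<le> a * (real ?N + 1)" if "0 \<le> a" for a :: real using that by (intro mult_left_mono) auto
    from this[of "real (tmax first_colour) + real (cost first_expr) + 1"]
    show "?t1 + (?t2 + (?t3 + ?t4)) \<le> step_cost * (real ?N + 1) + step_time n g w x"
      unfolding step_cost_def by (simp add: algebra_simps)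
  qed (use ok in auto)
qed

end

text \<open>In \<open>x powr r = x * x powr (r - 1)\<close> the second factor is monotone because
  \<open>r \<ge> 1\<close>, so it may be replaced by its value at the total.\<close>

lemma sum_powr_le:
  fixes f :: "'a \<Rightarrow> real"
  assumes "finite A" "\<And>a. a \<in> A \<Longrightarrow> 0 \<le> f a" "1 \<le> r"
  shows "(\<Sum>a\<in>A. f a powr r) \<le> (\<Sum>a\<in>A. f a) powr r"
proof -
  have split: "x powr r = x * x powr (r - 1)" if "0 \<le> x" for x :: real
    using that assms(3) powr_add[of x 1 "r - 1"] by (cases "x = 0") auto
  let ?S = "\<Sum>a\<in>A. f a"
  have S: "0 \<le> ?S" using assms(2) by (rule sum_nonneg)
  have "(\<Sum>a\<in>A. f a powr r) = (\<Sum>a\<in>A. f a * f a powr (r - 1))"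
    using split assms(2) by (intro sum.cong) auto
  also have "\<dots> \<le> (\<Sum>a\<in>A. f a * ?S powr (r - 1))"
    using assms member_le_sum[of _ A f] by (intro sum_mono mult_left_mono powr_mono2) auto
  also have "\<dots> = ?S powr r" using split[OF S] by (simp add: sum_distrib_right)
  finally show ?thesis .
qed

primrec assign :: "string \<Rightarrow> nat \<Rightarrow> expr list \<Rightarrow> com" where
  "assign X i [] = Skip"
| "assign X i (e # es) = Seq (Write X (Const (int i)) e) (assign X (Suc i) es)"

lemma wp_assign:
  assumes "ok W s" "int (i + length es) \<le> W"
    and "\<And>s' l. ok W s' \<Longrightarrow> keeps {X} s s' \<Longrightarrow> l < length es \<Longrightarrow> ev W s' (es ! l) (z (i + l))"
    and "\<And>s'. ok W s' \<Longrightarrow> keeps {X} s s' \<Longrightarrow> (\<forall>l<i. s' X (int l) = s X (int l)) \<Longrightarrow>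
      (\<forall>l. i \<le> l \<and> l < i + length es \<longrightarrow> s' X (int l) = z l) \<Longrightarrow> Q s'"
  shows "wp W (assign X i es) Q s"
  using assms
proof (induction es arbitrary: i s)
  case Nil
  then show ?case by auto
next
  case (Cons e es)
  have e: "ev W s e (z i)" using Cons.prems(3)[of s 0] Cons.prems(1) by simp
  then have "\<bar>z i\<bar> \<le> W" using fits_val[of W s e] by (auto simp: ev_def)
  let ?s = "upd s X (int i) (z i)"
  have ok: "ok W ?s" using Cons.prems(1) \<open>\<bar>z i\<bar> \<le> W\<close> by simp
  have "wp W (assign X (Suc i) es) Q ?s"
  proof (rule Cons.IH[OF ok])
    show "ev W s' (es ! l) (z (Suc i + l))" if "ok W s'" "keeps {X} ?s s'" "l < length es" for s' l
      using Cons.prems(3)[of s' "Suc l"] that by auto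
    fix s' assume s': "ok W s'" "keeps {X} ?s s'" "\<forall>l<Suc i. s' X (int l) = ?s X (int l)"
      "\<forall>l. Suc i \<le> l \<and> l < Suc i + length es \<longrightarrow> s' X (int l) = z l"
    show "Q s'"
    proof (rule Cons.prems(4))
      show "\<forall>l. i \<le> l \<and> l < i + length (e # es) \<longrightarrow> s' X (int l) = z l"
      proof (intro allI impI)
        fix l assume "i \<le> l \<and> l < i + length (e # es)"
        then show "s' X (int l) = z l" using s'(3,4) by (cases "l = i") auto
      qed
    qed (use s' in auto)
  qed (use Cons.prems in auto)
  then show ?case using e Cons.prems(2) by (auto simp: ev_def)
qed

section \<open>Running time summed over the colour classes\<close>

context partitioned
begin

definition blocks_const :: real where
  "blocks_const = 5 * (detect_cost me eA eB eC eX Ye Ze + 30) * 2 powr \<omega>"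

lemma blocks_const_nonneg: "0 \<le> blocks_const"
  by (simp add: blocks_const_def detect_cost_nonneg)

text \<open>From \<open>m \<le> 2 * N\<close> the summand \<open>2\<close> is at most
  \<open>4 * N / m\<close>, so at most \<open>5 * N / m\<close> products of size \<open>m\<close>
  are charged. Division by \<open>m\<close> lowers the exponent to \<open>\<omega> - 1\<close>,
  which is still at least \<open>1\<close>.\<close>

lemma blocks_time_le:
  assumes "0 < m" "m \<le> 2 * N"
  shows "blocks_time N m \<le> blocks_const * real N * real m powr (\<omega> - 1)"
proof -
  let ?K = "detect_cost me eA eB eC eX Ye Ze"
  have K: "0 \<le> ?K" by (rule detect_cost_nonneg)
  have m: "1 \<le> real m" using assms(1) by simp
  have "real (N div m + 2) \<le> real N / real m + 2" using of_nat_div_le_of_nat[of N m, where 'a = real] by simp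
  also have "2 \<le> 4 * (real N / real m)" using assms m by (simp add: field_simps)
  finally have 1: "real (N div m + 2) \<le> 5 * (real N / real m)" by simp
  have p: "1 \<le> (2 * real m) powr \<omega>" using m \<omega> by (intro ge_one_powr_ge_zero) auto
  have "?K * (real m + 1) powr \<omega> + 30 \<le> ?K * (2 * real m) powr \<omega> + 30 * (2 * real m) powr \<omega>"
    using m \<omega> K p by (intro add_mono mult_left_mono powr_mono2) auto
  also have "\<dots> = (?K + 30) * 2 powr \<omega> * real m powr \<omega>"
    using m by (simp add: powr_mult algebra_simps)
  finally have 2: "?K * (real m + 1) powr \<omega> + 30 \<le> (?K + 30) * 2 powr \<omega> * real m powr \<omega>" .
  have "blocks_time N m \<le> 5 * (real N / real m) * ((?K + 30) * 2 powr \<omega> * real m powr \<omega>)"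
    unfolding blocks_time_def using 1 2 K by (intro mult_mono) auto
  also have "\<dots> = blocks_const * real N * (real m powr \<omega> / real m)"
    by (simp add: blocks_const_def)
  also have "real m powr \<omega> / real m = real m powr (\<omega> - 1)"
    using m by (simp add: powr_diff)
  finally show ?thesis .
qed

text \<open>Two first members with the same colour are both the head of the same list, hence equal.
  As \<open>f\<close> recovers the colour from a list element, lists of different classes are
  disjoint sets of codes below \<open>n ^ k\<close>.\<close>

lemma sum_side_lists:
  fixes f :: "nat \<Rightarrow> int"
  assumes "\<And>c x. x \<in> set (side_list n g S w c) \<Longrightarrow> f x = c"
  shows "(\<Sum>x | x < n ^ k \<and> first n g w x. length (side_list n g S w (col1 n g (int w) (int x)))) \<le> n ^ k"
proof -
  let ?F = "{x. x < n ^ k \<and> first n g w x}" let ?c = "\<lambda>x. col1 n g (int w) (int x)"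
  let ?A = "\<lambda>x. set (side_list n g S w (?c x))"
  have inj: "x = y" if "x \<in> ?F" "y \<in> ?F" "?c x = ?c y" for x y
    using that by (auto simp: first_def Let_def)
  have disj: "?A x \<inter> ?A y = {}" if "x \<in> ?F" "y \<in> ?F" "x \<noteq> y" for x y
  proof (rule ccontr)
    assume "?A x \<inter> ?A y \<noteq> {}"
    then obtain u where "u \<in> ?A x" "u \<in> ?A y" by blast
    then have "?c x = ?c y" using assms by metis
    then show False using inj that by blast
  qed
  have "(\<Sum>x\<in>?F. length (side_list n g S w (?c x))) = (\<Sum>x\<in>?F. card (?A x))"
    by (intro sum.cong refl distinct_card[symmetric]) (simp add: side_list_def)
  also have "\<dots> = card (\<Union>x\<in>?F. ?A x)"
    using disj by (intro card_UN_disjoint[symmetric]) auto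
  also have "\<dots> \<le> card {..<n ^ k}"
    by (intro card_mono) (auto simp: set_side_list)
  finally show ?thesis by simp
qed

text \<open>For fixed \<open>w\<close> the sizes of the classes add up to at most
  \<open>2 * N\<close>, with \<open>N\<close> from either side. Superadditivity then bounds the
  products of all colours by what a single class of size \<open>2 * N\<close> would cost.\<close>

lemma sum_step_time:
  "(\<Sum>x<n ^ k. step_time n g w x) \<le> (1 + blocks_const * 2 powr \<omega>) * (real (n ^ k) + 1) powr \<omega>"
proof -
  let ?N = "n ^ k" let ?F = "{x. x < ?N \<and> first n g w x}" let ?c = "\<lambda>x. col1 n g (int w) (int x)"
  let ?m = "\<lambda>x. msize n g w (?c x)"
  have m: "0 < ?m x" if "x \<in> ?F" for x
    using that by (auto simp: first_def Let_def msize_def)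
  have fin: "finite ?F" by simp
  have pw: "y * y powr (\<omega> - 1) = y powr \<omega>" if "0 \<le> y" for y :: real
    using that powr_add[of y 1 "\<omega> - 1"] \<omega> by (cases "y = 0") auto
  have "(\<Sum>x<?N. step_time n g w x) \<le> (\<Sum>x<?N. 1 + (if first n g w x then blocks_time ?N (?m x) else 0))"
    by (intro sum_mono) (auto simp: step_time_def blocks_time_nonneg)
  also have "\<dots> = real ?N + (\<Sum>x\<in>?F. blocks_time ?N (?m x))"
    by (simp add: sum.distrib sum.inter_filter[symmetric])
  finally have 1: "(\<Sum>x<?N. step_time n g w x) \<le> real ?N + (\<Sum>x\<in>?F. blocks_time ?N (?m x))" .
  have "(\<Sum>x\<in>?F. ?m x) \<le> ?N + ?N"
    unfolding msize_def sum.distrib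
  proof (rule add_mono)
    show "(\<Sum>x\<in>?F. length (side_list n g S1 w (?c x))) \<le> ?N"
      by (rule sum_side_lists[where f = "\<lambda>x. col1 n g (int w) (int x)"]) (auto simp: set_side_list intro: tst_col1)
    show "(\<Sum>x\<in>?F. length (side_list n g S2 w (?c x))) \<le> ?N"
      by (rule sum_side_lists[where f = "\<lambda>x. col2 n g (int w) (int x)"]) (auto simp: set_side_list intro: tst_col2)
  qed
  from of_nat_mono[OF this, where 'a = real]
  have m2: "(\<Sum>x\<in>?F. real (?m x)) \<le> 2 * real ?N" by simp
  have "(\<Sum>x\<in>?F. real (?m x) powr (\<omega> - 1)) \<le> (\<Sum>x\<in>?F. real (?m x)) powr (\<omega> - 1)"
    using fin \<omega> by (intro sum_powr_le) auto
  also have "\<dots> \<le> (2 * real ?N) powr (\<omega> - 1)"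
    using m2 \<omega> by (intro powr_mono2 sum_nonneg) auto
  finally have 2: "(\<Sum>x\<in>?F. real (?m x) powr (\<omega> - 1)) \<le> (2 * real ?N) powr (\<omega> - 1)" .
  have "(\<Sum>x\<in>?F. blocks_time ?N (?m x)) \<le> (\<Sum>x\<in>?F. blocks_const * real ?N * real (?m x) powr (\<omega> - 1))"
    using m msize_le by (intro sum_mono blocks_time_le) auto
  also have "\<dots> = blocks_const * real ?N * (\<Sum>x\<in>?F. real (?m x) powr (\<omega> - 1))"
    by (simp add: sum_distrib_left)
  also have "\<dots> \<le> blocks_const * (2 * real ?N) * (2 * real ?N) powr (\<omega> - 1)"
    using 2 blocks_const_nonneg by (intro mult_mono sum_nonneg) auto
  also have "\<dots> = blocks_const * (2 * real ?N) powr \<omega>"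
    using pw[of "2 * real ?N"] by (simp only: mult.assoc)
  also have "\<dots> \<le> blocks_const * (2 * (real ?N + 1)) powr \<omega>"
    using \<omega> blocks_const_nonneg by (intro mult_left_mono powr_mono2) auto
  also have "(2 * (real ?N + 1)) powr \<omega> = 2 powr \<omega> * (real ?N + 1) powr \<omega>"
    by (rule powr_mult; simp)
  finally have 3: "(\<Sum>x\<in>?F. blocks_time ?N (?m x)) \<le> blocks_const * (2 powr \<omega> * (real ?N + 1) powr \<omega>)" .
  have "real ?N \<le> (real ?N + 1) powr \<omega>"
    using powr_mono[of 1 \<omega> "real ?N + 1"] \<omega> by simp
  then have "(\<Sum>x<?N. step_time n g w x) \<le> (real ?N + 1) powr \<omega> + blocks_const * (2 powr \<omega> * (real ?N + 1) powr \<omega>)"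
    using 1 3 by linarith
  then show ?thesis by (simp only: distrib_right mult_1 mult.assoc)
qed

end

context partitioned
begin

definition class_loop :: com where
  "class_loop = For (v 15) (Var (v 21)) class_step"

definition loop_const :: real where
  "loop_const = step_cost + 13 + blocks_const * 2 powr \<omega>"

lemma step_cost_ge: "100 \<le> step_cost"
  by (simp add: step_cost_def)

lemma loop_const_nonneg: "0 \<le> loop_const"
  using step_cost_ge blocks_const_nonneg by (simp add: loop_const_def)

lemma v_step_writes [simp]: "v i \<in> step_writes \<longleftrightarrow> i \<in> {0, 4, 5, 6, 7, 8, 9, 10, 11, 12, 13, 16, 17, 18, 19, 20, 22, 23}"
  by (auto simp: step_writes_def)

lemma run_class_loop:
  assumes fw: "fits_word W n M" and st: "stored n g s" "ok W s" and g: "\<And>x y. 0 \<le> g x y \<and> g x y \<le> int M + 1"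
    and s: "s (v 21) 0 = int (n ^ k)" "s (v 14) 0 = int w" and w: "w < n ^ j" and I: "Inv n g C s"
  shows "run W class_loop s (loop_const * (real (n ^ k) + 1) powr \<omega>) (Inv n g (C \<or> (\<exists>x<n ^ k. class_solved n g w x)))"
proof -
  let ?N = "n ^ k"
  have W: "1 \<le> W" "int (3 * ?N) \<le> W" using fw by (auto simp: fits_word_def)
  have NW: "int ?N \<le> W" using W(2) by linarith
  have wr: "keeps (insert (v 15) step_writes) s s'" if "keeps (insert (v 15) (writes class_step)) s s'" for s'
    using that writes_class_step by blast
  have "run W class_loop s ((\<Sum>x<?N. step_cost * (real ?N + 1) + step_time n g w x) + real (?N + 1) * (10 + real (cost (Var (v 21)))))
     (Inv n g (C \<or> (\<exists>x<?N. class_solved n g w x)))"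
    unfolding class_loop_def
  proof (rule run_For[where I = "\<lambda>x. Inv n g (C \<or> (\<exists>x'<x. class_solved n g w x'))"])
    show "Inv n g (C \<or> (\<exists>x'<0. class_solved n g w x')) (upd s (v 15) 0 0)"
      by (rule Inv_keeps[where X = "{v 15}" and s = s]) (use I in auto)
    show "ev W s' (Var (v 21)) (int ?N)" if "ok W s'" "keeps (insert (v 15) (writes class_step)) s s'" for s'
      using wr[OF that(2)] that(1) s by (intro ev_Var) auto
    fix x s' assume x: "x < ?N" "ok W s'" "keeps (insert (v 15) (writes class_step)) s s'" "s' (v 15) 0 = int x"
      "Inv n g (C \<or> (\<exists>x'<x. class_solved n g w x')) s'"
    \<comment> \<open>As \<open>j + k\<close> is positive, \<open>n = 0\<close> would make
      \<open>n ^ j\<close> or \<open>n ^ k\<close> zero, and the body of this loop would not be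
      reached.\<close>
    have "0 < n" using x(1) w vertices_pos by (cases n) (auto simp: power_0_left split: if_splits)
    then have "room W n s g" using fw st by (auto simp: room_def fits_word_def)
    then have r: "room W n s' g" by (rule room_keeps[OF _ x(2) wr[OF x(3)]]) auto
    have "run W class_step s' (step_cost * (real ?N + 1) + step_time n g w x)
        (Inv n g ((C \<or> (\<exists>x'<x. class_solved n g w x')) \<or> class_solved n g w x))"
      by (rule run_class_step[OF fw r g _ _ x(4) w x(1,5)]) (use wr[OF x(3)] s in auto)
    then show "run W class_step s' (step_cost * (real ?N + 1) + step_time n g w x)
        (\<lambda>s''. Inv n g (C \<or> (\<exists>x'<Suc x. class_solved n g w x')) (upd s'' (v 15) 0 (int (Suc x))))"
    proof (rule run_mono)
      fix s'' assume i: "Inv n g ((C \<or> (\<exists>x'<x. class_solved n g w x')) \<or> class_solved n g w x) s''"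
      have "Inv n g (C \<or> (\<exists>x'<Suc x. class_solved n g w x')) s''"
        by (rule Inv_mono[OF i]) (auto simp: less_Suc_eq)
      then show "Inv n g (C \<or> (\<exists>x'<Suc x. class_solved n g w x')) (upd s'' (v 15) 0 (int (Suc x)))"
        by (rule Inv_keeps[where X = "{v 15}"]) auto
    qed (use x in auto)
  qed (use st W NW writes_class_step in auto)
  then show ?thesis
  proof (rule run_mono)
    let ?y = "real ?N + 1"
    have p: "?y\<^sup>2 \<le> ?y powr \<omega>" using powr_mono[of 2 \<omega> ?y] \<omega> by (simp add: powr_numeral)
    have q: "?y \<le> ?y powr \<omega>" using powr_mono[of 1 \<omega> ?y] \<omega> by simp
    have "(\<Sum>x<?N. step_cost * ?y + step_time n g w x) = real ?N * (step_cost * ?y) + (\<Sum>x<?N. step_time n g w x)"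
      by (simp add: sum.distrib)
    also have "real ?N * (step_cost * ?y) \<le> step_cost * ?y\<^sup>2"
      using step_cost_ge by (simp add: power2_eq_square mult.left_commute mult_left_mono algebra_simps)
    also have "step_cost * ?y\<^sup>2 \<le> step_cost * ?y powr \<omega>"
      using p step_cost_ge by (intro mult_left_mono) auto
    finally have 1: "(\<Sum>x<?N. step_cost * ?y + step_time n g w x) \<le> step_cost * ?y powr \<omega> + (1 + blocks_const * 2 powr \<omega>) * ?y powr \<omega>"
      using sum_step_time[of n g w] by linarith
    have "real (?N + 1) * (10 + real (cost (Var (v 21)))) = 12 * ?y" by simp
    then have "real (?N + 1) * (10 + real (cost (Var (v 21)))) \<le> 12 * ?y powr \<omega>"
      using mult_left_mono[OF q, of 12] by simp
    then show "(\<Sum>x<?N. step_cost * ?y + step_time n g w x) + real (?N + 1) * (10 + real (cost (Var (v 21)))) \<le> loop_const * ?y powr \<omega>"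
      using 1 unfolding loop_const_def by (simp add: algebra_simps)
  qed (use st in auto)
qed

definition search :: com where
  "search = For (v 14) (npow v j) class_loop"

lemma writes_class_loop: "writes class_loop \<subseteq> insert (v 15) step_writes"
  using writes_class_step by (auto simp: class_loop_def)

lemma run_search:
  assumes fw: "fits_word W n M" and st: "stored n g s" "ok W s" and g: "\<And>x y. 0 \<le> g x y \<and> g x y \<le> int M + 1"
    and s: "s (v 21) 0 = int (n ^ k)" and I: "s (v 0) 0 = 0"
  shows "run W search s (real (n ^ j + 1) * (loop_const * (real (n ^ k) + 1) powr \<omega> + 10 + real (cost (npow v j))))
    (Inv n g (\<exists>w<n ^ j. \<exists>x<n ^ k. class_solved n g w x))"
  unfolding search_def
proof (rule run_For_const[where I = "\<lambda>w. Inv n g (\<exists>w'<w. \<exists>x<n ^ k. class_solved n g w' x)"])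
  have W: "1 \<le> W" "\<And>i. i \<le> j + k \<Longrightarrow> int n ^ i \<le> W" using fw by (auto simp: fits_word_def)
  show "1 \<le> W" "int (n ^ j) \<le> W" using W(1) W(2)[of j] by simp_all
  have wr: "keeps (insert (v 14) (insert (v 15) step_writes)) s s'" if "keeps (insert (v 14) (writes class_loop)) s s'" for s'
    using that writes_class_loop by blast
  show "v 14 \<notin> writes class_loop" using writes_class_loop by auto
  show "Inv n g (\<exists>w'<0. \<exists>x<n ^ k. class_solved n g w' x) (upd s (v 14) 0 0)"
    using I by (simp add: Inv_def)
  show "0 \<le> loop_const * (real (n ^ k) + 1) powr \<omega>" using loop_const_nonneg by simp
  show "ev W s' (npow v j) (int (n ^ j))" if "ok W s'" "keeps (insert (v 14) (writes class_loop)) s s'" for s'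
  proof -
    have "s' (v 2) 0 = int n" using wr[OF that(2)] st(1) by (simp add: stored_def)
    from ev_npow[where s = s' and n = n and v = v, OF that(1) this] W(2) show ?thesis by simp
  qed
  fix w s' assume w: "w < n ^ j" "ok W s'" "keeps (insert (v 14) (writes class_loop)) s s'" "s' (v 14) 0 = int w"
    "Inv n g (\<exists>w'<w. \<exists>x<n ^ k. class_solved n g w' x) s'"
  have "stored n g s'" by (rule stored_keeps[OF st(1) wr[OF w(3)]]) auto
  then have "run W class_loop s' (loop_const * (real (n ^ k) + 1) powr \<omega>)
      (Inv n g ((\<exists>w'<w. \<exists>x<n ^ k. class_solved n g w' x) \<or> (\<exists>x<n ^ k. class_solved n g w x)))"
    by (rule run_class_loop[OF fw _ w(2) g _ w(4,1,5)]) (use wr[OF w(3)] s in auto)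
  then show "run W class_loop s' (loop_const * (real (n ^ k) + 1) powr \<omega>)
      (\<lambda>s''. Inv n g (\<exists>w'<Suc w. \<exists>x<n ^ k. class_solved n g w' x) (upd s'' (v 14) 0 (int (Suc w))))"
  proof (rule run_mono)
    fix s'' assume i: "Inv n g ((\<exists>w'<w. \<exists>x<n ^ k. class_solved n g w' x) \<or> (\<exists>x<n ^ k. class_solved n g w x)) s''"
    have "Inv n g (\<exists>w'<Suc w. \<exists>x<n ^ k. class_solved n g w' x) s''"
      by (rule Inv_mono[OF i]) (auto simp: less_Suc_eq)
    then show "Inv n g (\<exists>w'<Suc w. \<exists>x<n ^ k. class_solved n g w' x) (upd s'' (v 14) 0 (int (Suc w)))"
      by (rule Inv_keeps[where X = "{v 14}"]) auto
  qed (use w in auto)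
qed (use st in auto)

text \<open>The \<open>x\<close> of a solution need not be the least of its class. The class is
  treated at the head of its list, which has the same colour \<open>c\<close>, and
  \<open>class_solved\<close> covers all members.\<close>

lemma class_solved_exists:
  assumes "\<And>x y. 0 \<le> g x y" "embedding n g (j + 3 * k) es f c"
  shows "\<exists>w<n ^ j. \<exists>x<n ^ k. class_solved n g w x"
proof -
  obtain w x y z where wx: "w < n ^ j" "x < n ^ k" "y < n ^ k" "z < n ^ k" "sol n g (int w) c (int x) (int y) (int z)"
    using embedding_sol[OF assms] by blast
  let ?L = "side_list n g S1 w c"
  have "x \<in> set ?L" using sol_parts(1)[OF wx(5)] wx(2) by (simp add: set_side_list)
  then have ne: "?L \<noteq> []" by auto
  then have "?L ! 0 \<in> set ?L" by simp
  then have x0: "?L ! 0 < n ^ k" "col1 n g (int w) (int (?L ! 0)) = c"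
    by (auto simp: set_side_list intro: tst_col1)
  have "0 < c" using wx(5) by (simp add: sol_def)
  then have "class_solved n g w (?L ! 0)"
    using x0 ne wx(2-5) by (auto simp: class_solved_def first_def)
  then show ?thesis using wx(1) x0(1) by blast
qed

definition place :: com where
  "place = Cond (Var (v 0)) (assign (v 1) 0 (map
     (vertex_expr (Op Quotient (Var (v 11)) (Var (v 21))) (Op Remainder (Var (v 11)) (Var (v 21))) (Var (v 12)) (Var (v 13)))
     [0..<j + 3 * k])) Skip"

lemma run_place:
  assumes fw: "fits_word W n M" and st: "stored n g s" "ok W s" and s: "s (v 21) 0 = int (n ^ k)" and I: "Inv n g C s"
  shows "run W place s (real (tmax place)) (\<lambda>s'. s' (v 0) = s (v 0) \<and>
    (s (v 0) 0 = 1 \<longrightarrow> (\<exists>c. embedding n g (j + 3 * k) es (\<lambda>i. s' (v 1) (int i)) c)))" (is "run _ _ _ _ ?Q")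
proof (rule run_wp)
  let ?N = "n ^ k" let ?h = "j + 3 * k"
  let ?w = "Op Quotient (Var (v 11)) (Var (v 21))" let ?x = "Op Remainder (Var (v 11)) (Var (v 21))"
  have W: "1 \<le> W" "int ?h \<le> W" using fw by (auto simp: fits_word_def)
  have "wp W (assign (v 1) 0 (map (vertex_expr ?w ?x (Var (v 12)) (Var (v 13))) [0..<?h])) ?Q s" if "s (v 0) 0 \<noteq> 0"
  proof -
    have "found_at n g s" using I that by (auto simp: Inv_def)
    then obtain w x y z c where f: "w < n ^ j" "x < ?N" "y < ?N" "z < ?N" "sol n g (int w) c (int x) (int y) (int z)"
      "s (v 11) 0 = int (w * ?N + x)" "s (v 12) 0 = int y" "s (v 13) 0 = int z"
      unfolding found_at_def by blast
    have n0: "0 < n" using f(1,2) vertices_pos by (cases n) (auto simp: power_0_left split: if_splits)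
    have W': "int (n ^ j * ?N) \<le> W" "int ?N \<le> W" "int (n ^ j) \<le> W" using fw by (auto simp: fits_word_def)
    let ?D = "image_of n (int w) (int x) (int y) (int z)"
    have room: "room W n s g" using fw st n0 by (auto simp: room_def fits_word_def)
    show ?thesis
    proof (rule wp_assign[where z = ?D])
      fix s' l assume s': "ok W s'" "keeps {v 1} s s'" "l < length (map (vertex_expr ?w ?x (Var (v 12)) (Var (v 13))) [0..<?h])"
      have r: "room W n s' g" by (rule room_keeps[OF room s'(1,2)]) auto
      have "(w * ?N + x) div ?N = w" "(w * ?N + x) mod ?N = x" using f(2) n0 by simp_all
      then have dm: "int (w * ?N + x) div int ?N = int w" "int (w * ?N + x) mod int ?N = int x"
        by (metis zdiv_int, metis zmod_int)
      have v: "ev W s' (Var (v 11)) (int (w * ?N + x))" "ev W s' (Var (v 21)) (int ?N)"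
        "ev W s' (Var (v 12)) (int y)" "ev W s' (Var (v 13)) (int z)"
        using s' f(6-8) s by (auto intro!: ev_Var)
      have "int w \<le> W" "int x \<le> W" using f(1,2) W' by linarith+
      then have "ev W s' ?w (int w)" "ev W s' ?x (int x)"
        using dm by (intro ev_Op[OF v(1,2)]; simp)+
      from ev_vertex[OF r this v(3,4), of l] s'(3)
      show "ev W s' (map (vertex_expr ?w ?x (Var (v 12)) (Var (v 13))) [0..<?h] ! l) (?D (0 + l))" by simp
    next
      fix s' assume s': "ok W s'" "keeps {v 1} s s'"
        "\<forall>l. 0 \<le> l \<and> l < 0 + length (map (vertex_expr ?w ?x (Var (v 12)) (Var (v 13))) [0..<?h]) \<longrightarrow> s' (v 1) (int l) = ?D l"
      have eq: "s' (v 1) (int l) = ?D l" if "l < ?h" for l using s'(3) that by simp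
      have "embedding n g ?h es ?D c" by (rule sol_embedding[OF n0 f(5)])
      then have "embedding n g ?h es (\<lambda>i. s' (v 1) (int i)) c"
        using eq es_less unfolding embedding_def by (fastforce simp: inj_on_def image_subset_iff)
      then show "?Q s'" using s'(2) by auto
    qed (use st W in auto)
  qed
  moreover have "?Q s" if "s (v 0) 0 = 0" using that by simp
  ultimately show "wp W place ?Q s"
    unfolding place_def using okD[OF st(2), of "v 0" 0] W by simp
qed

end

lemma int_less_power: "2 \<le> B \<Longrightarrow> int e \<le> B ^ e"
proof -
  assume "2 \<le> B"
  have "int e \<le> 2 ^ e" using of_nat_mono[OF less_imp_le[OF less_exp[of e]], where ?'a = int] by simp
  also have "\<dots> \<le> B ^ e" using \<open>2 \<le> B\<close> by (intro power_mono) auto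
  finally show ?thesis .
qed

context partitioned
begin

text \<open>With \<open>B = n + M + 2\<close>, the power \<open>B ^ (k + 3)\<close> bounds
  \<open>8 * n ^ k\<close> and with it the matrix sizes. Its power \<open>d\<^sub>0\<close> provides
  the words for the multiplication program and its square those for the number of entries; the
  remaining summands leave room for codes of tuples and for the indices of \<open>H\<close>.\<close>

definition word_exponent :: nat where
  "word_exponent = (k + 3) * (d\<^sub>0 + 2) + 3 * (j + k) + 4"

lemma fits_word_intro:
  assumes "(int n + int M + 2) ^ word_exponent \<le> W"
  shows "fits_word W n M"
proof -
  let ?B = "int n + int M + 2" let ?N = "int n ^ k"
  have pow: "?B ^ e \<le> W" if "e \<le> word_exponent" for e
    by (rule order_trans[OF power_increasing[OF that] assms]) simp
  have nB: "int n ^ i \<le> ?B ^ i" for i by (intro power_mono) auto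
  have B3: "8 * ?N \<le> ?B ^ (k + 3)" "8 \<le> ?B ^ (k + 3)"
  proof -
    have "2 ^ 3 \<le> ?B ^ 3" by (intro power_mono) auto
    then have 8: "8 \<le> ?B ^ 3" by simp
    have "1 \<le> ?B ^ k" by (rule one_le_power) simp
    then have "?N * 8 \<le> ?B ^ k * ?B ^ 3" "1 * 8 \<le> ?B ^ k * ?B ^ 3"
      using nB[of k] 8 by (intro mult_mono; simp)+
    then show "8 * ?N \<le> ?B ^ (k + 3)" "8 \<le> ?B ^ (k + 3)" by (simp_all add: power_add mult.commute)
  qed
  have N0: "0 \<le> ?N" by simp
  have B3': "2 * ?N + 3 \<le> ?B ^ (k + 3)"
  proof (cases "?N = 0")
    case False
    then have "1 \<le> ?N" using N0 by linarith
    then show ?thesis using B3 by linarith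
  qed (use B3 in simp)
  have B3'': "?B ^ (k + 3) \<le> W" by (rule pow) (simp add: word_exponent_def algebra_simps)
  have 1: "1 \<le> W" using pow[of 0] by simp
  have 2: "int n * int n \<le> W"
  proof -
    have "int n * int n \<le> ?B ^ 2" unfolding power2_eq_square by (intro mult_mono) auto
    also have "\<dots> \<le> W" by (rule pow) (simp add: word_exponent_def)
    finally show ?thesis .
  qed
  have 3: "int n ^ i \<le> W" if "i \<le> j + k" for i
    by (rule order_trans[OF nB pow]) (use that in \<open>simp add: word_exponent_def\<close>)
  have 4: "int M + 2 \<le> W" using pow[of 1] by (simp add: word_exponent_def)
  have 5: "(2 * ?N + 3) ^ d\<^sub>0 \<le> W"
  proof -
    have "(2 * ?N + 3) ^ d\<^sub>0 \<le> (?B ^ (k + 3)) ^ d\<^sub>0" using B3' by (intro power_mono) auto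
    also have "\<dots> = ?B ^ ((k + 3) * d\<^sub>0)" by (rule power_mult[symmetric])
    also have "\<dots> \<le> W" by (rule pow) (simp add: word_exponent_def algebra_simps)
    finally show ?thesis .
  qed
  have 6: "2 * ?N * (2 * ?N) \<le> W"
  proof -
    have "2 * ?N * (2 * ?N) \<le> ?B ^ (k + 3) * ?B ^ (k + 3)" using B3 N0 by (intro mult_mono) linarith+
    also have "\<dots> = ?B ^ ((k + 3) * 2)" by (simp only: power_mult power2_eq_square)
    also have "\<dots> \<le> W" by (rule pow) (simp add: word_exponent_def algebra_simps)
    finally show ?thesis .
  qed
  have 7: "3 * ?N \<le> W" using B3 B3'' N0 by linarith
  have 8: "int n ^ j * ?N \<le> W" using 3[of "j + k"] by (simp add: power_add)
  have 9: "int (j + 3 * k) \<le> W"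
    by (rule order_trans[OF int_less_power[of ?B] pow]) (simp_all add: word_exponent_def algebra_simps)
  show ?thesis
    unfolding fits_word_def using 1 2 3 4 5 6 7 8 9 by (simp add: algebra_simps)
qed

definition partition_program :: com where
  "partition_program = Seq init (Seq (Set (v 21) (npow v k)) (Seq search place))"

definition partition_const :: real where
  "partition_const = 2 * (2 powr \<omega> * loop_const + 10 + real (cost (npow v j))) + real (cost (npow v k)) + real (tmax place) + 102"

lemma partition_time:
  fixes n :: nat
  defines "y \<equiv> real n + 1"
  shows "100 * y\<^sup>2 + (2 + real (cost (npow v k)) +
     (real (n ^ j + 1) * (loop_const * (real (n ^ k) + 1) powr \<omega> + 10 + real (cost (npow v j))) + real (tmax place)))
     \<le> partition_const * y powr (\<omega> * real k + real j)"
proof -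
  let ?e = "\<omega> * real k + real j" let ?q = "y powr ?e"
  have y: "1 \<le> y" "0 < y" by (simp_all add: y_def)
  have q1: "1 \<le> ?q" using y exponent by (intro ge_one_powr_ge_zero) auto
  \<comment> \<open>Copying the input matrix is quadratic; the locale assumption
    \<open>exponent\<close> keeps this within the claimed bound.\<close>
  have q2: "y\<^sup>2 \<le> ?q" using powr_mono[OF exponent y(1)] y by (simp add: powr_numeral)
  have le1: "real (n ^ i) + 1 \<le> 2 * y ^ i" for i
  proof -
    have "real n ^ i \<le> y ^ i" "1 \<le> y ^ i" by (auto simp: y_def intro: power_mono one_le_power)
    then show ?thesis by simp
  qed
  have "(real (n ^ k) + 1) powr \<omega> \<le> (2 * y ^ k) powr \<omega>"
    using le1[of k] \<omega> by (intro powr_mono2) auto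
  also have "\<dots> = 2 powr \<omega> * (y ^ k) powr \<omega>" by (rule powr_mult; use y in simp)
  also have "(y ^ k) powr \<omega> = y powr (\<omega> * real k)"
    using y by (simp add: powr_realpow[symmetric] powr_powr mult.commute)
  finally have N: "(real (n ^ k) + 1) powr \<omega> \<le> 2 powr \<omega> * y powr (\<omega> * real k)" .
  have p1: "1 \<le> y powr (\<omega> * real k)" using y \<omega> by (intro ge_one_powr_ge_zero) auto
  let ?c = "10 + real (cost (npow v j))"
  have "loop_const * (real (n ^ k) + 1) powr \<omega> + ?c \<le> loop_const * (2 powr \<omega> * y powr (\<omega> * real k)) + ?c * y powr (\<omega> * real k)"
    using loop_const_nonneg N mult_left_mono[OF p1, of ?c] by (intro add_mono mult_left_mono) auto
  also have "\<dots> = (2 powr \<omega> * loop_const + ?c) * y powr (\<omega> * real k)" by (simp add: algebra_simps)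
  finally have 1: "loop_const * (real (n ^ k) + 1) powr \<omega> + ?c \<le> (2 powr \<omega> * loop_const + ?c) * y powr (\<omega> * real k)" .
  have j: "real (n ^ j + 1) \<le> 2 * y powr real j" using le1[of j] y by (simp add: powr_realpow)
  have "real (n ^ j + 1) * (loop_const * (real (n ^ k) + 1) powr \<omega> + ?c) \<le>
     (2 * y powr real j) * ((2 powr \<omega> * loop_const + ?c) * y powr (\<omega> * real k))"
    using loop_const_nonneg by (intro mult_mono j 1) auto
  also have "\<dots> = 2 * (2 powr \<omega> * loop_const + ?c) * ?q"
    by (simp add: powr_add algebra_simps)
  finally have 2: "real (n ^ j + 1) * (loop_const * (real (n ^ k) + 1) powr \<omega> + ?c) \<le> 2 * (2 powr \<omega> * loop_const + ?c) * ?q" .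
  let ?r = "2 + real (cost (npow v k)) + real (tmax place)"
  have 3: "?r \<le> ?r * ?q" using mult_left_mono[OF q1, of ?r] by simp
  have "100 * y\<^sup>2 + ?r + real (n ^ j + 1) * (loop_const * (real (n ^ k) + 1) powr \<omega> + ?c) \<le>
     100 * ?q + ?r * ?q + 2 * (2 powr \<omega> * loop_const + ?c) * ?q"
    by (intro add_mono 2 3 mult_left_mono q2) simp
  also have "\<dots> = partition_const * ?q" by (simp add: partition_const_def algebra_simps)
  finally show ?thesis by (simp add: algebra_simps)
qed

theorem detects_partitioned: "detects (j + 3 * k) es (\<omega> * real k + real j)"
proof -
  let ?h = "j + 3 * k"
  have "run W partition_program s (partition_const * (real n + 1) powr (\<omega> * real k + real j))
      (\<lambda>s'. if \<exists>f c. embedding n g ?h es f c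
        then s' (v 0) 0 = 1 \<and> (\<exists>c. embedding n g ?h es (\<lambda>i. s' (v 1) (int i)) c)
        else s' (v 0) 0 = 0)" (is "run _ _ _ _ ?Q")
    if cm: "colour_matrix n M g s" and ok: "ok W s" and W: "(int n + int M + 2) ^ word_exponent \<le> W" for n M g W s
  proof -
    have fw: "fits_word W n M" by (rule fits_word_intro[OF W])
    have Ws: "int (n * n) \<le> W" "1 \<le> W" "\<And>i. i \<le> k \<Longrightarrow> int n ^ i \<le> W" using fw by (auto simp: fits_word_def)
    have g: "\<And>x y. 0 \<le> g x y \<and> g x y \<le> int M + 1" using cm by (auto simp: colour_matrix_def)
    let ?ts = "real (n ^ j + 1) * (loop_const * (real (n ^ k) + 1) powr \<omega> + 10 + real (cost (npow v j)))"
    have "run W partition_program s (100 * (real n + 1)\<^sup>2 + (2 + real (cost (npow v k)) + (?ts + real (tmax place)))) ?Q"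
      unfolding partition_program_def
    proof (rule run_after_init[OF cm ok Ws(1,2)])
      fix s1 assume 1: "ok W s1" "stored n g s1" "s1 (v 0) 0 = 0"
      show "run W (Seq (Set (v 21) (npow v k)) (Seq search place)) s1 (2 + real (cost (npow v k)) + (?ts + real (tmax place))) ?Q"
      proof (rule run_Seq)
        have "ev W s1 (npow v k) (int n ^ k)"
          by (rule ev_npow) (use 1 Ws(3) in \<open>auto simp: stored_def\<close>)
        from run_Write[OF ev_Const[of 0 W] this, of "\<lambda>s'. s' (v 21) 0 = int n ^ k" "v 21"]
        show "run W (Set (v 21) (npow v k)) s1 (2 + real (cost (npow v k))) (\<lambda>s'. s' (v 21) 0 = int n ^ k)"
          using Ws(2) by simp
        fix s2 assume 2: "s2 (v 21) 0 = int n ^ k" "ok W s2" "keeps (writes (Set (v 21) (npow v k))) s1 s2"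
        have k2: "keeps {v 21} s1 s2" using 2(3) by simp
        have st2: "stored n g s2" by (rule stored_keeps[OF 1(2) k2]) auto
        show "run W (Seq search place) s2 (?ts + real (tmax place)) ?Q"
        proof (rule run_Seq)
          show "run W search s2 ?ts (Inv n g (\<exists>w<n ^ j. \<exists>x<n ^ k. class_solved n g w x))"
            by (rule run_search[OF fw st2 2(2) g]) (use 2(1) k2 1(3) in auto)
          fix s3 assume 3: "Inv n g (\<exists>w<n ^ j. \<exists>x<n ^ k. class_solved n g w x) s3" "ok W s3" "keeps (writes search) s2 s3"
          have k3: "keeps (insert (v 14) (insert (v 15) step_writes)) s2 s3"
            using 3(3) writes_class_loop by (auto simp: search_def)
          have st3: "stored n g s3" by (rule stored_keeps[OF st2 k3]) auto
          have N3: "s3 (v 21) 0 = int (n ^ k)" using 2(1) k3 by simp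
          show "run W place s3 (real (tmax place)) ?Q"
          proof (rule run_mono[OF run_place[OF fw st3 3(2) N3 3(1)]])
            fix s4 assume 4: "s4 (v 0) = s3 (v 0) \<and>
              (s3 (v 0) 0 = 1 \<longrightarrow> (\<exists>c. embedding n g ?h es (\<lambda>i. s4 (v 1) (int i)) c))"
            show "?Q s4"
            proof (cases "\<exists>f c. embedding n g ?h es f c")
              case True
              then have "\<exists>w<n ^ j. \<exists>x<n ^ k. class_solved n g w x" using class_solved_exists g by blast
              then have "s3 (v 0) 0 = 1" using 3(1) by (simp add: Inv_def)
              then show ?thesis unfolding if_P[OF True] using 4 by simp
            next
              case False
              have "s3 (v 0) 0 \<noteq> 1"
              proof
                assume "s3 (v 0) 0 = 1"
                with 4 have "\<exists>c. embedding n g ?h es (\<lambda>i. s4 (v 1) (int i)) c" by simp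
                with False show False by blast
              qed
              then have "s3 (v 0) 0 = 0" using 3(1) by (auto simp: Inv_def)
              then show ?thesis unfolding if_not_P[OF False] using 4 by simp
            qed
          qed (use 3 in auto)
        qed (use 2 in auto)
      qed (use 1 in auto)
    qed
    then show ?thesis
      by (rule run_mono) (use ok partition_time[of n] in auto)
  qed
  then show ?thesis unfolding detects_def by blast
qed

end

section \<open>Clocked programs\<close>

text \<open>
  The exponent \<open>\<omega>\<close> may be an uncomputable real, so that a program cannot compute a degree threshold
  that balances its running time.  Instead it runs a search with a clock, which counts
  the loop iterations, and gives up once the clock has run down.
\<close>

definition check :: "string \<Rightarrow> string \<Rightarrow> expr \<Rightarrow> com" where
  "check kv fv e = Cond (Var kv) (Set fv e) (Set fv (Const 0))"

definition tick :: "string \<Rightarrow> com" where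
  "tick kv = Set kv (Op Minus (Var kv) (Const 1))"

text \<open>Once the clock stands at \<open>0\<close>, the state may differ from that of the
  original run and its expressions need not fit into a word, so assignments and conditionals are
  skipped before anything is evaluated. For the same reason a loop condition is first copied to the
  flag \<open>fv\<close>, and only while the clock is alive; otherwise the flag becomes
  \<open>0\<close> and the loop ends.\<close>

primrec clocked :: "string \<Rightarrow> string \<Rightarrow> com \<Rightarrow> com" where
  "clocked kv fv Skip = Skip"
| "clocked kv fv (Write x e1 e2) = Cond (Var kv) (Write x e1 e2) Skip"
| "clocked kv fv (Seq c d) = Seq (clocked kv fv c) (clocked kv fv d)"
| "clocked kv fv (Cond e c d) = Cond (Var kv) (Cond e (clocked kv fv c) (clocked kv fv d)) Skip"
| "clocked kv fv (While e c) = Seq (check kv fv e)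
     (While (Var fv) (Seq (tick kv) (Seq (clocked kv fv c) (check kv fv e))))"

text \<open>Only loops repeat anything and each of their rounds consumes a tick. So the time is at
  most \<open>tick_time\<close> for every tick plus \<open>base_time\<close> once, regardless of the
  time of the original program.\<close>

primrec base_time :: "com \<Rightarrow> nat" where
  "base_time Skip = 1"
| "base_time (Write x e1 e2) = 4 + cost e1 + cost e2"
| "base_time (Seq c d) = base_time c + base_time d"
| "base_time (Cond e c d) = 4 + cost e + base_time c + base_time d"
| "base_time (While e c) = 9 + cost e"

primrec tick_time :: "com \<Rightarrow> nat" where
  "tick_time Skip = 0"
| "tick_time (Write x e1 e2) = 0"
| "tick_time (Seq c d) = tick_time c + tick_time d"
| "tick_time (Cond e c d) = tick_time c + tick_time d"
| "tick_time (While e c) = tick_time c + base_time c + 20 + cost e"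

lemma evars_keeps:
  "keeps X s s' \<Longrightarrow> evars e \<inter> X = {} \<Longrightarrow> val s' e = val s e \<and> fits W s' e = fits W s e"
  by (induction e) (simp_all add: Int_Un_distrib2)

lemma exec_check_dead:
  assumes "s kv 0 = 0" "0 \<le> W"
  shows "exec W (check kv fv e) s 6 (upd s fv 0 0)"
proof -
  have "exec W (Set fv (Const 0)) s 3 (upd s fv 0 0)"
    using exec.Write[of W s "Const 0" "Const 0" fv] assms by (simp add: upd_def eval_nat_numeral)
  from exec.Cond_false[OF _ _ this, of "Var kv" "Set fv e"] show ?thesis
    using assms by (simp add: check_def eval_nat_numeral)
qed

lemma exec_check_alive:
  assumes "s kv 0 = int b" "0 < b" "int b \<le> W" "fits W s e"
  shows "exec W (check kv fv e) s (5 + cost e) (upd s fv 0 (val s e))"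
proof -
  have "exec W (Set fv e) s (2 + cost e) (upd s fv 0 (val s e))"
    using exec.Write[of W s "Const 0" e fv] assms by (simp add: upd_def)
  from exec.Cond_true[OF _ _ this, of "Var kv" "Set fv (Const 0)"] show ?thesis
    using assms by (simp add: check_def eval_nat_numeral)
qed

text \<open>The clock is read before any expression of \<open>R\<close>, so the claim assumes
  nothing about the other arrays. The program text is passed once, without a round of any
  loop.\<close>

lemma exec_clocked_dead:
  assumes "kv \<noteq> fv" "kv \<notin> vars R" "0 \<le> W" "s kv 0 = 0"
  shows "\<exists>t s'. exec W (clocked kv fv R) s t s' \<and> t \<le> base_time R \<and> s' kv 0 = 0"
  using assms(2,4)
proof (induction R arbitrary: s)
  case Skip
  then show ?case using exec.Skip by fastforce
next
  case (Write x e1 e2)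
  have "exec W (Cond (Var kv) (Write x e1 e2) Skip) s (1 + cost (Var kv) + 1) s"
    by (rule exec.Cond_false[OF _ _ exec.Skip]) (use Write assms(3) in auto)
  then show ?case using Write by fastforce
next
  case (Seq c d)
  obtain t1 s1 where 1: "exec W (clocked kv fv c) s t1 s1" "t1 \<le> base_time c" "s1 kv 0 = 0"
    using Seq.IH(1)[of s] Seq.prems by auto
  obtain t2 s2 where 2: "exec W (clocked kv fv d) s1 t2 s2" "t2 \<le> base_time d" "s2 kv 0 = 0"
    using Seq.IH(2)[of s1] Seq.prems 1(3) by auto
  show ?case using exec.Seq[OF 1(1) 2(1)] 1(2) 2(2,3) by fastforce
next
  case (Cond e c d)
  have "exec W (Cond (Var kv) (Cond e (clocked kv fv c) (clocked kv fv d)) Skip) s (1 + cost (Var kv) + 1) s"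
    by (rule exec.Cond_false[OF _ _ exec.Skip]) (use Cond assms(3) in auto)
  then show ?case using Cond by fastforce
next
  case (While e c)
  let ?b = "Seq (tick kv) (Seq (clocked kv fv c) (check kv fv e))"
  have "exec W (While (Var fv) ?b) (upd s fv 0 0) (1 + cost (Var fv)) (upd s fv 0 0)"
    by (rule exec.While_false) (use assms(3) in auto)
  from exec.Seq[OF exec_check_dead[where kv = kv and s = s, OF While.prems(2) assms(3)] this]
  have "exec W (clocked kv fv (While e c)) s (6 + (1 + cost (Var fv))) (upd s fv 0 0)" by simp
  then show ?case using While.prems assms(1) by fastforce
qed

text \<open>A simulation of the original run: as long as the clock is positive, both states agree
  outside \<open>kv\<close> and \<open>fv\<close>. Every tick belongs to a loop round of the
  original run, which takes at least one step; this gives \<open>b \<le> b' + t\<close>, so a clock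
  set above the original running time cannot run out.\<close>

lemma exec_clocked:
  assumes "exec W R s t s'" "kv \<noteq> fv" "kv \<notin> vars R" "fv \<notin> vars R" "1 \<le> W"
    "keeps {kv, fv} s s0" "s0 kv 0 = int b" "int b \<le> W"
  shows "\<exists>t0 s0' b'. exec W (clocked kv fv R) s0 t0 s0' \<and> s0' kv 0 = int b' \<and> b' \<le> b \<and> b \<le> b' + t \<and>
    t0 \<le> tick_time R * (b - b') + base_time R \<and> (0 < b' \<longrightarrow> keeps {kv, fv} s' s0')"
  using assms(1,3,4,6-8)
proof (induction arbitrary: s0 b rule: exec.induct)
  case (Skip s)
  then show ?case using exec.Skip[of W s0] by (intro exI[of _ 1] exI[of _ s0] exI[of _ b]) auto
next
  case (Write s e1 e2 x)
  note pr = Write.prems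
  show ?case
  proof (cases "b = 0")
    case True
    then obtain t0 s0' where "exec W (clocked kv fv (Write x e1 e2)) s0 t0 s0'" "t0 \<le> base_time (Write x e1 e2)" "s0' kv 0 = 0"
      using exec_clocked_dead[of kv fv "Write x e1 e2" W s0] assms(2,5) pr by auto
    then show ?thesis using True by (intro exI[of _ t0] exI[of _ s0'] exI[of _ 0]) simp
  next
    case False
    have d: "evars e1 \<inter> {kv, fv} = {}" "evars e2 \<inter> {kv, fv} = {}" "x \<noteq> kv" "x \<noteq> fv" using pr(1,2) by auto
    note e = evars_keeps[OF pr(3) d(1), of W] evars_keeps[OF pr(3) d(2), of W]
    let ?s = "s0(x := (s0 x)(val s e1 := val s e2))"
    have "exec W (Write x e1 e2) s0 (1 + cost e1 + cost e2) ?s"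
      using exec.Write[of W s0 e1 e2 x] e Write.hyps by simp
    from exec.Cond_true[OF _ _ this, of "Var kv" Skip]
    have "exec W (clocked kv fv (Write x e1 e2)) s0 (1 + cost (Var kv) + (1 + cost e1 + cost e2)) ?s"
      using pr False assms(5) by simp
    moreover have "?s kv 0 = int b" "keeps {kv, fv} (s(x := (s x)(val s e1 := val s e2))) ?s"
      using pr d by auto
    ultimately show ?thesis by (intro exI conjI) (assumption | simp)+
  qed
next
  case (Seq P s t s' Q t' s'')
  obtain t1 s1 b1 where 1: "exec W (clocked kv fv P) s0 t1 s1" "s1 kv 0 = int b1" "b1 \<le> b" "b \<le> b1 + t"
    "t1 \<le> tick_time P * (b - b1) + base_time P" "0 < b1 \<longrightarrow> keeps {kv, fv} s' s1"
    using Seq.IH(1)[of s0 b] Seq.prems by auto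
  have "\<exists>t2 s2 b2. exec W (clocked kv fv Q) s1 t2 s2 \<and> s2 kv 0 = int b2 \<and> b2 \<le> b1 \<and> b1 \<le> b2 + t' \<and>
    t2 \<le> tick_time Q * (b1 - b2) + base_time Q \<and> (0 < b2 \<longrightarrow> keeps {kv, fv} s'' s2)"
  proof (cases "b1 = 0")
    case True
    then obtain t2 s2 where "exec W (clocked kv fv Q) s1 t2 s2" "t2 \<le> base_time Q" "s2 kv 0 = 0"
      using exec_clocked_dead[of kv fv Q W s1] assms(2,5) Seq.prems 1(2) by auto
    then show ?thesis using True by (intro exI[of _ t2] exI[of _ s2] exI[of _ 0]) simp
  next
    case False
    then show ?thesis using Seq.IH(2)[of s1 b1] Seq.prems 1 by auto
  qed
  then obtain t2 s2 b2 where 2: "exec W (clocked kv fv Q) s1 t2 s2" "s2 kv 0 = int b2" "b2 \<le> b1" "b1 \<le> b2 + t'"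
    "t2 \<le> tick_time Q * (b1 - b2) + base_time Q" "0 < b2 \<longrightarrow> keeps {kv, fv} s'' s2" by blast
  have "tick_time P * (b - b1) \<le> tick_time P * (b - b2)" "tick_time Q * (b1 - b2) \<le> tick_time Q * (b - b2)"
    using 1(3) 2(3) by (intro mult_left_mono; simp)+
  then have "t1 + t2 \<le> tick_time (Seq P Q) * (b - b2) + base_time (Seq P Q)"
    using 1(5) 2(5) unfolding tick_time.simps base_time.simps distrib_right by linarith
  moreover have "exec W (clocked kv fv (Seq P Q)) s0 (t1 + t2) s2" using exec.Seq[OF 1(1) 2(1)] by simp
  ultimately show ?case
    using 1(3,4) 2(2-4,6) by (intro exI[of _ "t1 + t2"] exI[of _ s2] exI[of _ b2]) auto
next
  case (Cond_true s e P t s' Q)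
  note pr = Cond_true.prems
  show ?case
  proof (cases "b = 0")
    case True
    then obtain t0 s0' where "exec W (clocked kv fv (Cond e P Q)) s0 t0 s0'" "t0 \<le> base_time (Cond e P Q)" "s0' kv 0 = 0"
      using exec_clocked_dead[of kv fv "Cond e P Q" W s0] assms(2,5) pr by auto
    then show ?thesis using True by (intro exI[of _ t0] exI[of _ s0'] exI[of _ 0]) simp
  next
    case False
    have d: "evars e \<inter> {kv, fv} = {}" using pr(1,2) by auto
    note e = evars_keeps[OF pr(3) d, of W]
    obtain t1 s1 b1 where 1: "exec W (clocked kv fv P) s0 t1 s1" "s1 kv 0 = int b1" "b1 \<le> b" "b \<le> b1 + t"
      "t1 \<le> tick_time P * (b - b1) + base_time P" "0 < b1 \<longrightarrow> keeps {kv, fv} s' s1"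
      using Cond_true.IH[of s0 b] pr by auto
    have "exec W (Cond e (clocked kv fv P) (clocked kv fv Q)) s0 (1 + cost e + t1) s1"
      using e Cond_true.hyps 1(1) by (intro exec.Cond_true) auto
    from exec.Cond_true[OF _ _ this, of "Var kv" Skip]
    have "exec W (clocked kv fv (Cond e P Q)) s0 (1 + cost (Var kv) + (1 + cost e + t1)) s1"
      using pr False assms(5) by simp
    then show ?thesis
      using 1 by (intro exI[of _ "1 + cost (Var kv) + (1 + cost e + t1)"] exI[of _ s1] exI[of _ b1]) (auto simp: distrib_right)
  qed
next
  case (Cond_false s e Q t s' P)
  note pr = Cond_false.prems
  show ?case
  proof (cases "b = 0")
    case True
    then obtain t0 s0' where "exec W (clocked kv fv (Cond e P Q)) s0 t0 s0'" "t0 \<le> base_time (Cond e P Q)" "s0' kv 0 = 0"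
      using exec_clocked_dead[of kv fv "Cond e P Q" W s0] assms(2,5) pr by auto
    then show ?thesis using True by (intro exI[of _ t0] exI[of _ s0'] exI[of _ 0]) simp
  next
    case False
    have d: "evars e \<inter> {kv, fv} = {}" using pr(1,2) by auto
    note e = evars_keeps[OF pr(3) d, of W]
    obtain t1 s1 b1 where 1: "exec W (clocked kv fv Q) s0 t1 s1" "s1 kv 0 = int b1" "b1 \<le> b" "b \<le> b1 + t"
      "t1 \<le> tick_time Q * (b - b1) + base_time Q" "0 < b1 \<longrightarrow> keeps {kv, fv} s' s1"
      using Cond_false.IH[of s0 b] pr by auto
    have "exec W (Cond e (clocked kv fv P) (clocked kv fv Q)) s0 (1 + cost e + t1) s1"
      using e Cond_false.hyps 1(1) by (intro exec.Cond_false) auto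
    from exec.Cond_true[OF _ _ this, of "Var kv" Skip]
    have "exec W (clocked kv fv (Cond e P Q)) s0 (1 + cost (Var kv) + (1 + cost e + t1)) s1"
      using pr False assms(5) by simp
    then show ?thesis
      using 1 by (intro exI[of _ "1 + cost (Var kv) + (1 + cost e + t1)"] exI[of _ s1] exI[of _ b1]) (auto simp: distrib_right)
  qed
next
  case (While_false s e P)
  note pr = While_false.prems
  let ?b = "Seq (tick kv) (Seq (clocked kv fv P) (check kv fv e))"
  show ?case
  proof (cases "b = 0")
    case True
    then obtain t0 s0' where "exec W (clocked kv fv (While e P)) s0 t0 s0'" "t0 \<le> base_time (While e P)" "s0' kv 0 = 0"
      using exec_clocked_dead[of kv fv "While e P" W s0] assms(2,5) pr by auto
    then show ?thesis using True by (intro exI[of _ t0] exI[of _ s0'] exI[of _ 0]) simp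
  next
    case False
    have d: "evars e \<inter> {kv, fv} = {}" using pr(1,2) by auto
    note e = evars_keeps[OF pr(3) d, of W]
    have wh: "exec W (While (Var fv) ?b) (upd s0 fv 0 0) (1 + cost (Var fv)) (upd s0 fv 0 0)"
      by (rule exec.While_false) (use assms(5) in auto)
    have chk: "exec W (check kv fv e) s0 (5 + cost e) (upd s0 fv 0 0)"
      using exec_check_alive[of s0 kv b W e fv] pr(4,5) e While_false.hyps False by simp
    have ex: "exec W (clocked kv fv (While e P)) s0 (5 + cost e + (1 + cost (Var fv))) (upd s0 fv 0 0)"
      unfolding clocked.simps by (rule exec.Seq[OF chk wh])
    have "upd s0 fv 0 0 kv 0 = int b" "keeps {kv, fv} s (upd s0 fv 0 0)"
      using pr assms(2) by auto
    with ex show ?thesis by (intro exI conjI) (assumption | simp)+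
  qed
next
  case (While_true s e P t s' t' s'')
  note pr = While_true.prems
  let ?b = "Seq (tick kv) (Seq (clocked kv fv P) (check kv fv e))"
  show ?case
  proof (cases "b = 0")
    case True
    then obtain t0 s0' where "exec W (clocked kv fv (While e P)) s0 t0 s0'" "t0 \<le> base_time (While e P)" "s0' kv 0 = 0"
      using exec_clocked_dead[of kv fv "While e P" W s0] assms(2,5) pr by auto
    then show ?thesis using True by (intro exI[of _ t0] exI[of _ s0'] exI[of _ 0]) simp
  next
    case False
    have d: "evars e \<inter> {kv, fv} = {}" using pr(1,2) by auto
    note e = evars_keeps[OF pr(3) d, of W]
    let ?s1 = "upd s0 fv 0 (val s e)" let ?s2 = "upd ?s1 kv 0 (int (b - 1))"
    have 1: "exec W (check kv fv e) s0 (5 + cost e) ?s1"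
      using exec_check_alive[of s0 kv b W e fv] pr(4,5) e While_true.hyps False by simp
    have 2: "exec W (tick kv) ?s1 6 ?s2"
      using exec.Write[of W ?s1 "Const 0" "Op Minus (Var kv) (Const 1)" kv] pr assms(2,5) False
      by (simp add: tick_def upd_def of_nat_diff eval_nat_numeral)
    have h: "kv \<notin> vars P" "fv \<notin> vars P" "keeps {kv, fv} s ?s2" "?s2 kv 0 = int (b - 1)" "int (b - 1) \<le> W"
      using pr by auto
    obtain t1 s3 b1 where 3: "exec W (clocked kv fv P) ?s2 t1 s3" "s3 kv 0 = int b1" "b1 \<le> b - 1" "b - 1 \<le> b1 + t"
      "t1 \<le> tick_time P * (b - 1 - b1) + base_time P" "0 < b1 \<longrightarrow> keeps {kv, fv} s' s3"
      using While_true.IH(1)[OF h] by blast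
    have "\<exists>t2 s4 b2. exec W (clocked kv fv (While e P)) s3 t2 s4 \<and> s4 kv 0 = int b2 \<and> b2 \<le> b1 \<and> b1 \<le> b2 + t' \<and>
      t2 \<le> tick_time (While e P) * (b1 - b2) + base_time (While e P) \<and> (0 < b2 \<longrightarrow> keeps {kv, fv} s'' s4)"
    proof (cases "b1 = 0")
      case True
      then obtain t2 s2 where "exec W (clocked kv fv (While e P)) s3 t2 s2" "t2 \<le> base_time (While e P)" "s2 kv 0 = 0"
        using exec_clocked_dead[of kv fv "While e P" W s3] assms(2,5) pr 3(2) by auto
      then show ?thesis using True by (intro exI[of _ t2] exI[of _ s2] exI[of _ 0]) simp
    next
      case False
      then show ?thesis using While_true.IH(2)[of s3 b1] pr 3 by auto
    qed
    then obtain t2 s4 b2 where 4: "exec W (clocked kv fv (While e P)) s3 t2 s4" "s4 kv 0 = int b2" "b2 \<le> b1" "b1 \<le> b2 + t'"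
      "t2 \<le> tick_time (While e P) * (b1 - b2) + base_time (While e P)" "0 < b2 \<longrightarrow> keeps {kv, fv} s'' s4" by blast
    \<comment> \<open>The clocked program for the remaining rounds begins with a check. This check
      is the one that ends the body of the present round, and what follows it is the inner loop
      itself.\<close>
    from 4(1) obtain tc tw sc where 5: "exec W (check kv fv e) s3 tc sc" "exec W (While (Var fv) ?b) sc tw s4" "t2 = tc + tw"
      by (auto elim: exec.cases)
    have body: "exec W ?b ?s1 (6 + (t1 + tc)) sc" by (rule exec.Seq[OF 2 exec.Seq[OF 3(1) 5(1)]])
    have fv: "val ?s1 (Var fv) \<noteq> 0" "fits W ?s1 (Var fv)"
      using While_true.hyps(2) fits_val[OF While_true.hyps(1)] assms(5) by simp_all
    have ex: "exec W (clocked kv fv (While e P)) s0 (5 + cost e + (1 + cost (Var fv) + (6 + (t1 + tc)) + tw)) s4"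
      unfolding clocked.simps by (rule exec.Seq[OF 1 exec.While_true[OF fv(2,1) body 5(2)]])
    have "b - 1 - b1 + 1 + (b1 - b2) = b - b2" using 3(3) 4(3) False by simp
    then have split: "tick_time (While e P) * (b - b2) =
        tick_time (While e P) * (b - 1 - b1) + tick_time (While e P) + tick_time (While e P) * (b1 - b2)"
      by (metis distrib_left mult.right_neutral)
    have tw: "tick_time (While e P) = tick_time P + base_time P + 20 + cost e"
      and bw: "base_time (While e P) = 9 + cost e" and c2: "cost (Var fv) = 2" by simp_all
    have "tick_time P * (b - 1 - b1) \<le> tick_time (While e P) * (b - 1 - b1)" by (intro mult_right_mono) auto
    then have "5 + cost e + (1 + cost (Var fv) + (6 + (t1 + tc)) + tw) \<le> tick_time (While e P) * (b - b2) + base_time (While e P)"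
      using 3(5) 4(5) 5(3) tw bw c2 unfolding split by linarith
    then show ?thesis
      using ex 4(2,6) 3(3,4) 4(3,4) by (intro exI conjI) (assumption | simp)+
  qed
qed

lemma writes_clocked: "writes (clocked kv fv R) \<subseteq> writes R \<union> {kv, fv}"
  by (induction R) (auto simp: check_def tick_def)

text \<open>A positive clock at the end certifies that the original program was carried out
  completely. The bound \<open>t\<close> enters only the guarantee of success and not the
  time.\<close>

lemma run_clocked:
  assumes "run W R s t Q" "kv \<noteq> fv" "kv \<notin> vars R" "fv \<notin> vars R" "1 \<le> W" "s kv 0 = int b" "int b \<le> W"
  shows "run W (clocked kv fv R) s (real (tick_time R) * real b + real (base_time R))
    (\<lambda>s'. 0 \<le> s' kv 0 \<and> (0 < s' kv 0 \<longrightarrow> (\<exists>s1. Q s1 \<and> keeps {kv, fv} s1 s')) \<and> (t < real b \<longrightarrow> 0 < s' kv 0))"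
proof -
  obtain t1 s1 where 1: "exec W R s t1 s1" "real t1 \<le> t" "Q s1" using assms(1) by (auto simp: run_def)
  obtain t0 s' b' where 2: "exec W (clocked kv fv R) s t0 s'" "s' kv 0 = int b'" "b' \<le> b" "b \<le> b' + t1"
    "t0 \<le> tick_time R * (b - b') + base_time R" "0 < b' \<longrightarrow> keeps {kv, fv} s1 s'"
    using exec_clocked[OF 1(1) assms(2-5), of s b] assms(6,7) by blast
  have "tick_time R * (b - b') \<le> tick_time R * b" by (intro mult_left_mono) auto
  then have "real t0 \<le> real (tick_time R * b + base_time R)" using 2(5) by linarith
  then have t0: "real t0 \<le> real (tick_time R) * real b + real (base_time R)" by simp
  have "0 < b'" if "t < real b" using that 1(2) 2(4) by linarith
  then show ?thesis unfolding run_def using 1(3) 2(1,2,6) t0 by (intro exI[of _ t0] exI[of _ s']) auto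
qed

section \<open>Monochromatic triangles\<close>

context mm_program
begin

abbreviation edge_at :: "expr \<Rightarrow> expr \<Rightarrow> expr" where
  "edge_at e1 e2 \<equiv> Read (v 3) (Op Plus (Op Times e1 (Var (v 2))) e2)"

abbreviation row_at :: "nat \<Rightarrow> expr \<Rightarrow> expr" where
  "row_at y e \<equiv> Read (v y) (Op Plus (Op Times (Var (v 29)) (Var (v 2))) e)"

lemma ev_edge_at:
  assumes "ok W s" "stored n g s" "ev W s e1 (int a)" "ev W s e2 (int b)" "a < n" "b < n" "int (n * n) \<le> W"
  shows "ev W s (edge_at e1 e2) (g (int a) (int b))"
proof -
  have "int (a * n + b) \<le> W" using row_major_less[OF assms(5,6)] assms(7) by linarith
  then have b: "\<bar>int (a * n)\<bar> \<le> W" "\<bar>int (a * n) + int b\<bar> \<le> W" by simp_all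
  have "ev W s (Var (v 2)) (int n)" using assms(1,2) by (intro ev_Var) (auto simp: stored_def)
  from ev_Op[OF assms(3) this] b(1) have "ev W s (Op Times e1 (Var (v 2))) (int (a * n))" by simp
  from ev_Op[OF this assms(4)] b(2) have "ev W s (Op Plus (Op Times e1 (Var (v 2))) e2) (int (a * n + b))" by simp
  from ev_Read[OF assms(1) this, of "v 3"] show ?thesis
    using assms(2,5,6) by (simp add: stored_def)
qed

lemma ev_row_at:
  assumes "ok W s" "s (v 29) 0 = c" "s (v 2) 0 = int n" "ev W s e (int i)" "i < n" "0 \<le> c" "c \<le> int M + 1"
    "(int M + 2) * int n \<le> W"
  shows "ev W s (row_at y e) (s (v y) (c * int n + int i))"
proof -
  have "0 \<le> c * int n" "c * int n \<le> (int M + 1) * int n" using assms by (auto intro: mult_right_mono)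
  then have "\<bar>c * int n\<bar> \<le> W" "\<bar>c * int n + int i\<bar> \<le> W" using assms(5,8) by (auto simp: algebra_simps)
  then have "ev W s (Op Plus (Op Times (Var (v 29)) (Var (v 2))) e) (c * int n + int i)"
    by (intro ev_Op[OF ev_Op[OF ev_Var[OF assms(1,2)] ev_Var[OF assms(1,3)]] assms(4)]) simp_all
  from ev_Read[OF assms(1) this] show ?thesis .
qed

definition tri :: "nat \<Rightarrow> (int \<Rightarrow> int \<Rightarrow> int) \<Rightarrow> int \<Rightarrow> nat \<Rightarrow> nat \<Rightarrow> nat \<Rightarrow> bool" where
  "tri n g c x y z \<longleftrightarrow> 0 < c \<and> x < n \<and> y < n \<and> z < n \<and> g (int x) (int y) = c \<and> g (int x) (int z) = c \<and> g (int y) (int z) = c"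

definition tri_inv :: "nat \<Rightarrow> (int \<Rightarrow> int \<Rightarrow> int) \<Rightarrow> bool \<Rightarrow> state \<Rightarrow> bool" where
  "tri_inv n g C s \<longleftrightarrow> (s (v 0) 0 = 0 \<or> s (v 0) 0 = 1 \<and>
     (\<exists>c x y z. tri n g c x y z \<and> s (v 11) 0 = int x \<and> s (v 12) 0 = int y \<and> s (v 13) 0 = int z)) \<and>
     (C \<longrightarrow> s (v 0) 0 = 1)"

lemma tri_inv_keeps: "tri_inv n g C s \<Longrightarrow> keeps X s s' \<Longrightarrow> X \<inter> v ` {0, 11, 12, 13} = {} \<Longrightarrow> tri_inv n g C s'"
proof -
  assume a: "tri_inv n g C s" "keeps X s s'" "X \<inter> v ` {0, 11, 12, 13} = {}"
  then have "s' (v 0) = s (v 0)" "s' (v 11) = s (v 11)" "s' (v 12) = s (v 12)" "s' (v 13) = s (v 13)" by auto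
  then show "tri_inv n g C s'" using a(1) by (simp add: tri_inv_def)
qed

lemma tri_inv_mono: "tri_inv n g C s \<Longrightarrow> (C' \<Longrightarrow> C) \<Longrightarrow> tri_inv n g C' s"
  by (auto simp: tri_inv_def)

definition heavies :: "nat \<Rightarrow> (int \<Rightarrow> int \<Rightarrow> int) \<Rightarrow> nat \<Rightarrow> int \<Rightarrow> nat \<Rightarrow> nat list" where
  "heavies n g D c x = filter (\<lambda>y. D < length (nbrs g y c n)) [0..<x]"

text \<open>The heavy vertices as known in the middle of row \<open>x\<close>: the vertex
  \<open>x\<close> joins as soon as its first \<open>k\<close> columns contain more than
  \<open>D\<close> neighbours. At \<open>k = n\<close> this is the list with which the next row
  starts.\<close>

definition heavy_list :: "nat \<Rightarrow> (int \<Rightarrow> int \<Rightarrow> int) \<Rightarrow> nat \<Rightarrow> nat \<Rightarrow> nat \<Rightarrow> int \<Rightarrow> nat list" where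
  "heavy_list n g D x k c = heavies n g D c x @ (if D < length (nbrs g x c k) then [x] else [])"

lemma heavies_0 [simp]: "heavies n g D c 0 = []"
  by (simp add: heavies_def)

lemma heavy_list_0: "heavy_list n g D x 0 = (\<lambda>c. heavies n g D c x)"
  by (simp add: heavy_list_def fun_eq_iff)

lemma heavy_list_n: "heavy_list n g D x n = (\<lambda>c. heavies n g D c (Suc x))"
  by (simp add: heavy_list_def heavies_def fun_eq_iff)

lemma length_heavies: "length (heavies n g D c x) \<le> x"
  using length_filter_le[of _ "[0..<x]"] by (simp add: heavies_def)

lemma set_heavies: "set (heavies n g D c x) = {y. y < x \<and> D < length (nbrs g y c n)}"
  by (auto simp: heavies_def)

definition colours :: "nat \<Rightarrow> (int \<Rightarrow> int \<Rightarrow> int) \<Rightarrow> int set" where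
  "colours n g = {g (int x) (int y) | x y. x < n \<and> y < n}"

definition stores :: "nat \<Rightarrow> (int \<Rightarrow> int \<Rightarrow> int) \<Rightarrow> (int \<Rightarrow> nat list) \<Rightarrow> state \<Rightarrow> bool" where
  "stores n g L s \<longleftrightarrow> (\<forall>c\<in>colours n g. s (v 31) c = int (length (L c)) \<and>
     (\<forall>i<length (L c). s (v 30) (c * int n + int i) = int (L c ! i)))"

lemma stores_keeps: "stores n g L s \<Longrightarrow> keeps X s s' \<Longrightarrow> v 30 \<notin> X \<Longrightarrow> v 31 \<notin> X \<Longrightarrow> stores n g L s'"
  by (simp add: stores_def)

lemma stores_push:
  assumes L: "stores n g L s" and len: "\<And>c. length (L c) \<le> n" "length (L c) < n" and c: "l = int (length (L c))"
  shows "stores n g (\<lambda>c'. if c' = c then L c @ [x] else L c') (upd (upd s (v 30) (c * int n + l) (int x)) (v 31) c (l + 1))"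
  unfolding stores_def
proof (intro ballI conjI allI impI)
  let ?L = "\<lambda>c'. if c' = c then L c @ [x] else L c'"
  let ?s = "upd (upd s (v 30) (c * int n + l) (int x)) (v 31) c (l + 1)"
  fix c' assume c': "c' \<in> colours n g"
  note L' = bspec[OF L[unfolded stores_def] c']
  show "?s (v 31) c' = int (length (?L c'))" using L' c by simp
  fix i assume i: "i < length (?L c')"
  then have "i < n" using len(1)[of c'] len(2) by (auto split: if_splits)
  then have "c' * int n + int i = c * int n + l \<longleftrightarrow> c' = c \<and> i = length (L c)"
    using c len(2) by (subst row_major_eq_int) auto
  then show "?s (v 30) (c' * int n + int i) = int (?L c' ! i)"
    using L' i by (auto simp: nth_append split: if_splits)
qed

definition hit_pair :: com where
  "hit_pair = Cond (eq_expr (edge_at (Var (v 26)) (row_at 28 (Var (v 34)))) (Var (v 29)))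
     (Seq (Set (v 0) (Const 1)) (Seq (Set (v 11) (Var (v 25))) (Seq (Set (v 12) (Var (v 26)))
       (Set (v 13) (row_at 28 (Var (v 34))))))) Skip"

definition push_heavy :: com where
  "push_heavy = Seq (Write (v 30) (Op Plus (Op Times (Var (v 29)) (Var (v 2))) (Read (v 31) (Var (v 29)))) (Var (v 25)))
     (Write (v 31) (Var (v 29)) (Op Plus (Read (v 31) (Var (v 29))) (Const 1)))"

text \<open>For a light \<open>x\<close> every pair of neighbours is inspected, at the larger of the
  two. For a heavy \<open>x\<close> the inspection ends when more than \<open>D\<close> earlier
  neighbours are listed, so the cost per matrix entry stays proportional to
  \<open>D\<close>.\<close>

definition light_pairs :: com where
  "light_pairs = Cond (Op Times (Op Less (Const 0) (Var (v 29))) (Op Less count_at (Op Plus (Var (v 33)) (Const 1))))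
     (For (v 34) count_at hit_pair) Skip"

text \<open>If the counter equals \<open>D\<close>, column \<open>k\<close> is neighbour number
  \<open>D + 1\<close> and makes \<open>x\<close> heavy. Testing for equality lets \<open>x\<close>
  enter the list of a colour only once.\<close>

definition tri_act :: com where
  "tri_act = Seq light_pairs (Cond (eq_expr count_at (Var (v 33))) push_heavy Skip)"

definition light_hit :: "(int \<Rightarrow> int \<Rightarrow> int) \<Rightarrow> nat \<Rightarrow> nat \<Rightarrow> nat \<Rightarrow> bool" where
  "light_hit g D x k \<longleftrightarrow> (let c = g (int x) (int k); L = nbrs g x c k in
     0 < c \<and> length L \<le> D \<and> (\<exists>y\<in>set L. g (int k) (int y) = c))"

definition act_cost :: nat where
  "act_cost = tmax hit_pair + tmax push_heavy + 100"

lemma run_light_pairs: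
  assumes ok: "ok W s" and st: "stored n g s" and W: "int (n * n) \<le> W" "(int M + 2) * int n \<le> W" "int M + 2 \<le> W"
    "int D + 1 \<le> W"
    and g: "\<And>x y. 0 \<le> g x y \<and> g x y \<le> int M + 1" and g_sym: "\<And>x y. g x y = g y x"
    and xk: "x < n" "k < n" "s (v 25) 0 = int x" "s (v 26) 0 = int k" "s (v 29) 0 = g (int x) (int k)" "s (v 33) 0 = int D"
    and L: "listed n g x k s" and I: "tri_inv n g C s"
  shows "run W light_pairs s (real (D + 1) * real (tmax hit_pair + 13) + 20) (tri_inv n g (C \<or> light_hit g D x k))"
proof -
  let ?c = "g (int x) (int k)" let ?L = "nbrs g x ?c k"
  let ?e = "Op Times (Op Less (Const 0) (Var (v 29))) (Op Less count_at (Op Plus (Var (v 33)) (Const 1)))"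
  have W1: "1 \<le> W" using W(3) by linarith
  have c: "?c \<in> g (int x) ` int ` {..<n}" using xk(2) by auto
  have Ld: "s' (v 27) ?c = int (length ?L)" "i < length ?L \<Longrightarrow> s' (v 28) (?c * int n + int i) = int (?L ! i)"
    if "listed n g x k s'" for s' i
    using bspec[OF that[unfolded listed_def] c] by blast+
  have lk: "length ?L \<le> k" by (rule length_nbrs)
  have nW: "int n \<le> W"
  proof -
    have "n \<le> n * n" by simp
    then show ?thesis using W(1) by linarith
  qed
  have cnt: "ev W s' count_at (int (length ?L))" if "ok W s'" "s' (v 29) 0 = ?c" "listed n g x k s'" for s'
    using ev_Read[OF that(1) ev_Var[OF that(1,2)], of "v 27"] Ld(1)[OF that(3)] by simp
  have e: "ev W s ?e (of_bool (0 < ?c \<and> int (length ?L) < int D + 1))"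
    using W W1 xk by (intro ev_And ev_Less cnt ok L ev_Op[OF ev_Var[OF ok xk(6)] ev_Const] ev_Const ev_Var) auto
  have "run W light_pairs s (1 + real (cost ?e) + (1 + real (D + 1) * (real (tmax hit_pair) + 10 + real (cost count_at))))
     (tri_inv n g (C \<or> light_hit g D x k))"
    unfolding light_pairs_def
  proof (rule run_Cond[OF e])
    assume "of_bool (0 < ?c \<and> int (length ?L) < int D + 1) \<noteq> (0 :: int)"
    then have lt: "0 < ?c" "length ?L \<le> D" by auto
    let ?I = "\<lambda>i. tri_inv n g (C \<or> (\<exists>y\<in>set (take i ?L). g (int k) (int y) = ?c))"
    have "run W (For (v 34) count_at hit_pair) s (real (length ?L + 1) * (real (tmax hit_pair) + 10 + real (cost count_at)))
      (?I (length ?L))"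
    proof (rule run_For_const[where I = ?I])
      show "?I 0 (upd s (v 34) 0 0)" by (rule tri_inv_keeps[where s = s and X = "{v 34}"]) (use I in auto)
      have w: "keeps (v ` {34, 0, 11, 12, 13}) s s'" if "keeps (insert (v 34) (writes hit_pair)) s s'" for s'
        using that by (auto simp: hit_pair_def)
      show "ev W s' count_at (int (length ?L))" if "ok W s'" "keeps (insert (v 34) (writes hit_pair)) s s'" for s'
        by (rule cnt[OF that(1) _ listed_keeps[OF L w[OF that(2)]]]) (use w[OF that(2)] xk in auto)
      fix i s1 assume 1: "i < length ?L" "ok W s1" "keeps (insert (v 34) (writes hit_pair)) s s1" "s1 (v 34) 0 = int i"
        "?I i s1"
      have k1: "keeps (v ` {34, 0, 11, 12, 13}) s s1" by (rule w[OF 1(3)])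
      have st1: "stored n g s1" by (rule stored_keeps[OF st k1]) auto
      have L1: "listed n g x k s1" by (rule listed_keeps[OF L k1]) auto
      have s1: "s1 (v 25) 0 = int x" "s1 (v 26) 0 = int k" "s1 (v 29) 0 = ?c" "s1 (v 2) 0 = int n"
        using k1 xk st by (auto simp: stored_def)
      let ?u = "?L ! i"
      have "?u \<in> set ?L" using 1(1) by simp
      then have u: "?u < k" "g (int x) (int ?u) = ?c" by (auto simp: set_nbrs)
      have U: "ev W s2 (row_at 28 (Var (v 34))) (int ?u)" if "ok W s2" "keeps (v ` {0, 11, 12}) s1 s2" for s2
      proof -
        have "ev W s2 (row_at 28 (Var (v 34))) (s2 (v 28) (?c * int n + int i))"
          by (rule ev_row_at[where M = M]) (use that s1 1 g lk xk(2) W in \<open>auto intro: ev_Var\<close>)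
        moreover have "s2 (v 28) (?c * int n + int i) = int ?u"
          using that(2) Ld(2)[OF L1 1(1)] by simp
        ultimately show ?thesis by simp
      qed
      have E: "ev W s1 (eq_expr (edge_at (Var (v 26)) (row_at 28 (Var (v 34)))) (Var (v 29))) (of_bool (g (int k) (int ?u) = ?c))"
        by (intro ev_eq ev_edge_at[where n = n] U) (use 1 st1 s1 u xk W W1 in \<open>auto intro: ev_Var\<close>)
      let ?Q = "\<lambda>s''. ?I (Suc i) (upd s'' (v 34) 0 (int (Suc i)))"
      have tk: "take (Suc i) ?L = take i ?L @ [?u]" using 1(1) by (rule take_Suc_conv_app_nth)
      have "wp W hit_pair ?Q s1"
        unfolding hit_pair_def wp.simps(4)
      proof (intro conjI impI)
        show "fits W s1 (eq_expr (edge_at (Var (v 26)) (row_at 28 (Var (v 34)))) (Var (v 29)))"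
          using E by (simp add: ev_def)
        assume "val s1 (eq_expr (edge_at (Var (v 26)) (row_at 28 (Var (v 34)))) (Var (v 29))) \<noteq> 0"
        then have eq: "g (int k) (int ?u) = ?c" using E by (simp add: ev_def split: if_splits)
        let ?s2 = "upd (upd (upd s1 (v 0) 0 1) (v 11) 0 (int x)) (v 12) 0 (int k)"
        have ok2: "ok W ?s2" using 1(2) W1 nW xk by simp
        have U2: "fits W ?s2 (row_at 28 (Var (v 34)))" "val ?s2 (row_at 28 (Var (v 34))) = int ?u"
          using U[OF ok2] by (auto simp: ev_def simp del: fits.simps val.simps)
        have "tri n g ?c x k ?u" using lt(1) xk(1,2) u eq by (auto simp: tri_def)
        then have "?Q (upd ?s2 (v 13) 0 (int ?u))"
          unfolding tri_inv_def by (intro conjI disjI2 exI[of _ ?c] exI[of _ x] exI[of _ k] exI[of _ ?u]) auto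
        then show "wp W (Seq (Set (v 0) (Const 1)) (Seq (Set (v 11) (Var (v 25))) (Seq (Set (v 12) (Var (v 26)))
           (Set (v 13) (row_at 28 (Var (v 34))))))) ?Q s1"
          using U2 s1 W1 nW xk(1,2) by (simp del: upd_apply add: upd_apply[of _ _ _ _ "v 25"] upd_apply[of _ _ _ _ "v 26"])
      next
        assume "val s1 (eq_expr (edge_at (Var (v 26)) (row_at 28 (Var (v 34)))) (Var (v 29))) = 0"
        then have "g (int k) (int ?u) \<noteq> ?c" using E by (simp add: ev_def split: if_splits)
        then have "?I (Suc i) s1" using 1(5) unfolding tk by simp
        then show "wp W Skip ?Q s1"
          unfolding wp.simps by (rule tri_inv_keeps[where X = "{v 34}"]) auto
      qed
      then show "run W hit_pair s1 (real (tmax hit_pair)) ?Q" by (rule run_wp)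
    qed (use ok W1 nW lk xk in \<open>auto simp: hit_pair_def\<close>)
    then show "run W (For (v 34) count_at hit_pair) s (1 + real (D + 1) * (real (tmax hit_pair) + 10 + real (cost count_at)))
      (tri_inv n g (C \<or> light_hit g D x k))"
    proof (rule run_mono)
      have "real (length ?L + 1) * (real (tmax hit_pair) + 10 + real (cost count_at)) \<le> real (D + 1) * (real (tmax hit_pair) + 10 + real (cost count_at))"
        using lt(2) by (intro mult_right_mono) auto
      then show "real (length ?L + 1) * (real (tmax hit_pair) + 10 + real (cost count_at)) \<le> 1 + real (D + 1) * (real (tmax hit_pair) + 10 + real (cost count_at))"
        by linarith
    qed (use ok in \<open>auto elim!: tri_inv_mono simp: light_hit_def Let_def\<close>)
  next
    assume "of_bool (0 < ?c \<and> int (length ?L) < int D + 1) = (0 :: int)"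
    then have "\<not> light_hit g D x k" by (auto simp: light_hit_def Let_def)
    then have "tri_inv n g (C \<or> light_hit g D x k) s" using I by simp
    from run_Skip[of "tri_inv n g (C \<or> light_hit g D x k)", OF this]
    show "run W Skip s (1 + real (D + 1) * (real (tmax hit_pair) + 10 + real (cost count_at))) (tri_inv n g (C \<or> light_hit g D x k))"
      by (rule run_mono) (use ok in auto)
  qed
  then show ?thesis by (rule run_mono) (use ok in \<open>auto simp: algebra_simps\<close>)
qed

end

context mm_program
begin

lemma heavy_list_Suc:
  "heavy_list n g D x (Suc k) c' = (if c' = g (int x) (int k) \<and> length (nbrs g x c' k) = D
     then heavy_list n g D x k c' @ [x] else heavy_list n g D x k c')"
  by (auto simp: heavy_list_def nbrs_Suc)

lemma length_heavy_list: "x < n \<Longrightarrow> length (heavy_list n g D x k c) \<le> n"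
  using length_heavies[of n g D c x] by (simp add: heavy_list_def)

lemma run_tri_act:
  assumes ok: "ok W s" and st: "stored n g s" and W: "int (n * n) \<le> W" "(int M + 2) * int n \<le> W" "int M + 2 \<le> W"
    "int D + 1 \<le> W"
    and g: "\<And>x y. 0 \<le> g x y \<and> g x y \<le> int M + 1" and g_sym: "\<And>x y. g x y = g y x"
    and xk: "x < n" "k < n" "s (v 25) 0 = int x" "s (v 26) 0 = int k" "s (v 29) 0 = g (int x) (int k)" "s (v 33) 0 = int D"
    and L: "listed n g x k s" and I: "tri_inv n g C s" and S: "stores n g (heavy_list n g D x k) s"
  shows "run W tri_act s (real (D + 1) * real act_cost) (\<lambda>s'. tri_inv n g (C \<or> light_hit g D x k) s' \<and>
    stores n g (heavy_list n g D x (Suc k)) s' \<and> s' (v 33) 0 = int D)"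
proof -
  let ?c = "g (int x) (int k)" let ?L = "nbrs g x ?c k" let ?H = "heavy_list n g D x k"
  let ?C = "C \<or> light_hit g D x k"
  let ?Q = "\<lambda>s'. tri_inv n g ?C s' \<and> stores n g (heavy_list n g D x (Suc k)) s' \<and> s' (v 33) 0 = int D"
  have W1: "1 \<le> W" using W(3) by linarith
  have nW: "int n \<le> W"
  proof -
    have "n \<le> n * n" by simp
    then show ?thesis using W(1) by linarith
  qed
  let ?P = "Cond (eq_expr count_at (Var (v 33))) push_heavy Skip"
  have "run W tri_act s ((real (D + 1) * real (tmax hit_pair + 13) + 20) + real (tmax ?P)) ?Q"
    unfolding tri_act_def
  proof (rule run_Seq[OF run_light_pairs[OF ok st W g g_sym xk L I] ok])
    fix s1 assume 1: "tri_inv n g ?C s1" "ok W s1" "keeps (writes light_pairs) s s1"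
    have k1: "keeps (v ` {34, 0, 11, 12, 13}) s s1" using 1(3) by (auto simp: light_pairs_def hit_pair_def)
    have s1: "s1 (v 25) 0 = int x" "s1 (v 29) 0 = ?c" "s1 (v 33) 0 = int D" "s1 (v 2) 0 = int n"
      using k1 xk st by (auto simp: stored_def)
    have S1: "stores n g ?H s1" by (rule stores_keeps[OF S k1]) auto
    have c: "?c \<in> g (int x) ` int ` {..<n}" "?c \<in> colours n g" using xk(1,2) by (auto simp: colours_def)
    have "s1 (v 27) ?c = int (length ?L)"
      using bspec[OF L[unfolded listed_def] c(1)] k1 by simp
    then have cnt: "ev W s1 count_at (int (length ?L))"
      using ev_Read[OF 1(2) ev_Var[OF 1(2) s1(2)], of "v 27"] by simp
    have E: "ev W s1 (eq_expr count_at (Var (v 33))) (of_bool (int (length ?L) = int D))"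
      by (intro ev_eq cnt ev_Var 1(2) s1 W1)
    have "wp W ?P ?Q s1"
      unfolding wp.simps(4)
    proof (intro conjI impI)
      show "fits W s1 (eq_expr count_at (Var (v 33)))" using E by (simp add: ev_def)
      assume "val s1 (eq_expr count_at (Var (v 33))) \<noteq> 0"
      then have D: "length ?L = D" using E by (simp add: ev_def split: if_splits)
      let ?l = "int (length (?H ?c))"
      have H: "?H ?c = heavies n g D ?c x" using D by (simp add: heavy_list_def)
      then have ln: "length (?H ?c) < n" using length_heavies[of n g D ?c x] xk(1) by simp
      have l1: "s1 (v 31) ?c = ?l" using bspec[OF S1[unfolded stores_def] c(2)] by simp
      let ?s2 = "upd (upd s1 (v 30) (?c * int n + ?l) (int x)) (v 31) ?c (?l + 1)"
      have "stores n g (\<lambda>c'. if c' = ?c then ?H ?c @ [x] else ?H c') ?s2"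
        by (rule stores_push[OF S1 length_heavy_list[OF xk(1)] ln refl])
      moreover have "(\<lambda>c'. if c' = ?c then ?H ?c @ [x] else ?H c') = heavy_list n g D x (Suc k)"
        using D by (auto simp: heavy_list_Suc)
      ultimately have "stores n g (heavy_list n g D x (Suc k)) ?s2" by simp
      moreover have "tri_inv n g ?C ?s2" by (rule tri_inv_keeps[OF 1(1), of "{v 30, v 31}"]) auto
      ultimately have Q: "?Q ?s2" using s1(3) by simp
      have "0 \<le> ?c" "?c \<le> int M + 1" using g by auto
      then have "0 \<le> ?c * int n" "?c * int n \<le> (int M + 1) * int n" by (auto intro: mult_right_mono)
      then have "\<bar>?c * int n\<bar> \<le> W" "\<bar>?c * int n + ?l\<bar> \<le> W" "\<bar>?c\<bar> \<le> W" "\<bar>?l\<bar> \<le> W" "\<bar>?l + 1\<bar> \<le> W" "\<bar>int x\<bar> \<le> W"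
        using ln W(2,3) nW xk(1) \<open>0 \<le> ?c\<close> \<open>?c \<le> int M + 1\<close> by (auto simp: algebra_simps)
      then show "wp W push_heavy ?Q s1"
        using s1 l1 Q W1 nW unfolding push_heavy_def wp.simps(2,3)
        by (simp del: upd_apply add: upd_apply[of _ _ _ _ "v 31"] upd_apply[of _ _ _ _ "v 29"])
    next
      assume "val s1 (eq_expr count_at (Var (v 33))) = 0"
      then have "length ?L \<noteq> D" using E by (simp add: ev_def split: if_splits)
      then have "heavy_list n g D x (Suc k) = ?H" by (auto simp: heavy_list_Suc)
      then show "wp W Skip ?Q s1" using 1(1) S1 s1(3) by simp
    qed
    then show "run W ?P s1 (real (tmax ?P)) ?Q" by (rule run_wp)
  qed
  then show ?thesis
  proof (rule run_mono)
    have "real (D + 1) * real act_cost = real (D + 1) * real (tmax hit_pair + 13) + real (D + 1) * real (tmax push_heavy + 87)"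
      by (simp add: act_cost_def algebra_simps)
    moreover have "1 * real (tmax push_heavy + 87) \<le> real (D + 1) * real (tmax push_heavy + 87)"
      by (intro mult_right_mono) auto
    moreover have "real (tmax ?P) + 20 \<le> 1 * real (tmax push_heavy + 87)"
      by (simp add: eq_expr_def push_heavy_def)
    ultimately show "(real (D + 1) * real (tmax hit_pair + 13) + 20) + real (tmax ?P) \<le> real (D + 1) * real act_cost"
      by linarith
  qed (use ok in auto)
qed

lemma run_tri_scan:
  assumes ok: "ok W s" and st: "stored n g s" and W: "int (n * n) \<le> W" "(int M + 2) * int n \<le> W" "int M + 2 \<le> W"
    "int D + 1 \<le> W"
    and g: "\<And>x y. 0 \<le> g x y \<and> g x y \<le> int M + 1" and g_sym: "\<And>x y. g x y = g y x"
    and s: "s (v 0) 0 = 0" "s (v 33) 0 = int D" "stores n g (\<lambda>c. []) s"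
  shows "run W (scan tri_act) s ((real n + 1)\<^sup>2 * (real (D + 1) * real act_cost + 200))
    (\<lambda>s'. tri_inv n g (\<exists>x<n. \<exists>k<n. light_hit g D x k) s' \<and> stores n g (\<lambda>c. heavies n g D c n) s')"
proof -
  let ?C = "\<lambda>x k. (\<exists>x'<x. \<exists>k'<n. light_hit g D x' k') \<or> (\<exists>k'<k. light_hit g D x k')"
  let ?I = "\<lambda>x k s'. tri_inv n g (?C x k) s' \<and> stores n g (heavy_list n g D x k) s' \<and> s' (v 33) 0 = int D"
  have "run W (scan tri_act) s ((real n + 1)\<^sup>2 * (real (D + 1) * real act_cost + 200)) (?I n 0)"
  proof (rule run_scan[where M = M and g = g and Inv = ?I])
    show "writes tri_act \<inter> v ` {2, 3, 25, 26, 27, 28, 29} = {}"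
      by (auto simp: tri_act_def light_pairs_def hit_pair_def push_heavy_def)
    show "?I 0 0 s" using s by (simp add: tri_inv_def heavy_list_0)
    show "?I (Suc x) 0 s'" if "?I x n s'" for x s'
    proof -
      have "?C (Suc x) 0 \<Longrightarrow> ?C x n" by (auto simp: less_Suc_eq)
      then show ?thesis using that tri_inv_mono[of n g "?C x n" s' "?C (Suc x) 0"] by (simp add: heavy_list_0 heavy_list_n)
    qed
    show "?I x k s2" if "?I x k s1" "keeps (v ` {25, 26, 27, 28, 29}) s1 s2" for x k s1 s2
    proof (intro conjI)
      show "tri_inv n g (?C x k) s2" by (rule tri_inv_keeps[OF conjunct1[OF that(1)] that(2)]) auto
      show "stores n g (heavy_list n g D x k) s2"
        by (rule stores_keeps[OF conjunct1[OF conjunct2[OF that(1)]] that(2)]) auto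
    qed (use that in auto)
  next
    fix x k s' assume a: "ok W s'" "x < n" "k < n" "s' (v 25) 0 = int x" "s' (v 26) 0 = int k"
      "s' (v 29) 0 = g (int x) (int k)" "stored n g s'" "listed n g x k s'" "?I x k s'"
    have "run W tri_act s' (real (D + 1) * real act_cost) (\<lambda>s'. tri_inv n g (?C x k \<or> light_hit g D x k) s' \<and>
      stores n g (heavy_list n g D x (Suc k)) s' \<and> s' (v 33) 0 = int D)"
      by (rule run_tri_act[OF a(1,7) W g g_sym a(2-6)]) (use a(8,9) in auto)
    then show "run W tri_act s' (real (D + 1) * real act_cost) (?I x (Suc k))"
    proof (rule run_mono)
      fix s'' assume i: "tri_inv n g (?C x k \<or> light_hit g D x k) s'' \<and>
        stores n g (heavy_list n g D x (Suc k)) s'' \<and> s'' (v 33) 0 = int D"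
      have "?C x (Suc k) \<Longrightarrow> ?C x k \<or> light_hit g D x k" by (auto simp: less_Suc_eq)
      then show "?I x (Suc k) s''" using i tri_inv_mono by blast
    qed (use a in auto)
  qed (use ok st W g in auto)
  then show ?thesis
    by (rule run_mono) (use ok in \<open>auto simp: heavy_list_0\<close>)
qed

text \<open>The counters are reached through the matrix entries, so the time is quadratic however
  large the colour numbers are.\<close>

definition reset_heavy :: com where
  "reset_heavy = For (v 32) (Op Times (Var (v 2)) (Var (v 2))) (Write (v 31) (Read (v 3) (Var (v 32))) (Const 0))"

definition entry :: "nat \<Rightarrow> (int \<Rightarrow> int \<Rightarrow> int) \<Rightarrow> nat \<Rightarrow> int" where
  "entry n g e = g (int (e div n)) (int (e mod n))"

lemma colours_entry: "colours n g = entry n g ` {..<n * n}"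
proof
  show "colours n g \<subseteq> entry n g ` {..<n * n}"
  proof
    fix c assume "c \<in> colours n g"
    then obtain x y where xy: "x < n" "y < n" "c = g (int x) (int y)" by (auto simp: colours_def)
    then have "entry n g (x * n + y) = c" by (simp add: entry_def)
    then show "c \<in> entry n g ` {..<n * n}" using row_major_less[OF xy(1,2)] by blast
  qed
  show "entry n g ` {..<n * n} \<subseteq> colours n g"
  proof
    fix c assume "c \<in> entry n g ` {..<n * n}"
    then obtain e where e: "e < n * n" "c = entry n g e" by auto
    then have "e div n < n" "e mod n < n" by (cases n; simp add: less_mult_imp_div_less)+
    then show "c \<in> colours n g" using e(2) unfolding entry_def colours_def by blast
  qed
qed

lemma ev_entry:
  assumes "ok W s" "stored n g s" "s (v 32) 0 = int e" "e < n * n"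
  shows "ev W s (Read (v 3) (Var (v 32))) (entry n g e)"
proof -
  have "e div n < n" "e mod n < n" using assms(4) by (cases n; simp add: less_mult_imp_div_less)+
  then have "s (v 3) (int (e div n * n + e mod n)) = entry n g e"
    using assms(2) unfolding stored_def entry_def by blast
  then have "s (v 3) (int e) = entry n g e" by (simp only: div_mult_mod_eq)
  then show ?thesis using ev_Read[OF assms(1) ev_Var[OF assms(1,3)], of "v 3"] by simp
qed

lemma ev_square:
  "ok W s \<Longrightarrow> stored n g s \<Longrightarrow> int (n * n) \<le> W \<Longrightarrow> ev W s (Op Times (Var (v 2)) (Var (v 2))) (int (n * n))"
  by (intro ev_Op[where a = "int n" and b = "int n"] ev_Var) (auto simp: stored_def)

lemma run_reset_heavy:
  assumes "ok W s" "stored n g s" "int (n * n) \<le> W" "1 \<le> W"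
  shows "run W reset_heavy s (real (n * n + 1) * 20) (stores n g (\<lambda>c. []))"
proof -
  let ?c = "Write (v 31) (Read (v 3) (Var (v 32))) (Const 0)"
  have "run W reset_heavy s (real (n * n + 1) * (5 + 10 + real (cost (Op Times (Var (v 2)) (Var (v 2))))))
     (\<lambda>s'. \<forall>e<n * n. s' (v 31) (entry n g e) = 0)"
    unfolding reset_heavy_def
  proof (rule run_For_const[where I = "\<lambda>i s'. \<forall>e<i. s' (v 31) (entry n g e) = 0"])
    have st: "stored n g s'" if "keeps (insert (v 32) (writes ?c)) s s'" for s'
      by (rule stored_keeps[OF assms(2) that]) auto
    show "ev W s' (Op Times (Var (v 2)) (Var (v 2))) (int (n * n))" if "ok W s'" "keeps (insert (v 32) (writes ?c)) s s'" for s'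
      by (rule ev_square[OF that(1) st[OF that(2)] assms(3)])
    fix i s' assume i: "i < n * n" "ok W s'" "keeps (insert (v 32) (writes ?c)) s s'" "s' (v 32) 0 = int i"
      "\<forall>e<i. s' (v 31) (entry n g e) = 0"
    from run_Write[OF ev_entry[OF i(2) st[OF i(3)] i(4,1)] ev_Const[of 0 W s'],
      of "\<lambda>s''. \<forall>e<Suc i. upd s'' (v 32) 0 (int (Suc i)) (v 31) (entry n g e) = 0" "v 31"] i(5) assms(4)
    show "run W ?c s' 5 (\<lambda>s''. \<forall>e<Suc i. upd s'' (v 32) 0 (int (Suc i)) (v 31) (entry n g e) = 0)"
      by (auto simp: less_Suc_eq)
  qed (use assms in auto)
  then show ?thesis
    by (rule run_mono) (use assms in \<open>auto simp: stores_def colours_entry\<close>)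
qed

end

section \<open>Matrix products on the heavy vertices of each colour\<close>

context mm_program
begin

abbreviation "pair_test i j \<equiv> eq_expr (edge_at (row_at 30 (Var (v i))) (row_at 30 (Var (v j)))) (Var (v 29))"

definition heavy_detect :: com where
  "heavy_detect = detect (Read (v 31) (Var (v 29))) (pair_test 4 6) (pair_test 6 5) (pair_test 4 5)
     (row_at 30 (Var (v 4))) (row_at 30 (Var (v 5))) (row_at 30 (Var (v 6)))"

definition heavy_cost :: real where
  "heavy_cost = detect_cost (Read (v 31) (Var (v 29))) (pair_test 4 6) (pair_test 6 5) (pair_test 4 5)
     (row_at 30 (Var (v 4))) (row_at 30 (Var (v 5))) (row_at 30 (Var (v 6)))"

definition heavy_hit :: "nat \<Rightarrow> (int \<Rightarrow> int \<Rightarrow> int) \<Rightarrow> nat \<Rightarrow> int \<Rightarrow> bool" where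
  "heavy_hit n g D c \<longleftrightarrow> 0 < c \<and> (\<exists>x\<in>set (heavies n g D c n). \<exists>y\<in>set (heavies n g D c n). \<exists>z\<in>set (heavies n g D c n).
     g (int x) (int y) = c \<and> g (int x) (int z) = c \<and> g (int y) (int z) = c)"

definition heavy_test :: expr where
  "heavy_test = Op Times (Op Less (Const 0) (Var (v 29))) (Op Less (Const 0) (Read (v 31) (Var (v 29))))"

text \<open>Clearing the length of the heavy list after its product marks the colour as done; so a
  colour is treated only at its first occurrence in the matrix, without any additional
  table.\<close>

definition heavy_step :: com where
  "heavy_step = Seq (Set (v 29) (Read (v 3) (Var (v 32)))) (Cond heavy_test
     (Seq heavy_detect (Write (v 31) (Var (v 29)) (Const 0))) Skip)"

definition heavy_loop :: com where
  "heavy_loop = For (v 32) (Op Times (Var (v 2)) (Var (v 2))) heavy_step"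

lemma writes_heavy_detect: "writes heavy_detect \<subseteq> scratch"
  unfolding heavy_detect_def by (rule writes_detect)

lemma heavy_cost_nonneg: "0 \<le> heavy_cost"
  by (simp add: heavy_cost_def detect_cost_nonneg)

lemma run_heavy_detect:
  assumes ok: "ok W s" and st: "stored n g s" and W: "int (n * n) \<le> W" "(int M + 2) * int n \<le> W" "int M + 2 \<le> W"
    "(int n + 3) ^ d\<^sub>0 \<le> W"
    and g: "\<And>x y. 0 \<le> g x y \<and> g x y \<le> int M + 1" and g_sym: "\<And>x y. g x y = g y x"
    and c: "s (v 29) 0 = c" "0 < c" "c \<le> int M + 1"
    and H: "s (v 31) c = int (length (heavies n g D c n))"
      "\<forall>i<length (heavies n g D c n). s (v 30) (c * int n + int i) = int (heavies n g D c n ! i)"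
    and I: "tri_inv n g C s"
  shows "run W heavy_detect s (heavy_cost * (real (length (heavies n g D c n)) + 1) powr \<omega>)
    (tri_inv n g (C \<or> heavy_hit n g D c))"
proof -
  let ?H = "heavies n g D c n" let ?m = "length ?H"
  let ?a = "\<lambda>i l. g (int (?H ! i)) (int (?H ! l)) = c"
  have W1: "1 \<le> W" using W(3) by linarith
  have mn: "?m \<le> n" by (rule length_heavies)
  have Hn: "?H ! i < n" if "i < ?m" for i using nth_mem[OF that] by (auto simp: set_heavies)
  have row: "ev W s' (row_at 30 (Var (v x))) (int (?H ! i))"
    if "ok W s'" "keeps scratch s s'" "i < ?m" "s' (v x) 0 = int i" for s' x i
  proof -
    have "ev W s' (row_at 30 (Var (v x))) (s' (v 30) (c * int n + int i))"
      by (rule ev_row_at[where M = M]) (use that c mn W st in \<open>auto intro: ev_Var simp: stored_def\<close>)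
    then show ?thesis using H(2) that(2,3) by simp
  qed
  have st': "stored n g s'" if "keeps scratch s s'" for s' by (rule stored_keeps[OF st that]) auto
  have pt: "ev W s' (pair_test x y) (of_bool (?a i l))"
    if "ok W s'" "keeps scratch s s'" "i < ?m" "l < ?m" "s' (v x) 0 = int i" "s' (v y) 0 = int l" for s' x y i l
    using that c(1) by (intro ev_eq ev_edge_at[where n = n] row ev_Var Hn st' W W1) auto
  have "run W heavy_detect s (heavy_cost * (real ?m + 1) powr \<omega>)
      (\<lambda>s'. if \<exists>i<?m. \<exists>y<?m. \<exists>l<?m. ?a i l \<and> ?a l y \<and> ?a i y
        then s' (v 0) 0 = 1 \<and> (\<exists>i<?m. \<exists>y<?m. \<exists>l<?m. ?a i l \<and> ?a l y \<and> ?a i y \<and>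
          s' (v 11) 0 = int (?H ! i) \<and> s' (v 12) 0 = int (?H ! y) \<and> s' (v 13) 0 = int (?H ! l))
        else \<forall>k\<in>{0, 11, 12, 13}. s' (v k) = s (v k))"
    unfolding heavy_detect_def heavy_cost_def
  proof (rule run_detect)
    show "(int ?m + 3) ^ d\<^sub>0 \<le> W" by (rule order_trans[OF power_mono W(4)]) (use mn in auto)
    have "?m * ?m \<le> n * n" using mn by (intro mult_mono) auto
    then show "int (?m * ?m) \<le> W" using W(1) by linarith
    show "ev W s (Read (v 31) (Var (v 29))) (int ?m)"
      using ev_Read[OF ok ev_Var[OF ok c(1)], of "v 31"] H(1) by simp
  qed ((rule ok W1; fail) | (rule pt; assumption) | (rule row; assumption))+
  then show ?thesis
  proof (rule run_mono)
    fix s' assume s': "if \<exists>i<?m. \<exists>y<?m. \<exists>l<?m. ?a i l \<and> ?a l y \<and> ?a i y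
        then s' (v 0) 0 = 1 \<and> (\<exists>i<?m. \<exists>y<?m. \<exists>l<?m. ?a i l \<and> ?a l y \<and> ?a i y \<and>
          s' (v 11) 0 = int (?H ! i) \<and> s' (v 12) 0 = int (?H ! y) \<and> s' (v 13) 0 = int (?H ! l))
        else \<forall>k\<in>{0, 11, 12, 13}. s' (v k) = s (v k)"
    show "tri_inv n g (C \<or> heavy_hit n g D c) s'"
    proof (cases "\<exists>i<?m. \<exists>y<?m. \<exists>l<?m. ?a i l \<and> ?a l y \<and> ?a i y")
      case True
      with s' obtain i y l where f: "s' (v 0) 0 = 1" "i < ?m" "y < ?m" "l < ?m" "?a i l" "?a l y" "?a i y"
        "s' (v 11) 0 = int (?H ! i)" "s' (v 12) 0 = int (?H ! y)" "s' (v 13) 0 = int (?H ! l)"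
        unfolding if_P[OF True] by blast
      have "tri n g c (?H ! i) (?H ! y) (?H ! l)"
        unfolding tri_def using f(5-7) Hn[OF f(2)] Hn[OF f(3)] Hn[OF f(4)] c(2) g_sym[of "int (?H ! y)" "int (?H ! l)"] by auto
      then show ?thesis unfolding tri_inv_def using f(1,8-10) by auto
    next
      case False
      with s' have same: "\<forall>k\<in>{0, 11, 12, 13}. s' (v k) = s (v k)" by (simp only: if_False)
      have "\<not> heavy_hit n g D c"
      proof
        assume "heavy_hit n g D c"
        then obtain x y z where "x \<in> set ?H" "y \<in> set ?H" "z \<in> set ?H"
          "g (int x) (int y) = c" "g (int x) (int z) = c" "g (int y) (int z) = c"
          by (auto simp: heavy_hit_def)
        moreover from this(1-3) obtain i k l where "i < ?m" "?H ! i = x" "k < ?m" "?H ! k = y" "l < ?m" "?H ! l = z"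
          by (auto simp: in_set_conv_nth)
        ultimately have "?a i l \<and> ?a l k \<and> ?a i k" using g_sym[of "int z" "int y"] by simp
        then show False using False \<open>i < ?m\<close> \<open>k < ?m\<close> \<open>l < ?m\<close> by blast
      qed
      moreover have "tri_inv n g C s'" using I same by (simp add: tri_inv_def)
      ultimately show ?thesis by simp
    qed
  qed (use ok in auto)
qed

definition fresh_entry :: "nat \<Rightarrow> (int \<Rightarrow> int \<Rightarrow> int) \<Rightarrow> nat \<Rightarrow> nat \<Rightarrow> bool" where
  "fresh_entry n g D e \<longleftrightarrow> 0 < entry n g e \<and> heavies n g D (entry n g e) n \<noteq> [] \<and> (\<forall>e'<e. entry n g e' \<noteq> entry n g e)"

definition heavy_step_time :: "nat \<Rightarrow> (int \<Rightarrow> int \<Rightarrow> int) \<Rightarrow> nat \<Rightarrow> nat \<Rightarrow> real" where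
  "heavy_step_time n g D e = 50 + (if fresh_entry n g D e
     then heavy_cost * (real (length (heavies n g D (entry n g e) n)) + 1) powr \<omega> else 0)"

definition heavy_state :: "nat \<Rightarrow> (int \<Rightarrow> int \<Rightarrow> int) \<Rightarrow> nat \<Rightarrow> nat \<Rightarrow> state \<Rightarrow> bool" where
  "heavy_state n g D e s \<longleftrightarrow> (\<forall>c\<in>colours n g.
     s (v 31) c = (if 0 < c \<and> (\<exists>e'<e. entry n g e' = c) then 0 else int (length (heavies n g D c n))) \<and>
     (\<forall>i<length (heavies n g D c n). s (v 30) (c * int n + int i) = int (heavies n g D c n ! i)))"

lemma heavy_state_keeps: "heavy_state n g D e s \<Longrightarrow> keeps X s s' \<Longrightarrow> v 30 \<notin> X \<Longrightarrow> v 31 \<notin> X \<Longrightarrow> heavy_state n g D e s'"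
  by (simp add: heavy_state_def)

lemma run_heavy_step:
  assumes ok: "ok W s" and st: "stored n g s" and W: "int (n * n) \<le> W" "(int M + 2) * int n \<le> W" "int M + 2 \<le> W"
    "(int n + 3) ^ d\<^sub>0 \<le> W"
    and g: "\<And>x y. 0 \<le> g x y \<and> g x y \<le> int M + 1" and g_sym: "\<And>x y. g x y = g y x"
    and e: "s (v 32) 0 = int e" "e < n * n" and H: "heavy_state n g D e s"
    and I: "tri_inv n g (C \<or> (\<exists>e'<e. heavy_hit n g D (entry n g e'))) s"
  shows "run W heavy_step s (heavy_step_time n g D e) (\<lambda>s'. heavy_state n g D (Suc e) s' \<and>
    tri_inv n g (C \<or> (\<exists>e'<Suc e. heavy_hit n g D (entry n g e'))) s')"
proof -
  let ?c = "entry n g e" let ?H = "heavies n g D ?c n"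
  let ?C = "\<lambda>e. C \<or> (\<exists>e'<e. heavy_hit n g D (entry n g e'))"
  let ?Q = "\<lambda>s'. heavy_state n g D (Suc e) s' \<and> tri_inv n g (?C (Suc e)) s'"
  let ?T = "if fresh_entry n g D e then heavy_cost * (real (length ?H) + 1) powr \<omega> else 0"
  have W1: "1 \<le> W" using W(3) by linarith
  have c: "0 \<le> ?c" "?c \<le> int M + 1" "?c \<in> colours n g" using g e(2) by (auto simp: entry_def colours_entry)
  have T0: "0 \<le> ?T" using heavy_cost_nonneg by simp
  have ee: "(\<exists>e'<Suc e. P e') \<longleftrightarrow> (\<exists>e'<e. P e') \<or> P e" for P by (auto simp: less_Suc_eq)
  have "run W heavy_step s (5 + (1 + real (cost heavy_test) + (4 + ?T))) ?Q"
    unfolding heavy_step_def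
  proof (rule run_Seq)
    from run_Write[OF ev_Const[of 0 W s] ev_entry[OF ok st e], of "\<lambda>s'. s' (v 29) 0 = ?c" "v 29"] W1
    show "run W (Set (v 29) (Read (v 3) (Var (v 32)))) s 5 (\<lambda>s'. s' (v 29) 0 = ?c)" by simp
    fix s1 assume 1: "s1 (v 29) 0 = ?c" "ok W s1" "keeps (writes (Set (v 29) (Read (v 3) (Var (v 32))))) s s1"
    have k1: "keeps {v 29} s s1" using 1(3) by simp
    have st1: "stored n g s1" by (rule stored_keeps[OF st k1]) auto
    have H1: "heavy_state n g D e s1" by (rule heavy_state_keeps[OF H k1]) auto
    have I1: "tri_inv n g (?C e) s1" by (rule tri_inv_keeps[OF I k1]) auto
    note Hc = bspec[OF H1[unfolded heavy_state_def] c(3)]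
    have f: "0 < ?c \<and> 0 < s1 (v 31) ?c \<longleftrightarrow> fresh_entry n g D e"
      using Hc by (auto simp: fresh_entry_def)
    have "ev W s1 heavy_test (of_bool (0 < ?c \<and> 0 < s1 (v 31) ?c))"
      unfolding heavy_test_def using 1 W1 by (intro ev_And ev_Less ev_Const ev_Read ev_Var) auto
    then have t: "ev W s1 heavy_test (of_bool (fresh_entry n g D e))" unfolding f .
    show "run W (Cond heavy_test (Seq heavy_detect (Write (v 31) (Var (v 29)) (Const 0))) Skip) s1
       (1 + real (cost heavy_test) + (4 + ?T)) ?Q"
    proof (rule run_Cond[OF t])
      assume "of_bool (fresh_entry n g D e) \<noteq> (0 :: int)"
      then have fr: "fresh_entry n g D e" by simp
      then have c0: "0 < ?c" and new: "\<forall>e'<e. entry n g e' \<noteq> ?c" by (auto simp: fresh_entry_def)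
      have len: "s1 (v 31) ?c = int (length ?H)" using Hc new by auto
      have "run W (Seq heavy_detect (Write (v 31) (Var (v 29)) (Const 0))) s1
         (heavy_cost * (real (length ?H) + 1) powr \<omega> + 4) ?Q"
      proof (rule run_Seq)
        show "run W heavy_detect s1 (heavy_cost * (real (length ?H) + 1) powr \<omega>) (tri_inv n g (?C e \<or> heavy_hit n g D ?c))"
          by (rule run_heavy_detect[OF 1(2) st1 W g g_sym 1(1) c0 c(2) len _ I1]) (use Hc in blast)
        fix s2 assume 2: "tri_inv n g (?C e \<or> heavy_hit n g D ?c) s2" "ok W s2" "keeps (writes heavy_detect) s1 s2"
        have k2: "keeps scratch s1 s2" using 2(3) writes_heavy_detect by blast
        have H2: "heavy_state n g D e s2" by (rule heavy_state_keeps[OF H1 k2]) auto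
        let ?s3 = "upd s2 (v 31) ?c 0"
        have "heavy_state n g D (Suc e) ?s3"
          using H2 c0 unfolding heavy_state_def by (auto simp: less_Suc_eq)
        moreover have "tri_inv n g (?C e \<or> heavy_hit n g D ?c) ?s3"
          by (rule tri_inv_keeps[OF 2(1), of "{v 31}"]) auto
        ultimately have "?Q ?s3" unfolding ee by (simp only: disj_assoc)
        moreover have "ev W s2 (Var (v 29)) ?c" using 2(2) k2 1(1) by (intro ev_Var) auto
        ultimately show "run W (Write (v 31) (Var (v 29)) (Const 0)) s2 4 ?Q"
          using run_Write[OF _ ev_Const[of 0 W s2], of "Var (v 29)" ?c ?Q "v 31"] W1 by simp
      qed (use 1 in auto)
      then show "run W (Seq heavy_detect (Write (v 31) (Var (v 29)) (Const 0))) s1 (4 + ?T) ?Q"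
        using fr by (simp add: add.commute)
    next
      assume "of_bool (fresh_entry n g D e) = (0 :: int)"
      then have fr: "\<not> fresh_entry n g D e" by simp
      \<comment> \<open>A positive colour that is passed over has length \<open>0\<close> already,
        either because it was treated before or because it has no heavy vertex. The state therefore
        looks as if it had been cleared now.\<close>
      have "heavy_state n g D (Suc e) s1"
        unfolding heavy_state_def
      proof (intro ballI conjI)
        fix c' assume c': "c' \<in> colours n g"
        note Hc' = bspec[OF H1[unfolded heavy_state_def] c']
        show "\<forall>i<length (heavies n g D c' n). s1 (v 30) (c' * int n + int i) = int (heavies n g D c' n ! i)"
          using Hc' by blast
        show "s1 (v 31) c' = (if 0 < c' \<and> (\<exists>e'<Suc e. entry n g e' = c') then 0 else int (length (heavies n g D c' n)))"
        proof (cases "0 < c' \<and> ?c = c'")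
          case True
          have "0 \<le> s1 (v 31) c'" using Hc' by simp
          moreover have "\<not> 0 < s1 (v 31) c'" using f fr True by blast
          ultimately have "s1 (v 31) c' = 0" by linarith
          then show ?thesis using True by auto
        next
          case False
          then have "(0 < c' \<and> (\<exists>e'<Suc e. entry n g e' = c')) = (0 < c' \<and> (\<exists>e'<e. entry n g e' = c'))"
            by (auto simp: less_Suc_eq)
          then show ?thesis using Hc' by simp
        qed
      qed
      moreover have "?C (Suc e) \<Longrightarrow> ?C e"
      proof -
        assume a: "?C (Suc e)"
        have "heavy_hit n g D ?c \<Longrightarrow> \<exists>e'<e. heavy_hit n g D (entry n g e')"
        proof -
          assume h: "heavy_hit n g D ?c"
          then have "0 < ?c" "?H \<noteq> []" by (auto simp: heavy_hit_def)
          then obtain e' where "e' < e" "entry n g e' = ?c" using fr by (auto simp: fresh_entry_def)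
          then show ?thesis using h by auto
        qed
        then show "?C e" using a unfolding ee by blast
      qed
      then have "tri_inv n g (?C (Suc e)) s1" by (rule tri_inv_mono[OF I1])
      ultimately have "?Q s1" by blast
      from run_Skip[of ?Q, OF this] show "run W Skip s1 (4 + ?T) ?Q"
        by (rule run_mono) (use 1 T0 in auto)
    qed
  qed (use ok in auto)
  then show ?thesis
    by (rule run_mono) (use ok in \<open>auto simp: heavy_step_time_def heavy_test_def\<close>)
qed

lemma run_heavy_loop:
  assumes ok: "ok W s" and st: "stored n g s" and W: "int (n * n) \<le> W" "(int M + 2) * int n \<le> W" "int M + 2 \<le> W"
    "(int n + 3) ^ d\<^sub>0 \<le> W"
    and g: "\<And>x y. 0 \<le> g x y \<and> g x y \<le> int M + 1" and g_sym: "\<And>x y. g x y = g y x"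
    and H: "stores n g (\<lambda>c. heavies n g D c n) s" and I: "tri_inv n g C s"
  shows "run W heavy_loop s ((\<Sum>e<n * n. heavy_step_time n g D e) + real (n * n + 1) * 15)
    (tri_inv n g (C \<or> (\<exists>c\<in>colours n g. heavy_hit n g D c)))"
proof -
  let ?C = "\<lambda>e. C \<or> (\<exists>e'<e. heavy_hit n g D (entry n g e'))"
  let ?I = "\<lambda>e s'. heavy_state n g D e s' \<and> tri_inv n g (?C e) s'"
  have w: "keeps (scratch \<union> v ` {29, 31, 32}) s s'" if "keeps (insert (v 32) (writes heavy_step)) s s'" for s'
    using that writes_heavy_detect by (auto simp: heavy_step_def)
  have "run W heavy_loop s ((\<Sum>e<n * n. heavy_step_time n g D e) + real (n * n + 1) * (10 + real (cost (Op Times (Var (v 2)) (Var (v 2))))))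
    (?I (n * n))"
    unfolding heavy_loop_def
  proof (rule run_For[where I = ?I])
    show "v 32 \<notin> writes heavy_step" using writes_heavy_detect by (auto simp: heavy_step_def)
    show "ev W s' (Op Times (Var (v 2)) (Var (v 2))) (int (n * n))" if "ok W s'" "keeps (insert (v 32) (writes heavy_step)) s s'" for s'
      by (rule ev_square[OF that(1) stored_keeps[OF st w[OF that(2)]] W(1)]) auto
    show "?I 0 (upd s (v 32) 0 0)"
    proof
      have "heavy_state n g D 0 s" using H by (auto simp: stores_def heavy_state_def)
      then show "heavy_state n g D 0 (upd s (v 32) 0 0)" by (rule heavy_state_keeps[of _ _ _ _ _ "{v 32}"]) auto
      show "tri_inv n g (?C 0) (upd s (v 32) 0 0)"
        by (rule tri_inv_keeps[where s = s and X = "{v 32}"]) (use I in auto)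
    qed
    fix e s' assume e: "e < n * n" "ok W s'" "keeps (insert (v 32) (writes heavy_step)) s s'" "s' (v 32) 0 = int e" "?I e s'"
    have st': "stored n g s'" by (rule stored_keeps[OF st w[OF e(3)]]) auto
    have "run W heavy_step s' (heavy_step_time n g D e) (?I (Suc e))"
      by (rule run_heavy_step[OF e(2) st' W g g_sym e(4,1) conjunct1[OF e(5)] conjunct2[OF e(5)]])
    then show "run W heavy_step s' (heavy_step_time n g D e) (\<lambda>s''. ?I (Suc e) (upd s'' (v 32) 0 (int (Suc e))))"
    proof (rule run_mono)
      fix s'' assume i: "?I (Suc e) s''"
      show "?I (Suc e) (upd s'' (v 32) 0 (int (Suc e)))"
        by (intro conjI heavy_state_keeps[OF conjunct1[OF i], of "{v 32}"] tri_inv_keeps[OF conjunct2[OF i], of "{v 32}"]) auto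
    qed (use e in auto)
  qed (use ok W in auto)
  then show ?thesis
  proof (rule run_mono)
    fix s' assume "?I (n * n) s'"
    moreover have "?C (n * n) = (C \<or> (\<exists>c\<in>colours n g. heavy_hit n g D c))" by (auto simp: colours_entry)
    ultimately show "tri_inv n g (C \<or> (\<exists>c\<in>colours n g. heavy_hit n g D c)) s'" by simp
  qed (use ok in auto)
qed

text \<open>A triangle with a light vertex is noticed in the row of this vertex, at the column of
  the larger of the two other vertices, when the smaller one is already listed. Otherwise all three
  vertices are heavy in the colour of the triangle.\<close>

lemma triangle_hit:
  assumes g_sym: "\<And>x y. g x y = g y x" and g_loop: "\<And>x. g x x = 0" and t: "tri n g c x y z"
  shows "(\<exists>x<n. \<exists>k<n. light_hit g D x k) \<or> (\<exists>c\<in>colours n g. heavy_hit n g D c)"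
proof -
  have light: "light_hit g D a k" if "length (nbrs g a c n) \<le> D" "b < k" "k < n" "g (int a) (int b) = c" "g (int a) (int k) = c"
    "g (int k) (int b) = c" "0 < c" for a b k
  proof -
    have "b \<in> set (nbrs g a c k)" using that by (simp add: set_nbrs)
    moreover have "length (nbrs g a c k) \<le> length (nbrs g a c n)"
    proof -
      have "card (set (nbrs g a c k)) \<le> card (set (nbrs g a c n))"
        by (rule card_mono) (use that(3) in \<open>auto simp: set_nbrs\<close>)
      then show ?thesis by (simp add: distinct_card distinct_nbrs)
    qed
    ultimately show ?thesis using that by (auto simp: light_hit_def Let_def)
  qed
  have light2: "\<exists>x<n. \<exists>k<n. light_hit g D x k" if "length (nbrs g a c n) \<le> D" "tri n g c a b d" for a b d
  proof -
    have f: "g (int a) (int b) = c" "g (int a) (int d) = c" "g (int b) (int d) = c" "g (int d) (int b) = c"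
      "0 < c" "a < n" "b < n" "d < n"
      using that(2) g_sym[of "int d" "int b"] by (auto simp: tri_def)
    have "b \<noteq> d" using f(3,5) g_loop[of "int b"] by auto
    then consider "b < d" | "d < b" by linarith
    then show ?thesis
    proof cases
      case 1
      then show ?thesis using light[OF that(1) 1 f(8,1,2,4,5)] f(6,8) by blast
    next
      case 2
      then show ?thesis using light[OF that(1) 2 f(7,2,1,3,5)] f(6,7) by blast
    qed
  qed
  have rot: "tri n g c y x z" "tri n g c z x y" 
    using t g_sym[of "int y" "int x"] g_sym[of "int z" "int x"] g_sym[of "int z" "int y"] by (auto simp: tri_def)
  show ?thesis
  proof (cases "length (nbrs g x c n) \<le> D \<or> length (nbrs g y c n) \<le> D \<or> length (nbrs g z c n) \<le> D")
    case True
    then show ?thesis using light2[OF _ t] light2[OF _ rot(1)] light2[OF _ rot(2)] by blast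
  next
    case False
    then have "x \<in> set (heavies n g D c n)" "y \<in> set (heavies n g D c n)" "z \<in> set (heavies n g D c n)"
      using t by (auto simp: set_heavies tri_def)
    then have "heavy_hit n g D c" using t unfolding heavy_hit_def tri_def by blast
    moreover have "c \<in> colours n g" using t by (auto simp: tri_def colours_def)
    ultimately show ?thesis by blast
  qed
qed

lemma card_heavies: "length (heavies n g D c x) = card {y. y < x \<and> D < length (nbrs g y c n)}"
  using distinct_card[of "heavies n g D c x"] by (simp add: set_heavies) (simp add: heavies_def)

text \<open>A vertex \<open>y\<close> that is heavy in some colour accounts for more than
  \<open>D\<close> entries of row \<open>y\<close> in this colour. Entries of different colours are
  disjoint and each of the \<open>n\<close> rows has \<open>n\<close> of them.\<close>

lemma sum_heavies:
  "(\<Sum>e | e < n * n \<and> fresh_entry n g D e. length (heavies n g D (entry n g e) n)) * D \<le> n * n"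
proof -
  let ?F = "{e. e < n * n \<and> fresh_entry n g D e}" let ?c = "entry n g"
  have fin: "finite ?F" by simp
  have inj: "e = e'" if "e \<in> ?F" "e' \<in> ?F" "?c e = ?c e'" for e e'
    using that by (cases e e' rule: linorder_cases) (auto simp: fresh_entry_def)
  have "(\<Sum>e\<in>?F. length (heavies n g D (?c e) n)) * D = (\<Sum>e\<in>?F. \<Sum>y | y < n \<and> D < length (nbrs g y (?c e) n). D)"
    by (simp add: sum_distrib_right card_heavies)
  also have "\<dots> \<le> (\<Sum>e\<in>?F. \<Sum>y<n. length (nbrs g y (?c e) n))"
  proof (rule sum_mono)
    fix e
    have "(\<Sum>y | y < n \<and> D < length (nbrs g y (?c e) n). D) \<le> (\<Sum>y | y < n \<and> D < length (nbrs g y (?c e) n). length (nbrs g y (?c e) n))"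
      by (intro sum_mono) auto
    also have "\<dots> \<le> (\<Sum>y<n. length (nbrs g y (?c e) n))" by (intro sum_mono2) auto
    finally show "(\<Sum>y | y < n \<and> D < length (nbrs g y (?c e) n). D) \<le> (\<Sum>y<n. length (nbrs g y (?c e) n))" .
  qed
  also have "\<dots> = (\<Sum>y<n. \<Sum>e\<in>?F. length (nbrs g y (?c e) n))" by (rule sum.swap)
  also have "\<dots> \<le> (\<Sum>y<n. n)"
  proof (rule sum_mono)
    fix y
    have "(\<Sum>e\<in>?F. length (nbrs g y (?c e) n)) = (\<Sum>e\<in>?F. card (set (nbrs g y (?c e) n)))"
      by (simp add: distinct_card distinct_nbrs)
    also have "\<dots> = card (\<Union>e\<in>?F. set (nbrs g y (?c e) n))"
      by (rule card_UN_disjoint[symmetric]) (use fin inj in \<open>auto simp: set_nbrs\<close>)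
    also have "\<dots> \<le> card {..<n}" by (rule card_mono) (auto simp: set_nbrs)
    finally show "(\<Sum>e\<in>?F. length (nbrs g y (?c e) n)) \<le> n" by simp
  qed
  finally show ?thesis by simp
qed

end

section \<open>A pass with fixed threshold, and the doubling of the threshold\<close>

context mm_program
begin

definition pass :: com where
  "pass = Seq (Set (v 0) (Const 0)) (Seq reset_heavy (Seq (scan tri_act) heavy_loop))"

definition pass_const :: real where
  "pass_const = 2 * real act_cost + 400 + heavy_cost * 2 powr \<omega>"

lemma pass_const_nonneg: "0 \<le> pass_const"
  using heavy_cost_nonneg by (simp add: pass_const_def)

text \<open>For a list of length \<open>h \<le> n\<close> the product costs about
  \<open>h powr \<omega> \<le> n powr (\<omega> - 1) * h\<close>. This is linear in
  \<open>h\<close>, and the lengths add up to at most \<open>n^2 / D\<close>.\<close>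

lemma sum_heavy_step_time:
  assumes "1 \<le> D"
  shows "(\<Sum>e<n * n. heavy_step_time n g D e) \<le> 50 * (real n + 1)\<^sup>2 + heavy_cost * 2 powr \<omega> * ((real n + 1) powr (\<omega> + 1) / real D)"
proof -
  let ?F = "{e. e < n * n \<and> fresh_entry n g D e}" let ?h = "\<lambda>e. length (heavies n g D (entry n g e) n)"
  let ?y = "real n + 1"
  have h: "1 \<le> ?h e" "?h e \<le> n" if "e \<in> ?F" for e
    using that length_heavies by (auto simp: fresh_entry_def Suc_le_eq)
  have "(real (?h e) + 1) powr \<omega> \<le> 2 powr \<omega> * (?y powr (\<omega> - 1) * real (?h e))" if "e \<in> ?F" for e
  proof -
    have h1: "1 \<le> real (?h e)" "real (?h e) \<le> ?y" using h[OF that] by auto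
    have "(real (?h e) + 1) powr \<omega> \<le> (2 * real (?h e)) powr \<omega>" using h1 \<omega> by (intro powr_mono2) auto
    also have "\<dots> = 2 powr \<omega> * (real (?h e) powr (\<omega> - 1) * real (?h e))"
      using h1 powr_add[of "real (?h e)" "\<omega> - 1" 1] by (simp add: powr_mult)
    also have "\<dots> \<le> 2 powr \<omega> * (?y powr (\<omega> - 1) * real (?h e))"
      using h1 \<omega> by (intro mult_left_mono mult_right_mono powr_mono2) auto
    finally show ?thesis .
  qed
  then have "(\<Sum>e\<in>?F. heavy_cost * (real (?h e) + 1) powr \<omega>) \<le> (\<Sum>e\<in>?F. heavy_cost * (2 powr \<omega> * (?y powr (\<omega> - 1) * real (?h e))))"
    using heavy_cost_nonneg by (intro sum_mono mult_left_mono) auto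
  also have "\<dots> = heavy_cost * 2 powr \<omega> * (?y powr (\<omega> - 1) * (\<Sum>e\<in>?F. real (?h e)))"
    by (simp add: sum_distrib_left mult.assoc)
  also have "\<dots> \<le> heavy_cost * 2 powr \<omega> * (?y powr (\<omega> - 1) * (?y\<^sup>2 / real D))"
  proof (intro mult_left_mono)
    have "real ((\<Sum>e\<in>?F. ?h e) * D) \<le> real (n * n)" using sum_heavies[where n = n and g = g and D = D] by (rule of_nat_mono)
    also have "\<dots> \<le> ?y\<^sup>2" by (simp add: power2_eq_square algebra_simps)
    finally show "(\<Sum>e\<in>?F. real (?h e)) \<le> ?y\<^sup>2 / real D" using assms by (simp add: field_simps)
  qed (use heavy_cost_nonneg in auto)
  also have "?y powr (\<omega> - 1) * (?y\<^sup>2 / real D) = ?y powr (\<omega> + 1) / real D"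
    using powr_add[of ?y "\<omega> - 1" 2] by (simp add: powr_numeral add.commute)
  finally have 1: "(\<Sum>e\<in>?F. heavy_cost * (real (?h e) + 1) powr \<omega>) \<le> heavy_cost * 2 powr \<omega> * (?y powr (\<omega> + 1) / real D)" .
  have "(\<Sum>e<n * n. heavy_step_time n g D e) = 50 * real (n * n) + (\<Sum>e\<in>?F. heavy_cost * (real (?h e) + 1) powr \<omega>)"
    by (simp add: heavy_step_time_def sum.distrib sum.inter_filter[symmetric])
  moreover have "real (n * n) \<le> ?y\<^sup>2" by (simp add: power2_eq_square algebra_simps)
  ultimately show ?thesis using 1 by linarith
qed

lemma run_pass:
  assumes ok: "ok W s" and st: "stored n g s" and W: "int (n * n) \<le> W" "(int M + 2) * int n \<le> W" "int M + 2 \<le> W"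
    "int D + 1 \<le> W" "(int n + 3) ^ d\<^sub>0 \<le> W"
    and g: "\<And>x y. 0 \<le> g x y \<and> g x y \<le> int M + 1" and g_sym: "\<And>x y. g x y = g y x" and g_loop: "\<And>x. g x x = 0"
    and D: "s (v 33) 0 = int D" "1 \<le> D"
  shows "run W pass s (pass_const * ((real n + 1)\<^sup>2 * real D + (real n + 1) powr (\<omega> + 1) / real D))
    (tri_inv n g (\<exists>c x y z. tri n g c x y z))"
proof -
  have W1: "1 \<le> W" using W(3) by linarith
  let ?t2 = "real (n * n + 1) * 20" let ?t3 = "(real n + 1)\<^sup>2 * (real (D + 1) * real act_cost + 200)"
  let ?t4 = "(\<Sum>e<n * n. heavy_step_time n g D e) + real (n * n + 1) * 15"
  have "run W pass s (3 + (?t2 + (?t3 + ?t4))) (tri_inv n g (\<exists>c x y z. tri n g c x y z))"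
    unfolding pass_def
  proof (rule run_Seq)
    from run_Write[OF ev_Const[of 0 W s] ev_Const[of 0 W s], of "\<lambda>s'. s' (v 0) 0 = 0" "v 0"] W1
    show "run W (Set (v 0) (Const 0)) s 3 (\<lambda>s'. s' (v 0) 0 = 0)" by simp
    fix s1 assume 1: "s1 (v 0) 0 = 0" "ok W s1" "keeps (writes (Set (v 0) (Const 0))) s s1"
    have k1: "keeps {v 0} s s1" using 1(3) by simp
    have st1: "stored n g s1" by (rule stored_keeps[OF st k1]) auto
    show "run W (Seq reset_heavy (Seq (scan tri_act) heavy_loop)) s1 (?t2 + (?t3 + ?t4)) (tri_inv n g (\<exists>c x y z. tri n g c x y z))"
    proof (rule run_Seq[OF run_reset_heavy[OF 1(2) st1 W(1) W1] 1(2)])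
      fix s2 assume 2: "stores n g (\<lambda>c. []) s2" "ok W s2" "keeps (writes reset_heavy) s1 s2"
      have k2: "keeps {v 31, v 32} s1 s2" using 2(3) by (simp add: reset_heavy_def)
      have st2: "stored n g s2" by (rule stored_keeps[OF st1 k2]) auto
      have s2: "s2 (v 0) 0 = 0" "s2 (v 33) 0 = int D" using k1 k2 1(1) D by auto
      show "run W (Seq (scan tri_act) heavy_loop) s2 (?t3 + ?t4) (tri_inv n g (\<exists>c x y z. tri n g c x y z))"
      proof (rule run_Seq[OF run_tri_scan[OF 2(2) st2 W(1-4) g g_sym s2 2(1)] 2(2)])
        fix s3 assume 3: "tri_inv n g (\<exists>x<n. \<exists>k<n. light_hit g D x k) s3 \<and> stores n g (\<lambda>c. heavies n g D c n) s3"
          "ok W s3" "keeps (writes (scan tri_act)) s2 s3"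
        have "v 2 \<notin> writes (scan tri_act)" "v 3 \<notin> writes (scan tri_act)"
          by (auto simp: scan_def tri_act_def light_pairs_def hit_pair_def push_heavy_def)
        then have st3: "stored n g s3" by (rule stored_keeps[OF st2 3(3)])
        show "run W heavy_loop s3 ?t4 (tri_inv n g (\<exists>c x y z. tri n g c x y z))"
        proof (rule run_mono[OF run_heavy_loop[OF 3(2) st3 W(1-3,5) g g_sym]])
          show "stores n g (\<lambda>c. heavies n g D c n) s3" using 3(1) by blast
          show "tri_inv n g (\<exists>x<n. \<exists>k<n. light_hit g D x k) s3" using 3(1) by blast
          fix s4 assume "tri_inv n g ((\<exists>x<n. \<exists>k<n. light_hit g D x k) \<or> (\<exists>c\<in>colours n g. heavy_hit n g D c)) s4"
          then show "tri_inv n g (\<exists>c x y z. tri n g c x y z) s4"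
            by (rule tri_inv_mono) (use triangle_hit[where g = g, OF g_sym g_loop] in blast)
        qed (use 3 in auto)
      qed
    qed
  qed (use ok in auto)
  then show ?thesis
  proof (rule run_mono)
    let ?y = "real n + 1" let ?A = "?y\<^sup>2 * real D" let ?B = "?y powr (\<omega> + 1) / real D"
    have nn: "real (n * n + 1) \<le> ?y\<^sup>2" by (simp add: power2_eq_square algebra_simps)
    have y1: "1 \<le> ?y\<^sup>2" by (simp add: one_le_power)
    have yA: "?y\<^sup>2 \<le> ?A" using D(2) by (simp add: mult_le_cancel_left1)
    have B0: "0 \<le> ?B" by simp
    have "real (D + 1) \<le> 2 * real D" using D(2) by simp
    then have "?y\<^sup>2 * (real (D + 1) * real act_cost) \<le> ?y\<^sup>2 * (2 * real D * real act_cost)"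
      by (intro mult_left_mono mult_right_mono) auto
    then have 3: "?t3 \<le> 2 * real act_cost * ?A + 200 * ?y\<^sup>2" by (simp add: algebra_simps)
    note 4 = sum_heavy_step_time[OF D(2), of n g]
    have "3 + (?t2 + (?t3 + ?t4)) \<le> 2 * real act_cost * ?A + 288 * ?y\<^sup>2 + heavy_cost * 2 powr \<omega> * ?B"
    proof -
      define t3 where "t3 = ?t3"
      define S where "S = (\<Sum>e<n * n. heavy_step_time n g D e)"
      define A where "A = 2 * real act_cost * ?A"
      define B where "B = heavy_cost * 2 powr \<omega> * ?B"
      define N where "N = real (n * n + 1)"
      have "3 + (N * 20 + (t3 + (S + N * 15))) \<le> A + 288 * ?y\<^sup>2 + B"
        using nn y1 3 4 unfolding A_def[symmetric] B_def[symmetric] t3_def[symmetric] S_def[symmetric] N_def[symmetric]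
        by linarith
      then show ?thesis by (simp only: A_def B_def t3_def S_def N_def)
    qed
    also have "\<dots> \<le> 2 * real act_cost * ?A + 288 * ?A + heavy_cost * 2 powr \<omega> * ?B"
      using yA by linarith
    also have "\<dots> \<le> pass_const * ?A + pass_const * ?B"
    proof -
      have "2 * real act_cost + 288 \<le> pass_const" "heavy_cost * 2 powr \<omega> \<le> pass_const"
        using heavy_cost_nonneg by (simp_all add: pass_const_def)
      from mult_right_mono[OF this(1), of ?A] mult_right_mono[OF this(2) B0]
      show ?thesis by (simp add: algebra_simps)
    qed
    finally show "3 + (?t2 + (?t3 + ?t4)) \<le> pass_const * (?A + ?B)" by (simp only: distrib_left)
  qed (use ok in auto)
qed

lemma vars_pass: "v 40 \<notin> vars pass" "v 41 \<notin> vars pass"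
  by (simp_all add: pass_def reset_heavy_def scan_def tri_act_def light_pairs_def hit_pair_def push_heavy_def
      heavy_loop_def heavy_step_def heavy_test_def heavy_detect_def detect_def fill_def For_def eq_expr_def)

text \<open>If the heavy term in the time of \<open>pass\<close> does not exceed the light term
  \<open>(n + 1)^2 * D\<close>, the whole time is at most \<open>2 * pass_const\<close> times the
  light term. The clock is set strictly above that.\<close>

definition budget :: nat where
  "budget = nat \<lceil>2 * pass_const\<rceil> + 1"

definition attempt :: com where
  "attempt = Seq (Set (v 40) (Op Times (Const (int budget)) (Op Times (Op Times (Op Plus (Var (v 2)) (Const 1)) (Op Plus (Var (v 2)) (Const 1))) (Var (v 33)))))
     (Seq (clocked (v 40) (v 41) pass)
       (Cond (Op Less (Const 0) (Var (v 40))) (Set (v 42) (Const 1)) (Set (v 33) (Op Plus (Var (v 33)) (Var (v 33))))))"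

definition attempt_const :: real where
  "attempt_const = real (tick_time pass) * real budget + real (base_time pass) + 60"

lemma writes_pass: "writes pass \<subseteq> scratch \<union> v ` {25, 26, 27, 28, 29, 30, 31, 32, 34}"
  using writes_heavy_detect
  by (auto simp: pass_def reset_heavy_def scan_def tri_act_def light_pairs_def hit_pair_def push_heavy_def
      heavy_loop_def heavy_step_def)

lemma writes_attempt: "writes attempt \<subseteq> scratch \<union> v ` {25, 26, 27, 28, 29, 30, 31, 32, 33, 34, 40, 41, 42}"
  using writes_pass writes_clocked[of "v 40" "v 41" pass] by (auto simp: attempt_def)

text \<open>An attempt costs a multiple of \<open>n^2 * D\<close> whether or not it succeeds. A
  failure carries information: the heavy term must have exceeded the light one, and this means
  \<open>D^2 < (n + 1) powr (\<omega> - 1)\<close>, so that the threshold is still too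
  small.\<close>

lemma run_attempt:
  assumes ok: "ok W s" and st: "stored n g s" and W: "int (n * n) \<le> W" "(int M + 2) * int n \<le> W" "int M + 2 \<le> W"
    "int D + 1 \<le> W" "(int n + 3) ^ d\<^sub>0 \<le> W" "int budget * ((int n + 1) * (int n + 1) * int D) \<le> W" "2 * int D \<le> W"
    "(int n + 1) * (int n + 1) * int D \<le> W" "(int n + 1) * (int n + 1) \<le> W" "int budget \<le> W"
    and g: "\<And>x y. 0 \<le> g x y \<and> g x y \<le> int M + 1" and g_sym: "\<And>x y. g x y = g y x" and g_loop: "\<And>x. g x x = 0"
    and D: "s (v 33) 0 = int D" "1 \<le> D"
  shows "run W attempt s (attempt_const * ((real n + 1)\<^sup>2 * real D))
    (\<lambda>s'. s' (v 42) 0 = 1 \<and> tri_inv n g (\<exists>c x y z. tri n g c x y z) s' \<or>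
      s' (v 42) 0 = s (v 42) 0 \<and> s' (v 33) 0 = 2 * int D \<and> (real D)\<^sup>2 < (real n + 1) powr (\<omega> - 1))" (is "run _ _ _ _ ?Q")
proof -
  let ?y = "real n + 1" let ?A = "?y\<^sup>2 * real D"
  let ?T = "\<exists>c x y z. tri n g c x y z"
  define b where "b = budget * ((n + 1) * (n + 1) * D)"
  have bW: "int b \<le> W" using W(6) by (simp add: b_def algebra_simps)
  have rb: "real b = real budget * ?A" by (simp add: b_def power2_eq_square algebra_simps)
  have W1: "1 \<le> W" using W(3) by linarith
  have nW: "int n + 1 \<le> W"
  proof -
    have "(int n + 1) * 1 \<le> (int n + 1) * (int n + 1)" by (intro mult_left_mono) auto
    then show ?thesis using W(9) by (simp only: mult_1_right)
  qed
  let ?e = "Op Times (Const (int budget)) (Op Times (Op Times (Op Plus (Var (v 2)) (Const 1)) (Op Plus (Var (v 2)) (Const 1))) (Var (v 33)))"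
  have v2: "s (v 2) 0 = int n" using st by (simp add: stored_def)
  have n1: "ev W s (Op Plus (Var (v 2)) (Const 1)) (int n + 1)"
    using nW W1 by (intro ev_Op[OF ev_Var[OF ok v2] ev_Const[of 1]]) auto
  have "ev W s (Op Times (Op Plus (Var (v 2)) (Const 1)) (Op Plus (Var (v 2)) (Const 1))) ((int n + 1) * (int n + 1))"
    using W(9) by (intro ev_Op[OF n1 n1]) auto
  then have "ev W s (Op Times (Op Times (Op Plus (Var (v 2)) (Const 1)) (Op Plus (Var (v 2)) (Const 1))) (Var (v 33))) ((int n + 1) * (int n + 1) * int D)"
    using W(8) by (intro ev_Op[OF _ ev_Var[OF ok D(1)]]) auto
  moreover have "int b = int budget * ((int n + 1) * (int n + 1) * int D)" by (simp add: b_def algebra_simps)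
  ultimately have e: "ev W s ?e (int b)"
    using W(6,10) by (intro ev_Op[OF ev_Const[of "int budget"]]) auto
  have fails: "(real D)\<^sup>2 < ?y powr (\<omega> - 1)" if "\<not> pass_const * (?A + ?y powr (\<omega> + 1) / real D) < real b"
  proof (rule ccontr)
    assume "\<not> (real D)\<^sup>2 < ?y powr (\<omega> - 1)"
    then have "?y\<^sup>2 * ?y powr (\<omega> - 1) \<le> ?y\<^sup>2 * (real D)\<^sup>2" by (intro mult_left_mono) auto
    moreover have "?y\<^sup>2 * ?y powr (\<omega> - 1) = ?y powr (\<omega> + 1)"
      using powr_add[of ?y 2 "\<omega> - 1"] by (simp add: powr_numeral add.commute)
    ultimately have "?y powr (\<omega> + 1) \<le> ?y\<^sup>2 * (real D)\<^sup>2" by linarith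
    also have "\<dots> = ?A * real D" by (simp add: power2_eq_square)
    finally have "?y powr (\<omega> + 1) / real D \<le> ?A" using D(2) by (simp only: divide_le_eq) simp
    then have "pass_const * (?A + ?y powr (\<omega> + 1) / real D) \<le> pass_const * (?A + ?A)"
      using pass_const_nonneg by (intro mult_left_mono add_left_mono)
    also have "\<dots> = 2 * pass_const * ?A" by simp
    also have "\<dots> < real budget * ?A"
    proof (rule mult_strict_right_mono)
      show "2 * pass_const < real budget" unfolding budget_def using pass_const_nonneg by linarith
    qed (use D(2) in simp)
    finally show False using that rb by simp
  qed
  have "run W attempt s (real (2 + cost ?e) + ((real (tick_time pass) * real b + real (base_time pass)) + 12)) ?Q"
    unfolding attempt_def
  proof (rule run_Seq)
    from run_Write[OF ev_Const[of 0 W s] e, of "\<lambda>s'. s' (v 40) 0 = int b" "v 40"] W1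
    show "run W (Set (v 40) ?e) s (real (2 + cost ?e)) (\<lambda>s'. s' (v 40) 0 = int b)" by simp
    fix s1 assume 1: "s1 (v 40) 0 = int b" "ok W s1" "keeps (writes (Set (v 40) ?e)) s s1"
    have k1: "keeps {v 40} s s1" using 1(3) by simp
    have st1: "stored n g s1" by (rule stored_keeps[OF st k1]) auto
    have D1: "s1 (v 33) 0 = int D" using k1 D(1) by simp
    note rp = run_clocked[OF run_pass[OF 1(2) st1 W(1-5) g g_sym g_loop D1 D(2)] _ vars_pass W1 1(1) bW]
    let ?L = "Cond (Op Less (Const 0) (Var (v 40))) (Set (v 42) (Const 1)) (Set (v 33) (Op Plus (Var (v 33)) (Var (v 33))))"
    show "run W (Seq (clocked (v 40) (v 41) pass) ?L) s1 ((real (tick_time pass) * real b + real (base_time pass)) + 12) ?Q"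
    proof (rule run_Seq[OF rp 1(2)])
      show "v 40 \<noteq> v 41" by simp
      fix s2 assume 2: "0 \<le> s2 (v 40) 0 \<and> (0 < s2 (v 40) 0 \<longrightarrow> (\<exists>s'. tri_inv n g ?T s' \<and> keeps {v 40, v 41} s' s2)) \<and>
          (pass_const * (?A + ?y powr (\<omega> + 1) / real D) < real b \<longrightarrow> 0 < s2 (v 40) 0)"
        "ok W s2" "keeps (writes (clocked (v 40) (v 41) pass)) s1 s2"
      have k2: "keeps (scratch \<union> v ` {25, 26, 27, 28, 29, 30, 31, 32, 34, 40, 41}) s1 s2"
        using 2(3) writes_clocked[of "v 40" "v 41" pass] writes_pass by blast
      have s2: "s2 (v 33) 0 = int D" "s2 (v 42) 0 = s (v 42) 0" using k1 k2 D1 by auto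
      have "wp W ?L ?Q s2"
      proof (cases "0 < s2 (v 40) 0")
        case True
        then obtain s' where "tri_inv n g ?T s'" "keeps {v 40, v 41} s' s2" using 2(1) by blast
        then have "tri_inv n g ?T s2" by (rule tri_inv_keeps) auto
        then have "tri_inv n g ?T (upd s2 (v 42) 0 1)" by (rule tri_inv_keeps[of _ _ _ _ "{v 42}"]) auto
        then have "?Q (upd s2 (v 42) 0 1)" by simp
        then show ?thesis using True okD[OF 2(2), of "v 40" 0] W1 by simp
      next
        case False
        then have "(real D)\<^sup>2 < ?y powr (\<omega> - 1)" using fails 2(1) by blast
        then have "?Q (upd s2 (v 33) 0 (2 * int D))" using s2 by simp
        then show ?thesis using False okD[OF 2(2), of "v 40" 0] W1 W(7) s2(1) by simp
      qed
      from run_wp[OF this] show "run W ?L s2 12 ?Q" by (rule run_mono) (use 2 in auto)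
    qed
  qed (use ok in auto)
  then show ?thesis
  proof (rule run_mono)
    have "1 \<le> ?y\<^sup>2" by (simp add: one_le_power)
    then have "1 * 1 \<le> ?A" using D(2) by (intro mult_mono) auto
    then have "(real (base_time pass) + 60) * 1 \<le> (real (base_time pass) + 60) * ?A" by (intro mult_left_mono) auto
    then have "real (base_time pass) + 60 \<le> (real (base_time pass) + 60) * ?A" by (simp only: mult_1_right)
    moreover have "real (2 + cost ?e) \<le> 40" by simp
    moreover have "attempt_const * ?A = real (tick_time pass) * real b + (real (base_time pass) + 60) * ?A"
      by (simp add: attempt_const_def rb algebra_simps)
    ultimately show "real (2 + cost ?e) + ((real (tick_time pass) * real b + real (base_time pass)) + 12) \<le> attempt_const * ?A"
      by linarith
  qed (use ok in auto)
qed

end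

context mm_program
begin

abbreviation search_loop :: com where
  "search_loop \<equiv> While (Op Less (Var (v 42)) (Const 1)) attempt"

lemma run_search_step:
  assumes ok: "ok W s" and st: "stored n g s" and W: "int (n * n) \<le> W" "(int M + 2) * int n \<le> W" "int M + 2 \<le> W"
    "(int n + 3) ^ d\<^sub>0 \<le> W" "(int budget + 2) * ((int n + 1) * (int n + 1) * int D) \<le> W"
    and g: "\<And>x y. 0 \<le> g x y \<and> g x y \<le> int M + 1" and g_sym: "\<And>x y. g x y = g y x" and g_loop: "\<And>x. g x x = 0"
    and D: "s (v 33) 0 = int D" "1 \<le> D" and f: "s (v 42) 0 = 0" and t: "5 \<le> t"
    and rest: "\<And>s'. ok W s' \<Longrightarrow> stored n g s' \<Longrightarrow> s' (v 33) 0 = int (2 * D) \<Longrightarrow> s' (v 42) 0 = 0 \<Longrightarrow>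
      (real D)\<^sup>2 < (real n + 1) powr (\<omega> - 1) \<Longrightarrow> run W search_loop s' t (tri_inv n g (\<exists>c x y z. tri n g c x y z))"
  shows "run W search_loop s (5 + (attempt_const * ((real n + 1)\<^sup>2 * real D) + t))
    (tri_inv n g (\<exists>c x y z. tri n g c x y z))"
proof -
  let ?T = "\<exists>c x y z. tri n g c x y z"
  define Y where "Y = (int n + 1) * (int n + 1)"
  define b where "b = int budget"
  define d where "d = int D"
  have Y: "1 \<le> Y" using mult_mono[of 1 "int n + 1" 1 "int n + 1"] by (simp add: Y_def)
  have d: "1 \<le> d" and b: "0 \<le> b" using D(2) by (auto simp: d_def b_def)
  have "1 * d \<le> Y * d" "Y * 1 \<le> Y * d" "b * 1 \<le> b * (Y * d)"
    using Y d b mult_mono[of 1 Y 1 d] by (intro mult_mono; simp)+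
  then have le: "d \<le> Y * d" "Y \<le> Y * d" "b \<le> b * (Y * d)" by (simp_all only: mult_1 mult_1_right)
  have "b * (Y * d) + 2 * (Y * d) \<le> W" using W(5) unfolding Y_def b_def d_def by (simp only: distrib_right)
  moreover have "0 \<le> b * (Y * d)" using b Y d by simp
  ultimately have WW: "d + 1 \<le> W" "b * (Y * d) \<le> W" "2 * d \<le> W" "Y * d \<le> W" "Y \<le> W" "b \<le> W"
    using le d by linarith+
  have W1: "1 \<le> W" using W(3) by linarith
  have test: "ev W s' (Op Less (Var (v 42)) (Const 1)) z" if "ok W s'" "s' (v 42) 0 = a" "z = (if a < 1 then 1 else 0)" for s' a z
    using that W1 by (intro ev_Op[OF ev_Var[OF that(1,2)] ev_Const[of 1]]) auto
  note at = run_attempt[OF ok st W(1-3) WW(1)[unfolded d_def] W(4) WW(2)[unfolded d_def Y_def b_def] WW(3)[unfolded d_def]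
    WW(4)[unfolded d_def Y_def] WW(5)[unfolded Y_def] WW(6)[unfolded b_def] g g_sym g_loop D]
  have "run W search_loop s (1 + real (cost (Op Less (Var (v 42)) (Const 1))) + (attempt_const * ((real n + 1)\<^sup>2 * real D) + t)) (tri_inv n g ?T)"
  proof (rule run_While_true[OF test[OF ok f refl]])
    show "run W (Seq attempt search_loop) s (attempt_const * ((real n + 1)\<^sup>2 * real D) + t) (tri_inv n g ?T)"
    proof (rule run_Seq[OF at ok])
      fix s' assume s': "s' (v 42) 0 = 1 \<and> tri_inv n g ?T s' \<or>
        s' (v 42) 0 = s (v 42) 0 \<and> s' (v 33) 0 = 2 * int D \<and> (real D)\<^sup>2 < (real n + 1) powr (\<omega> - 1)"
        "ok W s'" "keeps (writes attempt) s s'"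
      have "v 2 \<notin> writes attempt" "v 3 \<notin> writes attempt" using writes_attempt by (auto simp: scratch_def)
      then have st': "stored n g s'" by (rule stored_keeps[OF st s'(3)])
      show "run W search_loop s' t (tri_inv n g ?T)"
      proof (cases "s' (v 42) 0 = 1")
        case True
        then have "tri_inv n g ?T s'" using s'(1) f by auto
        then have "run W search_loop s' (1 + real (cost (Op Less (Var (v 42)) (Const 1)))) (tri_inv n g ?T)"
          by (intro run_While_false[OF test[OF s'(2) True]]) auto
        then show ?thesis by (rule run_mono) (use t s' in auto)
      next
        case False
        then show ?thesis using s' st' f by (intro rest) auto
      qed
    qed
  qed simp
  then show ?thesis by (rule run_mono) (use ok in auto)
qed

lemma attempt_const_nonneg: "0 \<le> attempt_const"
  by (simp add: attempt_const_def)

text \<open>The last assumption makes \<open>D * 2 ^ r\<close> a threshold at which an attempt must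
  succeed. The costs of the attempts form a geometric series; \<open>2 * (D * 2 ^ r) - D\<close> is
  its sum from \<open>D\<close> up to \<open>D * 2 ^ r\<close>, in a form that telescopes in the
  induction.\<close>

lemma run_search_loop:
  assumes "ok W s" "stored n g s" and W: "int (n * n) \<le> W" "(int M + 2) * int n \<le> W" "int M + 2 \<le> W"
    "(int n + 3) ^ d\<^sub>0 \<le> W" and "(int budget + 2) * ((int n + 1) * (int n + 1) * int (D * 2 ^ r)) \<le> W"
    and g: "\<And>x y. 0 \<le> g x y \<and> g x y \<le> int M + 1" and g_sym: "\<And>x y. g x y = g y x" and g_loop: "\<And>x. g x x = 0"
    and "s (v 33) 0 = int D" "1 \<le> D" "s (v 42) 0 = 0" "(real n + 1) powr (\<omega> - 1) \<le> (real (D * 2 ^ r))\<^sup>2"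
  shows "run W search_loop s ((attempt_const + 10) * ((real n + 1)\<^sup>2 * (2 * real (D * 2 ^ r) - real D)) + 5)
    (tri_inv n g (\<exists>c x y z. tri n g c x y z))"
  using assms(1,2,7,11-)
proof (induction r arbitrary: s D)
  case (0 s D)
  define E where "E = (real n + 1)\<^sup>2 * real D"
  have "1 * 1 \<le> E" unfolding E_def using 0 by (intro mult_mono) (auto simp: one_le_power)
  then have E: "1 \<le> E" by simp
  have b: "(int budget + 2) * ((int n + 1) * (int n + 1) * int D) \<le> W" using 0 by simp
  \<comment> \<open>At this threshold a failure would contradict the assumption on \<open>D\<close>,
    so there is no further round; the \<open>5\<close> inside the bracket pays for the test that
    ends the loop.\<close>
  have "run W search_loop s (5 + (attempt_const * ((real n + 1)\<^sup>2 * real D) + 5)) (tri_inv n g (\<exists>c x y z. tri n g c x y z))"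
    by (rule run_search_step[OF 0(1,2) W b g g_sym g_loop 0(4-6)]) (use 0(7) in auto)
  then show ?case
    by (rule run_mono) (use E 0(1) in \<open>auto simp: E_def algebra_simps\<close>)
next
  case (Suc r s D)
  define E where "E = (real n + 1)\<^sup>2 * real D"
  have "1 * 1 \<le> E" unfolding E_def using Suc.prems(5) by (intro mult_mono) (auto simp: one_le_power)
  then have E: "1 \<le> E" by simp
  have D2: "D * 2 ^ Suc r = 2 * D * 2 ^ r" by simp
  note IH = Suc.IH[OF _ _ Suc.prems(3)[unfolded D2] _ _ _ Suc.prems(7)[unfolded D2]]
  define t where "t = (attempt_const + 10) * ((real n + 1)\<^sup>2 * (2 * real (2 * D * 2 ^ r) - real (2 * D))) + 5"
  have "D \<le> D * 2 ^ r" by simp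
  then have "0 \<le> 2 * real (2 * D * 2 ^ r) - real (2 * D)" by linarith
  then have t: "5 \<le> t" using attempt_const_nonneg by (simp add: t_def)
  have "D * 1 \<le> D * 2 ^ Suc r" by (intro mult_left_mono one_le_power) auto
  then have "int D \<le> int (D * 2 ^ Suc r)" by (simp only: mult_1_right of_nat_le_iff)
  then have "(int budget + 2) * ((int n + 1) * (int n + 1) * int D) \<le> (int budget + 2) * ((int n + 1) * (int n + 1) * int (D * 2 ^ Suc r))"
    by (intro mult_left_mono) auto
  then have b: "(int budget + 2) * ((int n + 1) * (int n + 1) * int D) \<le> W" using Suc.prems(3) by linarith
  have "run W search_loop s (5 + (attempt_const * ((real n + 1)\<^sup>2 * real D) + t)) (tri_inv n g (\<exists>c x y z. tri n g c x y z))"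
    by (rule run_search_step[OF Suc.prems(1,2) W b g g_sym g_loop Suc.prems(4-6) t]) (use IH Suc.prems(5) in \<open>auto simp: t_def\<close>)
  then show ?case
  proof (rule run_mono)
    have "(attempt_const + 10) * ((real n + 1)\<^sup>2 * (2 * real (D * 2 ^ Suc r) - real D)) + 5 = t + (attempt_const + 10) * E"
      by (simp add: t_def E_def algebra_simps)
    then show "5 + (attempt_const * ((real n + 1)\<^sup>2 * real D) + t) \<le>
      (attempt_const + 10) * ((real n + 1)\<^sup>2 * (2 * real (D * 2 ^ Suc r) - real D)) + 5"
      using E unfolding E_def[symmetric] distrib_right by linarith
  qed (use Suc.prems in auto)
qed

lemma embedding_iff_tri:
  assumes es: "set es = {(a, b). a < 3 \<and> b < 3 \<and> a \<noteq> b}"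
    and g: "\<And>x y. 0 \<le> g x y \<and> g x y \<le> int M + 1" and g_sym: "\<And>x y. g x y = g y x" and g_loop: "\<And>x. g x x = 0"
  shows "embedding n g 3 es f c \<longleftrightarrow> (\<exists>x y z. tri n g c x y z \<and> f 0 = int x \<and> f 1 = int y \<and> f 2 = int z)"
proof -
  have e: "set es = {(0, 1), (1, 0), (0, 2), (2, 0), (1, 2), (2, 1)}"
    unfolding es by (auto simp: numeral_3_eq_3 less_Suc_eq)
  have 3: "{..<3::nat} = {0, 1, 2}" by auto
  show ?thesis
  proof
    assume a: "embedding n g 3 es f c"
    then have b: "c \<noteq> 0" "g (f 0) (f 1) = c" "g (f 0) (f 2) = c" "g (f 1) (f 2) = c"
      and "f 0 \<in> {0..<int n}" "f 1 \<in> {0..<int n}" "f 2 \<in> {0..<int n}"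
      unfolding embedding_def e 3 by auto
    then have "0 \<le> f 0" "f 0 < int n" "0 \<le> f 1" "f 1 < int n" "0 \<le> f 2" "f 2 < int n" by auto
    moreover have "0 < c" using b(1,2) g[of "f 0" "f 1"] by linarith
    ultimately have "tri n g c (nat (f 0)) (nat (f 1)) (nat (f 2))" using b unfolding tri_def by (simp add: nat_less_iff)
    then show "\<exists>x y z. tri n g c x y z \<and> f 0 = int x \<and> f 1 = int y \<and> f 2 = int z"
      using \<open>0 \<le> f 0\<close> \<open>0 \<le> f 1\<close> \<open>0 \<le> f 2\<close> by (metis int_nat_eq)
  next
    assume "\<exists>x y z. tri n g c x y z \<and> f 0 = int x \<and> f 1 = int y \<and> f 2 = int z"
    then obtain x y z where t: "tri n g c x y z" and f: "f 0 = int x" "f 1 = int y" "f 2 = int z" by blast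
    have ne: "x \<noteq> y" "x \<noteq> z" "y \<noteq> z" using t g_loop by (auto simp: tri_def)
    have sym: "g (int y) (int x) = c" "g (int z) (int x) = c" "g (int z) (int y) = c"
      using t unfolding tri_def by (metis g_sym)+
    show "embedding n g 3 es f c"
      using t ne sym f unfolding embedding_def e 3 tri_def by auto
  qed
qed

definition triangle_place :: com where
  "triangle_place = Cond (Var (v 0)) (assign (v 1) 0 [Var (v 11), Var (v 12), Var (v 13)]) Skip"

definition triangle_program :: com where
  "triangle_program = Seq init (Seq (Set (v 33) (Const 1)) (Seq (Set (v 42) (Const 0)) (Seq search_loop triangle_place)))"

lemma run_triangle_place:
  assumes es: "set es = {(a, b). a < 3 \<and> b < 3 \<and> a \<noteq> b}" and ok: "ok W s" and W: "3 \<le> W"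
    and g: "\<And>x y. 0 \<le> g x y \<and> g x y \<le> int M + 1" and g_sym: "\<And>x y. g x y = g y x" and g_loop: "\<And>x. g x x = 0"
    and I: "tri_inv n g (\<exists>c x y z. tri n g c x y z) s"
  shows "run W triangle_place s (real (tmax triangle_place))
      (\<lambda>s'. if \<exists>f k. embedding n g 3 es f k
        then s' (v 0) 0 = 1 \<and> (\<exists>k. embedding n g 3 es (\<lambda>i. s' (v 1) (int i)) k)
        else s' (v 0) 0 = 0)" (is "run _ _ _ _ ?Q")
proof (rule run_wp)
  note emb = embedding_iff_tri[OF es g g_sym g_loop, where n = n]
  show "wp W triangle_place ?Q s"
  proof (cases "s (v 0) 0 = 0")
    case True
    then have "\<not> (\<exists>f k. embedding n g 3 es f k)" using I unfolding tri_inv_def emb by auto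
    then have "?Q s" using True by simp
    then show ?thesis using True W by (simp add: triangle_place_def)
  next
    case False
    then obtain c x y z where t: "tri n g c x y z" and s: "s (v 0) 0 = 1" "s (v 11) 0 = int x" "s (v 12) 0 = int y" "s (v 13) 0 = int z"
      using I unfolding tri_inv_def by auto
    let ?z = "\<lambda>i::nat. if i = 0 then int x else if i = 1 then int y else int z"
    have "wp W (assign (v 1) 0 [Var (v 11), Var (v 12), Var (v 13)]) ?Q s"
    proof (rule wp_assign[OF ok, where z = ?z])
      show "int (0 + length [Var (v 11), Var (v 12), Var (v 13)]) \<le> W" using W by simp
      fix s' l assume ok': "ok W s'" and k: "keeps {v 1} s s'" and l: "l < length [Var (v 11), Var (v 12), Var (v 13)]"
      have "s' (v 11) 0 = int x" "s' (v 12) 0 = int y" "s' (v 13) 0 = int z" using s k by auto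
      note ev_Var[OF ok' this(1)] ev_Var[OF ok' this(2)] ev_Var[OF ok' this(3)]
      moreover have "l = 0 \<or> l = 1 \<or> l = 2" using l by auto
      ultimately show "ev W s' ([Var (v 11), Var (v 12), Var (v 13)] ! l) (?z (0 + l))" by auto
    next
      fix s' assume k: "keeps {v 1} s s'" and
        w: "\<forall>l. 0 \<le> l \<and> l < 0 + length [Var (v 11), Var (v 12), Var (v 13)] \<longrightarrow> s' (v 1) (int l) = ?z l"
      have "s' (v 1) (int 0) = int x" "s' (v 1) (int 1) = int y" "s' (v 1) (int 2) = int z"
        using w[rule_format, of 0] w[rule_format, of 1] w[rule_format, of 2] by auto
      then have e: "embedding n g 3 es (\<lambda>i. s' (v 1) (int i)) c" using t unfolding emb by blast
      then have "\<exists>f k. embedding n g 3 es f k" by blast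
      moreover have "s' (v 0) 0 = 1" using k s by auto
      ultimately show "?Q s'" using e by auto
    qed
    then show ?thesis using s(1) W unfolding triangle_place_def wp.simps(4) by (simp del: assign.simps)
  qed
qed

text \<open>The threshold never exceeds \<open>2 * (n + 1) powr ((\<omega> - 1) / 2)\<close>, for
  which an integer above \<open>\<omega>\<close> is a sufficient exponent. The constant factor of
  the clock is bounded through \<open>budget + 2 \<le> B ^ (budget + 2)\<close> with
  \<open>B = n + M + 2\<close>.\<close>

definition search_exponent :: nat where
  "search_exponent = 2 * d\<^sub>0 + budget + nat \<lceil>\<omega>\<rceil> + 10"

text \<open>Rounding the ideal threshold up to a power of two loses at most a factor
  \<open>2\<close>.\<close>

lemma doublings:
  fixes y q :: real
  assumes "1 \<le> y" "0 \<le> q"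
  obtains r :: nat where "y powr q \<le> 2 ^ r" "2 ^ r \<le> 2 * y powr q"
proof -
  let ?l = "log 2 (y powr q)"
  have y: "1 \<le> y powr q" using assms by (simp add: ge_one_powr_ge_zero)
  then have l: "0 \<le> ?l" using assms(1) by simp
  have e: "(2::real) powr ?l = y powr q" using y assms(1) by simp
  let ?r = "nat \<lceil>?l\<rceil>"
  have r: "?l \<le> real ?r" "real ?r \<le> ?l + 1" using l by linarith+
  have "y powr q \<le> 2 powr real ?r" using powr_mono[OF r(1), of 2] e by simp
  moreover have "2 powr real ?r \<le> 2 * y powr q"
    using powr_mono[OF r(2), of 2] e by (simp add: powr_add)
  ultimately show ?thesis using that[of ?r] by (simp add: powr_realpow)
qed

definition triangle_const :: real where
  "triangle_const = 4 * (attempt_const + 10) + real (tmax triangle_place) + 120"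

lemma triangle_time:
  assumes "y = real n + 1" "2 ^ r \<le> 2 * y powr ((\<omega> - 1) / 2)"
  shows "100 * y\<^sup>2 + (3 + (3 + ((attempt_const + 10) * (y\<^sup>2 * (2 * 2 ^ r - 1)) + 5 + real (tmax triangle_place))))
    \<le> triangle_const * y powr ((3 + \<omega>) / 2)"
proof -
  let ?p = "y powr ((\<omega> - 1) / 2)"
  define Z where "Z = y powr ((3 + \<omega>) / 2)"
  have y: "1 \<le> y" using assms(1) by simp
  have p: "1 \<le> ?p" using y \<omega> by (intro ge_one_powr_ge_zero) auto
  have "(3 + \<omega>) / 2 = 2 + (\<omega> - 1) / 2" by (simp add: field_simps)
  \<comment> \<open>Quadratic work multiplied by the balanced threshold yields the claimed
    exponent.\<close>
  then have Z: "Z = y\<^sup>2 * ?p" using y by (simp only: Z_def powr_add) (simp add: powr_numeral)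
  have y2: "1 \<le> y\<^sup>2" using y by (simp add: one_le_power)
  have "y\<^sup>2 * 1 \<le> y\<^sup>2 * ?p" using p by (intro mult_left_mono) auto
  then have yZ: "y\<^sup>2 \<le> Z" unfolding Z by (simp only: mult_1_right)
  then have Z1: "1 \<le> Z" using y2 by linarith
  have "y\<^sup>2 * (2 * 2 ^ r - 1) \<le> y\<^sup>2 * (4 * ?p)" using assms(2) by (intro mult_left_mono) auto
  also have "\<dots> = 4 * Z" unfolding Z by simp
  finally have "(attempt_const + 10) * (y\<^sup>2 * (2 * 2 ^ r - 1)) \<le> (attempt_const + 10) * (4 * Z)"
    using attempt_const_nonneg by (intro mult_left_mono) auto
  also have "\<dots> = 4 * (attempt_const + 10) * Z" by simp
  finally have 1: "(attempt_const + 10) * (y\<^sup>2 * (2 * 2 ^ r - 1)) \<le> 4 * (attempt_const + 10) * Z" .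
  have "real (tmax triangle_place) * 1 \<le> real (tmax triangle_place) * Z" using Z1 by (intro mult_left_mono) auto
  then have 2: "real (tmax triangle_place) \<le> real (tmax triangle_place) * Z" by (simp only: mult_1_right)
  have "triangle_const * Z = 4 * (attempt_const + 10) * Z + real (tmax triangle_place) * Z + 120 * Z"
    unfolding triangle_const_def by (simp only: distrib_right)
  then show ?thesis using 1 2 yZ Z1 unfolding Z_def[symmetric] by linarith
qed

lemma search_word:
  assumes W: "(int n + int M + 2) ^ search_exponent \<le> W" and r: "2 ^ r \<le> 2 * (real n + 1) powr ((\<omega> - 1) / 2)"
  shows "(int n + 3) ^ d\<^sub>0 \<le> W" "(int budget + 2) * ((int n + 1) * (int n + 1) * 2 ^ r) \<le> W" "3 \<le> W"
proof -
  let ?B = "int n + int M + 2"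
  obtain e where e: "search_exponent = 2 * d\<^sub>0 + budget + e + 10" "\<omega> \<le> real e"
    using real_nat_ceiling_ge[of \<omega>] by (auto simp: search_exponent_def)
  have pw: "?B ^ a \<le> W" if "a \<le> search_exponent" for a
    using power_increasing[OF that, of ?B] W by linarith
  have "2 * ?B \<le> ?B * ?B" by (intro mult_right_mono) auto
  then have B2: "int n + 3 \<le> ?B\<^sup>2" by (simp add: power2_eq_square)
  then have "(int n + 3) ^ d\<^sub>0 \<le> (?B\<^sup>2) ^ d\<^sub>0" by (intro power_mono) auto
  also have "\<dots> = ?B ^ (2 * d\<^sub>0)" by (simp only: power_mult)
  also have "\<dots> \<le> W" by (rule pw) (simp add: e(1))
  finally show "(int n + 3) ^ d\<^sub>0 \<le> W" .
  have "?B\<^sup>2 \<le> W" by (rule pw) (simp add: e(1))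
  then show "3 \<le> W" using B2 by linarith
  have "(real n + 1) powr ((\<omega> - 1) / 2) \<le> (real n + 1) powr real e"
    using \<omega> e(2) by (intro powr_mono) auto
  also have "\<dots> = (real n + 1) ^ e" by (simp add: powr_realpow)
  finally have "2 ^ r \<le> 2 * (real n + 1) ^ e" using r by linarith
  then have "real_of_int (2 ^ r) \<le> real_of_int (2 * (int n + 1) ^ e)" by simp
  then have "(2::int) ^ r \<le> 2 * (int n + 1) ^ e" by (simp only: of_int_le_iff)
  also have "\<dots> \<le> ?B * ?B ^ e" by (intro mult_mono power_mono) auto
  finally have r': "(2::int) ^ r \<le> ?B ^ Suc e" by simp
  have "(int n + 1) * (int n + 1) \<le> ?B * ?B" by (intro mult_mono) auto
  moreover have "int budget + 2 \<le> ?B ^ (budget + 2)" using int_less_power[of ?B "budget + 2"] by simp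
  ultimately have "(int budget + 2) * ((int n + 1) * (int n + 1) * 2 ^ r) \<le> ?B ^ (budget + 2) * (?B * ?B * ?B ^ Suc e)"
    using r' by (intro mult_mono) auto
  also have "\<dots> = ?B ^ (budget + 2 + (2 + Suc e))" by (simp only: power_add power2_eq_square mult.assoc)
  also have "\<dots> \<le> W" by (rule pw) (simp add: e(1))
  finally show "(int budget + 2) * ((int n + 1) * (int n + 1) * 2 ^ r) \<le> W" .
qed

theorem detects_triangle:
  assumes es: "set es = {(a, b). a < 3 \<and> b < 3 \<and> a \<noteq> b}"
  shows "detects 3 es ((3 + \<omega>) / 2)"
proof -
  have "run W triangle_program s (triangle_const * (real n + 1) powr ((3 + \<omega>) / 2))
      (\<lambda>s'. if \<exists>f k. embedding n g 3 es f k
        then s' (v 0) 0 = 1 \<and> (\<exists>k. embedding n g 3 es (\<lambda>i. s' (v 1) (int i)) k)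
        else s' (v 0) 0 = 0)" (is "run _ _ _ _ ?Q")
    if cm: "colour_matrix n M g s" and ok: "ok W s" and W: "(int n + int M + 2) ^ search_exponent \<le> W" for n M g W s
  proof -
    have g: "\<And>x y. 0 \<le> g x y \<and> g x y \<le> int M + 1" "\<And>x y. g x y = g y x" "\<And>x. g x x = 0"
      using cm by (auto simp: colour_matrix_def)
    have "0 \<le> (\<omega> - 1) / 2" using \<omega> by simp
    then obtain r where r: "(real n + 1) powr ((\<omega> - 1) / 2) \<le> 2 ^ r" "2 ^ r \<le> 2 * (real n + 1) powr ((\<omega> - 1) / 2)"
      using doublings[of "real n + 1" "(\<omega> - 1) / 2"] by auto
    have "((real n + 1) powr ((\<omega> - 1) / 2))\<^sup>2 \<le> (2 ^ r)\<^sup>2" using r(1) by (intro power_mono) auto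
    moreover have "((real n + 1) powr ((\<omega> - 1) / 2))\<^sup>2 = (real n + 1) powr (\<omega> - 1)"
      by (simp add: power2_eq_square powr_add[symmetric])
    ultimately have r2: "(real n + 1) powr (\<omega> - 1) \<le> (real (1 * 2 ^ r))\<^sup>2" by simp
    note sw = search_word[OF W r(2)]
    have sw2: "(int budget + 2) * ((int n + 1) * (int n + 1) * int (1 * 2 ^ r)) \<le> W" using sw(2) by simp
    have "search_exponent = 2 * d\<^sub>0 + budget + nat \<lceil>\<omega>\<rceil> + 6 + 4" by (simp add: search_exponent_def)
    note Wn = word_bounds[OF W[unfolded this]]
    let ?T = "\<exists>c x y z. tri n g c x y z"
    let ?t = "(attempt_const + 10) * ((real n + 1)\<^sup>2 * (2 * real (1 * 2 ^ r) - real 1)) + 5"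
    have "run W triangle_program s (100 * (real n + 1)\<^sup>2 + (3 + (3 + (?t + real (tmax triangle_place))))) ?Q"
      unfolding triangle_program_def
    proof (rule run_after_init[OF cm ok Wn(1,6)])
      fix s1 assume 1: "ok W s1" "stored n g s1" "s1 (v 0) 0 = 0"
      show "run W (Seq (Set (v 33) (Const 1)) (Seq (Set (v 42) (Const 0)) (Seq search_loop triangle_place))) s1
        (3 + (3 + (?t + real (tmax triangle_place)))) ?Q"
      proof (rule run_Seq)
        from run_Write[OF ev_Const[of 0 W s1] ev_Const[of 1 W s1], of "\<lambda>s'. s' (v 33) 0 = 1" "v 33"] Wn(6)
        show "run W (Set (v 33) (Const 1)) s1 3 (\<lambda>s'. s' (v 33) 0 = 1)" by simp
        fix s2 assume 2: "s2 (v 33) 0 = 1" "ok W s2" "keeps (writes (Set (v 33) (Const 1))) s1 s2"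
        have k2: "keeps {v 33} s1 s2" using 2(3) by simp
        show "run W (Seq (Set (v 42) (Const 0)) (Seq search_loop triangle_place)) s2 (3 + (?t + real (tmax triangle_place))) ?Q"
        proof (rule run_Seq)
          from run_Write[OF ev_Const[of 0 W s2] ev_Const[of 0 W s2], of "\<lambda>s'. s' (v 42) 0 = 0" "v 42"] Wn(6)
          show "run W (Set (v 42) (Const 0)) s2 3 (\<lambda>s'. s' (v 42) 0 = 0)" by simp
          fix s3 assume 3: "s3 (v 42) 0 = 0" "ok W s3" "keeps (writes (Set (v 42) (Const 0))) s2 s3"
          have k3: "keeps {v 42} s2 s3" using 3(3) by simp
          have st3: "stored n g s3"
            by (rule stored_keeps[OF stored_keeps[OF 1(2) k2] k3]) auto
          have D3: "s3 (v 33) 0 = int 1" using 2(1) k3 by simp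
          show "run W (Seq search_loop triangle_place) s3 (?t + real (tmax triangle_place)) ?Q"
          proof (rule run_Seq[OF run_search_loop[OF 3(2) st3 Wn(1-3) sw(1) sw2 g D3 le_refl 3(1) r2] 3(2)])
            fix s4 assume 4: "tri_inv n g ?T s4" "ok W s4"
            show "run W triangle_place s4 (real (tmax triangle_place)) ?Q"
              by (rule run_triangle_place[OF es 4(2) sw(3) g 4(1)])
          qed
        qed (use 2 in auto)
      qed (use 1 in auto)
    qed
    then show ?thesis
      by (rule run_mono) (use ok triangle_time[OF refl r(2)] in \<open>auto\<close>)
  qed
  then show ?thesis unfolding detects_def by blast
qed

end

section \<open>Placing the edges of a connected graph\<close>

text \<open>The remaining positions and the remaining elements are equally many, so the partial
  assignment extends to a full numbering. This puts the ends of selected edges into selected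
  parts.\<close>

lemma list_with_prescribed_entries:
  assumes V: "finite V" "card V = N" and p: "inj_on p A" "A \<subseteq> {..<N}" "p ` A \<subseteq> V"
  obtains hs where "distinct hs" "set hs = V" "length hs = N" "\<And>i. i \<in> A \<Longrightarrow> hs ! i = p i"
proof -
  have fA: "finite A" using p(2) finite_subset by blast
  have "card ({..<N} - A) = card (V - p ` A)"
    using V p fA by (simp add: card_Diff_subset card_image)
  then obtain q where q: "bij_betw q ({..<N} - A) (V - p ` A)"
    using finite_same_card_bij[of "{..<N} - A" "V - p ` A"] V(1) by auto
  define f where "f = (\<lambda>i. if i \<in> A then p i else q i)"
  have "bij_betw f A (p ` A)" using p(1) by (simp add: f_def bij_betw_def inj_on_def)
  moreover have "bij_betw f ({..<N} - A) (V - p ` A)"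
    using q by (simp add: f_def bij_betw_def inj_on_def)
  ultimately have "bij_betw f (A \<union> ({..<N} - A)) (p ` A \<union> (V - p ` A))"
    by (rule bij_betw_combine) auto
  moreover have "A \<union> ({..<N} - A) = {..<N}" "p ` A \<union> (V - p ` A) = V" using p by auto
  ultimately have f: "bij_betw f {..<N} V" by simp
  show ?thesis
  proof (rule that[of "map f [0..<N]"])
    show "distinct (map f [0..<N])" using f by (simp add: distinct_map bij_betw_def atLeast0LessThan)
    show "set (map f [0..<N]) = V" using f by (simp add: bij_betw_def atLeast0LessThan)
    show "map f [0..<N] ! i = p i" if "i \<in> A" for i using that p(2) by (auto simp: f_def)
  qed simp
qed

text \<open>A walk from inside \<open>S\<close> to the outside uses an arc that leaves
  \<open>S\<close>. Connectedness is defined through the symmetric closure, which adds nothing here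
  because the arcs of \<open>H\<close> are symmetric already.\<close>

lemma connected_crossing_arc:
  assumes H: "pair_graph H" "connected (with_proj H)" and u: "u \<in> pverts H" "u \<in> S" and v: "v \<in> pverts H" "v \<notin> S"
  obtains x y where "(x, y) \<in> parcs H" "x \<in> S" "y \<notin> S"
proof -
  interpret pair_graph H by fact
  have "u \<rightarrow>\<^sup>*\<^bsub>with_proj (mk_symmetric (with_proj H))\<^esub> v"
    using H(2) u v by (auto simp: connected_def strongly_connected_def mk_symmetric_def)
  then have "u \<rightarrow>\<^sup>*\<^bsub>with_proj H\<^esub> v"
    using reachable_mk_symmetric_eq[of u v] sym_arcs by simp
  then have "v \<notin> S \<longrightarrow> (\<exists>x y. (x, y) \<in> parcs H \<and> x \<in> S \<and> y \<notin> S)"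
  proof (induction rule: reachable_induct)
    case base
    then show ?case using u by simp
  next
    case (step x y)
    then show ?case by auto
  qed
  then show ?thesis using v that by blast
qed

lemma pair_graph_arcs:
  assumes "pair_graph H" "(x, y) \<in> parcs H"
  shows "(y, x) \<in> parcs H" "x \<noteq> y" "x \<in> pverts H" "y \<in> pverts H"
proof -
  interpret pair_graph H by fact
  show "(y, x) \<in> parcs H" using assms(2) by (rule arcs_symmetric)
  show "x \<noteq> y" using assms(2) no_loops[of "(x, y)"] by simp
  show "x \<in> pverts H" "y \<in> pverts H" using in_arcsD1 in_arcsD2 assms(2) by auto
qed

lemma pair_graph_finite: "pair_graph H \<Longrightarrow> finite (pverts H)"
proof -
  assume "pair_graph H"
  then interpret pair_graph H .
  show ?thesis by (rule finite_verts)
qed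

lemma connected_arc_exists:
  assumes H: "pair_graph H" "connected (with_proj H)" and "2 \<le> card (pverts H)"
  obtains x y where "(x, y) \<in> parcs H"
proof -
  obtain u v where "u \<in> pverts H" "v \<in> pverts H" "u \<noteq> v"
  proof -
    have "finite (pverts H)" using assms(3) by (intro card_ge_0_finite) simp
    then have "\<not> (\<forall>u\<in>pverts H. \<forall>v\<in>pverts H. u = v)" using card_le_Suc0_iff_eq[of "pverts H"] assms(3) by simp
    then show ?thesis using that by blast
  qed
  then show ?thesis using connected_crossing_arc[OF H, of u "{u}" v] that by auto
qed

text \<open>A third vertex forces an arc out of the two ends of an edge, and this arc shares one end
  with the edge.\<close>

lemma connected_path_exists:
  assumes H: "pair_graph H" "connected (with_proj H)" and n: "3 \<le> card (pverts H)"
  obtains a b c where "(a, b) \<in> parcs H" "(a, c) \<in> parcs H" "b \<noteq> c"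
proof -
  have "2 \<le> card (pverts H)" using n by simp
  then obtain x y where xy: "(x, y) \<in> parcs H" by (rule connected_arc_exists[OF H])
  note g = pair_graph_arcs[OF H(1)]
  have "card {x, y} \<le> 2" by (simp add: card_insert_if)
  then have "\<not> pverts H \<subseteq> {x, y}" using n card_mono[of "{x, y}" "pverts H"] by auto
  then obtain v where v: "v \<in> pverts H" "v \<notin> {x, y}" by auto
  obtain s t where st: "(s, t) \<in> parcs H" "s \<in> {x, y}" "t \<notin> {x, y}"
    using connected_crossing_arc[OF H g(3)[OF xy], of "{x, y}" v] v by auto
  show ?thesis
  proof (cases "s = x")
    case True
    then show ?thesis using that[of x y t] xy st by auto
  next
    case False
    then show ?thesis using that[of y x t] g(1)[OF xy] st by auto
  qed
qed

text \<open>Take two edges \<open>ab\<close> and \<open>ac\<close>. An edge that avoids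
  \<open>a\<close> has to meet both, hence is \<open>bc\<close> and closes a triangle. With a fourth
  vertex, some edge would leave the triangle and miss one of its sides; without one, the graph is
  the excluded complete graph. So all edges contain \<open>a\<close>, and connectedness joins every
  other vertex to \<open>a\<close>.\<close>

lemma star_if_arcs_intersect:
  assumes H: "pair_graph H" "connected (with_proj H)" and n: "3 \<le> card (pverts H)"
    and K3: "\<not> complete_digraph 3 (with_proj H)"
    and "\<forall>p q r s. (p, q) \<in> parcs H \<longrightarrow> (r, s) \<in> parcs H \<longrightarrow> {p, q} \<inter> {r, s} \<noteq> {}"
  obtains a where "a \<in> pverts H" "parcs H = {(a, x) | x. x \<in> pverts H - {a}} \<union> {(x, a) | x. x \<in> pverts H - {a}}"
proof -
  note g = pair_graph_arcs[OF H(1)]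
  have meet: "{p, q} \<inter> {r, s} \<noteq> {}" if "(p, q) \<in> parcs H" "(r, s) \<in> parcs H" for p q r s
    using assms(5) that by blast
  obtain a b c where abc: "(a, b) \<in> parcs H" "(a, c) \<in> parcs H" "b \<noteq> c" using connected_path_exists[OF H n] .
  note ne = g(2)[OF abc(1)] g(2)[OF abc(2)] and V = g(3,4)[OF abc(1)] g(4)[OF abc(2)]
  have bc: "(b, c) \<notin> parcs H"
  proof
    assume bc: "(b, c) \<in> parcs H"
    show False
    proof (cases "pverts H = {a, b, c}")
      case True
      have "card (pverts H) = 3" using True ne abc(3) by simp
      moreover have "parcs H = {(u, v). (u, v) \<in> pverts H \<times> pverts H \<and> u \<noteq> v}"
      proof (intro equalityI subsetI)
        fix e assume e: "e \<in> parcs H"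
        obtain u v where "e = (u, v)" by (cases e)
        then show "e \<in> {(u, v). (u, v) \<in> pverts H \<times> pverts H \<and> u \<noteq> v}" using e g(2-4)[of u v] by auto
      next
        fix e assume "e \<in> {(u, v). (u, v) \<in> pverts H \<times> pverts H \<and> u \<noteq> v}"
        then show "e \<in> parcs H" using True abc bc g(1)[OF abc(1)] g(1)[OF abc(2)] g(1)[OF bc] by auto
      qed
      ultimately have "complete_digraph 3 (with_proj H)"
        using pair_graph_finite[OF H(1)] unfolding complete_digraph_pair_def by blast
      then show False using K3 by simp
    next
      case False
      then obtain v where "v \<in> pverts H" "v \<notin> {a, b, c}" using V by auto
      then obtain s d where sd: "(s, d) \<in> parcs H" "s \<in> {a, b, c}" "d \<notin> {a, b, c}"
        using connected_crossing_arc[OF H V(1), of "{a, b, c}" v] by auto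
      then show False using meet[OF sd(1) abc(1)] meet[OF sd(1) abc(2)] meet[OF sd(1) bc] ne abc(3) by auto
    qed
  qed
  have a: "x = a \<or> y = a" if xy: "(x, y) \<in> parcs H" for x y
  proof (rule ccontr)
    assume "\<not> (x = a \<or> y = a)"
    then have "{x, y} = {b, c}" using meet[OF xy abc(1)] meet[OF xy abc(2)] abc(3) by auto
    then have "(b, c) \<in> parcs H" using xy g(1)[OF xy] by (auto simp: doubleton_eq_iff)
    then show False using bc by simp
  qed
  have star: "(a, x) \<in> parcs H" if x: "x \<in> pverts H" "x \<noteq> a" for x
  proof -
    obtain s t where st: "(s, t) \<in> parcs H" "s \<in> {x}" "t \<notin> {x}"
      using connected_crossing_arc[OF H x(1), of "{x}" a] V(1) x(2) by auto
    then have "(t, s) = (a, x)" using a[OF st(1)] x(2) by auto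
    then show ?thesis using g(1)[OF st(1)] by simp
  qed
  have "parcs H = {(a, x) | x. x \<in> pverts H - {a}} \<union> {(x, a) | x. x \<in> pverts H - {a}}"
  proof (intro equalityI subsetI)
    fix e assume e: "e \<in> parcs H"
    obtain x y where xy: "e = (x, y)" by (cases e)
    show "e \<in> {(a, x) | x. x \<in> pverts H - {a}} \<union> {(x, a) | x. x \<in> pverts H - {a}}"
      using a[of x y] g[of x y] e xy by auto
  next
    fix e assume "e \<in> {(a, x) | x. x \<in> pverts H - {a}} \<union> {(x, a) | x. x \<in> pverts H - {a}}"
    then show "e \<in> parcs H" using star g(1)[OF star] by auto
  qed
  then show ?thesis using that V(1) by blast
qed

context mm_program
begin

text \<open>The map \<open>p\<close> prescribes vertices only at the ends of the two edges.
  Injectivity on the set of the four indices allows the edges to share ends or to coincide.\<close>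

lemma detects_with_arcs:
  assumes H: "pair_graph H" and N: "card (pverts H) = 3 * k + j"
    and arcs: "(p a1, p b1) \<in> parcs H" "(p a2, p b2) \<in> parcs H" and inj: "inj_on p {a1, b1, a2, b2}"
    and idx: "a1 < j + k" "b1 < j + k" "a2 < j \<or> j + k \<le> a2 \<and> a2 < j + 2 * k" "b2 < j \<or> j + k \<le> b2 \<and> b2 < j + 2 * k"
    and e: "2 \<le> \<omega> * real k + real j"
  shows "\<exists>hs es. index_list H hs es \<and> detects (length hs) es (\<omega> * real k + real j)"
proof -
  have "finite (pverts H)" using H by (rule pair_graph_finite)
  moreover have "{a1, b1, a2, b2} \<subseteq> {..<3 * k + j}" using idx by auto
  moreover have "p ` {a1, b1, a2, b2} \<subseteq> pverts H" using arcs pair_graph_arcs[OF H] by auto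
  ultimately obtain hs where hs: "distinct hs" "set hs = pverts H" "length hs = 3 * k + j"
      "\<And>i. i \<in> {a1, b1, a2, b2} \<Longrightarrow> hs ! i = p i"
    using list_with_prescribed_entries[OF _ N inj] by blast
  obtain es where es: "index_list H hs es" using index_list_exists[OF H hs(1,2)] by blast
  have s: "set es = {(a, b). a < length hs \<and> b < length hs \<and> (hs ! a, hs ! b) \<in> parcs H}" using es by (simp add: index_list_def)
  have "partitioned P d\<^sub>0 C\<^sub>0 \<omega> v j k es a1 b1 a2 b2"
  proof (rule partitioned.intro[OF mm_program_axioms partitioned_axioms.intro])
    show "a < j + 3 * k \<and> b < j + 3 * k" if "(a, b) \<in> set es" for a b using that s hs(3) by simp
    show "(a1, b1) \<in> set es" using idx(1,2) arcs(1) hs(4)[of a1] hs(4)[of b1] by (simp add: s hs(3))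
    show "(a2, b2) \<in> set es" using idx(3,4) arcs(2) hs(4)[of a2] hs(4)[of b2] by (auto simp: s hs(3))
  qed (use idx e in blast)+
  from partitioned.detects_partitioned[OF this] have "detects (j + 3 * k) es (\<omega> * real k + real j)" .
  moreover have "length hs = j + 3 * k" using hs(3) by simp
  ultimately have "detects (length hs) es (\<omega> * real k + real j)" by simp
  then show ?thesis using es by blast
qed

lemma detects_connected:
  assumes H: "pair_graph H" "connected (with_proj H)" and N: "card (pverts H) = 3 * k + j" "j \<in> {0, 1, 2}"
    and K3: "\<not> complete_digraph 3 (with_proj H)"
  shows "\<exists>hs es. index_list H hs es \<and> detects (length hs) es (\<omega> * real k + real j)"
proof -
  note g = pair_graph_arcs[OF H(1)]
  have fin: "finite (pverts H)" using H(1) by (rule pair_graph_finite)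
  have ne: "pverts H \<noteq> {}" using H(2) by (auto simp: connected_def strongly_connected_def mk_symmetric_def)
  have wk: "2 \<le> \<omega> * real k" if "1 \<le> k"
    using mult_mono[of 2 \<omega> 1 "real k"] \<omega> that by simp
  consider "j = 2" | "j = 1" "k = 0" | "j = 1" "1 \<le> k" | "j = 0" "1 \<le> k"
    using N ne fin by (cases k) auto
  then show ?thesis
  proof cases
    case 1
    have "2 \<le> card (pverts H)" using N(1) 1 by simp
    then obtain x y where xy: "(x, y) \<in> parcs H" by (rule connected_arc_exists[OF H])
    have "2 \<le> \<omega> * real k + real j" using 1 \<omega> by simp
    \<comment> \<open>Both ends of one edge form the first part, which is contained in
      \<open>S1\<close> and in \<open>S2\<close>; so a single edge serves for both long
      parts.\<close>
    then show ?thesis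
      by (intro detects_with_arcs[OF H(1) N(1), where p = "\<lambda>i. if i = 0 then x else y" and ?a1.0 = 0 and ?b1.0 = 1 and ?a2.0 = 0 and ?b2.0 = 1])
        (use xy g(2)[OF xy] 1 in \<open>auto simp: inj_on_def\<close>)
  next
    case 2
    then obtain x where x: "pverts H = {x}" using N(1) by (auto simp: card_1_singleton_iff)
    have "(u, v) \<notin> parcs H" for u v using g[of u v] x by auto
    then have "parcs H = {}" by auto
    then have "index_list H [x] []" using x by (simp add: index_list_def)
    moreover have "detects (length [x]) [] (\<omega> * real k + real j)" using detects_vertex 2 by simp
    ultimately show ?thesis by blast
  next
    case 3
    have "3 \<le> card (pverts H)" using N(1) 3 by simp
    then obtain a b c where abc: "(a, b) \<in> parcs H" "(a, c) \<in> parcs H" "b \<noteq> c"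
      by (rule connected_path_exists[OF H])
    have "2 \<le> \<omega> * real k + real j" using wk[OF 3(2)] by simp
    \<comment> \<open>The middle vertex \<open>a\<close> of the path is the whole first part;
      \<open>b\<close> at index \<open>1\<close> opens the second part and \<open>c\<close> at index
      \<open>1 + k\<close> the third.\<close>
    then show ?thesis
      by (intro detects_with_arcs[OF H(1) N(1), where p = "\<lambda>i. if i = 0 then a else if i = 1 then b else c" and ?a1.0 = 0 and ?b1.0 = 1 and ?a2.0 = 0 and ?b2.0 = "1 + k"])
        (use abc g(2)[OF abc(1)] g(2)[OF abc(2)] 3 in \<open>auto simp: inj_on_def\<close>)
  next
    case 4
    have e: "2 \<le> \<omega> * real k + real j" using wk[OF 4(2)] by simp
    show ?thesis
    proof (cases "\<exists>p q r s. (p, q) \<in> parcs H \<and> (r, s) \<in> parcs H \<and> {p, q} \<inter> {r, s} = {}")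
      case True
      then obtain p q r s where pq: "(p, q) \<in> parcs H" and rs: "(r, s) \<in> parcs H" and d: "{p, q} \<inter> {r, s} = {}" by blast
      \<comment> \<open>The first part is empty, so each edge has to fit into a part of size
        \<open>k\<close>. Four distinct vertices among \<open>3 * k\<close> give
        \<open>k \<ge> 2\<close>, which leaves the room.\<close>
      have "card {p, q, r, s} = 4" using d g(2)[OF pq] g(2)[OF rs] by auto
      moreover have "card {p, q, r, s} \<le> card (pverts H)" using g[OF pq] g[OF rs] fin by (intro card_mono) auto
      ultimately have k: "2 \<le> k" using N(1) 4 by linarith
      show ?thesis
        by (intro detects_with_arcs[OF H(1) N(1), where p = "\<lambda>i. if i = 0 then p else if i = 1 then q else if i = k then r else s"
            and ?a1.0 = 0 and ?b1.0 = 1 and ?a2.0 = k and ?b2.0 = "Suc k"])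
          (use pq rs d g(2)[OF pq] g(2)[OF rs] 4 k e in \<open>auto simp: inj_on_def\<close>)
    next
      case False
      have "3 \<le> card (pverts H)" using N(1) 4 by simp
      moreover have "\<forall>p q r s. (p, q) \<in> parcs H \<longrightarrow> (r, s) \<in> parcs H \<longrightarrow> {p, q} \<inter> {r, s} \<noteq> {}"
        using False by simp
      ultimately obtain a where a: "a \<in> pverts H" "parcs H = {(a, x) | x. x \<in> pverts H - {a}} \<union> {(x, a) | x. x \<in> pverts H - {a}}"
        by (rule star_if_arcs_intersect[OF H _ K3])
      have "card (pverts H) = 3 * k" "inj_on (\<lambda>_. a) {0::nat}" "{0} \<subseteq> {..<3 * k}" "(\<lambda>_. a) ` {0::nat} \<subseteq> pverts H"
        using N(1) 4 a(1) by simp_all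
      from list_with_prescribed_entries[OF fin this] obtain hs
        where hs': "distinct hs" "set hs = pverts H" "length hs = 3 * k" "\<And>i. i \<in> {0} \<Longrightarrow> hs ! i = a" by blast
      have hs: "distinct hs" "set hs = pverts H" "length hs = 3 * k" "hs ! 0 = a"
        by (fact hs'(1-3))+ (rule hs'(4)[OF singletonI])
      obtain es where es: "index_list H hs es" using index_list_exists[OF H(1) hs(1,2)] by blast
      have i: "hs ! i = a \<longleftrightarrow> i = 0" "hs ! i \<in> pverts H" if "i < 3 * k" for i
        using that hs(2-4) nth_eq_iff_index_eq[OF hs(1), of i 0] nth_mem[of i hs] by simp_all
      have arc: "(hs ! x, hs ! y) \<in> parcs H \<longleftrightarrow> x = 0 \<and> y \<noteq> 0 \<or> x \<noteq> 0 \<and> y = 0" if "x < 3 * k" "y < 3 * k" for x y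
        unfolding a(2) using i[OF that(1)] i[OF that(2)] by auto
      have "set es = {(0, i) | i. 1 \<le> i \<and> i \<le> 3 * k - 1} \<union> {(i, 0) | i. 1 \<le> i \<and> i \<le> 3 * k - 1}"
      proof -
        have "set es = {(x, y). x < 3 * k \<and> y < 3 * k \<and> (hs ! x, hs ! y) \<in> parcs H}" using es hs(3) by (simp add: index_list_def)
        also have "\<dots> = {(x, y). x < 3 * k \<and> y < 3 * k \<and> (x = 0 \<and> y \<noteq> 0 \<or> x \<noteq> 0 \<and> y = 0)}"
          using arc by auto
        also have "\<dots> = {(0, i) | i. 1 \<le> i \<and> i \<le> 3 * k - 1} \<union> {(i, 0) | i. 1 \<le> i \<and> i \<le> 3 * k - 1}"
          using 4 by auto
        finally show ?thesis .
      qed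
      then have "detects (Suc (3 * k - 1)) es 2" using 4 by (intro detects_star) auto
      moreover have "Suc (3 * k - 1) = length hs" using 4 hs(3) by simp
      ultimately have "detects (length hs) es 2" by simp
      \<comment> \<open>The quadratic search for stars stays within the bound because
        \<open>k \<ge> 1\<close> and \<open>\<omega> \<ge> 2\<close>.\<close>
      then have "detects (length hs) es (\<omega> * real k + real j)" by (rule detects_mono[OF _ e])
      then show ?thesis using es by blast
    qed
  qed
qed

lemma detects_complete_3:
  assumes "complete_digraph 3 (with_proj K)"
  shows "pair_graph K \<and> (\<exists>hs es. index_list K hs es \<and> detects (length hs) es ((3 + \<omega>) / 2))"
proof -
  have K: "pair_graph K" "card (pverts K) = 3" "parcs K = {(u, v). (u, v) \<in> pverts K \<times> pverts K \<and> u \<noteq> v}"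
  proof -
    have k: "finite (pverts K)" "card (pverts K) = 3"
      and arcs: "parcs K = {(u, v). (u, v) \<in> pverts K \<times> pverts K \<and> u \<noteq> v}"
      using assms unfolding complete_digraph_pair_def by blast+
    have "finite (parcs K)" by (rule finite_subset[of _ "pverts K \<times> pverts K"]) (use arcs k in auto)
    then show "pair_graph K"
      using k arcs by unfold_locales (auto simp: symmetric_def split: prod.splits intro: symI)
    show "card (pverts K) = 3" "parcs K = {(u, v). (u, v) \<in> pverts K \<times> pverts K \<and> u \<noteq> v}" by fact+
  qed
  obtain hs where hs: "set hs = pverts K" "distinct hs"
    using finite_distinct_list[OF pair_graph_finite[OF K(1)]] by blast
  have 3: "length hs = 3" using K(2) distinct_card[OF hs(2)] hs(1) by simp
  obtain es where es: "index_list K hs es" using index_list_exists[OF K(1) hs(2,1)] by blast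
  have arc: "(hs ! a, hs ! b) \<in> parcs K \<longleftrightarrow> a \<noteq> b" if "a < 3" "b < 3" for a b
    using that 3 hs(1) nth_mem[of a hs] nth_mem[of b hs] nth_eq_iff_index_eq[OF hs(2), of a b] by (simp add: K(3))
  have "set es = {(a, b). a < 3 \<and> b < 3 \<and> (hs ! a, hs ! b) \<in> parcs K}" using es 3 by (simp add: index_list_def)
  also have "\<dots> = {(a, b). a < 3 \<and> b < 3 \<and> a \<noteq> b}"
    using arc by auto
  finally have "detects (length hs) es ((3 + \<omega>) / 2)" using detects_triangle by (simp only: 3)
  then show ?thesis using es K(1) by blast
qed

end

theorem theorem1p7:
  fixes \<omega> :: real
  assumes "matrix_multiplication_exponent \<omega>"
  shows
    "(\<forall>(H :: 'h pair_pre_digraph) (k :: nat) (j :: nat).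
        pair_graph H \<and> connected (with_proj H) \<and>
        card (pverts H) = 3 * k + j \<and> j \<in> {0, 1, 2} \<and>
        \<not> complete_digraph 3 (with_proj H) \<longrightarrow>
        solvable_in_time coloured_graph_input
          (H_subgraph_answer H :: int pair_pre_digraph \<times> (int set \<Rightarrow> 'c) \<Rightarrow> state \<Rightarrow> bool)
          (\<omega> * real k + real j)) \<and>
     (\<forall>K :: 'h pair_pre_digraph.
        complete_digraph 3 (with_proj K) \<longrightarrow>
        solvable_in_time coloured_graph_input
          (H_subgraph_answer K :: int pair_pre_digraph \<times> (int set \<Rightarrow> 'c) \<Rightarrow> state \<Rightarrow> bool)
          ((3 + \<omega>) / 2))"
proof -
  obtain P d C v where mm: "mm_program P d C \<omega> v" using mm_program_exists[OF assms] by blast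
  note \<omega> = mm_program.\<omega>[OF mm]
  show ?thesis
  proof (intro conjI allI impI, elim conjE)
    fix H :: "'h pair_pre_digraph" and k j :: nat
    assume H: "pair_graph H" "connected (with_proj H)" "card (pverts H) = 3 * k + j" "j \<in> {0, 1, 2}"
      "\<not> complete_digraph 3 (with_proj H)"
    from mm_program.detects_connected[OF mm H] obtain hs es
      where hs: "index_list H hs es" "mm_program.detects v (length hs) es (\<omega> * real k + real j)" by blast
    have "0 \<le> \<omega> * real k + real j" using \<omega> by simp
    from mm_program.solvable_of_detects[OF mm hs(2) H(1) hs(1) this] show "solvable_in_time coloured_graph_input
      (H_subgraph_answer H :: int pair_pre_digraph \<times> (int set \<Rightarrow> 'c) \<Rightarrow> state \<Rightarrow> bool) (\<omega> * real k + real j)" .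
  next
    fix K :: "'h pair_pre_digraph" assume "complete_digraph 3 (with_proj K)"
    from mm_program.detects_complete_3[OF mm this] obtain hs es
      where hs: "pair_graph K" "index_list K hs es" "mm_program.detects v (length hs) es ((3 + \<omega>) / 2)" by blast
    have "0 \<le> (3 + \<omega>) / 2" using \<omega> by simp
    from mm_program.solvable_of_detects[OF mm hs(3,1,2) this] show "solvable_in_time coloured_graph_input
      (H_subgraph_answer K :: int pair_pre_digraph \<times> (int set \<Rightarrow> 'c) \<Rightarrow> state \<Rightarrow> bool) ((3 + \<omega>) / 2)" .
  qed
qed

end
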